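(* Let the geometric assumption, the CutFEM stability assumption and the covering assumption (all defined in the context) hold. For every prescribed ghost weight $\gamma=\gamma(p)\in(0,1]$ and admissible Nitsche parameter $\gamma_D=\gamma_D(p)$ there is $\sigma(p,\gamma,\gamma_D)<1$, independent of the level $\ell$, of the position of $\Gamma$ relative to the mesh, and of the chosen sweep ordering, such that $$\sigma_\ell(p):=\bigl\|E_{\mathrm{cut}}\big|_{V_c^\Sigma}\bigr\|_{A_\ell}\le\sigma(p,\gamma,\gamma_D),$$ where $E_{\mathrm{cut}}$ is the error operator of one exact multiplicative sweep over the strip patches and $V_c^\Sigma$ is their combined span (both defined in the context).
   Context: Meshes and spaces. $d\in\{2,3\}$, $p\ge1$; $\Omega\subset\mathbb R^d$ is a bounded domain with boundary $\Gamma$ and outward unit normal $n$. $\mathcal M_0,\dots,\mathcal M_L$ are nested Cartesian background grids covering $\Omega$: the cells of $\mathcal M_\ell$ are closed axis-parallel cubes of edge $h_\ell$, and $\mathcal M_\ell$ is the uniform dyadic refinement of $\mathcal M_{\ell-1}$, so $h_\ell=h_{\ell-1}/2$. Active cells: $\mathcal M_{\ell,\Omega}=\{K\in\mathcal M_\ell:K\cap\Omega\ne\emptyset\}$; $\Omega_\ell$ is their union. Cut (intersected) cells are those meeting $\Gamma$. $\mathbb Q_p(K)$: polynomials of degree at most $p$ in each variable. $V_\ell$: continuous functions on $\Omega_\ell$ that are in $\mathbb Q_p(K)$ on each active cell $K$, with nodal (Lagrange) basis $\phi_{\ell,i}$ at the tensor-product Gauss–Lobatto nodes $x_{\ell,i}$.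 $\mathbb F_G=\mathbb F_G^\ell$: faces shared by two active cells at least one of which is cut. Forms. $A_\ell=a_\ell+g_\ell$ with $a_\ell(u,v)=(\nabla u,\nabla v)_\Omega-(\partial_n u,v)_\Gamma-(u,\partial_n v)_\Gamma+\gamma_D h_\ell^{-1}(u,v)_\Gamma$ and $g_\ell(u,v)=\gamma\sum_{F\in\mathbb F_G}\sum_{k=1}^p\frac{h_\ell^{2k-1}}{(k!)^2}(\llbracket\partial_n^k u\rrbracket,\llbracket\partial_n^k v\rrbracket)_F$, $\gamma\in(0,1]$ (on $F$, $n$ is a fixed unit normal and $\llbracket\cdot\rrbracket$ the jump). $\|v\|_{A_\ell}^2:=A_\ell(v,v)$, and $\|\cdot\|_{A_\ell}$ of an operator is the induced operator norm. Geometric assumption. $\Gamma$ is $C^2$ with positive reach $\delta_0>0$ (the closest-point projection onto $\Gamma$ is well defined and $C^1$ in the tube of radius $\delta_0$). On every level, if $\Gamma$ meets a cell $K$, then $\Gamma\cap K$ is a single curve (surface) intersecting $\partial K$ exactly twice (in a single closed curve if $d=3$), each closed face is intersected at most once, and $K\setminus\Gamma$ has exactly two connected components. $\Gamma$ contains no mesh vertex of any $\mathcal M_\ell$, $\Omega_\ell\subseteq\Omega_{\ell-1}$ for all $\ell$, and $c_R h_{\ell-1}\le\delta_0$ on every level used, with $c_R=24d+10\sqrt d$. CutFEM stability assumption. With $N_\ell(v)^2:=\|\nabla v\|_{0,\Omega}^2+h_\ell\|\partial_n v\|_{0,\Gamma}^2+h_\ell^{-1}\|v\|_{0,\Gamma}^2+g_\ell(v,v)$,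 one has for $u,v\in V_\ell$: $c_A N_\ell(v)^2\le A_\ell(v,v)$, $A_\ell(u,v)\le C_A N_\ell(u)N_\ell(v)$, and $|v|_{1,\Omega_\ell\setminus\Omega}^2\le C(|v|_{1,\Omega}^2+g_\ell(v,v))$, where $c_A,C_A,C>0$ are independent of $\ell$ and of the cut configuration. $\gamma_D$ is admissible if this assumption holds for it. Patches. Admissible vertices $\vartheta_1,\dots,\vartheta_J$ of $\mathcal M_\ell$: all grid vertices in $\Omega$ and all exterior vertices with at least one cut adjacent cell. $\widehat\omega_j$: union of the $2^d$ background cells sharing $\vartheta_j$; $\omega_j$: union of the active cells in $\widehat\omega_j$. For a basis function $\phi_{\ell,i}$, $\omega(i)$ is the union of all active cells containing $x_{\ell,i}$. Local spaces: $V^{\mathrm D}_{\ell,j}=\operatorname{span}\{\phi_{\ell,i}:x_{\ell,i}\in\operatorname{int}\widehat\omega_j\}$ or $V^{\mathrm{FR}}_{\ell,j}=\operatorname{span}\{\phi_{\ell,i}:\omega(i)\subseteq\omega_j\}$; $V_{\ell,j}$ denotes either. $P_j$ is the $A_\ell$-orthogonal projection onto $V_{\ell,j}$. Covering assumption. For each nodal basis function $\phi_{\ell,i}$ of $V_\ell$ there is $j\in\{1,\dots,J\}$ with $\phi_{\ell,i}\in V_{\ell,j}$. Strip sweep. $\mathbb J_c:=\{j:\omega_j\text{ contains a cut cell}\}$ are the strip patches, $V_c^\Sigma:=\sum_{j\in\mathbb J_c}V_{\ell,j}$. For a fixed ordering $\mathbb J_c=\{j_1,\dots,j_m\}$, $E_{\mathrm{cut}}:=(I-P_{j_m})\cdots(I-P_{j_1})$;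 it maps $V_c^\Sigma$ into itself. *)

theory Defs
  imports "HOL-Analysis.Analysis" "HOL-Computational_Algebra.Polynomial"
begin

text \<open>
  Normalised Hausdorff outer measure of integer dimension \<open>s\<close>. The factor is chosen so that for
  \<open>s\<close> equal to one or two it is arc length and area.
\<close>

definition hausdorff_content :: "nat \<Rightarrow> real \<Rightarrow> 'a::metric_space set \<Rightarrow> ennreal" where
  "hausdorff_content s \<epsilon> A =
     (INF U\<in>{U :: nat \<Rightarrow> 'a set. A \<subseteq> (\<Union>i. U i) \<and> (\<forall>i. bounded (U i) \<and> diameter (U i) \<le> \<epsilon>)}.
        \<Sum>i. ennreal (unit_ball_vol (real s) * (diameter (U i) / 2) ^ s))"

definition hausdorff_outer :: "nat \<Rightarrow> 'a::metric_space set \<Rightarrow> ennreal" where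
  "hausdorff_outer s A = (SUP \<epsilon>\<in>{0<..}. hausdorff_content s \<epsilon> A)"

text \<open>
  Hausdorff outer measure is a metric outer measure, hence countably additive on Borel sets, so
  this is the restriction of the \<open>(d-1)\<close>-dimensional Hausdorff measure to the Borel sets.
\<close>

definition surf :: "(real ^ 'n) measure" where
  "surf = measure_of UNIV (sets borel) (hausdorff_outer (CARD('n) - 1))"

definition C1_on :: "'a::real_normed_vector set \<Rightarrow> ('a \<Rightarrow> 'b::real_normed_vector) \<Rightarrow> bool" where
  "C1_on S f \<longleftrightarrow>
     (\<exists>f'. (\<forall>x\<in>S. (f has_derivative blinfun_apply (f' x)) (at x)) \<and> continuous_on S f')"

text \<open>
  \<open>\<psi>\<close> is a local \<open>C\<^sup>2\<close> defining function of the boundary on the open set \<open>U\<close>, with gradient \<open>g\<close>,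
  negative inside the domain.
\<close>

definition boundary_chart ::
  "'a::euclidean_space set \<Rightarrow> 'a set \<Rightarrow> ('a \<Rightarrow> real) \<Rightarrow> ('a \<Rightarrow> 'a) \<Rightarrow> bool" where
  "boundary_chart \<Omega> U \<psi> g \<longleftrightarrow>
     open U \<and> (\<forall>y\<in>U. GDERIV \<psi> y :> g y \<and> g y \<noteq> 0) \<and> C1_on U g \<and>
     \<Omega> \<inter> U = {y\<in>U. \<psi> y < 0} \<and> frontier \<Omega> \<inter> U = {y\<in>U. \<psi> y = 0}"

definition C2_boundary :: "'a::euclidean_space set \<Rightarrow> bool" where
  "C2_boundary \<Omega> \<longleftrightarrow> (\<forall>x\<in>frontier \<Omega>. \<exists>U \<psi> g. x \<in> U \<and> boundary_chart \<Omega> U \<psi> g)"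

definition outward_normal :: "'a::euclidean_space set \<Rightarrow> 'a \<Rightarrow> 'a" where
  "outward_normal \<Omega> x = (THE \<nu>. \<exists>U \<psi> g. x \<in> U \<and> boundary_chart \<Omega> U \<psi> g \<and> \<nu> = sgn (g x))"

definition has_reach :: "'a::euclidean_space set \<Rightarrow> real \<Rightarrow> bool" where
  "has_reach \<Gamma> \<delta> \<longleftrightarrow> 0 < \<delta> \<and>
     (\<exists>\<pi>. C1_on {x. infdist x \<Gamma> < \<delta>} \<pi> \<and>
        (\<forall>x. infdist x \<Gamma> < \<delta> \<longrightarrow> \<pi> x \<in> \<Gamma> \<and> dist x (\<pi> x) = infdist x \<Gamma> \<and>
           (\<forall>y\<in>\<Gamma>. dist x y = infdist x \<Gamma> \<longrightarrow> y = \<pi> x)))"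

text \<open>
  One level: the domain, one lattice point, and the edge length of the cells. The background
  grid is the full lattice of cubes; cells and vertices are addressed by integer vectors. Every
  lattice cell that meets the open domain belongs to every subfamily of cells covering the domain,
  so the active cells do not depend on how far the background grid extends.
\<close>

record 'n grid =
  dom :: "(real ^ 'n) set"
  org :: "real ^ 'n"
  edge :: real

definition bdry :: "('n::finite) grid \<Rightarrow> (real ^ 'n) set" where
  "bdry G = frontier (dom G)"

definition vtx :: "('n::finite) grid \<Rightarrow> int ^ 'n \<Rightarrow> real ^ 'n" where
  "vtx G z = org G + edge G *\<^sub>R (\<chi> i. real_of_int (z $ i))"

definition cell :: "('n::finite) grid \<Rightarrow> int ^ 'n \<Rightarrow> (real ^ 'n) set" where
  "cell G z = cbox (vtx G z) (vtx G (z + 1))"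

definition active :: "('n::finite) grid \<Rightarrow> (int ^ 'n) set" where
  "active G = {z. cell G z \<inter> dom G \<noteq> {}}"

definition cut :: "('n::finite) grid \<Rightarrow> (int ^ 'n) set" where
  "cut G = {z. cell G z \<inter> bdry G \<noteq> {}}"

definition active_dom :: "('n::finite) grid \<Rightarrow> (real ^ 'n) set" where
  "active_dom G = (\<Union>z\<in>active G. cell G z)"

text \<open>The face between the cells \<open>z\<close> and \<open>z + e\<^sub>i\<close>; each face of the lattice arises exactly once.\<close>

definition face :: "('n::finite) grid \<Rightarrow> int ^ 'n \<Rightarrow> 'n \<Rightarrow> (real ^ 'n) set" where
  "face G z i = cell G z \<inter> cell G (z + axis i 1)"

definition ghost_faces :: "('n::finite) grid \<Rightarrow> ((int ^ 'n) \<times> 'n) set" where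
  "ghost_faces G = {(z, i). z \<in> active G \<and> z + axis i 1 \<in> active G \<and>
                            (z \<in> cut G \<or> z + axis i 1 \<in> cut G)}"

definition level :: "(real ^ 'n) set \<Rightarrow> real ^ 'n \<Rightarrow> real \<Rightarrow> nat \<Rightarrow> ('n::finite) grid" where
  "level \<Omega> o\<^sub>0 h\<^sub>0 l = \<lparr>dom = \<Omega>, org = o\<^sub>0, edge = h\<^sub>0 / 2 ^ l\<rparr>"

definition Qp :: "nat \<Rightarrow> (real ^ 'n \<Rightarrow> real) set" where
  "Qp p = {q. \<exists>c :: ('n \<Rightarrow> nat) \<Rightarrow> real. \<forall>x. q x = (\<Sum>\<alpha> | \<forall>i. \<alpha> i \<le> p. c \<alpha> * (\<Prod>i\<in>UNIV. x $ i ^ \<alpha> i))}"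

text \<open>Functions on the active domain are represented by their extension by zero.\<close>

definition FE :: "('n::finite) grid \<Rightarrow> nat \<Rightarrow> (real ^ 'n \<Rightarrow> real) set" where
  "FE G p = {v. (\<forall>x. x \<notin> active_dom G \<longrightarrow> v x = 0) \<and> continuous_on (active_dom G) v \<and>
                (\<forall>z\<in>active G. \<exists>q\<in>Qp p. \<forall>x\<in>cell G z. v x = q x)}"

text \<open>Rodrigues' formula. The Gauss--Lobatto nodes are the zeros of \<open>(1 - t\<^sup>2) P\<^sub>p'(t)\<close>.\<close>

definition legendre :: "nat \<Rightarrow> real poly" where
  "legendre p = smult (1 / (2 ^ p * fact p)) ((pderiv ^^ p) ([:-1, 0, 1:] ^ p))"

definition gauss_lobatto :: "nat \<Rightarrow> real set" where
  "gauss_lobatto p = {t. poly ([:1, 0, -1:] * pderiv (legendre p)) t = 0}"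

definition nodes :: "('n::finite) grid \<Rightarrow> nat \<Rightarrow> (real ^ 'n) set" where
  "nodes G p = {x. \<exists>z\<in>active G. \<forall>i. \<exists>t\<in>gauss_lobatto p. x $ i = vtx G z $ i + edge G * (1 + t) / 2}"

text \<open>The nodal basis is indexed by the nodes themselves.\<close>

definition basis_fun :: "('n::finite) grid \<Rightarrow> nat \<Rightarrow> real ^ 'n \<Rightarrow> (real ^ 'n \<Rightarrow> real)" where
  "basis_fun G p x = (THE \<phi>. \<phi> \<in> FE G p \<and> (\<forall>y\<in>nodes G p. \<phi> y = (if y = x then 1 else 0)))"

definition nodal_span :: "('n::finite) grid \<Rightarrow> nat \<Rightarrow> (real ^ 'n) set \<Rightarrow> (real ^ 'n \<Rightarrow> real) set" where
  "nodal_span G p S = {v. \<exists>c. v = (\<lambda>y. \<Sum>x\<in>S. c x * basis_fun G p x y)}"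

definition dir_deriv :: "nat \<Rightarrow> real ^ 'n \<Rightarrow> (real ^ 'n \<Rightarrow> real) \<Rightarrow> real ^ 'n \<Rightarrow> real" where
  "dir_deriv k \<nu> q x = (deriv ^^ k) (\<lambda>t. q (x + t *\<^sub>R \<nu>)) 0"

definition piece :: "('n::finite) grid \<Rightarrow> nat \<Rightarrow> (real ^ 'n \<Rightarrow> real) \<Rightarrow> int ^ 'n \<Rightarrow> (real ^ 'n \<Rightarrow> real)" where
  "piece G p v z = (THE q. q \<in> Qp p \<and> (\<forall>x\<in>cell G z. q x = v x))"

text \<open>
  The cellwise gradient. At points on several cells the polynomial of the cell whose half-open
  version contains the point is used, so that the gradient is defined everywhere and is linear
  in \<open>v\<close>; off the grid faces it is the classical gradient of \<open>v\<close>.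
\<close>

definition cell_index :: "('n::finite) grid \<Rightarrow> real ^ 'n \<Rightarrow> int ^ 'n" where
  "cell_index G x = (\<chi> i. \<lfloor>(x $ i - org G $ i) / edge G\<rfloor>)"

definition grad :: "('n::finite) grid \<Rightarrow> nat \<Rightarrow> (real ^ 'n \<Rightarrow> real) \<Rightarrow> real ^ 'n \<Rightarrow> real ^ 'n" where
  "grad G p v x = (\<chi> i. dir_deriv 1 (axis i 1) (piece G p v (cell_index G x)) x)"

definition normal_deriv :: "('n::finite) grid \<Rightarrow> nat \<Rightarrow> (real ^ 'n \<Rightarrow> real) \<Rightarrow> real ^ 'n \<Rightarrow> real" where
  "normal_deriv G p v x = grad G p v x \<bullet> outward_normal (dom G) x"

definition jump ::
  "('n::finite) grid \<Rightarrow> nat \<Rightarrow> nat \<Rightarrow> (real ^ 'n \<Rightarrow> real) \<Rightarrow> int ^ 'n \<Rightarrow> 'n \<Rightarrow> real ^ 'n \<Rightarrow> real" where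
  "jump G p k v z i x =
     dir_deriv k (axis i 1) (piece G p v (z + axis i 1)) x - dir_deriv k (axis i 1) (piece G p v z) x"

definition grad_prod ::
  "('n::finite) grid \<Rightarrow> nat \<Rightarrow> (real ^ 'n) set \<Rightarrow> (real ^ 'n \<Rightarrow> real) \<Rightarrow> (real ^ 'n \<Rightarrow> real) \<Rightarrow> real" where
  "grad_prod G p S u v = (LINT x:S|lborel. grad G p u x \<bullet> grad G p v x)"

definition bdry_prod :: "('n::finite) grid \<Rightarrow> (real ^ 'n \<Rightarrow> real) \<Rightarrow> (real ^ 'n \<Rightarrow> real) \<Rightarrow> real" where
  "bdry_prod G f g = (LINT x:bdry G|surf. f x * g x)"

definition nitsche_form ::
  "('n::finite) grid \<Rightarrow> nat \<Rightarrow> real \<Rightarrow> (real ^ 'n \<Rightarrow> real) \<Rightarrow> (real ^ 'n \<Rightarrow> real) \<Rightarrow> real" where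
  "nitsche_form G p \<gamma>\<^sub>D u v =
     grad_prod G p (dom G) u v - bdry_prod G (normal_deriv G p u) v - bdry_prod G u (normal_deriv G p v)
     + \<gamma>\<^sub>D / edge G * bdry_prod G u v"

definition ghost_form ::
  "('n::finite) grid \<Rightarrow> nat \<Rightarrow> real \<Rightarrow> (real ^ 'n \<Rightarrow> real) \<Rightarrow> (real ^ 'n \<Rightarrow> real) \<Rightarrow> real" where
  "ghost_form G p \<gamma> u v =
     \<gamma> * (\<Sum>(z, i)\<in>ghost_faces G. \<Sum>k=1..p.
            edge G ^ (2 * k - 1) / (fact k)\<^sup>2 * (LINT x:face G z i|surf. jump G p k u z i x * jump G p k v z i x))"

definition cut_form ::
  "('n::finite) grid \<Rightarrow> nat \<Rightarrow> real \<Rightarrow> real \<Rightarrow> (real ^ 'n \<Rightarrow> real) \<Rightarrow> (real ^ 'n \<Rightarrow> real) \<Rightarrow> real" where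
  "cut_form G p \<gamma> \<gamma>\<^sub>D u v = nitsche_form G p \<gamma>\<^sub>D u v + ghost_form G p \<gamma> u v"

definition A_norm :: "('n::finite) grid \<Rightarrow> nat \<Rightarrow> real \<Rightarrow> real \<Rightarrow> (real ^ 'n \<Rightarrow> real) \<Rightarrow> real" where
  "A_norm G p \<gamma> \<gamma>\<^sub>D v = sqrt (cut_form G p \<gamma> \<gamma>\<^sub>D v v)"

definition A_opnorm ::
  "('n::finite) grid \<Rightarrow> nat \<Rightarrow> real \<Rightarrow> real \<Rightarrow> (real ^ 'n \<Rightarrow> real) set \<Rightarrow>
   ((real ^ 'n \<Rightarrow> real) \<Rightarrow> (real ^ 'n \<Rightarrow> real)) \<Rightarrow> real" where
  "A_opnorm G p \<gamma> \<gamma>\<^sub>D W T = (SUP v\<in>W. A_norm G p \<gamma> \<gamma>\<^sub>D (T v) / A_norm G p \<gamma> \<gamma>\<^sub>D v)"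

definition N_norm :: "('n::finite) grid \<Rightarrow> nat \<Rightarrow> real \<Rightarrow> (real ^ 'n \<Rightarrow> real) \<Rightarrow> real" where
  "N_norm G p \<gamma> v =
     sqrt (grad_prod G p (dom G) v v + edge G * bdry_prod G (normal_deriv G p v) (normal_deriv G p v)
           + 1 / edge G * bdry_prod G v v + ghost_form G p \<gamma> v v)"

definition admissible :: "('n::finite) grid \<Rightarrow> (int ^ 'n) set" where
  "admissible G = {j. vtx G j \<in> dom G \<or>
                      (vtx G j \<notin> closure (dom G) \<and> (\<exists>z\<in>cut G. vtx G j \<in> cell G z))}"

definition full_patch :: "('n::finite) grid \<Rightarrow> int ^ 'n \<Rightarrow> (real ^ 'n) set" where
  "full_patch G j = (\<Union>z\<in>{z. vtx G j \<in> cell G z}. cell G z)"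

definition patch :: "('n::finite) grid \<Rightarrow> int ^ 'n \<Rightarrow> (real ^ 'n) set" where
  "patch G j = (\<Union>z\<in>{z\<in>active G. vtx G j \<in> cell G z}. cell G z)"

definition node_patch :: "('n::finite) grid \<Rightarrow> real ^ 'n \<Rightarrow> (real ^ 'n) set" where
  "node_patch G x = (\<Union>z\<in>{z\<in>active G. x \<in> cell G z}. cell G z)"

datatype patch_kind = Kind_D | Kind_FR

fun patch_space :: "patch_kind \<Rightarrow> ('n::finite) grid \<Rightarrow> nat \<Rightarrow> int ^ 'n \<Rightarrow> (real ^ 'n \<Rightarrow> real) set" where
  "patch_space Kind_D G p j = nodal_span G p {x\<in>nodes G p. x \<in> interior (full_patch G j)}"
| "patch_space Kind_FR G p j = nodal_span G p {x\<in>nodes G p. node_patch G x \<subseteq> patch G j}"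

definition strip :: "('n::finite) grid \<Rightarrow> (int ^ 'n) set" where
  "strip G = {j\<in>admissible G. \<exists>z\<in>cut G. cell G z \<subseteq> patch G j}"

definition strip_space :: "patch_kind \<Rightarrow> ('n::finite) grid \<Rightarrow> nat \<Rightarrow> (real ^ 'n \<Rightarrow> real) set" where
  "strip_space kd G p =
     {v. \<exists>w. (\<forall>j\<in>strip G. w j \<in> patch_space kd G p j) \<and> v = (\<lambda>x. \<Sum>j\<in>strip G. w j x)}"

definition A_proj ::
  "patch_kind \<Rightarrow> ('n::finite) grid \<Rightarrow> nat \<Rightarrow> real \<Rightarrow> real \<Rightarrow> int ^ 'n \<Rightarrow> (real ^ 'n \<Rightarrow> real) \<Rightarrow> (real ^ 'n \<Rightarrow> real)" where
  "A_proj kd G p \<gamma> \<gamma>\<^sub>D j v =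
     (THE w. w \<in> patch_space kd G p j \<and>
             (\<forall>u\<in>patch_space kd G p j. cut_form G p \<gamma> \<gamma>\<^sub>D (\<lambda>x. v x - w x) u = 0))"

text \<open>For \<open>js = [j\<^sub>1, \<dots>, j\<^sub>m]\<close> the patch \<open>j\<^sub>1\<close> is treated first.\<close>

definition sweep ::
  "patch_kind \<Rightarrow> ('n::finite) grid \<Rightarrow> nat \<Rightarrow> real \<Rightarrow> real \<Rightarrow> (int ^ 'n) list \<Rightarrow>
   (real ^ 'n \<Rightarrow> real) \<Rightarrow> (real ^ 'n \<Rightarrow> real)" where
  "sweep kd G p \<gamma> \<gamma>\<^sub>D js = fold (\<lambda>j v x. v x - A_proj kd G p \<gamma> \<gamma>\<^sub>D j v x) js"

text \<open>
  In the plane the trace of the boundary in a cut cell is an arc; in space it is a connected piece of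
  the boundary surface. That a closed face is met at most once means that its intersection
  with the boundary is connected (possibly empty); in the plane this is at most one point, because
  the whole cell boundary is met in two points only.
\<close>

definition regular_cut :: "('n::finite) grid \<Rightarrow> int ^ 'n \<Rightarrow> bool" where
  "regular_cut G z \<longleftrightarrow>
     (CARD('n) = 2 \<longrightarrow>
        (\<exists>c. arc c \<and> path_image c = bdry G \<inter> cell G z) \<and> card (bdry G \<inter> frontier (cell G z)) = 2) \<and>
     (CARD('n) = 3 \<longrightarrow>
        connected (bdry G \<inter> cell G z) \<and>
        (\<exists>c. simple_path c \<and> pathfinish c = pathstart c \<and>
             path_image c = bdry G \<inter> frontier (cell G z))) \<and>
     (\<forall>i. connected (bdry G \<inter> face G z i) \<and> connected (bdry G \<inter> face G (z - axis i 1) i)) \<and>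
     card (components (cell G z - bdry G)) = 2"

definition c_R :: "'n::finite itself \<Rightarrow> real" where
  "c_R _ = 24 * CARD('n) + 10 * sqrt CARD('n)"

text \<open>
  In the reach condition, truncated subtraction makes the coarsest level use its own mesh size;
  for \<open>0 < L\<close> this coincides with the condition on level one.
\<close>

definition geometric_assumption ::
  "(real ^ ('n::finite)) set \<Rightarrow> real ^ 'n \<Rightarrow> real \<Rightarrow> nat \<Rightarrow> real \<Rightarrow> bool" where
  "geometric_assumption \<Omega> o\<^sub>0 h\<^sub>0 L \<delta>\<^sub>0 \<longleftrightarrow>
     C2_boundary \<Omega> \<and> has_reach (frontier \<Omega>) \<delta>\<^sub>0 \<and>
     (\<forall>l\<le>L. (\<forall>z\<in>cut (level \<Omega> o\<^sub>0 h\<^sub>0 l). regular_cut (level \<Omega> o\<^sub>0 h\<^sub>0 l) z) \<and>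
            (\<forall>z. vtx (level \<Omega> o\<^sub>0 h\<^sub>0 l) z \<notin> frontier \<Omega>) \<and>
            active_dom (level \<Omega> o\<^sub>0 h\<^sub>0 l) \<subseteq> active_dom (level \<Omega> o\<^sub>0 h\<^sub>0 (l - 1)) \<and>
            c_R TYPE('n) * edge (level \<Omega> o\<^sub>0 h\<^sub>0 (l - 1)) \<le> \<delta>\<^sub>0)"

definition cutfem_stable ::
  "('n::finite) grid \<Rightarrow> nat \<Rightarrow> real \<Rightarrow> real \<Rightarrow> real \<Rightarrow> real \<Rightarrow> real \<Rightarrow> bool" where
  "cutfem_stable G p \<gamma> \<gamma>\<^sub>D c\<^sub>A C\<^sub>A C \<longleftrightarrow>
     (\<forall>v\<in>FE G p. c\<^sub>A * (N_norm G p \<gamma> v)\<^sup>2 \<le> cut_form G p \<gamma> \<gamma>\<^sub>D v v) \<and>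
     (\<forall>u\<in>FE G p. \<forall>v\<in>FE G p. cut_form G p \<gamma> \<gamma>\<^sub>D u v \<le> C\<^sub>A * N_norm G p \<gamma> u * N_norm G p \<gamma> v) \<and>
     (\<forall>v\<in>FE G p. grad_prod G p (active_dom G - dom G) v v
                   \<le> C * (grad_prod G p (dom G) v v + ghost_form G p \<gamma> v v))"

definition covering_assumption :: "patch_kind \<Rightarrow> ('n::finite) grid \<Rightarrow> nat \<Rightarrow> bool" where
  "covering_assumption kd G p \<longleftrightarrow>
     (\<forall>x\<in>nodes G p. \<exists>j\<in>admissible G. basis_fun G p x \<in> patch_space kd G p j)"

end

theory Submission
  imports Defs
begin

text \<open>
  The patches overlap boundedly, so a multiplicative Schwarz argument reduces the bound to a stable
  splitting of the functions in the strip space. Such a function is split by its nodal values, and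
  inverse estimates bound the energy of the pieces by \<open>h\<^sup>d\<^sup>-\<^sup>2\<close> times the squared nodal values.

  These in turn are controlled by a discrete Friedrichs inequality. A strip function vanishes on all
  cells at a few mesh widths from \<open>\<Gamma>\<close>, and since the reach of \<open>\<Gamma>\<close> is many mesh widths, every cell
  of the strip is joined to such a cell by a segment inside \<open>\<Omega>\<close>, hence by a face-to-face chain of
  boundedly many active cells. Along the chain the polynomial pieces are compared across ghost faces by
  means of the penalised normal jumps, which are exactly its Taylor coefficients, and inside uncut
  cells by means of the gradient, so that arbitrarily small cuts do no harm.

  The inverse estimates require the surface measure of \<open>\<Gamma>\<close> in a cell to be of order \<open>h\<^sup>d\<^sup>-\<^sup>1\<close>:
  positive reach makes the unit normal Lipschitz continuous, so that \<open>\<Gamma>\<close> is locally a Lipschitz graph.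
\<close>

subsection \<open>Gauss--Lobatto nodes and Lagrange interpolation\<close>

text \<open>The difficulty is uniformity: one number has to serve all domains, levels, cut positions
  and orderings. Hence every constant is a term in the dimension, the degree, \<gamma> and the
  stability constants alone, and norm equivalence on polynomials is made quantitative: a derivative
  bound from nodal values shows that a polynomial keeps half of its maximum on a subcube of fixed
  relative size, and this bounds point values by integrals over cells and faces. Strip functions are
  anchored at their zeros on the inner side rather than at their trace on \<Gamma>, because the part
  of \<Gamma> in a cut cell may be arbitrarily small. Stability bounds the form below by a sum of
  squares, so it is first treated as semidefinite; the Friedrichs bound later yields definiteness on
  the strip space, and this makes the projections, which are definite descriptions, unique.
  Similarly, the surface measure is given by \<open>measure_of\<close> and takes the values of the
  outer measure only once the Borel sets are shown to be measurable for it.\<close>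

lemma linear_power_dvd_pderiv:
  fixes f :: "real poly"
  assumes "[:-a, 1:] ^ Suc n dvd f"
  shows "[:-a, 1:] ^ n dvd pderiv f"
proof -
  obtain r where f: "f = [:-a, 1:] ^ Suc n * r" using assms by (elim dvdE)
  have "pderiv f = [:-a, 1:] ^ n * ([:-a, 1:] * pderiv r + smult (of_nat (Suc n)) r)"
    unfolding f pderiv_mult pderiv_power_Suc
    by (simp add: pderiv_pCons algebra_simps)
  then show ?thesis by simp
qed

lemma linear_power_dvd_higher_pderiv:
  fixes f :: "real poly"
  assumes "[:-a, 1:] ^ n dvd f" "k \<le> n"
  shows "[:-a, 1:] ^ (n - k) dvd (pderiv ^^ k) f"
  using assms(2)
proof (induction k)
  case 0
  then show ?case using assms by simp
next
  case (Suc k)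
  then have "[:-a, 1:] ^ (n - k) dvd (pderiv ^^ k) f" by simp
  moreover have "n - k = Suc (n - Suc k)" using Suc.prems by simp
  ultimately show ?case using linear_power_dvd_pderiv by simp
qed

text \<open>Removing the largest root and applying the mean value theorem between the two largest
  ones adds one critical point per induction step. The open enclosing interval is part of the claim
  because it keeps the new point apart from those already found.\<close>

lemma rolle_roots:
  fixes f :: "real poly"
  assumes "finite R" "card R = Suc m" "\<And>x. x \<in> R \<Longrightarrow> poly f x = 0"
  shows "\<exists>B. finite B \<and> card B = m \<and> B \<subseteq> {Min R<..<Max R} \<and> (\<forall>x\<in>B. poly (pderiv f) x = 0)"
  using assms
proof (induction m arbitrary: R)
  case 0
  then show ?case by (intro exI[of _ "{}"]) auto
next
  case (Suc m)
  let ?x = "Max R" and ?R = "R - {Max R}"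
  have ne: "R \<noteq> {}" using Suc.prems by auto
  have mem: "?x \<in> R" using Suc.prems(1) ne by simp
  have c: "card ?R = Suc m" using Suc.prems mem by simp
  have ne': "?R \<noteq> {}"
  proof
    assume "?R = {}"
    then have "card ?R = 0" by (simp only: card.empty)
    then show False using c by linarith
  qed
  have fin': "finite ?R" using Suc.prems by simp
  obtain B where B: "finite B" "card B = m" "B \<subseteq> {Min ?R<..<Max ?R}"
    "\<forall>x\<in>B. poly (pderiv f) x = 0"
    using Suc.IH[OF fin' c] Suc.prems(3) by blast
  let ?y = "Max ?R"
  have y: "?y \<in> ?R" using Max_in[OF fin' ne'] .
  then have lt: "?y < ?x" using Suc.prems(1) by (metis DiffD1 DiffD2 Max_ge insertI1 order_le_less)
  have "\<exists>z. ?y < z \<and> z < ?x \<and> poly f ?x - poly f ?y = (?x - ?y) * poly (pderiv f) z"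
    using poly_MVT[OF lt, of f] by blast
  then obtain z where z: "?y < z" "z < ?x" "poly (pderiv f) z = 0"
    using Suc.prems(3)[of ?x] Suc.prems(3)[of ?y] mem y lt by auto
  have minR: "Min R \<le> Min ?R" using Min_antimono[of ?R R] ne' Suc.prems(1) by blast
  have "Min ?R \<le> ?y" using Min_le[OF fin' y] .
  then have "insert z B \<subseteq> {Min R<..<Max R}" using z B(3) minR lt by fastforce
  moreover have "z \<notin> B" using B(3) z by fastforce
  ultimately show ?case using B z by (intro exI[of _ "insert z B"]) auto
qed

text \<open>As long as \<open>k < p\<close>, the points 1 and -1 remain zeros of the
  \<open>k\<close>-th derivative, by their multiplicity \<open>p\<close>. Together with the
  \<open>k\<close> interior zeros they give \<open>k + 2\<close> zeros, so Rolle's theorem yields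
  \<open>k + 1\<close> interior zeros of the next derivative.\<close>

lemma higher_pderiv_rodrigues_roots:
  assumes "k \<le> p"
  shows "\<exists>B. finite B \<and> card B = k \<and> B \<subseteq> {-1<..<1} \<and>
           (\<forall>x\<in>B. poly ((pderiv ^^ k) ([:-1, 0, 1::real:] ^ p)) x = 0)"
  using assms
proof (induction k)
  case 0
  then show ?case by (intro exI[of _ "{}"]) auto
next
  case (Suc k)
  let ?f = "(pderiv ^^ k) ([:-1, 0, 1::real:] ^ p)"
  obtain B where B: "finite B" "card B = k" "B \<subseteq> {-1<..<1}" "\<forall>x\<in>B. poly ?f x = 0"
    using Suc by auto
  have fact: "[:-1, 0, 1::real:] ^ p = [:-1, 1:] ^ p * [:-(-1), 1:] ^ p"
    by (simp add: power_mult_distrib[symmetric])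
  have "poly ?f a = 0" if "a = 1 \<or> a = -1" for a
  proof -
    have "[:-a, 1:] ^ p dvd [:-1, 0, 1::real:] ^ p"
      unfolding fact using that by auto
    then have "[:-a, 1:] ^ (p - k) dvd ?f"
      using linear_power_dvd_higher_pderiv[of a p _ k] Suc.prems by simp
    then have "[:-a, 1:] dvd ?f"
      using Suc.prems by (metis Suc_diff_Suc Suc_le_lessD dvd_mult_left power_Suc)
    then show ?thesis by (simp add: poly_eq_0_iff_dvd)
  qed
  then have roots: "poly ?f x = 0" if "x \<in> insert (-1) (insert 1 B)" for x using that B by auto
  let ?R = "insert (-1) (insert (1::real) B)"
  have "card ?R = Suc (Suc k)" using B by (subst card_insert_disjoint; force)+
  then obtain C where C: "finite C" "card C = Suc k" "C \<subseteq> {Min ?R<..<Max ?R}" "\<forall>x\<in>C. poly (pderiv ?f) x = 0"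
    using rolle_roots[of ?R "Suc k" ?f] roots B(1) by blast
  have "Min ?R = -1" using B by (intro Min_eqI) force+
  moreover have "Max ?R = 1" using B by (intro Max_eqI) force+
  ultimately show ?case using C by (intro exI[of _ C]) auto
qed

lemma degree_higher_pderiv: "degree ((pderiv ^^ k) (f :: real poly)) = degree f - k"
  by (induction k) (auto simp: degree_pderiv)

text \<open>By Rodrigues' formula the Legendre polynomial has \<open>p\<close> interior zeros, hence
  its derivative has \<open>p - 1\<close>; the endpoints complete them to \<open>p + 1\<close>, and
  the degree leaves room for no more. Exactly \<open>p + 1\<close> nodes give unisolvence, and the
  endpoints among them give continuity between cells.\<close>

lemma gauss_lobatto_nodes:
  assumes "1 \<le> p"
  shows "finite (gauss_lobatto p)" "card (gauss_lobatto p) = Suc p"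
    "gauss_lobatto p \<subseteq> {-1..1}" "-1 \<in> gauss_lobatto p" "1 \<in> gauss_lobatto p"
proof -
  let ?f = "(pderiv ^^ p) ([:-1, 0, 1::real:] ^ p)"
  let ?g = "[:1, 0, -1::real:] * pderiv (legendre p)"
  have degf: "degree ?f = p" by (simp add: degree_higher_pderiv degree_power_eq)
  have degP: "degree (pderiv (legendre p)) = p - 1"
    by (simp add: legendre_def pderiv_smult degree_pderiv degf)
  obtain B where B: "finite B" "card B = p" "B \<subseteq> {-1<..<1}" "\<forall>x\<in>B. poly ?f x = 0"
    using higher_pderiv_rodrigues_roots[of p p] by auto
  then obtain q where q: "p = Suc q" "card B = Suc q" using assms by (metis Suc_le_D One_nat_def)
  obtain C where C: "finite C" "card C = q" "C \<subseteq> {Min B<..<Max B}" "\<forall>x\<in>C. poly (pderiv ?f) x = 0"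
    using rolle_roots[OF B(1) q(2)] B(4) by blast
  have "B \<noteq> {}" using q by auto
  then have "Min B \<in> {-1<..<1}" "Max B \<in> {-1<..<1}"
    using B(1,3) Min_in[of B] Max_in[of B] by blast+
  then have C1: "C \<subseteq> {-1<..<1}" using C(3) by force
  have nz: "pderiv (legendre p) \<noteq> 0"
  proof
    assume "pderiv (legendre p) = 0"
    then have "pderiv ?f = 0" by (simp add: legendre_def pderiv_smult)
    then have "degree ?f = 0" by (simp add: pderiv_eq_0_iff)
    then show False using degf assms by simp
  qed
  then have g0: "?g \<noteq> 0" by (metis mult_eq_0_iff pCons_eq_0_iff zero_neq_one)
  have "degree ?g = 2 + (p - 1)"
    by (subst degree_mult_eq[OF _ nz]) (simp_all add: degP)
  then have degg: "degree ?g = Suc p" using assms by simp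
  let ?D = "insert (-1) (insert 1 C)"
  have gl: "gauss_lobatto p = {t. poly ?g t = 0}" by (simp add: gauss_lobatto_def)
  have sub: "?D \<subseteq> gauss_lobatto p" unfolding gl using C(4) by (auto simp: legendre_def pderiv_smult)
  have cD: "card ?D = Suc p" using C C1 q by (subst card_insert_disjoint; force)+
  show fin: "finite (gauss_lobatto p)" unfolding gl by (rule poly_roots_finite[OF g0])
  have "card (gauss_lobatto p) \<le> Suc p" unfolding gl using card_poly_roots_bound[OF g0] degg by simp
  then have eq: "gauss_lobatto p = ?D"
    using card_seteq[OF fin sub] cD by simp
  show "card (gauss_lobatto p) = Suc p" by (simp only: eq cD)
  show "gauss_lobatto p \<subseteq> {-1..1}" using C1 unfolding eq by force
  show "-1 \<in> gauss_lobatto p" "1 \<in> gauss_lobatto p" unfolding eq by auto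
qed

section \<open>Lagrange interpolation in one variable\<close>

definition lagrange :: "real set \<Rightarrow> real \<Rightarrow> real poly" where
  "lagrange X t = (\<Prod>s\<in>X - {t}. smult (1 / (t - s)) [:-s, 1:])"

lemma degree_lagrange:
  assumes "finite X" "card X = Suc p" "t \<in> X"
  shows "degree (lagrange X t) \<le> p"
proof -
  have "degree (lagrange X t) \<le> (\<Sum>s\<in>X - {t}. degree (smult (1 / (t - s)) [:-s, 1:]))"
    using degree_prod_sum_le[of "X - {t}" "\<lambda>s. smult (1 / (t - s)) [:-s, 1:]"] assms(1)
    unfolding lagrange_def by (simp only: o_def finite_Diff)
  also have "\<dots> \<le> (\<Sum>s\<in>X - {t}. 1)" by (intro sum_mono) auto
  also have "\<dots> = p" using assms by simp
  finally show ?thesis .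
qed

lemma poly_lagrange:
  assumes "finite X" "t \<in> X" "s \<in> X"
  shows "poly (lagrange X t) s = (if s = t then 1 else 0)"
proof (cases "s = t")
  case True
  then show ?thesis
    unfolding lagrange_def poly_prod by (auto intro!: prod.neutral simp: diff_divide_distrib[symmetric])
next
  case False
  then have "s \<in> X - {t}" using assms by auto
  then show ?thesis using False assms unfolding lagrange_def poly_prod by (auto intro!: prod_zero)
qed

lemma lagrange_interpolation:
  fixes f :: "real poly"
  assumes "finite X" "card X = Suc p" "degree f \<le> p"
  shows "f = (\<Sum>t\<in>X. smult (poly f t) (lagrange X t))"
proof (rule ccontr)
  let ?g = "(\<Sum>t\<in>X. smult (poly f t) (lagrange X t))"
  assume "f \<noteq> ?g"
  then have nz: "f - ?g \<noteq> 0" by simp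
  have "degree ?g \<le> p"
    using assms degree_lagrange[OF assms(1,2)] by (intro degree_sum_le) (auto intro: order.trans[OF degree_smult_le])
  then have "degree (f - ?g) \<le> p" using assms(3) by (intro degree_diff_le)
  moreover have "poly (f - ?g) s = 0" if "s \<in> X" for s
    using assms(1) that by (simp add: poly_sum poly_lagrange[OF assms(1) _ that] if_distrib cong: if_cong)
  then have "card X \<le> card {x. poly (f - ?g) x = 0}"
    using poly_roots_finite[OF nz] by (intro card_mono) auto
  ultimately show False using card_poly_roots_bound[OF nz] assms(2) by simp
qed

subsection \<open>Tensor-product polynomials\<close>

lemma multiindex_PiE: "{\<alpha> :: 'n::finite \<Rightarrow> nat. \<forall>i. \<alpha> i \<le> p} = PiE UNIV (\<lambda>_. {..p})"
  by (auto simp: PiE_def)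

lemma finite_multiindex [simp]: "finite {\<alpha> :: 'n::finite \<Rightarrow> nat. \<forall>i. \<alpha> i \<le> p}"
  unfolding multiindex_PiE by (intro finite_PiE) auto

lemma Qp_sum:
  assumes "finite A" "\<And>a. a \<in> A \<Longrightarrow> q a \<in> Qp p"
  shows "(\<lambda>x :: real ^ 'n::finite. \<Sum>a\<in>A. q a x) \<in> Qp p"
proof -
  have "\<forall>a\<in>A. \<exists>c. \<forall>x. q a x = (\<Sum>\<alpha> | \<forall>i. \<alpha> i \<le> p. c \<alpha> * (\<Prod>i\<in>UNIV. x $ i ^ \<alpha> i))"
    using assms(2) by (auto simp: Qp_def)
  from bchoice[OF this] obtain c
    where c: "\<forall>a\<in>A. \<forall>x. q a x = (\<Sum>\<alpha> | \<forall>i. \<alpha> i \<le> p. c a \<alpha> * (\<Prod>i\<in>UNIV. x $ i ^ \<alpha> i))" ..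
  have "(\<Sum>a\<in>A. q a x) = (\<Sum>\<alpha> | \<forall>i. \<alpha> i \<le> p. (\<Sum>a\<in>A. c a \<alpha>) * (\<Prod>i\<in>UNIV. x $ i ^ \<alpha> i))" for x
    using c by (simp add: sum_distrib_right) (rule sum.swap)
  then show ?thesis unfolding Qp_def by (intro CollectI exI[of _ "\<lambda>\<alpha>. \<Sum>a\<in>A. c a \<alpha>"]) simp
qed

lemma Qp_scale:
  assumes "q \<in> Qp p"
  shows "(\<lambda>x. a * q x) \<in> Qp p"
proof -
  obtain c where c: "\<forall>x. q x = (\<Sum>\<alpha> | \<forall>i. \<alpha> i \<le> p. c \<alpha> * (\<Prod>i\<in>UNIV. x $ i ^ \<alpha> i))"
    using assms by (auto simp: Qp_def)
  then show ?thesis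
    unfolding Qp_def by (intro CollectI exI[of _ "\<lambda>\<alpha>. a * c \<alpha>"]) (simp add: sum_distrib_left mult.assoc)
qed

lemma Qp_add:
  assumes "q \<in> Qp p" "r \<in> Qp p"
  shows "(\<lambda>x :: real ^ 'n::finite. q x + r x) \<in> Qp p"
  using Qp_sum[of "UNIV :: bool set" "\<lambda>b. if b then q else r" p] assms by (simp add: UNIV_bool add.commute)

lemma Qp_diff:
  assumes "q \<in> Qp p" "r \<in> Qp p"
  shows "(\<lambda>x :: real ^ 'n::finite. q x - r x) \<in> Qp p"
  using Qp_add[OF assms(1) Qp_scale[OF assms(2), of "-1"]] by simp

lemma Qp_prod:
  fixes f :: "'n::finite \<Rightarrow> real poly"
  assumes "\<And>i. degree (f i) \<le> p"
  shows "(\<lambda>x :: real ^ 'n. \<Prod>i\<in>UNIV. poly (f i) (x $ i)) \<in> Qp p"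
proof -
  have 1: "poly (f i) t = (\<Sum>k\<le>p. coeff (f i) k * t ^ k)" for i t
    unfolding poly_altdef using assms[of i]
    by (intro sum.mono_neutral_left) (auto simp: coeff_eq_0)
  have "(\<Prod>i\<in>UNIV. poly (f i) (x $ i)) =
     (\<Sum>\<alpha> | \<forall>i. \<alpha> i \<le> p. (\<Prod>i\<in>UNIV. coeff (f i) (\<alpha> i)) * (\<Prod>i\<in>UNIV. x $ i ^ \<alpha> i))" for x :: "real ^ 'n"
    unfolding 1 multiindex_PiE by (subst prod_sum_PiE) (simp_all add: prod.distrib)
  then show ?thesis
    unfolding Qp_def by (intro CollectI exI[of _ "\<lambda>\<alpha>. \<Prod>i\<in>UNIV. coeff (f i) (\<alpha> i)"] allI)
qed

text \<open>Monomials as products of univariate polynomials: an operation on single coordinates,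
  such as an affine change, differentiation or freezing, then acts factor by factor.\<close>

lemma Qp_obtain_prod:
  fixes q :: "real ^ 'n::finite \<Rightarrow> real"
  assumes "q \<in> Qp p"
  obtains c where "\<And>x. q x = (\<Sum>\<alpha> | \<forall>i. \<alpha> i \<le> p. c \<alpha> * (\<Prod>i\<in>UNIV. poly (monom 1 (\<alpha> i)) (x $ i)))"
  using assms unfolding Qp_def by (auto simp: poly_monom)

lemma degree_affine_pcompose: "degree (pcompose f [:a, b :: real:]) \<le> degree f"
  by (rule order.trans[OF degree_pcompose_le]) (simp add: degree_pCons_le)

text \<open>Translation and a common scaling mix no coordinates, so the degree in each variable is
  preserved.\<close>

lemma Qp_affine:
  fixes q :: "real ^ 'n::finite \<Rightarrow> real"
  assumes "q \<in> Qp p"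
  shows "(\<lambda>x. q (a + b *\<^sub>R x)) \<in> Qp p"
proof -
  obtain c where c: "\<And>x. q x = (\<Sum>\<alpha> | \<forall>i. \<alpha> i \<le> p. c \<alpha> * (\<Prod>i\<in>UNIV. poly (monom 1 (\<alpha> i)) (x $ i)))"
    using assms Qp_obtain_prod by blast
  have "q (a + b *\<^sub>R x) = (\<Sum>\<alpha> | \<forall>i. \<alpha> i \<le> p. c \<alpha> * (\<Prod>i\<in>UNIV. poly (pcompose (monom 1 (\<alpha> i)) [:a $ i, b:]) (x $ i)))" for x
    unfolding c by (simp add: poly_pcompose mult.commute)
  moreover have "(\<lambda>x :: real ^ 'n. \<Sum>\<alpha> | \<forall>i. \<alpha> i \<le> p. c \<alpha> * (\<Prod>i\<in>UNIV. poly (pcompose (monom 1 (\<alpha> i)) [:a $ i, b:]) (x $ i))) \<in> Qp p"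
    by (intro Qp_sum Qp_scale Qp_prod) (auto intro: order.trans[OF degree_affine_pcompose] simp: degree_monom_eq)
  ultimately show ?thesis by presburger
qed

lemma continuous_on_Qp:
  fixes q :: "real ^ 'n::finite \<Rightarrow> real"
  assumes "q \<in> Qp p"
  shows "continuous_on S q"
proof -
  obtain c where "q = (\<lambda>x. \<Sum>\<alpha> | \<forall>i. \<alpha> i \<le> p. c \<alpha> * (\<Prod>i\<in>UNIV. x $ i ^ \<alpha> i))"
    using assms unfolding Qp_def by auto
  then show ?thesis by (auto intro!: continuous_intros)
qed

lemma differentiable_Qp:
  fixes q :: "real ^ 'n::finite \<Rightarrow> real"
  assumes "q \<in> Qp p"
  shows "q differentiable (at x)"
proof -
  obtain c where "q = (\<lambda>x. \<Sum>\<alpha> | \<forall>i. \<alpha> i \<le> p. c \<alpha> * (\<Prod>i\<in>UNIV. x $ i ^ \<alpha> i))"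
    using assms unfolding Qp_def by auto
  moreover have "(\<lambda>x :: real ^ 'n. \<Sum>\<alpha> | \<forall>i. \<alpha> i \<le> p. c \<alpha> * (\<Prod>i\<in>UNIV. x $ i ^ \<alpha> i)) differentiable (at x)"
  proof -
    have 1: "(\<lambda>x :: real ^ 'n. x $ i) differentiable (at x)" for i
      by (rule bounded_linear_imp_differentiable) (rule bounded_linear_vec_nth)
    have 2: "(\<lambda>x :: real ^ 'n. \<Prod>i\<in>I. x $ i ^ \<alpha> i) differentiable (at x)" if "finite I" for \<alpha> :: "'n \<Rightarrow> nat" and I
      using that by (induction I rule: finite_induct) (auto intro!: differentiable_mult differentiable_power 1)
    show ?thesis by (intro differentiable_sum ballI differentiable_mult differentiable_const 2) auto
  qed
  ultimately show ?thesis by simp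
qed

subsection \<open>Directional derivatives\<close>

text \<open>\<open>dir_deriv\<close> iterates the analytic derivative along a line; on polynomials
  this identity replaces it by the formal derivative. The shift \<open>a\<close> carries the base
  point.\<close>

lemma higher_deriv_poly: "(deriv ^^ k) (\<lambda>t. poly f (a + t)) = (\<lambda>t :: real. poly ((pderiv ^^ k) f) (a + t))"
proof (induction k)
  case (Suc k)
  have "((\<lambda>t. poly ((pderiv ^^ k) f) (a + t)) has_field_derivative poly (pderiv ((pderiv ^^ k) f)) (a + t)) (at t)" for t
    using DERIV_chain2[where f = "poly ((pderiv ^^ k) f)" and g = "\<lambda>t. a + t" and x = t and Db = 1 and s = UNIV, OF poly_DERIV]
    by (auto intro!: derivative_eq_intros)
  then have "deriv (\<lambda>t. poly ((pderiv ^^ k) f) (a + t)) = (\<lambda>t. poly (pderiv ((pderiv ^^ k) f)) (a + t))"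
    by (intro ext DERIV_imp_deriv)
  then show ?case using Suc by simp
qed simp

lemma pderiv_sum: "pderiv (\<Sum>a\<in>A. f a) = (\<Sum>a\<in>A. pderiv (f a :: real poly))"
  by (induction A rule: infinite_finite_induct) (auto simp: pderiv_add)

lemma higher_pderiv_sum: "(pderiv ^^ k) (\<Sum>a\<in>A. f a) = (\<Sum>a\<in>A. (pderiv ^^ k) (f a :: real poly))"
  by (induction k) (auto simp: pderiv_sum)

lemma higher_pderiv_smult: "(pderiv ^^ k) (smult c f) = smult c ((pderiv ^^ k) (f :: real poly))"
  by (induction k) (auto simp: pderiv_smult)

lemma axis_line_nth: "(x + t *\<^sub>R axis i 1) $ j = (if j = i then x $ i + t else x $ j :: real)"
  by (simp add: axis_def)

text \<open>Along the axis only the factor with index \<open>i\<close> varies, so the restriction to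
  the line is a univariate polynomial with the other factors as coefficients.\<close>

lemma dir_deriv_prod_sum:
  fixes f :: "'a \<Rightarrow> 'n::finite \<Rightarrow> real poly"
  assumes "finite A"
  shows "dir_deriv k (axis i 1) (\<lambda>x. \<Sum>a\<in>A. c a * (\<Prod>j\<in>UNIV. poly (f a j) (x $ j))) x =
    (\<Sum>a\<in>A. c a * (\<Prod>j\<in>UNIV. poly (if j = i then (pderiv ^^ k) (f a j) else f a j) (x $ j)))"
proof -
  let ?r = "\<lambda>a. \<Prod>j\<in>UNIV - {i}. poly (f a j) (x $ j)"
  let ?P = "\<Sum>a\<in>A. smult (c a * ?r a) (f a i)"
  have *: "(\<Prod>j\<in>UNIV. h j) = h i * (\<Prod>j\<in>UNIV - {i}. h j)" for h :: "'n \<Rightarrow> real"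
    by (simp add: prod.remove)
  have "(\<lambda>t. \<Sum>a\<in>A. c a * (\<Prod>j\<in>UNIV. poly (f a j) ((x + t *\<^sub>R axis i 1) $ j))) = (\<lambda>t. poly ?P (x $ i + t))"
    unfolding axis_line_nth by (subst *) (simp add: poly_sum algebra_simps)
  then have "dir_deriv k (axis i 1) (\<lambda>x. \<Sum>a\<in>A. c a * (\<Prod>j\<in>UNIV. poly (f a j) (x $ j))) x = poly ((pderiv ^^ k) ?P) (x $ i)"
    unfolding dir_deriv_def by (simp add: higher_deriv_poly)
  also have "\<dots> = (\<Sum>a\<in>A. c a * (\<Prod>j\<in>UNIV. poly (if j = i then (pderiv ^^ k) (f a j) else f a j) (x $ j)))"
    by (subst *) (simp add: higher_pderiv_sum higher_pderiv_smult poly_sum algebra_simps)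
  finally show ?thesis .
qed

lemma Qp_dir_deriv:
  fixes q :: "real ^ 'n::finite \<Rightarrow> real"
  assumes "q \<in> Qp p"
  shows "dir_deriv k (axis i 1) q \<in> Qp p"
proof -
  obtain c where c: "\<And>x. q x = (\<Sum>\<alpha> | \<forall>i. \<alpha> i \<le> p. c \<alpha> * (\<Prod>i\<in>UNIV. poly (monom 1 (\<alpha> i)) (x $ i)))"
    using assms Qp_obtain_prod by blast
  have "dir_deriv k (axis i 1) q = (\<lambda>x. \<Sum>\<alpha> | \<forall>i. \<alpha> i \<le> p. c \<alpha> *
      (\<Prod>j\<in>UNIV. poly (if j = i then (pderiv ^^ k) (monom 1 (\<alpha> j)) else monom 1 (\<alpha> j)) (x $ j)))"
    by (rule ext) (simp add: c[abs_def] dir_deriv_prod_sum)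
  also have "\<dots> \<in> Qp p"
    by (intro Qp_sum Qp_scale Qp_prod) (auto simp: degree_higher_pderiv degree_monom_eq intro: order.trans[OF diff_le_self])
  finally show ?thesis .
qed

text \<open>The degree bound on a line parallel to an axis is what makes the Taylor expansion below
  stop at order \<open>p\<close>.\<close>

lemma Qp_axis_poly:
  fixes q :: "real ^ 'n::finite \<Rightarrow> real"
  assumes "q \<in> Qp p"
  obtains P where "degree P \<le> p" "\<And>t. q (x + t *\<^sub>R axis i 1) = poly P t"
    "\<And>k t. dir_deriv k (axis i 1) q (x + t *\<^sub>R axis i 1) = poly ((pderiv ^^ k) P) t"
proof -
  obtain c where c: "\<And>x. q x = (\<Sum>\<alpha> | \<forall>i. \<alpha> i \<le> p. c \<alpha> * (\<Prod>i\<in>UNIV. poly (monom 1 (\<alpha> i)) (x $ i)))"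
    using assms Qp_obtain_prod by blast
  let ?I = "{\<alpha>. \<forall>i. \<alpha> i \<le> p}"
  let ?r = "\<lambda>\<alpha>. \<Prod>j\<in>UNIV - {i}. poly (monom 1 (\<alpha> j)) (x $ j)"
  let ?P = "pcompose (\<Sum>\<alpha>\<in>?I. smult (c \<alpha> * ?r \<alpha>) (monom 1 (\<alpha> i))) [:x $ i, 1:]"
  have *: "(\<Prod>j\<in>UNIV. h j) = h i * (\<Prod>j\<in>UNIV - {i}. h j)" for h :: "'n \<Rightarrow> real"
    by (simp add: prod.remove)
  have q: "q (x + t *\<^sub>R axis i 1) = poly ?P t" for t
    unfolding c axis_line_nth by (subst *) (simp add: poly_sum poly_pcompose algebra_simps)
  have "degree ?P \<le> p"
    by (rule order.trans[OF degree_affine_pcompose])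
      (auto intro!: degree_sum_le order.trans[OF degree_smult_le] simp: degree_monom_eq)
  moreover have "dir_deriv k (axis i 1) q (x + t *\<^sub>R axis i 1) = poly ((pderiv ^^ k) ?P) t" for k t
  proof -
    have "(\<lambda>s. q (x + t *\<^sub>R axis i 1 + s *\<^sub>R axis i 1)) = (\<lambda>s. poly ?P (t + s))"
      using q[of "t + s" for s] by (simp add: scaleR_add_left add.assoc)
    then show ?thesis unfolding dir_deriv_def by (simp add: higher_deriv_poly)
  qed
  ultimately show ?thesis using q that by blast
qed

lemma dir_deriv_linear:
  fixes q r :: "real ^ 'n::finite \<Rightarrow> real"
  assumes "q \<in> Qp p" "r \<in> Qp p"
  shows "dir_deriv k (axis i 1) (\<lambda>x. a * q x + b * r x) x = a * dir_deriv k (axis i 1) q x + b * dir_deriv k (axis i 1) r x"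
proof -
  obtain P where P: "\<And>t. q (x + t *\<^sub>R axis i 1) = poly P t"
    using Qp_axis_poly[OF assms(1)] by metis
  obtain R where R: "\<And>t. r (x + t *\<^sub>R axis i 1) = poly R t"
    using Qp_axis_poly[OF assms(2)] by metis
  have "(\<lambda>t. a * poly P t + b * poly R t) = (\<lambda>t. poly (smult a P + smult b R) (0 + t))" by auto
  then have "(deriv ^^ k) (\<lambda>t. a * poly P t + b * poly R t) 0 = poly ((pderiv ^^ k) (smult a P + smult b R)) 0"
    by (simp only: higher_deriv_poly) simp
  then show ?thesis unfolding dir_deriv_def P R
    using higher_deriv_poly[of k P 0] higher_deriv_poly[of k R 0]
    by (simp add: higher_pderiv_add higher_pderiv_smult)
qed

text \<open>Exact, because \<open>q\<close> is a polynomial of degree at most \<open>p\<close> on the line.\<close>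

lemma Qp_taylor:
  fixes q :: "real ^ 'n::finite \<Rightarrow> real"
  assumes "q \<in> Qp p"
  shows "q (x + t *\<^sub>R axis i 1) = (\<Sum>k\<le>p. t ^ k / fact k * dir_deriv k (axis i 1) q x)"
proof -
  obtain P where P: "degree P \<le> p" "\<And>t. q (x + t *\<^sub>R axis i 1) = poly P t"
    "\<And>k t. dir_deriv k (axis i 1) q (x + t *\<^sub>R axis i 1) = poly ((pderiv ^^ k) P) t"
    using Qp_axis_poly[OF assms] by metis
  have "poly P t = (\<Sum>k\<le>p. coeff P k * t ^ k)"
    unfolding poly_altdef using P(1) by (intro sum.mono_neutral_left) (auto simp: coeff_eq_0)
  moreover have "coeff P k = dir_deriv k (axis i 1) q x / fact k" for k
    using P(3)[of k 0] by (simp add: poly_0_coeff_0 coeff_higher_pderiv pochhammer_fact[symmetric])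
  ultimately show ?thesis unfolding P(2) by (simp add: mult.commute)
qed

text \<open>Each directional derivative costs a factor \<open>1 / h\<close>; the ghost weights
  \<open>edge G ^ (2 * k - 1)\<close> are matched to this scaling.\<close>

lemma dir_deriv_scale:
  fixes q :: "real ^ 'n::finite \<Rightarrow> real"
  assumes "q \<in> Qp p" "h \<noteq> 0"
  shows "dir_deriv k (axis i 1) q (a + h *\<^sub>R x) = dir_deriv k (axis i 1) (\<lambda>x. q (a + h *\<^sub>R x)) x / h ^ k"
proof -
  obtain P where P: "\<And>t. q (a + h *\<^sub>R x + t *\<^sub>R axis i 1) = poly P t"
    "\<And>k t. dir_deriv k (axis i 1) q (a + h *\<^sub>R x + t *\<^sub>R axis i 1) = poly ((pderiv ^^ k) P) t"
    using Qp_axis_poly[OF assms(1)] by metis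
  have 1: "(pderiv ^^ k) (pcompose P [:0, h:]) = smult (h ^ k) (pcompose ((pderiv ^^ k) P) [:0, h:])"
    by (induction k) (auto simp: pderiv_smult pderiv_pcompose pderiv_pCons mult.commute)
  have "(\<lambda>t. q (a + h *\<^sub>R (x + t *\<^sub>R axis i 1))) = (\<lambda>t. poly (pcompose P [:0, h:]) (0 + t))"
    using P(1)[of "h * t" for t] by (simp add: poly_pcompose scaleR_add_right add.assoc mult.commute)
  then have "dir_deriv k (axis i 1) (\<lambda>x. q (a + h *\<^sub>R x)) x = poly ((pderiv ^^ k) (pcompose P [:0, h:])) 0"
    unfolding dir_deriv_def by (simp only: higher_deriv_poly) simp
  also have "\<dots> = h ^ k * poly ((pderiv ^^ k) P) 0" unfolding 1 by (simp add: poly_pcompose)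
  finally show ?thesis using P(2)[of k 0] assms(2) by simp
qed

subsection \<open>Hausdorff measure\<close>

abbreviation ball_weight :: "nat \<Rightarrow> 'a::metric_space set \<Rightarrow> ennreal" where
  "ball_weight s U \<equiv> ennreal (unit_ball_vol (real s) * (diameter U / 2) ^ s)"

lemma hausdorff_content_le:
  assumes "A \<subseteq> (\<Union>i. U i)" "\<And>i. bounded (U i)" "\<And>i. diameter (U i) \<le> \<epsilon>"
  shows "hausdorff_content s \<epsilon> A \<le> (\<Sum>i. ball_weight s (U i))"
  unfolding hausdorff_content_def using assms by (intro INF_lower) auto

lemma hausdorff_content_mono: "A \<subseteq> B \<Longrightarrow> hausdorff_content s \<epsilon> A \<le> hausdorff_content s \<epsilon> B"
  unfolding hausdorff_content_def by (intro INF_superset_mono) auto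

lemma hausdorff_content_antimono: "\<epsilon> \<le> \<delta> \<Longrightarrow> hausdorff_content s \<delta> A \<le> hausdorff_content s \<epsilon> A"
  unfolding hausdorff_content_def by (intro INF_superset_mono) (auto intro: order.trans)

lemma hausdorff_outer_mono: "A \<subseteq> B \<Longrightarrow> hausdorff_outer s A \<le> hausdorff_outer s B"
  unfolding hausdorff_outer_def by (intro SUP_mono') (auto intro: hausdorff_content_mono)

lemma hausdorff_content_le_outer: "0 < \<epsilon> \<Longrightarrow> hausdorff_content s \<epsilon> A \<le> hausdorff_outer s A"
  unfolding hausdorff_outer_def by (intro SUP_upper) auto

lemma hausdorff_content_le_finite:
  assumes "finite I" "A \<subseteq> (\<Union>i\<in>I. U i)" "\<And>i. i \<in> I \<Longrightarrow> bounded (U i)"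
    "\<And>i. i \<in> I \<Longrightarrow> diameter (U i) \<le> \<epsilon>" "1 \<le> s" "0 < \<epsilon>"
  shows "hausdorff_content s \<epsilon> A \<le> (\<Sum>i\<in>I. ball_weight s (U i))"
proof -
  obtain e where e: "bij_betw e {0..<card I} I" using ex_bij_betw_nat_finite[OF assms(1)] by blast
  \<comment> \<open>Pad the finite cover with empty sets. Their weight vanishes because
    \<open>1 \<le> s\<close>; for \<open>s = 0\<close> it would contain
    \<open>0 ^ 0 = 1\<close>.\<close>
  define V where "V n = (if n < card I then U (e n) else {})" for n
  have I: "I = e ` {0..<card I}" using e by (auto simp: bij_betw_def)
  have "hausdorff_content s \<epsilon> A \<le> (\<Sum>n. ball_weight s (V n))"
  proof (rule hausdorff_content_le)
    show "A \<subseteq> (\<Union>n. V n)"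
    proof
      fix x assume "x \<in> A"
      then obtain i where "i \<in> I" "x \<in> U i" using assms(2) by auto
      moreover from \<open>i \<in> I\<close> have "i \<in> e ` {0..<card I}" by (simp only: I[symmetric])
      then obtain n where "n < card I" "i = e n" by auto
      ultimately have "x \<in> V n" by (simp add: V_def)
      then show "x \<in> (\<Union>n. V n)" by blast
    qed
    have "e n \<in> I" if "n < card I" for n using e that by (auto simp: bij_betw_def)
    then show "bounded (V n)" "diameter (V n) \<le> \<epsilon>" for n
      using assms(3,4,6) by (auto simp: V_def diameter_empty)
  qed
  also have "\<dots> = (\<Sum>n\<in>{0..<card I}. ball_weight s (V n))"
    using assms(5) by (intro suminf_finite) (auto simp: V_def diameter_empty)
  also have "\<dots> = (\<Sum>n\<in>{0..<card I}. ball_weight s (U (e n)))"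
    by (intro sum.cong) (auto simp: V_def)
  also have "\<dots> = (\<Sum>i\<in>I. ball_weight s (U i))"
    using sum.reindex_bij_betw[OF e, of "\<lambda>i. ball_weight s (U i)"] by simp
  finally show ?thesis .
qed

lemma hausdorff_outer_empty:
  assumes "1 \<le> s"
  shows "hausdorff_outer s {} = 0"
proof -
  have "hausdorff_content s \<epsilon> {} \<le> 0" if "0 < \<epsilon>" for \<epsilon>
    using hausdorff_content_le_finite[of "{}" "{}" _ \<epsilon> s] assms that by simp
  then show ?thesis unfolding hausdorff_outer_def by (intro antisym SUP_least) auto
qed

lemma hausdorff_content_close:
  assumes "hausdorff_content s \<epsilon> A < c"
  obtains U where "A \<subseteq> (\<Union>i :: nat. U i)" "\<And>i. bounded (U i)" "\<And>i. diameter (U i) \<le> \<epsilon>"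
    "(\<Sum>i. ball_weight s (U i)) < c"
  using assms unfolding hausdorff_content_def INF_less_iff by auto

text \<open>Covers of the sets \<open>A n\<close> that are optimal up to
  \<open>e / 2 ^ (n + 1)\<close> are merged into one sequence through
  \<open>prod_decode\<close>.\<close>

lemma hausdorff_content_UN_le: "hausdorff_content s \<epsilon> (\<Union>n. A n) \<le> (\<Sum>n :: nat. hausdorff_content s \<epsilon> (A n))"
proof (rule ennreal_le_epsilon)
  fix e :: real assume e: "0 < e" and fin: "(\<Sum>n. hausdorff_content s \<epsilon> (A n)) < top"
  then have lt: "hausdorff_content s \<epsilon> (A n) < hausdorff_content s \<epsilon> (A n) + e * (1/2) ^ Suc n" for n
    by (auto simp add: less_top dest!: ennreal_suminf_lessD)
  have "\<exists>U. A n \<subseteq> (\<Union>i :: nat. U i) \<and> (\<forall>i. bounded (U i) \<and> diameter (U i) \<le> \<epsilon>) \<and>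
      (\<Sum>i. ball_weight s (U i)) < hausdorff_content s \<epsilon> (A n) + e * (1/2) ^ Suc n" for n
    using hausdorff_content_close[OF lt[of n]] by metis
  then have "\<forall>n. \<exists>U. A n \<subseteq> (\<Union>i :: nat. U i) \<and> (\<forall>i. bounded (U i) \<and> diameter (U i) \<le> \<epsilon>) \<and>
      (\<Sum>i. ball_weight s (U i)) < hausdorff_content s \<epsilon> (A n) + e * (1/2) ^ Suc n" by blast
  from choice[OF this] obtain B where
    B: "\<And>n. A n \<subseteq> (\<Union>i :: nat. B n i)" "\<And>n i. bounded (B n i)" "\<And>n i. diameter (B n i) \<le> \<epsilon>"
    "\<And>n. (\<Sum>i. ball_weight s (B n i)) < hausdorff_content s \<epsilon> (A n) + e * (1/2) ^ Suc n" by blast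
  define C where "C = (\<lambda>k. case_prod B (prod_decode k))"
  have "hausdorff_content s \<epsilon> (\<Union>n. A n) \<le> (\<Sum>k. ball_weight s (C k))"
  proof (rule hausdorff_content_le)
    show "(\<Union>n. A n) \<subseteq> (\<Union>k. C k)"
    proof
      fix x assume "x \<in> (\<Union>n. A n)"
      then obtain n i where "x \<in> B n i" using B(1) by blast
      then have "x \<in> C (prod_encode (n, i))" by (simp add: C_def)
      then show "x \<in> (\<Union>k. C k)" by blast
    qed
    show "bounded (C k)" "diameter (C k) \<le> \<epsilon>" for k using B by (auto simp: C_def split: prod.splits)
  qed
  also have "\<dots> = (\<Sum>n. \<Sum>i. ball_weight s (B n i))"
    unfolding C_def 
    using suminf_ennreal_2dimen[of "\<lambda>n. \<Sum>i. ball_weight s (B n i)" "\<lambda>(n, i). ball_weight s (B n i)"]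
    by (simp add: comp_def case_prod_beta)
  also have "\<dots> \<le> (\<Sum>n. hausdorff_content s \<epsilon> (A n) + e * (1/2) ^ Suc n)"
    using B(4) by (intro suminf_le) (auto intro: less_imp_le)
  also have "\<dots> = (\<Sum>n. hausdorff_content s \<epsilon> (A n)) + (\<Sum>n. ennreal e * ennreal ((1/2) ^ Suc n))"
    using e by (subst suminf_add[symmetric])
      (auto simp del: ennreal_suminf_cmult simp add: ennreal_mult[symmetric])
  also have "\<dots> = (\<Sum>n. hausdorff_content s \<epsilon> (A n)) + e"
    unfolding ennreal_suminf_cmult
    by (subst suminf_ennreal_eq[OF zero_le_power power_half_series]) auto
  finally show "hausdorff_content s \<epsilon> (\<Union>n. A n) \<le> (\<Sum>n. hausdorff_content s \<epsilon> (A n)) + e" .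
qed

lemma hausdorff_outer_UN_le: "hausdorff_outer s (\<Union>n. A n) \<le> (\<Sum>n :: nat. hausdorff_outer s (A n))"
  unfolding hausdorff_outer_def[of s "\<Union>n. A n"]
proof (rule SUP_least)
  fix \<epsilon> :: real assume "\<epsilon> \<in> {0<..}"
  then have "(\<Sum>n. hausdorff_content s \<epsilon> (A n)) \<le> (\<Sum>n. hausdorff_outer s (A n))"
    by (intro suminf_le) (auto intro: hausdorff_content_le_outer)
  then show "hausdorff_content s \<epsilon> (\<Union>n. A n) \<le> (\<Sum>n. hausdorff_outer s (A n))"
    using hausdorff_content_UN_le order.trans by blast
qed

section \<open>Caratheodory measurability and the surface measure\<close>

lemma hausdorff_outer_space:
  assumes "1 \<le> s"
  shows "outer_measure_space (Pow UNIV) (hausdorff_outer s)"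
  unfolding outer_measure_space_def positive_def increasing_def countably_subadditive_def
  using hausdorff_outer_empty[OF assms] hausdorff_outer_mono hausdorff_outer_UN_le by auto

lemma hausdorff_outer_Un_le:
  assumes "1 \<le> s"
  shows "hausdorff_outer s (A \<union> B) \<le> hausdorff_outer s A + hausdorff_outer s B"
proof -
  have "subadditive (Pow UNIV) (hausdorff_outer s :: 'a set \<Rightarrow> ennreal)"
    using hausdorff_outer_space[OF assms]
    by (intro ring_of_sets.countably_subadditive_subadditive[OF ring_of_sets_Pow])
      (auto simp: outer_measure_space_def)
  then have "hausdorff_outer s (A \<union> (B - A)) \<le> hausdorff_outer s A + hausdorff_outer s (B - A)"
    unfolding subadditive_def by blast
  also have "\<dots> \<le> hausdorff_outer s A + hausdorff_outer s B"
    by (intro add_left_mono hausdorff_outer_mono) auto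
  finally show ?thesis by simp
qed

text \<open>A set of diameter below \<open>\<eta>\<close> cannot meet both \<open>A\<close> and
  \<open>B\<close>, so every sufficiently fine cover of the union splits into two disjoint
  subfamilies that cover \<open>A\<close> and \<open>B\<close>.\<close>

lemma hausdorff_outer_separated:
  fixes A B :: "'a::metric_space set"
  assumes s: "1 \<le> s" and "0 < \<eta>" and sep: "\<And>x y. x \<in> A \<Longrightarrow> y \<in> B \<Longrightarrow> \<eta> \<le> dist x y"
  shows "hausdorff_outer s A + hausdorff_outer s B \<le> hausdorff_outer s (A \<union> B)"
proof -
  have small: "hausdorff_content s \<epsilon> A + hausdorff_content s \<epsilon> B \<le> hausdorff_content s \<epsilon> (A \<union> B)"
    if \<epsilon>: "0 < \<epsilon>" "\<epsilon> < \<eta>" for \<epsilon>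
    unfolding hausdorff_content_def[of s \<epsilon> "A \<union> B"]
  proof (rule INF_greatest, clarify)
    fix U :: "nat \<Rightarrow> 'a set"
    assume cov: "A \<union> B \<subseteq> (\<Union>i. U i)" and U: "\<forall>i. bounded (U i) \<and> diameter (U i) \<le> \<epsilon>"
    define UA where "UA i = (if U i \<inter> A = {} then {} else U i)" for i
    define UB where "UB i = (if U i \<inter> B = {} then {} else U i)" for i
    have "U i \<inter> A = {} \<or> U i \<inter> B = {}" for i
    proof (rule ccontr)
      assume "\<not> ?thesis"
      then obtain x y where xy: "x \<in> U i" "x \<in> A" "y \<in> U i" "y \<in> B" by auto
      then have "dist x y \<le> diameter (U i)" using U diameter_bounded_bound by blast
      then show False using sep[OF xy(2,4)] U \<epsilon> by (smt (verit))
    qed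
    then have le: "ball_weight s (UA i) + ball_weight s (UB i) \<le> ball_weight s (U i)" for i
      using s by (auto simp: UA_def UB_def diameter_empty power_0_left)
    have covA: "A \<subseteq> (\<Union>i. UA i)"
    proof
      fix x assume "x \<in> A"
      then obtain i where "x \<in> U i" using cov by auto
      then have "x \<in> UA i" using \<open>x \<in> A\<close> by (auto simp: UA_def)
      then show "x \<in> (\<Union>i. UA i)" by blast
    qed
    have covB: "B \<subseteq> (\<Union>i. UB i)"
    proof
      fix x assume "x \<in> B"
      then obtain i where "x \<in> U i" using cov by auto
      then have "x \<in> UB i" using \<open>x \<in> B\<close> by (auto simp: UB_def)
      then show "x \<in> (\<Union>i. UB i)" by blast
    qed
    have "hausdorff_content s \<epsilon> A \<le> (\<Sum>i. ball_weight s (UA i))"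
      using covA U \<epsilon> by (intro hausdorff_content_le) (auto simp: UA_def diameter_empty)
    moreover have "hausdorff_content s \<epsilon> B \<le> (\<Sum>i. ball_weight s (UB i))"
      using covB U \<epsilon> by (intro hausdorff_content_le) (auto simp: UB_def diameter_empty)
    ultimately have "hausdorff_content s \<epsilon> A + hausdorff_content s \<epsilon> B
        \<le> (\<Sum>i. ball_weight s (UA i)) + (\<Sum>i. ball_weight s (UB i))" by (rule add_mono)
    also have "\<dots> = (\<Sum>i. ball_weight s (UA i) + ball_weight s (UB i))"
      by (intro suminf_add) auto
    also have "\<dots> \<le> (\<Sum>i. ball_weight s (U i))" using le by (intro suminf_le) auto
    finally show "hausdorff_content s \<epsilon> A + hausdorff_content s \<epsilon> B \<le> (\<Sum>i. ball_weight s (U i))" .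
  qed
  have "hausdorff_outer s A + hausdorff_outer s B
      = (SUP \<epsilon>\<in>{0<..}. hausdorff_content s \<epsilon> A + hausdorff_content s \<epsilon> B)"
    unfolding hausdorff_outer_def
  proof (rule SUP_add_directed_ennreal[symmetric])
    fix i j :: real assume "i \<in> {0<..}" "j \<in> {0<..}"
    then show "\<exists>k\<in>{0<..}. hausdorff_content s i A + hausdorff_content s j B
        \<le> hausdorff_content s k A + hausdorff_content s k B"
      by (intro bexI[of _ "min i j"] add_mono hausdorff_content_antimono) auto
  qed
  also have "\<dots> \<le> hausdorff_outer s (A \<union> B)"
  proof (rule SUP_least)
    fix \<epsilon> :: real assume "\<epsilon> \<in> {0<..}"
    then have \<epsilon>: "0 < min \<epsilon> (\<eta> / 2)" "min \<epsilon> (\<eta> / 2) < \<eta>" using assms(2) by auto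
    have "hausdorff_content s \<epsilon> A + hausdorff_content s \<epsilon> B
        \<le> hausdorff_content s (min \<epsilon> (\<eta> / 2)) A + hausdorff_content s (min \<epsilon> (\<eta> / 2)) B"
      by (intro add_mono hausdorff_content_antimono) auto
    also have "\<dots> \<le> hausdorff_content s (min \<epsilon> (\<eta> / 2)) (A \<union> B)" by (rule small[OF \<epsilon>])
    also have "\<dots> \<le> hausdorff_outer s (A \<union> B)" by (rule hausdorff_content_le_outer[OF \<epsilon>(1)])
    finally show "hausdorff_content s \<epsilon> A + hausdorff_content s \<epsilon> B \<le> hausdorff_outer s (A \<union> B)" .
  qed
  finally show ?thesis .
qed

text \<open>Caratheodory's condition for a closed set. The part of \<open>X\<close> off
  \<open>C\<close> is exhausted by the sets \<open>Y n\<close>, which keep a positive distance from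
  \<open>C\<close>; what \<open>Y n\<close> misses is a union of rings, and rings of equal parity
  are separated from each other, so the series of their measures is bounded by the measure of
  \<open>X\<close>.\<close>

lemma closed_hausdorff_additive:
  fixes C X :: "'a::metric_space set"
  assumes s: "1 \<le> s" and "closed C"
  shows "hausdorff_outer s (X \<inter> C) + hausdorff_outer s (X - C) \<le> hausdorff_outer s X"
proof (cases "C = {} \<or> hausdorff_outer s X = top")
  case True
  then show ?thesis using hausdorff_outer_empty[OF s] by auto
next
  case False
  then have C: "C \<noteq> {}" and fin: "hausdorff_outer s X \<noteq> top" by auto
  let ?H = "hausdorff_outer s"
  define Y where "Y n = {x \<in> X. 1 / real (Suc n) \<le> infdist x C}" for n
  define R where "R n = Y (Suc n) - Y n" for n
  have YX: "Y n \<subseteq> X - C" for n by (auto simp: Y_def)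
  have Y_mono: "Y n \<subseteq> Y m" if "n \<le> m" for n m
  proof -
    have "1 / real (Suc m) \<le> 1 / real (Suc n)" using that by (simp add: frac_le)
    then show ?thesis by (auto simp: Y_def)
  qed
  have Y_UN: "\<exists>n. x \<in> Y n" if "x \<in> X" "x \<notin> C" for x
  proof -
    have "0 < infdist x C" using assms(2) C that by (metis in_closed_iff_infdist_zero infdist_nonneg order_less_le)
    then obtain n where "inverse (real (Suc n)) < infdist x C" using reals_Archimedean by blast
    then show ?thesis using that by (auto simp: Y_def inverse_eq_divide intro!: exI[of _ n])
  qed
  have R_le: "1 / real (n + 2) \<le> infdist x C" "infdist x C < 1 / real (n + 1)" if "x \<in> R n" for x n
    using that by (auto simp: R_def Y_def add.commute)
  have dist: "infdist x C - infdist y C \<le> dist x y" for x y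
    using infdist_triangle[of x C y] by simp
  \<comment> \<open>\<open>b\<close> is 0 or 1 for the parity. Between two such rings lies a whole
    ring, whose width bounds their distance from below.\<close>
  have rings: "(\<Sum>k<N. ?H (R (2 * k + b))) \<le> ?H (\<Union>k<N. R (2 * k + b))" for b N
  proof (induction N)
    case (Suc N)
    define a where "a = 2 * N + b"
    have "?H (\<Union>k<N. R (2 * k + b)) + ?H (R a) \<le> ?H ((\<Union>k<N. R (2 * k + b)) \<union> R a)"
    proof (cases "N = 0")
      case True
      then show ?thesis by (simp add: hausdorff_outer_empty[OF s])
    next
      case False
      then have a: "1 \<le> a" by (simp add: a_def)
      show ?thesis
      proof (rule hausdorff_outer_separated[OF s, of "1 / real a - 1 / real (a + 1)"])
        show "0 < 1 / real a - 1 / real (a + 1)" using a by (simp add: frac_less2)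
        fix x y assume x: "x \<in> (\<Union>k<N. R (2 * k + b))" and y: "y \<in> R a"
        then obtain k where k: "k < N" "x \<in> R (2 * k + b)" by auto
        have "2 * k + b + 2 \<le> a" using k by (simp add: a_def)
        then have "1 / real a \<le> 1 / real (2 * k + b + 2)" by (intro divide_left_mono) auto
        then show "1 / real a - 1 / real (a + 1) \<le> dist x y"
          using R_le(1)[OF k(2)] R_le(2)[OF y] dist[of x y] by linarith
      qed
    qed
    then have "(\<Sum>k<N. ?H (R (2 * k + b))) + ?H (R a) \<le> ?H ((\<Union>k<N. R (2 * k + b)) \<union> R a)"
      using Suc.IH by (meson add_right_mono order.trans)
    moreover have "(\<Union>k<Suc N. R (2 * k + b)) = (\<Union>k<N. R (2 * k + b)) \<union> R a"
      by (auto simp: a_def lessThan_Suc)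
    ultimately show ?case by (simp only: a_def sum.lessThan_Suc)
  qed simp
  define S where "S b = (\<Sum>k. ?H (R (2 * k + b)))" for b
  have S_fin: "S b \<noteq> top" for b
  proof -
    have "(\<Sum>k<N. ?H (R (2 * k + b))) \<le> ?H X" for N
    proof -
      have sub: "(\<Union>k<N. R (2 * k + b)) \<subseteq> X" using YX unfolding R_def by blast
      show ?thesis by (rule order.trans[OF rings[of b N] hausdorff_outer_mono[OF sub]])
    qed
    then have "S b \<le> ?H X" unfolding S_def by (intro suminf_le_const) auto
    then show ?thesis using fin by (auto simp: top_unique)
  qed
  \<comment> \<open>The least \<open>m\<close> with \<open>x\<close> in \<open>Y m\<close> is either
    at most \<open>2 * n\<close> or determines the ring that contains \<open>x\<close>.\<close>
  have X_eq: "X - C = Y (2 * n) \<union> ((\<Union>k. R (2 * (k + n) + 0)) \<union> (\<Union>k. R (2 * (k + n) + 1)))" for n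
  proof (intro equalityI subsetI)
    fix x assume x: "x \<in> X - C"
    define m where "m = (LEAST m. x \<in> Y m)"
    have m: "x \<in> Y m" unfolding m_def using Y_UN[of x] x by (intro LeastI_ex[of "\<lambda>m. x \<in> Y m"]) blast
    show "x \<in> Y (2 * n) \<union> ((\<Union>k. R (2 * (k + n) + 0)) \<union> (\<Union>k. R (2 * (k + n) + 1)))"
    proof (cases "m \<le> 2 * n")
      case True
      then show ?thesis using m Y_mono by blast
    next
      case False
      then obtain l where l: "m = Suc l" "2 * n \<le> l" by (cases m) auto
      then have "l < m" by simp
      then have "x \<notin> Y l" unfolding m_def by (rule not_less_Least)
      then have "x \<in> R l" using m l by (simp add: R_def)
      then consider "x \<in> R (2 * ((l div 2 - n) + n) + 0)" | "x \<in> R (2 * ((l div 2 - n) + n) + 1)"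
      proof (cases "even l")
        case True
        then have e: "2 * ((l div 2 - n) + n) + 0 = l" using l(2) by presburger
        show ?thesis by (rule that(1)) (simp only: e \<open>x \<in> R l\<close>)
      next
        case False
        then have e: "2 * ((l div 2 - n) + n) + 1 = l" using l(2) by presburger
        show ?thesis by (rule that(2)) (simp only: e \<open>x \<in> R l\<close>)
      qed
      then show ?thesis by cases blast+
    qed
  qed (use YX in \<open>auto simp: R_def\<close>)
  \<comment> \<open>Differences of extended reals are avoided: the partial sums are added to both
    sides, and the finite total \<open>S 0 + S 1\<close> is cancelled after the passage to the
    limit.\<close>
  have step: "(?H (X \<inter> C) + ?H (X - C)) + ((\<Sum>k<n. ?H (R (2 * k + 0))) + (\<Sum>k<n. ?H (R (2 * k + 1))))
      \<le> ?H X + (S 0 + S 1)" for n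
  proof -
    have tail: "(\<Sum>k<n. ?H (R (2 * k + b))) + ?H (\<Union>k. R (2 * (k + n) + b)) \<le> S b" for b
    proof -
      have "?H (\<Union>k. R (2 * (k + n) + b)) \<le> (\<Sum>k. ?H (R (2 * (k + n) + b)))"
        by (rule hausdorff_outer_UN_le)
      moreover have "S b = (\<Sum>k. ?H (R (2 * (k + n) + b))) + (\<Sum>k<n. ?H (R (2 * k + b)))"
        unfolding S_def by (rule suminf_offset[OF summableI])
      ultimately show ?thesis by (simp add: add.commute add_left_mono)
    qed
    have "?H (X - C) \<le> ?H (Y (2 * n)) + (?H (\<Union>k. R (2 * (k + n) + 0)) + ?H (\<Union>k. R (2 * (k + n) + 1)))"
      unfolding X_eq[of n] by (rule order.trans[OF hausdorff_outer_Un_le[OF s] add_left_mono[OF hausdorff_outer_Un_le[OF s]]])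
    then have "(?H (X \<inter> C) + ?H (X - C)) + ((\<Sum>k<n. ?H (R (2 * k + 0))) + (\<Sum>k<n. ?H (R (2 * k + 1))))
      \<le> (?H (X \<inter> C) + (?H (Y (2 * n)) + (?H (\<Union>k. R (2 * (k + n) + 0)) + ?H (\<Union>k. R (2 * (k + n) + 1)))))
         + ((\<Sum>k<n. ?H (R (2 * k + 0))) + (\<Sum>k<n. ?H (R (2 * k + 1))))"
      by (intro add_right_mono add_left_mono)
    also have "\<dots> = (?H (X \<inter> C) + ?H (Y (2 * n))) +
        (((\<Sum>k<n. ?H (R (2 * k + 0))) + ?H (\<Union>k. R (2 * (k + n) + 0)))
         + ((\<Sum>k<n. ?H (R (2 * k + 1))) + ?H (\<Union>k. R (2 * (k + n) + 1))))"
      by (simp only: ac_simps)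
    also have "\<dots> \<le> ?H X + (S 0 + S 1)"
    proof (intro add_mono tail)
      have "?H (X \<inter> C) + ?H (Y (2 * n)) \<le> ?H ((X \<inter> C) \<union> Y (2 * n))"
      proof (rule hausdorff_outer_separated[OF s, of "1 / real (Suc (2 * n))"])
        fix x y assume "x \<in> X \<inter> C" "y \<in> Y (2 * n)"
        then show "1 / real (Suc (2 * n)) \<le> dist x y"
          using infdist_le[of x C y] by (auto simp: Y_def dist_commute)
      qed simp
      also have "\<dots> \<le> ?H X" using YX by (intro hausdorff_outer_mono) blast
      finally show "?H (X \<inter> C) + ?H (Y (2 * n)) \<le> ?H X" .
    qed
    finally show ?thesis .
  qed
  have lim: "(\<lambda>n. \<Sum>k<n. ?H (R (2 * k + b))) \<longlonglongrightarrow> S b" for b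
    unfolding S_def by (rule summable_LIMSEQ[OF summableI])
  have "(?H (X \<inter> C) + ?H (X - C)) + (S 0 + S 1) \<le> ?H X + (S 0 + S 1)"
    by (rule LIMSEQ_le_const2[OF tendsto_add[OF tendsto_const tendsto_add[OF lim lim]]])
      (use step in blast)
  then show ?thesis using S_fin by (simp add: ennreal_add_left_cancel_le add.commute[of _ "S 0 + S 1"])
qed

text \<open>A measure built by \<open>measure_of\<close> takes the prescribed values only if these
  form a measure. Closed sets satisfy Caratheodory's condition, and they generate the Borel
  sets.\<close>

theorem emeasure_surf:
  fixes A :: "(real ^ 'n::finite) set"
  assumes "2 \<le> CARD('n)" "A \<in> sets borel"
  shows "emeasure surf A = hausdorff_outer (CARD('n) - 1) A"
proof -
  let ?s = "CARD('n) - 1"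
  let ?H = "hausdorff_outer ?s :: (real ^ 'n) set \<Rightarrow> ennreal"
  have s: "1 \<le> ?s" using assms(1) by simp
  let ?L = "lambda_system UNIV (Pow UNIV) ?H"
  have ms: "measure_space UNIV ?L ?H"
    by (rule sigma_algebra.caratheodory_lemma[OF sigma_algebra_Pow hausdorff_outer_space[OF s]])
  then have sa: "sigma_algebra UNIV ?L" by (simp add: measure_space_def)
  have cl: "C \<in> ?L" if "closed C" for C
    unfolding algebra.lambda_system_eq[OF algebra_Pow]
  proof (intro CollectI conjI ballI)
    fix X :: "(real ^ 'n) set"
    have "?H (X \<inter> C \<union> (X - C)) \<le> ?H (X \<inter> C) + ?H (X - C)" by (rule hausdorff_outer_Un_le[OF s])
    moreover have "X \<inter> C \<union> (X - C) = X" by blast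
    ultimately show "?H (X \<inter> C) + ?H (X - C) = ?H X"
      using closed_hausdorff_additive[OF s that, of X] by (intro antisym) auto
  qed simp
  have "sets borel \<subseteq> ?L"
    unfolding borel_eq_closed sets_measure_of[OF subset_UNIV[of "Collect closed", unfolded Pow_UNIV[symmetric]]]
    using cl sa by (intro sigma_algebra.sigma_sets_subset) auto
  then have "countably_additive (sets borel) ?H"
    using ms unfolding measure_space_def countably_additive_def by (meson subset_trans subset_iff)
  moreover have "positive (sets borel) ?H" using hausdorff_outer_empty[OF s] by (simp add: positive_def)
  ultimately show ?thesis
    unfolding surf_def using assms(2) sets.sigma_algebra_axioms[of borel]
    by (intro emeasure_measure_of_sigma) auto
qed

lemma sets_surf [simp, measurable_cong]: "sets surf = sets (borel :: (real ^ 'n::finite) measure)"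
  using sets.sigma_sets_eq[of "borel :: (real ^ 'n) measure"] by (simp add: surf_def sets_measure_of_conv)

lemma space_surf [simp]: "space surf = UNIV"
  unfolding surf_def by (simp add: space_measure_of_conv)

section \<open>Area bounds for graphs and flat faces\<close>

lemma card_pred_index: "card (UNIV - {i0 :: 'n::finite}) = CARD('n) - 1"
  by simp

lemma prod_one_other: "(\<Prod>j\<in>UNIV. if j = i0 then r else t :: real) = r * t ^ (CARD('n) - 1)" for i0 :: "'n::finite"
proof -
  have "(\<Prod>j\<in>UNIV. if j = i0 then r else t) = r * (\<Prod>j\<in>UNIV - {i0}. if j = i0 then r else t)"
    by (subst prod.remove[of UNIV i0]) auto
  also have "(\<Prod>j\<in>UNIV - {i0}. if j = i0 then r else t) = (\<Prod>j\<in>UNIV - {i0}. t)"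
    by (intro prod.cong) auto
  finally show ?thesis by simp
qed

text \<open>Subdivide the base into \<open>N ^ (CARD('n) - 1)\<close> cubes. The part of the graph
  over one cube has diameter at most \<open>CARD('n) * L * h / N\<close>, so the total weight is
  bounded independently of \<open>N\<close>, and \<open>N\<close> can be taken large enough for any
  scale \<open>\<epsilon>\<close>.\<close>

lemma hausdorff_outer_graph_le:
  fixes A :: "(real ^ 'n::finite) set"
  assumes d: "2 \<le> CARD('n)" and h: "0 < h" and L: "1 \<le> L"
    and A: "\<And>x i. x \<in> A \<Longrightarrow> a $ i \<le> x $ i \<and> x $ i \<le> a $ i + h"
    and graph: "\<And>x y \<delta>. x \<in> A \<Longrightarrow> y \<in> A \<Longrightarrow> (\<And>i. i \<noteq> i0 \<Longrightarrow> \<bar>x $ i - y $ i\<bar> \<le> \<delta>) \<Longrightarrow> \<bar>x $ i0 - y $ i0\<bar> \<le> L * \<delta>"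
  shows "hausdorff_outer (CARD('n) - 1) A \<le>
    ennreal (unit_ball_vol (real (CARD('n) - 1)) * (real CARD('n) * L * h) ^ (CARD('n) - 1))"
  unfolding hausdorff_outer_def
proof (rule SUP_least)
  fix \<epsilon> :: real assume "\<epsilon> \<in> {0<..}"
  then have \<epsilon>: "0 < \<epsilon>" by simp
  let ?s = "CARD('n) - 1" and ?d = "real CARD('n)"
  have pos: "0 < ?d * L * h" using h L by simp
  obtain N :: nat where N: "?d * L * h / \<epsilon> < N" using reals_Archimedean2 by blast
  then have N0: "0 < N" using pos \<epsilon> by (smt (verit) divide_pos_pos of_nat_0_less_iff)
  define \<kappa> where "\<kappa> = h / N"
  have \<kappa>: "0 < \<kappa>" using h N0 by (simp add: \<kappa>_def)
  have small: "?d * L * \<kappa> \<le> \<epsilon>" using N \<epsilon> N0 by (simp add: \<kappa>_def field_simps)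
  define I where "I = PiE (UNIV - {i0}) (\<lambda>_. {..<N})"
  define U where "U g = {x \<in> A. \<forall>i. i \<noteq> i0 \<longrightarrow> a $ i + \<kappa> * real (g i) \<le> x $ i \<and> x $ i \<le> a $ i + \<kappa> * (real (g i) + 1)}"
    for g :: "'n \<Rightarrow> nat"
  have finI: "finite I" unfolding I_def by (intro finite_PiE) auto
  have cardI: "card I = N ^ ?s" unfolding I_def by (simp add: card_PiE)
  have cover: "A \<subseteq> (\<Union>g\<in>I. U g)"
  proof
    fix x assume x: "x \<in> A"
    \<comment> \<open>\<open>min (N - 1)\<close> puts the points on the upper faces into the last
      cube.\<close>
    define g where "g = restrict (\<lambda>i. min (N - 1) (nat \<lfloor>(x $ i - a $ i) / \<kappa>\<rfloor>)) (UNIV - {i0})"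
    have "g \<in> I" using N0 by (auto simp: g_def I_def)
    moreover have "a $ i + \<kappa> * real (g i) \<le> x $ i \<and> x $ i \<le> a $ i + \<kappa> * (real (g i) + 1)" if "i \<noteq> i0" for i
    proof -
      define t where "t = (x $ i - a $ i) / \<kappa>"
      have xt: "x $ i = a $ i + \<kappa> * t" using \<kappa> by (simp add: t_def)
      have "x $ i - a $ i \<le> N * \<kappa>" using A[OF x, of i] N0 by (simp add: \<kappa>_def)
      then have t: "0 \<le> t" "t \<le> N" using A[OF x, of i] \<kappa> by (auto simp: t_def pos_divide_le_eq)
      have gi: "g i = min (N - 1) (nat \<lfloor>t\<rfloor>)" using that by (simp add: g_def t_def)
      have "real (g i) \<le> t" using t(1) unfolding gi by (simp add: min_le_iff_disj) linarith
      moreover have "t \<le> real (g i) + 1"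
      proof (cases "nat \<lfloor>t\<rfloor> \<le> N - 1")
        case True
        then show ?thesis using t(1) unfolding gi by (simp add: min_absorb2)
      next
        case False
        then show ?thesis using t(2) N0 unfolding gi by (simp add: min_absorb1 of_nat_diff)
      qed
      ultimately show ?thesis unfolding xt using \<kappa> by (simp add: mult_le_cancel_left_pos)
    qed
    ultimately show "x \<in> (\<Union>g\<in>I. U g)" using x unfolding U_def by blast
  qed
  have diff: "norm (x - y) \<le> ?d * L * \<kappa>" if "x \<in> U g" "y \<in> U g" for x y g
  proof -
    have 1: "\<bar>x $ i - y $ i\<bar> \<le> \<kappa>" if "i \<noteq> i0" for i
    proof -
      have "a $ i + \<kappa> * real (g i) \<le> x $ i \<and> x $ i \<le> a $ i + \<kappa> * real (g i) + \<kappa>"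
        "a $ i + \<kappa> * real (g i) \<le> y $ i \<and> y $ i \<le> a $ i + \<kappa> * real (g i) + \<kappa>"
        using \<open>x \<in> U g\<close> \<open>y \<in> U g\<close> that by (auto simp: U_def algebra_simps)
      then show ?thesis by linarith
    qed
    have "\<kappa> \<le> L * \<kappa>" using L \<kappa> by simp
    moreover have "\<bar>x $ i0 - y $ i0\<bar> \<le> L * \<kappa>" using graph[of x y \<kappa>] 1 that by (auto simp: U_def)
    ultimately have "\<bar>(x - y) $ i\<bar> \<le> L * \<kappa>" for i using 1[of i] by (cases "i = i0") auto
    then have "(\<Sum>i\<in>UNIV. \<bar>(x - y) $ i\<bar>) \<le> (\<Sum>i\<in>(UNIV :: 'n set). L * \<kappa>)" by (intro sum_mono) auto
    then show ?thesis using norm_le_l1_cart[of "x - y"] by simp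
  qed
  have bounded: "bounded (U g)" for g
    using diff bounded_two_points[of "U g"] by (metis dist_norm)
  have diam: "diameter (U g) \<le> ?d * L * \<kappa>" for g
    using diff[of _ g] pos \<kappa> L by (intro diameter_le) auto
  have "hausdorff_content ?s \<epsilon> A \<le> (\<Sum>g\<in>I. ball_weight ?s (U g))"
    using d diam small bounded by (intro hausdorff_content_le_finite[OF finI cover]) (auto intro: order.trans \<epsilon>)
  also have "\<dots> \<le> (\<Sum>g\<in>I. ennreal (unit_ball_vol (real ?s) * (?d * L * \<kappa>) ^ ?s))"
  proof (intro sum_mono ennreal_leI mult_left_mono power_mono)
    fix g
    have "0 \<le> diameter (U g)" by (rule diameter_ge_0[OF bounded])
    then show "diameter (U g) / 2 \<le> ?d * L * \<kappa>" using diam[of g] by linarith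
    show "0 \<le> diameter (U g) / 2" using \<open>0 \<le> diameter (U g)\<close> by simp
  qed simp
  also have "\<dots> = ennreal (real (N ^ ?s) * (unit_ball_vol (real ?s) * (?d * L * \<kappa>) ^ ?s))"
    using pos \<kappa> L by (simp add: cardI ennreal_mult' ennreal_of_nat_eq_real_of_nat)
  also have "real (N ^ ?s) * (unit_ball_vol (real ?s) * (?d * L * \<kappa>) ^ ?s) = unit_ball_vol (real ?s) * (?d * L * h) ^ ?s"
    using N0 by (simp add: \<kappa>_def power_mult_distrib power_divide)
  finally show "hausdorff_content ?s \<epsilon> A \<le> ennreal (unit_ball_vol (real ?s) * (?d * L * h) ^ ?s)" .
qed

text \<open>Comparison with Lebesgue measure one dimension higher: thickening the face and the
  covering sets to height \<open>\<rho>\<close> in direction \<open>i0\<close> turns the cover into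
  a cover of a cube by boxes. A set of diameter \<open>\<delta>\<close> gets a box of side
  \<open>2 * \<delta>\<close>, four times the half diameter in its weight, whence the factor
  1/4.\<close>

lemma hausdorff_outer_flat_ge:
  fixes a :: "real ^ 'n::finite"
  assumes d: "2 \<le> CARD('n)" and \<rho>: "0 < \<rho>"
  shows "ennreal (unit_ball_vol (real (CARD('n) - 1)) * (\<rho> / 4) ^ (CARD('n) - 1))
    \<le> hausdorff_outer (CARD('n) - 1) {x. x $ i0 = c \<and> (\<forall>i. i \<noteq> i0 \<longrightarrow> a $ i \<le> x $ i \<and> x $ i \<le> a $ i + \<rho>)}"
    (is "_ \<le> hausdorff_outer _ ?A")
proof -
  let ?s = "CARD('n) - 1"
  let ?v = "unit_ball_vol (real ?s)"
  have v: "0 < ?v" by (rule unit_ball_vol_pos) simp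
  have "ennreal (?v * (\<rho> / 4) ^ ?s) \<le> hausdorff_content ?s 1 ?A"
    unfolding hausdorff_content_def
  proof (rule INF_greatest, clarify)
    fix U :: "nat \<Rightarrow> (real ^ 'n) set"
    assume cov: "?A \<subseteq> (\<Union>i. U i)" and U: "\<forall>i. bounded (U i) \<and> diameter (U i) \<le> 1"
    define \<delta> where "\<delta> i = diameter (U i)" for i
    have \<delta>: "0 \<le> \<delta> i" for i using U by (simp add: \<delta>_def diameter_ge_0)
    define u where "u i = (SOME u. u \<in> U i)" for i
    define V where "V i = cbox (\<chi> j. if j = i0 then c else u i $ j - \<delta> i) (\<chi> j. if j = i0 then c + \<rho> else u i $ j + \<delta> i)" for i
    define B where "B = cbox (\<chi> j. if j = i0 then c else a $ j) (\<chi> j. if j = i0 then c + \<rho> else a $ j + \<rho>)"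
    have BV: "B \<subseteq> (\<Union>i. V i)"
    proof
      fix x assume x: "x \<in> B"
      let ?x = "\<chi> j. if j = i0 then c else x $ j"
      have "?x \<in> ?A" using x by (auto simp: B_def mem_box_cart split: if_splits)
      then obtain i where i: "?x \<in> U i" using cov by blast
      then have "u i \<in> U i" unfolding u_def by (rule someI)
      then have "dist ?x (u i) \<le> \<delta> i" unfolding \<delta>_def using U i by (intro diameter_bounded_bound) auto
      then have dl: "\<bar>(?x - u i) $ j\<bar> \<le> \<delta> i" for j
        using component_le_norm_cart[of "?x - u i" j] by (simp add: dist_norm)
      have "\<bar>x $ j - u i $ j\<bar> \<le> \<delta> i" if "j \<noteq> i0" for j using that dl[of j] by simp
      moreover have "c \<le> x $ i0 \<and> x $ i0 \<le> c + \<rho>"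
        using x[unfolded B_def mem_box_cart, rule_format, of i0] by simp
      ultimately have "x \<in> V i" unfolding V_def mem_box_cart by (auto simp: abs_le_iff algebra_simps)
      then show "x \<in> (\<Union>i. V i)" by blast
    qed
    have mB: "emeasure lborel B = ennreal (\<rho> * \<rho> ^ ?s)"
    proof -
      have ne: "B \<noteq> {}" using \<rho> unfolding B_def by (auto simp: interval_ne_empty_cart)
      have "measure lborel B = (\<Prod>j\<in>(UNIV :: 'n set). \<rho>)"
        using ne unfolding B_def by (subst content_cbox_cart) (assumption, rule prod.cong, simp_all)
      also have "\<dots> = \<rho> * \<rho> ^ ?s" by (simp add: power_Suc[symmetric] del: power_Suc)
      finally show ?thesis unfolding B_def
        using emeasure_lborel_cbox_finite by (subst emeasure_eq_ennreal_measure) (auto simp: less_top)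
    qed
    have mV: "emeasure lborel (V i) = ennreal (\<rho> * (2 * \<delta> i) ^ ?s)" for i
    proof -
      have ne: "V i \<noteq> {}" using \<rho> \<delta>[of i] unfolding V_def by (auto simp: interval_ne_empty_cart)
      have "measure lborel (V i) = (\<Prod>j\<in>UNIV. if j = i0 then \<rho> else 2 * \<delta> i)"
        using ne unfolding V_def by (subst content_cbox_cart) (assumption, rule prod.cong, simp_all)
      then show ?thesis unfolding prod_one_other unfolding V_def
        using emeasure_lborel_cbox_finite by (subst emeasure_eq_ennreal_measure) (auto simp: less_top)
    qed
    have "emeasure lborel B \<le> emeasure lborel (\<Union>i. V i)"
      using BV by (intro emeasure_mono) (auto simp: V_def)
    also have "\<dots> \<le> (\<Sum>i. emeasure lborel (V i))"
      by (intro emeasure_subadditive_countably) (auto simp: V_def)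
    finally have le: "ennreal (\<rho> * \<rho> ^ ?s) \<le> (\<Sum>i. ennreal (\<rho> * (2 * \<delta> i) ^ ?s))" unfolding mB mV .
    have "ennreal (?v * (\<rho> / 4) ^ ?s) = ennreal (?v / (\<rho> * 4 ^ ?s)) * ennreal (\<rho> * \<rho> ^ ?s)"
      using \<rho> v by (simp add: ennreal_mult[symmetric] power_divide)
    also have "\<dots> \<le> ennreal (?v / (\<rho> * 4 ^ ?s)) * (\<Sum>i. ennreal (\<rho> * (2 * \<delta> i) ^ ?s))"
      by (rule mult_left_mono[OF le]) simp
    also have "\<dots> = (\<Sum>i. ennreal (?v / (\<rho> * 4 ^ ?s)) * ennreal (\<rho> * (2 * \<delta> i) ^ ?s))"
      by simp
    also have "\<dots> = (\<Sum>i. ball_weight ?s (U i))"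
    proof (rule arg_cong[of _ _ suminf], rule ext)
      fix i
      have "2 * \<delta> i = 4 * (\<delta> i / 2)" by simp
      then have "(2 * \<delta> i) ^ ?s = 4 ^ ?s * (\<delta> i / 2) ^ ?s" by (simp only: power_mult_distrib)
      then have "?v / (\<rho> * 4 ^ ?s) * (\<rho> * (2 * \<delta> i) ^ ?s) = ?v * (\<delta> i / 2) ^ ?s"
        using \<rho> by (simp add: field_simps)
      then show "ennreal (?v / (\<rho> * 4 ^ ?s)) * ennreal (\<rho> * (2 * \<delta> i) ^ ?s) = ball_weight ?s (U i)"
        using \<rho> v \<delta>[of i] unfolding \<delta>_def[symmetric] by (subst ennreal_mult[symmetric]) auto
    qed
    finally show "ennreal (?v * (\<rho> / 4) ^ ?s) \<le> (\<Sum>i. ball_weight ?s (U i))" .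
  qed
  also have "\<dots> \<le> hausdorff_outer ?s ?A" by (rule hausdorff_content_le_outer) simp
  finally show ?thesis .
qed

subsection \<open>Sets of positive reach\<close>

text \<open>The unit vector \<open>N\<close> points away from the nearest point. By continuity of
  \<open>\<pi>\<close> the nearest point of a slightly moved point is seen from \<open>w\<close>
  almost in direction \<open>- N\<close>, so a small step along \<open>N\<close> increases the
  distance by almost its length.\<close>

lemma infdist_slope:
  fixes \<Gamma> :: "'a::euclidean_space set"
  assumes \<pi>: "\<And>x. infdist x \<Gamma> < \<delta> \<Longrightarrow> \<pi> x \<in> \<Gamma> \<and> dist x (\<pi> x) = infdist x \<Gamma>"
    and cont: "continuous_on {x. infdist x \<Gamma> < \<delta>} \<pi>"
    and w: "0 < infdist w \<Gamma>" "infdist w \<Gamma> < \<delta>" and "0 < \<eta>" "0 < r"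
  shows "\<exists>w'. 0 < dist w' w \<and> dist w' w < r \<and> (1 - \<eta>) * dist w' w \<le> infdist w' \<Gamma> - infdist w \<Gamma>"
proof -
  define N where "N = sgn (w - \<pi> w)"
  have nN: "norm N = 1"
    using \<pi>[OF w(2)] w(1) by (auto simp: N_def norm_sgn)
  have op: "open {x. infdist x \<Gamma> < \<delta>}" by (intro open_Collect_less continuous_intros)
  then have "isCont \<pi> w" using cont w(2) by (simp add: continuous_on_eq_continuous_at)
  moreover have "((\<lambda>t :: real. w + t *\<^sub>R N) \<longlongrightarrow> w + 0 *\<^sub>R N) (at_right 0)" by (intro tendsto_intros)
  ultimately have lim\<pi>: "((\<lambda>t :: real. \<pi> (w + t *\<^sub>R N)) \<longlongrightarrow> \<pi> w) (at_right 0)"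
    by (intro isCont_tendsto_compose[of w \<pi>]) auto
  have "w - \<pi> w \<noteq> 0" using nN by (auto simp: N_def)
  then have "((\<lambda>t. inner N (sgn (w - \<pi> (w + t *\<^sub>R N)))) \<longlongrightarrow> inner N (sgn (w - \<pi> w))) (at_right 0)"
    by (intro tendsto_intros lim\<pi>)
  moreover have "inner N (sgn (w - \<pi> w)) = 1" using nN by (simp add: N_def[symmetric] dot_square_norm)
  ultimately have ev1: "\<forall>\<^sub>F t in at_right 0. 1 - \<eta> < inner N (sgn (w - \<pi> (w + t *\<^sub>R N)))"
    using assms(5) by (intro order_tendstoD(1)) auto
  have "((\<lambda>t :: real. infdist (w + t *\<^sub>R N) \<Gamma>) \<longlongrightarrow> infdist (w + 0 *\<^sub>R N) \<Gamma>) (at_right 0)"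
    by (intro tendsto_intros)
  then have ev2: "\<forall>\<^sub>F t :: real in at_right 0. infdist (w + t *\<^sub>R N) \<Gamma> < \<delta>"
    using w(2) by (intro order_tendstoD(2)) auto
  have ev3: "\<forall>\<^sub>F t :: real in at_right 0. t \<in> {0<..<r}" by (rule eventually_at_right_real[OF assms(6)])
  from ev1 ev2 ev3 have "\<forall>\<^sub>F t :: real in at_right 0. 1 - \<eta> < inner N (sgn (w - \<pi> (w + t *\<^sub>R N)))
      \<and> infdist (w + t *\<^sub>R N) \<Gamma> < \<delta> \<and> t \<in> {0<..<r}"
    by eventually_elim simp
  then obtain t :: real where t: "1 - \<eta> < inner N (sgn (w - \<pi> (w + t *\<^sub>R N)))"
     "infdist (w + t *\<^sub>R N) \<Gamma> < \<delta>" "0 < t" "t < r"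
    using eventually_happens'[of "at_right (0::real)"] by (auto simp: trivial_limit_at_right_real)
  let ?w = "w + t *\<^sub>R N" and ?q = "\<pi> (w + t *\<^sub>R N)"
  have q: "?q \<in> \<Gamma>" "dist ?w ?q = infdist ?w \<Gamma>" using \<pi>[OF t(2)] by auto
  have le: "infdist w \<Gamma> \<le> dist w ?q" using q(1) by (rule infdist_le)
  \<comment> \<open>Cauchy-Schwarz in the direction from the new nearest point \<open>?q\<close> to
    \<open>w\<close> bounds the new distance below by the old one plus almost
    \<open>t\<close>.\<close>
  have "inner (?w - ?q) (sgn (w - ?q)) \<le> norm (?w - ?q) * norm (sgn (w - ?q))" by (rule norm_cauchy_schwarz)
  also have "\<dots> = infdist ?w \<Gamma>" using q(2) le w(1) by (simp add: norm_sgn dist_norm) (auto simp: dist_norm)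
  finally have "inner (?w - ?q) (sgn (w - ?q)) \<le> infdist ?w \<Gamma>" .
  moreover have "inner (?w - ?q) (sgn (w - ?q)) = inner (w - ?q) (sgn (w - ?q)) + t * inner N (sgn (w - ?q))"
    by (simp add: inner_add_left inner_diff_left)
  moreover have "w \<noteq> ?q" using le w(1) by auto
  then have "inner (w - ?q) (sgn (w - ?q)) = dist w ?q"
    by (simp add: sgn_div_norm dist_norm dot_square_norm power2_eq_square)
  moreover have "(1 - \<eta>) * t \<le> t * inner N (sgn (w - ?q))" using t(1,3) by (simp add: mult.commute)
  ultimately have "(1 - \<eta>) * t \<le> infdist ?w \<Gamma> - infdist w \<Gamma>" using le by linarith
  moreover have "dist ?w w = t" using t(3) nN by (simp add: dist_norm)
  ultimately show ?thesis using t by (intro exI[of _ ?w]) simp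
qed

text \<open>
  The distance function has slope one off \<open>\<Gamma>\<close>, so it grows by \<open>s\<close> on the ball of radius \<open>s\<close>; the
  point where it does so lies on the ray from \<open>\<pi> y\<close> through \<open>y\<close> by the equality case of the
  triangle inequality.
\<close>

lemma infdist_along_normal:
  fixes \<Gamma> :: "'a::euclidean_space set"
  assumes \<pi>: "\<And>x. infdist x \<Gamma> < \<delta> \<Longrightarrow> \<pi> x \<in> \<Gamma> \<and> dist x (\<pi> x) = infdist x \<Gamma>"
    and cont: "continuous_on {x. infdist x \<Gamma> < \<delta>} \<pi>"
    and y: "0 < infdist y \<Gamma>" "0 \<le> s" "infdist y \<Gamma> + s < \<delta>"
  shows "infdist (y + s *\<^sub>R sgn (y - \<pi> y)) \<Gamma> = infdist y \<Gamma> + s"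
proof (cases "s = 0")
  case False
  then have s: "0 < s" using y(2) by simp
  let ?D = "\<lambda>w. infdist w \<Gamma>"
  have lip: "?D w \<le> ?D v + dist w v" for v w using infdist_triangle[of w \<Gamma> v] .
  have ne: "cball y s \<noteq> {}" using s by simp
  have contD: "continuous_on (cball y s) ?D" by (intro continuous_on_infdist continuous_on_id)
  obtain w where w: "w \<in> cball y s" "\<And>v. v \<in> cball y s \<Longrightarrow> ?D v \<le> ?D w"
    using continuous_attains_sup[OF compact_cball ne contD] by blast
  have ge: "?D y + s \<le> ?D w"
  proof (rule ccontr)
    assume "\<not> ?thesis"
    then have gap: "0 < ?D y + s - ?D w" by simp
    define \<epsilon> where "\<epsilon> = (?D y + s - ?D w) / (2 * s)"
    have "?D y \<le> ?D w" using w(2)[of y] s by simp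
    then have \<epsilon>: "0 < \<epsilon>" "\<epsilon> < 1" using gap s by (auto simp: \<epsilon>_def field_simps)
    have "\<epsilon> * s = (?D y + s - ?D w) / 2" using s by (simp add: \<epsilon>_def)
    then have \<epsilon>s: "?D w < ?D y + (1 - \<epsilon>) * s" using gap by (simp add: algebra_simps)
    \<comment> \<open>Maximise the distance function minus \<open>1 - \<epsilon>\<close> times the
      distance from \<open>y\<close>. By the choice of \<open>\<epsilon>\<close> the maximiser is
      interior, and there \<open>infdist_slope\<close> with \<open>\<epsilon> / 2\<close> produces a
      larger value.\<close>
    let ?f = "\<lambda>v. ?D v - (1 - \<epsilon>) * dist v y"
    have contf: "continuous_on (cball y s) ?f" by (intro continuous_on_diff contD continuous_intros)
    obtain v where v: "v \<in> cball y s" "\<And>u. u \<in> cball y s \<Longrightarrow> ?f u \<le> ?f v"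
      using continuous_attains_sup[OF compact_cball ne contf] by blast
    have fv: "?D y \<le> ?f v" using v(2)[of y] s by simp
    have "dist v y < s"
    proof (rule ccontr)
      assume "\<not> dist v y < s"
      then have "dist v y = s" using v(1) by (simp add: dist_commute)
      then show False using fv \<epsilon>s w(2)[OF v(1)] by simp
    qed
    moreover have "0 < ?D v" using fv y(1) \<epsilon> by (smt (verit) mult_nonneg_nonneg zero_le_dist)
    moreover have "?D v < \<delta>" using lip[of v y] \<open>dist v y < s\<close> y(3) by linarith
    ultimately obtain u where u: "0 < dist u v" "dist u v < s - dist v y" "(1 - \<epsilon> / 2) * dist u v \<le> ?D u - ?D v"
      using infdist_slope[OF \<pi> cont, of v "\<epsilon> / 2" "s - dist v y"] \<epsilon> by auto
    have "dist u y \<le> dist u v + dist v y" by (rule dist_triangle)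
    moreover from this have "(1 - \<epsilon>) * dist u y \<le> (1 - \<epsilon>) * (dist u v + dist v y)" using \<epsilon> by (intro mult_left_mono) auto
    moreover have "0 < \<epsilon> / 2 * dist u v" using \<epsilon> u(1) by simp
    ultimately have "?f v < ?f u" "u \<in> cball y s"
      using u by (auto simp: dist_commute algebra_simps)
    then show False using v(2)[of u] by simp
  qed
  define x where "x = \<pi> y"
  have x: "x \<in> \<Gamma>" "dist y x = ?D y" using \<pi>[of y] y s by (auto simp: x_def)
  have wy: "norm (w - y) \<le> s" using w(1) by (simp add: dist_norm norm_minus_commute)
  have "?D w \<le> norm (w - x)" using infdist_le[OF x(1), of w] by (simp add: dist_norm)
  moreover have "norm (w - x) \<le> norm (y - x) + norm (w - y)"
    using norm_triangle_ineq[of "y - x" "w - y"] by simp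
  ultimately have eq: "norm (w - x) = norm (y - x) + norm (w - y)" "norm (w - y) = s" "?D w = ?D y + s"
    using ge wy x(2) by (auto simp: dist_norm)
  have "norm ((y - x) + (w - y)) = norm (y - x) + norm (w - y)" using eq(1) by simp
  then have "norm (y - x) *\<^sub>R (w - y) = norm (w - y) *\<^sub>R (y - x)" by (simp only: norm_triangle_eq)
  then have "(1 / norm (y - x)) *\<^sub>R (norm (y - x) *\<^sub>R (w - y)) = (1 / norm (y - x)) *\<^sub>R (s *\<^sub>R (y - x))"
    by (simp add: eq(2))
  then have "w - y = s *\<^sub>R sgn (y - x)"
    using x(2) y(1) by (auto simp: sgn_div_norm dist_norm divide_inverse mult.commute)
  then have "w = y + s *\<^sub>R sgn (y - x)" by (simp add: algebra_simps)
  then show ?thesis using eq(3) by (simp add: x_def)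
qed simp

text \<open>Points of \<open>A\<close> near \<open>x\<close> are pushed along their normal rays to
  distance \<open>r\<close>. The ball around the result misses \<Gamma>, meets \<open>A\<close> and
  is connected, so it lies in \<open>A\<close>. The detour over nearby points is taken since no ray
  based at \<open>x\<close> is known beforehand; its direction arises as a limit of unit
  vectors.\<close>

lemma one_sided_ball:
  fixes \<Gamma> :: "'a::euclidean_space set"
  assumes \<pi>: "\<And>x. infdist x \<Gamma> < \<delta> \<Longrightarrow> \<pi> x \<in> \<Gamma> \<and> dist x (\<pi> x) = infdist x \<Gamma>"
    and cont: "continuous_on {x. infdist x \<Gamma> < \<delta>} \<pi>"
    and \<Gamma>: "closed \<Gamma>" "\<Gamma> \<noteq> {}" and A: "open A" "frontier A \<subseteq> \<Gamma>" "A \<inter> \<Gamma> = {}"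
    and x: "x \<in> \<Gamma>" "x \<in> closure A" and r: "0 < r" "r < \<delta>"
  shows "\<exists>u. norm u = 1 \<and> ball (x + r *\<^sub>R u) r \<subseteq> A"
proof -
  let ?D = "\<lambda>w. infdist w \<Gamma>"
  obtain y0 where y0: "\<And>n. y0 n \<in> A" "y0 \<longlonglongrightarrow> x"
    using x(2) unfolding closure_sequential by blast
  have "(\<lambda>n. ?D (y0 n)) \<longlonglongrightarrow> ?D x" by (intro tendsto_intros y0)
  then have "\<forall>\<^sub>F n in sequentially. ?D (y0 n) < r"
    using x(1) r by (intro order_tendstoD(2)) auto
  then obtain n0 where n0: "\<And>n. n0 \<le> n \<Longrightarrow> ?D (y0 n) < r" by (auto simp: eventually_sequentially)
  define y where "y n = y0 (n + n0)" for n
  have y: "y n \<in> A" "?D (y n) < r" for n using y0(1) n0 by (auto simp: y_def)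
  have ylim: "y \<longlonglongrightarrow> x" unfolding y_def using y0(2) by (rule LIMSEQ_ignore_initial_segment)
  have D0: "0 < ?D (y n)" for n
    using y(1)[of n] A(3) \<Gamma> by (metis IntI empty_iff in_closed_iff_infdist_zero infdist_nonneg order_less_le)
  define q where "q n = \<pi> (y n)" for n
  have q: "q n \<in> \<Gamma>" "dist (y n) (q n) = ?D (y n)" for n using \<pi>[of "y n"] y(2)[of n] r by (auto simp: q_def)
  have Dlim: "(\<lambda>n. ?D (y n)) \<longlonglongrightarrow> 0"
    using tendsto_infdist[OF ylim, of \<Gamma>] x(1) by simp
  have "(\<lambda>n. y n - q n) \<longlonglongrightarrow> 0"
    by (rule tendsto_norm_zero_cancel) (use Dlim q(2) in \<open>simp add: dist_norm\<close>)
  then have qlim: "q \<longlonglongrightarrow> x" using tendsto_diff[OF ylim] by fastforce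
  define u where "u n = sgn (y n - q n)" for n
  have nu: "norm (u n) = 1" for n using q(2)[of n] D0[of n] by (auto simp: u_def norm_sgn)
  have qu: "y n = q n + ?D (y n) *\<^sub>R u n" for n
    using q(2)[of n] D0[of n] by (simp add: u_def sgn_div_norm dist_norm)
  define c where "c n = q n + r *\<^sub>R u n" for n
  have cy: "c n = y n + (r - ?D (y n)) *\<^sub>R u n" for n
    using qu[of n] by (simp add: c_def algebra_simps)
  have Dc: "?D (c n) = r" for n
  proof -
    have "?D (y n + (r - ?D (y n)) *\<^sub>R sgn (y n - \<pi> (y n))) = ?D (y n) + (r - ?D (y n))"
      using y(2)[of n] r D0[of n] by (intro infdist_along_normal[OF \<pi> cont]) auto
    then show ?thesis by (simp add: cy u_def q_def)
  qed
  have ballA: "ball (c n) r \<subseteq> A" for n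
  proof (rule ccontr)
    assume "\<not> ?thesis"
    then have "ball (c n) r - A \<noteq> {}" by blast
    moreover have "y n \<in> ball (c n) r" using D0[of n] y(2)[of n] nu[of n] by (simp add: cy dist_norm)
    ultimately have "ball (c n) r \<inter> frontier A \<noteq> {}"
      using y(1)[of n] by (intro connected_Int_frontier) auto
    then obtain w where "w \<in> ball (c n) r" "w \<in> frontier A" by blast
    then have "w \<in> \<Gamma>" "dist (c n) w < r" using A(2) by auto
    then show False using infdist_le[of w \<Gamma> "c n"] Dc[of n] by simp
  qed
  have "u n \<in> sphere 0 1" for n using nu by simp
  then obtain v \<tau> where v: "v \<in> sphere 0 1" "strict_mono \<tau>" "(u \<circ> \<tau>) \<longlonglongrightarrow> v"
    using compact_sphere[of "0::'a" 1] unfolding compact_def by metis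
  have "(c \<circ> \<tau>) \<longlonglongrightarrow> x + r *\<^sub>R v"
    using LIMSEQ_subseq_LIMSEQ[OF qlim v(2)] v(3) unfolding c_def comp_def by (intro tendsto_intros)
  then have clim: "(\<lambda>n. c (\<tau> n)) \<longlonglongrightarrow> x + r *\<^sub>R v" by (simp add: comp_def)
  \<comment> \<open>The limit ball is open, so each of its points lies in some ball along the
    subsequence.\<close>
  have "ball (x + r *\<^sub>R v) r \<subseteq> A"
  proof
    fix w assume "w \<in> ball (x + r *\<^sub>R v) r"
    then have "\<forall>\<^sub>F n in sequentially. dist (c (\<tau> n)) w < r"
      by (intro order_tendstoD(2)[OF tendsto_dist[OF clim tendsto_const]]) simp
    then obtain n where "dist (c (\<tau> n)) w < r" by (auto simp: eventually_sequentially)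
    then show "w \<in> A" using ballA[of "\<tau> n"] by (simp add: subset_iff)
  qed
  then show ?thesis using v(1) by auto
qed

section \<open>Unit normals from charts and from tangent balls\<close>

lemma boundary_chart_direction:
  assumes "boundary_chart \<Omega> U \<psi> g" "x \<in> U" "x \<in> frontier \<Omega>"
  shows "inner w (g x) < 0 \<Longrightarrow> \<exists>d>0. \<forall>t. 0 < t \<longrightarrow> t < d \<longrightarrow> x + t *\<^sub>R w \<in> U \<and> x + t *\<^sub>R w \<in> \<Omega>"
    and "0 < inner w (g x) \<Longrightarrow> \<exists>d>0. \<forall>t. 0 < t \<longrightarrow> t < d \<longrightarrow> x + t *\<^sub>R w \<in> U \<and> x + t *\<^sub>R w \<notin> closure \<Omega>"
proof -
  have ch: "open U" "GDERIV \<psi> x :> g x" "\<And>y. y \<in> U \<Longrightarrow> y \<in> \<Omega> \<longleftrightarrow> \<psi> y < 0" "\<And>y. y \<in> U \<Longrightarrow> y \<in> frontier \<Omega> \<longleftrightarrow> \<psi> y = 0"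
    using assms(1,2) unfolding boundary_chart_def by blast+
  have x0: "\<psi> x = 0" using ch(4) assms(2,3) by blast
  have der: "((\<lambda>t. \<psi> (x + t *\<^sub>R w)) has_real_derivative inner w (g x)) (at 0)"
  proof -
    have "(\<psi> has_derivative (\<lambda>h. inner h (g x))) (at (x + 0 *\<^sub>R w))" using ch(2) by (simp add: gderiv_def)
    moreover have "((\<lambda>t :: real. x + t *\<^sub>R w) has_derivative (\<lambda>t. t *\<^sub>R w)) (at 0)"
      by (auto intro!: derivative_eq_intros)
    ultimately have "((\<lambda>t. \<psi> (x + t *\<^sub>R w)) has_derivative (\<lambda>t. inner (t *\<^sub>R w) (g x))) (at 0)"
      by (rule has_derivative_compose[rotated])
    moreover have "(\<lambda>t. inner (t *\<^sub>R w) (g x)) = (*) (inner w (g x))" by (auto simp: mult.commute)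
    ultimately show ?thesis by (simp only: has_field_derivative_def)
  qed
  have "((\<lambda>t :: real. x + t *\<^sub>R w) \<longlongrightarrow> x + 0 *\<^sub>R w) (at 0)" by (intro tendsto_intros)
  then have "\<forall>\<^sub>F t :: real in at 0. x + t *\<^sub>R w \<in> U" using ch(1) assms(2) by (intro topological_tendstoD) auto
  then obtain e where e: "e > 0" "\<And>t :: real. t \<noteq> 0 \<Longrightarrow> \<bar>t\<bar> < e \<Longrightarrow> x + t *\<^sub>R w \<in> U"
    unfolding eventually_at by (auto simp: dist_real_def)
  {
    assume "inner w (g x) < 0"
    then obtain d where d: "d > 0" "\<And>t. 0 < t \<Longrightarrow> t < d \<Longrightarrow> \<psi> (x + t *\<^sub>R w) < 0"
      using DERIV_neg_dec_right[OF der] x0 by auto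
    then show "\<exists>d>0. \<forall>t. 0 < t \<longrightarrow> t < d \<longrightarrow> x + t *\<^sub>R w \<in> U \<and> x + t *\<^sub>R w \<in> \<Omega>"
      using e ch(3) by (intro exI[of _ "min d e"]) auto
  }
  {
    assume "0 < inner w (g x)"
    then obtain d where d: "d > 0" "\<And>t. 0 < t \<Longrightarrow> t < d \<Longrightarrow> 0 < \<psi> (x + t *\<^sub>R w)"
      using DERIV_pos_inc_right[OF der] x0 by auto
    have "x + t *\<^sub>R w \<in> U \<and> x + t *\<^sub>R w \<notin> closure \<Omega>" if t: "0 < t" "t < min d e" for t
    proof -
      have "x + t *\<^sub>R w \<in> U" using e t by auto
      moreover have "0 < \<psi> (x + t *\<^sub>R w)" using d t by auto
      ultimately show ?thesis using ch(3,4) closure_Un_frontier[of \<Omega>] by fastforce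
    qed
    then show "\<exists>d>0. \<forall>t. 0 < t \<longrightarrow> t < d \<longrightarrow> x + t *\<^sub>R w \<in> U \<and> x + t *\<^sub>R w \<notin> closure \<Omega>"
      using d e by (intro exI[of _ "min d e"]) auto
  }
qed

text \<open>If two charts had different unit gradients, the difference of these would point into
  \<open>\<Omega>\<close> by one chart and out of its closure by the other. Hence the description of
  \<open>outward_normal\<close> is unambiguous.\<close>

lemma outward_normal_eq:
  assumes ch: "boundary_chart \<Omega> U \<psi> g" "x \<in> U" and x: "x \<in> frontier \<Omega>"
  shows "outward_normal \<Omega> x = sgn (g x)"
  unfolding outward_normal_def
proof (rule the_equality)
  show "\<exists>U \<psi> g'. x \<in> U \<and> boundary_chart \<Omega> U \<psi> g' \<and> sgn (g x) = sgn (g' x)" using ch by blast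
next
  fix \<nu> assume "\<exists>U \<psi> g. x \<in> U \<and> boundary_chart \<Omega> U \<psi> g \<and> \<nu> = sgn (g x)"
  then obtain U' \<psi>' g' where ch': "x \<in> U'" "boundary_chart \<Omega> U' \<psi>' g'" and \<nu>: "\<nu> = sgn (g' x)" by blast
  have nz: "g x \<noteq> 0" "g' x \<noteq> 0" using ch ch' unfolding boundary_chart_def by blast+
  show "\<nu> = sgn (g x)"
  proof (rule ccontr)
    assume ne: "\<nu> \<noteq> sgn (g x)"
    define w where "w = sgn (g' x) - sgn (g x)"
    define c where "c = inner (sgn (g' x)) (sgn (g x))"
    have "0 < inner w w" using ne by (simp add: w_def \<nu>)
    moreover have "inner (sgn (g x)) (sgn (g x)) = 1" "inner (sgn (g' x)) (sgn (g' x)) = 1"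
      using nz by (simp_all add: dot_square_norm norm_sgn)
    then have "inner w w = 2 - 2 * c"
      by (simp only: w_def c_def inner_diff_left inner_diff_right) (simp add: inner_commute)
    ultimately have c: "c < 1" by simp
    have gs: "g x = norm (g x) *\<^sub>R sgn (g x)" "g' x = norm (g' x) *\<^sub>R sgn (g' x)"
      using nz by (auto simp: sgn_div_norm)
    have "inner w (sgn (g x)) = c - 1" "inner w (sgn (g' x)) = 1 - c"
      using \<open>inner (sgn (g x)) (sgn (g x)) = 1\<close> \<open>inner (sgn (g' x)) (sgn (g' x)) = 1\<close>
      by (simp_all add: w_def c_def inner_diff_left) (simp add: inner_commute)
    then have "inner w (g x) = norm (g x) * (c - 1)" "inner w (g' x) = norm (g' x) * (1 - c)"
      using arg_cong[OF gs(1), of "inner w"] arg_cong[OF gs(2), of "inner w"] by (simp_all only: inner_scaleR_right)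
    then have sg: "inner w (g x) < 0" "0 < inner w (g' x)"
      using c nz by (simp_all add: mult_pos_neg)
    obtain d1 where d1: "d1 > 0" "\<And>t. 0 < t \<Longrightarrow> t < d1 \<Longrightarrow> x + t *\<^sub>R w \<in> \<Omega>"
      using boundary_chart_direction(1)[OF ch x sg(1)] by blast
    obtain d2 where d2: "d2 > 0" "\<And>t. 0 < t \<Longrightarrow> t < d2 \<Longrightarrow> x + t *\<^sub>R w \<notin> closure \<Omega>"
      using boundary_chart_direction(2)[OF ch'(2,1) x sg(2)] by blast
    have "x + (min d1 d2 / 2) *\<^sub>R w \<in> \<Omega>" using d1 d2 by (intro d1(2)) auto
    moreover have "x + (min d1 d2 / 2) *\<^sub>R w \<notin> closure \<Omega>" using d1 d2 by (intro d2(2)) auto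
    ultimately show False using closure_subset by blast
  qed
qed

lemma norm_outward_normal_le:
  assumes "C2_boundary \<Omega>" "x \<in> frontier \<Omega>"
  shows "norm (outward_normal \<Omega> x) \<le> 1"
proof -
  obtain U \<psi> g where "x \<in> U" "boundary_chart \<Omega> U \<psi> g" using assms unfolding C2_boundary_def by blast
  from outward_normal_eq[OF this(2,1) assms(2)] show ?thesis by (simp add: norm_sgn)
qed

lemma continuous_on_outward_normal:
  assumes "C2_boundary \<Omega>"
  shows "continuous_on (frontier \<Omega>) (outward_normal \<Omega>)"
  unfolding continuous_on_eq_continuous_within
proof
  fix x assume x: "x \<in> frontier \<Omega>"
  obtain U \<psi> g where ch: "x \<in> U" "boundary_chart \<Omega> U \<psi> g" using assms x unfolding C2_boundary_def by blast
  have U: "open U" "continuous_on U g" "g x \<noteq> 0"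
    using ch unfolding boundary_chart_def C1_on_def
    by (auto intro!: continuous_at_imp_continuous_on dest: has_derivative_continuous)
  have "continuous (at x) g" using U ch(1) by (simp add: continuous_on_eq_continuous_at)
  then have "(g \<longlongrightarrow> g x) (at x within frontier \<Omega>)"
    unfolding continuous_at by (rule tendsto_within_subset) simp
  then have "continuous (at x within frontier \<Omega>) (\<lambda>y. sgn (g y))"
    unfolding continuous_within by (rule tendsto_sgn[OF _ U(3)])
  then show "continuous (at x within frontier \<Omega>) (outward_normal \<Omega>)"
  proof (rule continuous_transform_within_openin)
    show "openin (top_of_set (frontier \<Omega>)) (frontier \<Omega> \<inter> U)" using U(1) by (rule openin_open_Int)
    show "x \<in> frontier \<Omega> \<inter> U" using x ch(1) by simp
    show "sgn (g y) = outward_normal \<Omega> y" if "y \<in> frontier \<Omega> \<inter> U" for y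
      using outward_normal_eq[OF ch(2), of y] that by simp
  qed
qed

lemma diff_midpoint: "a - (1 / 2) *\<^sub>R (a + b) = (1 / 2) *\<^sub>R (a - b :: 'a::real_vector)"
proof -
  have "(1 / 2) *\<^sub>R (a - b) + (1 / 2) *\<^sub>R (a + b) = (1 / 2) *\<^sub>R (a + a)"
    by (simp flip: scaleR_add_right)
  then have "(1 / 2) *\<^sub>R (a - b) + (1 / 2) *\<^sub>R (a + b) = a" by (simp only: scaleR_half_double)
  then show ?thesis by (metis add_diff_cancel_right')
qed

lemma disjoint_balls_dist:
  fixes a b :: "'a::real_normed_vector"
  assumes "ball a r \<inter> ball b r = {}"
  shows "2 * r \<le> norm (a - b)"
proof -
  let ?m = "(1 / 2) *\<^sub>R (a + b)"
  have "dist a ?m = norm (a - b) / 2" unfolding dist_norm diff_midpoint by simp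
  moreover have "dist b ?m = norm (a - b) / 2"
    using diff_midpoint[of b a] unfolding dist_norm by (simp add: add.commute norm_minus_commute)
  moreover have "?m \<notin> ball a r \<inter> ball b r" using assms by simp
  ultimately show ?thesis by auto
qed

text \<open>Each boundary point carries an inner and an outer tangent ball of radius
  \<open>r\<close>, and their centres fix \<nu>. Boundary points avoid all these balls, which gives
  the quadratic bound; disjointness of the inner ball at one point from the outer ball at another
  gives the Lipschitz bound.\<close>

lemma reach_normals:
  fixes \<Omega> :: "'a::euclidean_space set"
  assumes C2: "C2_boundary \<Omega>" and op: "open \<Omega>" and reach: "has_reach (frontier \<Omega>) \<delta>" and ne: "frontier \<Omega> \<noteq> {}"
    and r: "0 < r" "r < \<delta>"
  obtains \<nu> where "\<And>x. x \<in> frontier \<Omega> \<Longrightarrow> norm (\<nu> x) = 1"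
    "\<And>x y. x \<in> frontier \<Omega> \<Longrightarrow> y \<in> frontier \<Omega> \<Longrightarrow> \<bar>inner (y - x) (\<nu> x)\<bar> \<le> (norm (y - x))\<^sup>2 / (2 * r)"
    "\<And>x y. x \<in> frontier \<Omega> \<Longrightarrow> y \<in> frontier \<Omega> \<Longrightarrow> norm (\<nu> x - \<nu> y) \<le> norm (x - y) / r"
proof -
  let ?\<Gamma> = "frontier \<Omega>"
  obtain \<pi> where C1: "C1_on {x. infdist x ?\<Gamma> < \<delta>} \<pi>"
    and \<pi>: "\<And>x. infdist x ?\<Gamma> < \<delta> \<Longrightarrow> \<pi> x \<in> ?\<Gamma> \<and> dist x (\<pi> x) = infdist x ?\<Gamma>"
    using reach unfolding has_reach_def by blast
  have cont: "continuous_on {x. infdist x ?\<Gamma> < \<delta>} \<pi>"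
    using C1 unfolding C1_on_def
    by (auto intro!: continuous_at_imp_continuous_on simp: has_derivative_continuous)
  have ball: "\<exists>u. norm u = 1 \<and> ball (x - r *\<^sub>R u) r \<subseteq> \<Omega> \<and> ball (x + r *\<^sub>R u) r \<subseteq> - closure \<Omega>" if x: "x \<in> ?\<Gamma>" for x
  proof -
    have "\<exists>u. norm u = 1 \<and> ball (x + r *\<^sub>R u) r \<subseteq> \<Omega>"
      using op x r by (intro one_sided_ball[OF \<pi> cont]) (auto simp: ne frontier_def interior_open)
    then obtain u where u: "norm u = 1" "ball (x + r *\<^sub>R u) r \<subseteq> \<Omega>" by blast
    \<comment> \<open>The chart excludes that the domain lies on both sides of its boundary at
      \<open>x\<close>.\<close>
    have "x \<in> closure (- closure \<Omega>)"
    proof -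
      obtain U \<psi> g where ch: "x \<in> U" "boundary_chart \<Omega> U \<psi> g" using C2 x unfolding C2_boundary_def by blast
      then have "0 < inner (g x) (g x)" unfolding boundary_chart_def by auto
      from boundary_chart_direction(2)[OF ch(2,1) x this]
      obtain d where d: "d > 0" "\<And>t. 0 < t \<Longrightarrow> t < d \<Longrightarrow> x + t *\<^sub>R g x \<notin> closure \<Omega>" by blast
      have "(\<lambda>n. x + (d / real (n + 2)) *\<^sub>R g x) \<longlonglongrightarrow> x + 0 *\<^sub>R g x"
        by (intro tendsto_intros LIMSEQ_ignore_initial_segment[OF lim_const_over_n])
      moreover have "x + (d / real (n + 2)) *\<^sub>R g x \<in> - closure \<Omega>" for n
      proof -
        have "d / real (n + 2) < d" "0 < d / real (n + 2)" using d(1) by (simp_all add: divide_less_eq)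
        then show ?thesis using d(2) by blast
      qed
      ultimately show ?thesis
        unfolding closure_sequential by (intro exI[of _ "\<lambda>n. x + (d / real (n + 2)) *\<^sub>R g x"]) simp
    qed
    moreover have "frontier (- closure \<Omega>) \<subseteq> ?\<Gamma>" 
      using interior_mono[OF closure_subset[of \<Omega>]] unfolding frontier_complement by (auto simp: frontier_def)
    moreover have "- closure \<Omega> \<inter> ?\<Gamma> = {}" by (auto simp: frontier_def)
    ultimately have "\<exists>u. norm u = 1 \<and> ball (x + r *\<^sub>R u) r \<subseteq> - closure \<Omega>"
      using x r by (intro one_sided_ball[OF \<pi> cont]) (auto simp: ne)
    then obtain u' where u': "norm u' = 1" "ball (x + r *\<^sub>R u') r \<subseteq> - closure \<Omega>" by blast
    \<comment> \<open>The centres of two disjoint balls of radius \<open>r\<close> are at least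
      \<open>2 * r\<close> apart; as both lie at distance \<open>r\<close> from \<open>x\<close>,
      the unit directions are opposite.\<close>
    have "ball (x + r *\<^sub>R u) r \<inter> ball (x + r *\<^sub>R u') r = {}"
      using u(2) u'(2) closure_subset by blast
    then have "2 * r \<le> norm ((x + r *\<^sub>R u) - (x + r *\<^sub>R u'))" by (rule disjoint_balls_dist)
    also have "\<dots> = r * norm (u - u')"
      using r(1) by (simp flip: scaleR_diff_right)
    finally have "2 \<le> norm (u - u')" using r(1) by simp
    then have "2\<^sup>2 \<le> (norm (u - u'))\<^sup>2" by (rule power_mono) simp
    then have "inner u u' \<le> -1"
      using u(1) u'(1) by (simp add: power2_norm_eq_inner inner_diff_left inner_diff_right inner_commute norm_eq_1)
    then have "(norm (u + u'))\<^sup>2 \<le> 0"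
      using u(1) u'(1) by (simp add: power2_norm_eq_inner inner_add_left inner_add_right inner_commute norm_eq_1)
    then have "u + u' = 0" by simp
    then have "u = - u'" by (simp add: eq_neg_iff_add_eq_0)
    then show ?thesis using u u' by (intro exI[of _ u']) simp
  qed
  then obtain \<nu> where \<nu>: "\<And>x. x \<in> ?\<Gamma> \<Longrightarrow> norm (\<nu> x) = 1"
    "\<And>x. x \<in> ?\<Gamma> \<Longrightarrow> ball (x - r *\<^sub>R \<nu> x) r \<subseteq> \<Omega>" "\<And>x. x \<in> ?\<Gamma> \<Longrightarrow> ball (x + r *\<^sub>R \<nu> x) r \<subseteq> - closure \<Omega>"
    by metis
  have sq: "r\<^sup>2 \<le> (norm v)\<^sup>2" if "r \<le> norm v" for v :: 'a using that r(1) by (intro power_mono) auto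
  show ?thesis
  proof (rule that)
    show "norm (\<nu> x) = 1" if "x \<in> ?\<Gamma>" for x using \<nu>(1) that .
  next
    fix x y assume x: "x \<in> ?\<Gamma>" and y: "y \<in> ?\<Gamma>"
    have y': "y \<notin> \<Omega>" "y \<in> closure \<Omega>" using y op by (auto simp: frontier_def interior_open)
    have "y \<notin> ball (x - r *\<^sub>R \<nu> x) r" "y \<notin> ball (x + r *\<^sub>R \<nu> x) r" using \<nu>(2,3)[OF x] y' by blast+
    then have "r \<le> norm ((y - x) + r *\<^sub>R \<nu> x)" "r \<le> norm ((y - x) - r *\<^sub>R \<nu> x)"
      by (auto simp: dist_norm norm_minus_commute algebra_simps)
    then have "r\<^sup>2 \<le> (norm ((y - x) + r *\<^sub>R \<nu> x))\<^sup>2" "r\<^sup>2 \<le> (norm ((y - x) - r *\<^sub>R \<nu> x))\<^sup>2"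
      using sq by blast+
    moreover have "inner (\<nu> x) (\<nu> x) = 1" using \<nu>(1)[OF x] by (simp add: norm_eq_1)
    then have ex: "(norm ((y - x) + c *\<^sub>R \<nu> x))\<^sup>2 = (norm (y - x))\<^sup>2 + 2 * c * inner (y - x) (\<nu> x) + c\<^sup>2" for c
      using dot_norm[of "y - x" "c *\<^sub>R \<nu> x"] \<nu>(1)[OF x] by (simp add: power_mult_distrib field_simps)
    ultimately have "- (norm (y - x))\<^sup>2 \<le> 2 * r * inner (y - x) (\<nu> x)" "2 * r * inner (y - x) (\<nu> x) \<le> (norm (y - x))\<^sup>2"
      using ex[of r] ex[of "- r"] by auto
    then have "\<bar>2 * r * inner (y - x) (\<nu> x)\<bar> \<le> (norm (y - x))\<^sup>2" by linarith
    then show "\<bar>inner (y - x) (\<nu> x)\<bar> \<le> (norm (y - x))\<^sup>2 / (2 * r)"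
      using r(1) by (simp add: abs_mult pos_le_divide_eq mult.commute)
  next
    fix x y assume x: "x \<in> ?\<Gamma>" and y: "y \<in> ?\<Gamma>"
    have sep: "4 * r\<^sup>2 \<le> (norm ((a - b) - r *\<^sub>R (\<nu> a + \<nu> b)))\<^sup>2" if a: "a \<in> ?\<Gamma>" and b: "b \<in> ?\<Gamma>" for a b
    proof -
      let ?p = "a - r *\<^sub>R \<nu> a" and ?q = "b + r *\<^sub>R \<nu> b"
      have "ball ?p r \<inter> ball ?q r = {}" using \<nu>(2)[OF a] \<nu>(3)[OF b] closure_subset by blast
      then have "2 * r \<le> norm (?p - ?q)" by (rule disjoint_balls_dist)
      then have "(2 * r)\<^sup>2 \<le> (norm (?p - ?q))\<^sup>2" using r(1) by (intro power_mono) auto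
      moreover have "?p - ?q = (a - b) - r *\<^sub>R (\<nu> a + \<nu> b)" by (simp add: algebra_simps)
      ultimately show ?thesis by (simp add: power2_eq_square)
    qed
    define e where "e = x - y"
    define n where "n = \<nu> x + \<nu> y"
    have "4 * r\<^sup>2 \<le> (norm (e - r *\<^sub>R n))\<^sup>2" using sep[OF x y] by (simp add: e_def n_def)
    moreover have "4 * r\<^sup>2 \<le> (norm (e + r *\<^sub>R n))\<^sup>2"
    proof -
      have "(y - x) - r *\<^sub>R (\<nu> y + \<nu> x) = - (e + r *\<^sub>R n)" by (simp add: e_def n_def algebra_simps)
      then show ?thesis using sep[OF y x] by (metis norm_minus_cancel)
    qed
    \<comment> \<open>Parallelogram law: adding the two separation inequalities cancels the mixed
      term.\<close>
    moreover have "(norm (e - r *\<^sub>R n))\<^sup>2 + (norm (e + r *\<^sub>R n))\<^sup>2 = 2 * (norm e)\<^sup>2 + 2 * r\<^sup>2 * (norm n)\<^sup>2"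
      unfolding power2_norm_eq_inner by (simp add: inner_add_left inner_add_right inner_diff_left inner_diff_right power2_eq_square algebra_simps)
    moreover have "(norm n)\<^sup>2 = 4 - (norm (\<nu> x - \<nu> y))\<^sup>2"
      using \<nu>(1)[OF x] \<nu>(1)[OF y] unfolding n_def power2_norm_eq_inner
      by (simp add: inner_add_left inner_add_right inner_diff_left inner_diff_right norm_eq_1 inner_commute)
    ultimately have "r\<^sup>2 * (norm (\<nu> x - \<nu> y))\<^sup>2 \<le> (norm e)\<^sup>2" by (simp add: algebra_simps)
    then have "(r * norm (\<nu> x - \<nu> y))\<^sup>2 \<le> (norm e)\<^sup>2" by (simp add: power_mult_distrib)
    then have "r * norm (\<nu> x - \<nu> y) \<le> norm e" by (rule power2_le_imp_le) simp
    then show "norm (\<nu> x - \<nu> y) \<le> norm (x - y) / r" using r(1) by (simp add: e_def pos_le_divide_eq mult.commute)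
  qed
qed

subsection \<open>Interpolation at the Gauss--Lobatto nodes\<close>

definition unit_nodes :: "nat \<Rightarrow> real set" where
  "unit_nodes p = (\<lambda>t. (1 + t) / 2) ` gauss_lobatto p"

lemma unit_nodes:
  assumes "1 \<le> p"
  shows "finite (unit_nodes p)" "card (unit_nodes p) = Suc p" "unit_nodes p \<subseteq> {0..1}"
    "0 \<in> unit_nodes p" "1 \<in> unit_nodes p"
proof -
  note gl = gauss_lobatto_nodes[OF assms]
  show "finite (unit_nodes p)" using gl(1) by (simp add: unit_nodes_def)
  show "card (unit_nodes p) = Suc p"
    unfolding unit_nodes_def by (subst card_image) (auto simp: inj_on_def gl(2))
  show "unit_nodes p \<subseteq> {0..1}" using gl(3) by (force simp: unit_nodes_def)
  have "(\<lambda>t. (1 + t) / 2) (-1) \<in> unit_nodes p" unfolding unit_nodes_def using gl(4) by (rule imageI)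
  then show "0 \<in> unit_nodes p" by simp
  have "(\<lambda>t. (1 + t) / 2) 1 \<in> unit_nodes p" unfolding unit_nodes_def using gl(5) by (rule imageI)
  then show "1 \<in> unit_nodes p" by simp
qed

text \<open>Index functions instead of vectors, so that products of sums expand by
  \<open>prod_sum_PiE\<close>.\<close>

abbreviation node_tuples :: "nat \<Rightarrow> ('n::finite \<Rightarrow> real) set" where
  "node_tuples p \<equiv> PiE UNIV (\<lambda>_. unit_nodes p)"

lemma finite_node_tuples: "1 \<le> p \<Longrightarrow> finite (node_tuples p :: ('n::finite \<Rightarrow> real) set)"
  by (intro finite_PiE) (auto simp: unit_nodes)

lemma Qp_interpolation:
  fixes q :: "real ^ 'n::finite \<Rightarrow> real"
  assumes "1 \<le> p" "q \<in> Qp p"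
  shows "q x = (\<Sum>\<tau>\<in>node_tuples p. q (\<chi> i. \<tau> i) * (\<Prod>i\<in>UNIV. poly (lagrange (unit_nodes p) (\<tau> i)) (x $ i)))"
proof -
  let ?X = "unit_nodes p"
  let ?L = "\<lambda>\<tau>. \<Prod>i\<in>UNIV. poly (lagrange ?X (\<tau> i)) (x $ i)"
  note X = unit_nodes[OF assms(1)]
  obtain c where c: "\<And>x. q x = (\<Sum>\<alpha> | \<forall>i. \<alpha> i \<le> p. c \<alpha> * (\<Prod>i\<in>UNIV. x $ i ^ \<alpha> i))"
    using assms(2) unfolding Qp_def by auto
  have mono: "s ^ k = (\<Sum>t\<in>?X. t ^ k * poly (lagrange ?X t) s)" if "k \<le> p" for s :: real and k
  proof -
    have "degree (monom 1 k :: real poly) \<le> p" using that by (simp add: degree_monom_eq)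
    from arg_cong[OF lagrange_interpolation[OF X(1,2) this], of "\<lambda>f. poly f s"]
    show ?thesis by (simp add: poly_monom poly_sum)
  qed
  have "(\<Prod>i\<in>UNIV. x $ i ^ \<alpha> i) = (\<Sum>\<tau>\<in>node_tuples p. (\<Prod>i\<in>UNIV. \<tau> i ^ \<alpha> i) * ?L \<tau>)" if "\<forall>i. \<alpha> i \<le> p" for \<alpha>
  proof -
    have "(\<Prod>i\<in>UNIV. x $ i ^ \<alpha> i) = (\<Prod>i\<in>UNIV. \<Sum>t\<in>?X. t ^ \<alpha> i * poly (lagrange ?X t) (x $ i))"
      using that by (intro prod.cong mono) auto
    also have "\<dots> = (\<Sum>\<tau>\<in>node_tuples p. \<Prod>i\<in>UNIV. \<tau> i ^ \<alpha> i * poly (lagrange ?X (\<tau> i)) (x $ i))"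
      by (rule prod_sum_PiE) (auto simp: X(1))
    finally show ?thesis by (simp add: prod.distrib)
  qed
  then have "q x = (\<Sum>\<alpha> | \<forall>i. \<alpha> i \<le> p. c \<alpha> * (\<Sum>\<tau>\<in>node_tuples p. (\<Prod>i\<in>UNIV. \<tau> i ^ \<alpha> i) * ?L \<tau>))"
    unfolding c by (intro sum.cong) auto
  also have "\<dots> = (\<Sum>\<alpha> | \<forall>i. \<alpha> i \<le> p. \<Sum>\<tau>\<in>node_tuples p. c \<alpha> * (\<Prod>i\<in>UNIV. \<tau> i ^ \<alpha> i) * ?L \<tau>)"
    by (simp add: sum_distrib_left mult.assoc)
  also have "\<dots> = (\<Sum>\<tau>\<in>node_tuples p. \<Sum>\<alpha> | \<forall>i. \<alpha> i \<le> p. c \<alpha> * (\<Prod>i\<in>UNIV. \<tau> i ^ \<alpha> i) * ?L \<tau>)"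
    by (rule sum.swap)
  also have "\<dots> = (\<Sum>\<tau>\<in>node_tuples p. q (\<chi> i. \<tau> i) * ?L \<tau>)"
    unfolding c by (simp add: sum_distrib_right)
  finally show ?thesis .
qed

text \<open>Unisolvence on an arbitrary scaled copy of the node grid: pulled back to the unit cube,
  both polynomials have the same interpolant.\<close>

lemma Qp_eqI:
  fixes q r :: "real ^ 'n::finite \<Rightarrow> real"
  assumes "1 \<le> p" "q \<in> Qp p" "r \<in> Qp p" "h \<noteq> 0"
    and eq: "\<And>\<tau>. \<tau> \<in> node_tuples p \<Longrightarrow> q (a + h *\<^sub>R (\<chi> i. \<tau> i)) = r (a + h *\<^sub>R (\<chi> i. \<tau> i))"
  shows "q = r"
proof
  fix x
  have x: "x = a + h *\<^sub>R ((1 / h) *\<^sub>R (x - a))" using assms(4) by simp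
  have "q (a + h *\<^sub>R y) = r (a + h *\<^sub>R y)" for y
    using Qp_interpolation[OF assms(1) Qp_affine[OF assms(2)], of a h y]
      Qp_interpolation[OF assms(1) Qp_affine[OF assms(3)], of a h y] eq by simp
  then show "q x = r x" using x by metis
qed

lemma poly_bounded_interval: "\<exists>b. \<forall>s\<in>{l..u}. \<bar>poly f s\<bar> \<le> (b :: real)"
proof -
  have "compact ((\<lambda>s. poly f s) ` {l..u})" by (intro compact_continuous_image continuous_intros) auto
  then have "bounded ((\<lambda>s. poly f s) ` {l..u})" by (rule compact_imp_bounded)
  then show ?thesis unfolding bounded_iff by auto
qed

lemma abs_prod_le_power:
  fixes f :: "'n::finite \<Rightarrow> real"
  assumes "\<And>i. \<bar>f i\<bar> \<le> b"
  shows "\<bar>\<Prod>i\<in>UNIV. f i\<bar> \<le> b ^ CARD('n)"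
proof -
  have "(\<Prod>i\<in>UNIV. \<bar>f i\<bar>) \<le> (\<Prod>i\<in>(UNIV :: 'n set). b)" using assms by (intro prod_mono) auto
  then show ?thesis by (simp add: abs_prod)
qed

text \<open>The factor two around the cell is for extrapolation to neighbouring cells.\<close>

lemma Qp_deriv_bound:
  assumes p: "1 \<le> p"
  obtains B :: real where "1 \<le> B"
    "\<And>(q :: real ^ 'n::finite \<Rightarrow> real) a h M k i x. \<lbrakk>q \<in> Qp p; 0 < h; k \<le> p; 0 \<le> M;
       \<And>\<tau>. \<tau> \<in> node_tuples p \<Longrightarrow> \<bar>q (a + h *\<^sub>R (\<chi> i. \<tau> i))\<bar> \<le> M;
       \<And>j. a $ j - h \<le> x $ j \<and> x $ j \<le> a $ j + 2 * h\<rbrakk>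
     \<Longrightarrow> \<bar>dir_deriv k (axis i 1) q x\<bar> \<le> B * M / h ^ k"
proof -
  let ?X = "unit_nodes p"
  let ?f = "\<lambda>k t. (pderiv ^^ k) (lagrange ?X t)"
  note X = unit_nodes[OF p]
  \<comment> \<open>After rescaling, the enlarged cell is the cube over [-1, 2]; the finitely many
    derivatives of Lagrange polynomials are bounded there by one constant \<open>b1\<close>.\<close>
  have "\<forall>kt\<in>{..p} \<times> ?X. \<exists>b. \<forall>s\<in>{-1..2}. \<bar>poly (?f (fst kt) (snd kt)) s\<bar> \<le> b"
    by (intro ballI poly_bounded_interval)
  from bchoice[OF this] obtain b where
    b0: "\<forall>kt\<in>{..p} \<times> ?X. \<forall>s\<in>{-1..2}. \<bar>poly (?f (fst kt) (snd kt)) s\<bar> \<le> b kt" ..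
  have b: "\<bar>poly (?f k t) s\<bar> \<le> b (k, t)" if "k \<le> p" "t \<in> ?X" "s \<in> {-1..2}" for k t s
    using b0[rule_format, of "(k, t)" s] that by simp
  define b1 where "b1 = 1 + (\<Sum>kt\<in>{..p} \<times> ?X. \<bar>b kt\<bar>)"
  have b1: "\<bar>poly (?f k t) s\<bar> \<le> b1" if "k \<le> p" "t \<in> ?X" "s \<in> {-1..2}" for k t s
  proof -
    have "\<bar>b (k, t)\<bar> \<le> (\<Sum>kt\<in>{..p} \<times> ?X. \<bar>b kt\<bar>)"
      using that X(1) by (intro member_le_sum) auto
    then show ?thesis using b[OF that] by (simp add: b1_def)
  qed
  have b1_ge: "1 \<le> b1" unfolding b1_def by (simp add: sum_nonneg)
  define B where "B = real (card (node_tuples p :: ('n \<Rightarrow> real) set)) * b1 ^ CARD('n)"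
  have card1: "1 \<le> card (node_tuples p :: ('n \<Rightarrow> real) set)"
    using X(2) by (simp add: card_PiE)
  show ?thesis
  proof (rule that)
    have "1 * 1 \<le> B" unfolding B_def using card1 b1_ge by (intro mult_mono one_le_power) auto
    then show "1 \<le> B" by simp
  next
    fix q :: "real ^ 'n \<Rightarrow> real" and a x :: "real ^ 'n" and h M :: real and k i
    assume q: "q \<in> Qp p" and h: "0 < h" and k: "k \<le> p" and M: "0 \<le> M"
      and nod: "\<And>\<tau>. \<tau> \<in> node_tuples p \<Longrightarrow> \<bar>q (a + h *\<^sub>R (\<chi> i. \<tau> i))\<bar> \<le> M"
      and x: "\<And>j. a $ j - h \<le> x $ j \<and> x $ j \<le> a $ j + 2 * h"
    define y where "y = (1 / h) *\<^sub>R (x - a)"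
    have xy: "x = a + h *\<^sub>R y" using h by (simp add: y_def)
    have y: "y $ j \<in> {-1..2}" for j using x[of j] h by (auto simp: y_def field_simps)
    let ?Q = "\<lambda>x. \<Sum>\<tau>\<in>node_tuples p. q (a + h *\<^sub>R (\<chi> i. \<tau> i)) * (\<Prod>i\<in>UNIV. poly (lagrange ?X (\<tau> i)) (x $ i))"
    have Q: "(\<lambda>x. q (a + h *\<^sub>R x)) = ?Q"
      by (rule ext) (rule Qp_interpolation[OF p Qp_affine[OF q]])
    have "dir_deriv k (axis i 1) q x = dir_deriv k (axis i 1) ?Q y / h ^ k"
      unfolding xy using dir_deriv_scale[OF q] h Q by simp
    also have "dir_deriv k (axis i 1) ?Q y = (\<Sum>\<tau>\<in>node_tuples p. q (a + h *\<^sub>R (\<chi> i. \<tau> i)) *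
        (\<Prod>j\<in>UNIV. poly (if j = i then ?f k (\<tau> j) else lagrange ?X (\<tau> j)) (y $ j)))"
      by (rule dir_deriv_prod_sum[OF finite_node_tuples[OF p]])
    finally have eq: "dir_deriv k (axis i 1) q x = \<dots> / h ^ k" .
    have "\<bar>\<Sum>\<tau>\<in>node_tuples p. q (a + h *\<^sub>R (\<chi> i. \<tau> i)) *
        (\<Prod>j\<in>UNIV. poly (if j = i then ?f k (\<tau> j) else lagrange ?X (\<tau> j)) (y $ j))\<bar>
      \<le> (\<Sum>\<tau>\<in>(node_tuples p :: ('n \<Rightarrow> real) set). M * b1 ^ CARD('n))"
    proof (rule order.trans[OF sum_abs sum_mono])
      fix \<tau> :: "'n \<Rightarrow> real" assume \<tau>: "\<tau> \<in> node_tuples p"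
      have "\<bar>poly (if j = i then ?f k (\<tau> j) else lagrange ?X (\<tau> j)) (y $ j)\<bar> \<le> b1" for j
        using b1[OF k, of "\<tau> j" "y $ j"] b1[of 0 "\<tau> j" "y $ j"] \<tau> y[of j] by (auto simp: PiE_def)
      then have "\<bar>\<Prod>j\<in>UNIV. poly (if j = i then ?f k (\<tau> j) else lagrange ?X (\<tau> j)) (y $ j)\<bar> \<le> b1 ^ CARD('n)"
        by (rule abs_prod_le_power)
      then show "\<bar>q (a + h *\<^sub>R (\<chi> i. \<tau> i)) *
        (\<Prod>j\<in>UNIV. poly (if j = i then ?f k (\<tau> j) else lagrange ?X (\<tau> j)) (y $ j))\<bar> \<le> M * b1 ^ CARD('n)"
        unfolding abs_mult using nod[OF \<tau>] M by (intro mult_mono) auto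
    qed
    also have "\<dots> = B * M" by (simp add: B_def)
    finally show "\<bar>dir_deriv k (axis i 1) q x\<bar> \<le> B * M / h ^ k"
      unfolding eq abs_divide using h by (simp add: divide_right_mono)
  qed
qed

lemma dir_deriv_0: "dir_deriv 0 \<nu> q = q"
  by (simp add: dir_deriv_def fun_eq_iff)

lemma Qp_has_derivative:
  fixes q :: "real ^ 'n::finite \<Rightarrow> real"
  assumes "q \<in> Qp p"
  shows "(q has_derivative (\<lambda>v. \<Sum>i\<in>UNIV. v $ i * dir_deriv 1 (axis i 1) q x)) (at x)"
proof -
  obtain D where D: "(q has_derivative D) (at x)"
    using differentiable_Qp[OF assms] unfolding differentiable_def by blast
  then have lin: "linear D" by (rule has_derivative_linear)
  have Da: "D (axis i 1) = dir_deriv 1 (axis i 1) q x" for i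
  proof -
    have "(q has_derivative D) (at (x + 0 *\<^sub>R axis i 1))" using D by simp
    moreover have "((\<lambda>t :: real. x + t *\<^sub>R axis i 1) has_derivative (\<lambda>t. t *\<^sub>R axis i 1)) (at 0)"
      by (auto intro!: derivative_eq_intros)
    ultimately have "((\<lambda>t. q (x + t *\<^sub>R axis i 1)) has_derivative (\<lambda>t. D (t *\<^sub>R axis i 1))) (at 0)"
      by (rule has_derivative_compose[rotated])
    moreover have "(\<lambda>t. D (t *\<^sub>R axis i 1)) = (*) (D (axis i 1))"
      using lin by (auto simp: linear_scale mult.commute)
    ultimately have "((\<lambda>t. q (x + t *\<^sub>R axis i 1)) has_real_derivative D (axis i 1)) (at 0)"
      by (simp only: has_field_derivative_def)
    then show ?thesis unfolding dir_deriv_def by (simp add: DERIV_imp_deriv)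
  qed
  have Dv: "D v = (\<Sum>i\<in>UNIV. v $ i * D (axis i 1))" for v
  proof -
    have "D v = D (\<Sum>i\<in>UNIV. v $ i *\<^sub>R axis i 1)"
      using basis_expansion[of v] by (simp add: scalar_mult_eq_scaleR)
    then show ?thesis using lin by (simp add: linear_sum linear_scale)
  qed
  have "D = (\<lambda>v. \<Sum>i\<in>UNIV. v $ i * dir_deriv 1 (axis i 1) q x)"
    by (rule ext, subst Dv) (simp only: Da)
  then show ?thesis using D by simp
qed

section \<open>Point values of polynomials controlled by integrals\<close>

lemma Qp_lipschitz:
  fixes q :: "real ^ 'n::finite \<Rightarrow> real"
  assumes "q \<in> Qp p" "convex S" "x \<in> S" "y \<in> S"
    and G: "\<And>z i. z \<in> S \<Longrightarrow> \<bar>dir_deriv 1 (axis i 1) q z\<bar> \<le> G"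
  shows "\<bar>q x - q y\<bar> \<le> real CARD('n) * G * norm (x - y)"
proof -
  have "norm (q x - q y) \<le> real CARD('n) * G * norm (x - y)"
  proof (rule differentiable_bound[OF assms(2)])
    show "(q has_derivative (\<lambda>v. \<Sum>i\<in>UNIV. v $ i * dir_deriv 1 (axis i 1) q z)) (at z within S)" for z
      using Qp_has_derivative[OF assms(1)] has_derivative_at_withinI by blast
    show "onorm (\<lambda>v. \<Sum>i\<in>UNIV. v $ i * dir_deriv 1 (axis i 1) q z) \<le> real CARD('n) * G" if "z \<in> S" for z
    proof (rule onorm_le)
      fix v :: "real ^ 'n"
      have "norm (\<Sum>i\<in>UNIV. v $ i * dir_deriv 1 (axis i 1) q z) \<le> (\<Sum>i\<in>(UNIV :: 'n set). norm v * G)"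
      proof (rule order.trans[OF norm_sum sum_mono])
        fix i :: 'n
        show "norm (v $ i * dir_deriv 1 (axis i 1) q z) \<le> norm v * G"
          using component_le_norm_cart[of v i] G[OF that, of i] by (simp add: abs_mult mult_mono)
      qed
      then show "norm (\<Sum>i\<in>UNIV. v $ i * dir_deriv 1 (axis i 1) q z) \<le> real CARD('n) * G * norm v"
        by (simp add: mult.assoc mult.commute[of G])
    qed
  qed (use assms in auto)
  then show ?thesis by simp
qed

text \<open>A quantitative substitute for norm equivalence: the gradient is bounded by a multiple of
  the maximum divided by \<open>h\<close>, so the polynomial keeps at least half of its maximum on a
  subcube whose relative size depends only on dimension and degree. The 4 is the square of the
  inverse of this half.\<close>

lemma Qp_near_max:
  assumes p: "1 \<le> p"
  obtains \<rho> :: real where "0 < \<rho>" "\<rho> \<le> 1 / 2"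
    "\<And>(q :: real ^ 'n::finite \<Rightarrow> real) a h. \<lbrakk>q \<in> Qp p; 0 < h\<rbrakk> \<Longrightarrow>
      \<exists>l. (\<forall>i. a $ i \<le> l $ i \<and> l $ i + \<rho> * h \<le> a $ i + h) \<and>
          (\<forall>x y. (\<forall>i. a $ i \<le> x $ i \<and> x $ i \<le> a $ i + h) \<longrightarrow> (\<forall>i. l $ i \<le> y $ i \<and> y $ i \<le> l $ i + \<rho> * h)
              \<longrightarrow> (q x)\<^sup>2 \<le> 4 * (q y)\<^sup>2)"
proof -
  obtain B where B: "1 \<le> B" "\<And>(q :: real ^ 'n::finite \<Rightarrow> real) a h M k i x. \<lbrakk>q \<in> Qp p; 0 < h; k \<le> p; 0 \<le> M;
       \<And>\<tau>. \<tau> \<in> node_tuples p \<Longrightarrow> \<bar>q (a + h *\<^sub>R (\<chi> i. \<tau> i))\<bar> \<le> M;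
       \<And>j. a $ j - h \<le> x $ j \<and> x $ j \<le> a $ j + 2 * h\<rbrakk>
     \<Longrightarrow> \<bar>dir_deriv k (axis i 1) q x\<bar> \<le> B * M / h ^ k"
    using Qp_deriv_bound[OF p, where 'n = 'n] by blast
  let ?d = "real CARD('n)"
  have d1: "1 \<le> ?d" by simp
  \<comment> \<open>One factor \<open>?d\<close> comes from the Lipschitz constant, the other from
    bounding the distance by the sum of the coordinates; the 2 leaves half of the maximum.\<close>
  define \<rho> where "\<rho> = 1 / (2 * ?d * ?d * B)"
  have dd: "1 \<le> ?d * ?d * B"
    using mult_mono[OF mult_mono[OF d1 d1] B(1)] by simp
  have \<rho>: "0 < \<rho>" "\<rho> \<le> 1 / 2" using dd by (auto simp: \<rho>_def field_simps)
  show ?thesis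
  proof (rule that[OF \<rho>])
    fix q :: "real ^ 'n \<Rightarrow> real" and a :: "real ^ 'n" and h :: real
    assume q: "q \<in> Qp p" and h: "0 < h"
    let ?S = "{x. \<forall>i. a $ i \<le> x $ i \<and> x $ i \<le> a $ i + h}"
    have S: "?S = cbox a (a + (\<chi> i. h))" by (auto simp: mem_box_cart)
    have "?S \<noteq> {}" using h by (auto intro!: exI[of _ a])
    moreover have "compact ?S" unfolding S by (rule compact_cbox)
    moreover have "continuous_on ?S (\<lambda>x. \<bar>q x\<bar>)" by (intro continuous_on_rabs continuous_on_Qp[OF q])
    ultimately obtain x0 where x0: "x0 \<in> ?S" "\<And>x. x \<in> ?S \<Longrightarrow> \<bar>q x\<bar> \<le> \<bar>q x0\<bar>"
      using continuous_attains_sup[of ?S "\<lambda>x. \<bar>q x\<bar>"] by blast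
    let ?M = "\<bar>q x0\<bar>"
    have G: "\<bar>dir_deriv 1 (axis i 1) q z\<bar> \<le> B * ?M / h" if "z \<in> ?S" for z i
    proof -
      have "\<bar>dir_deriv 1 (axis i 1) q z\<bar> \<le> B * ?M / h ^ 1"
      proof (rule B(2)[OF q h, where a = a])
        fix \<tau> :: "'n \<Rightarrow> real" assume "\<tau> \<in> node_tuples p"
        then have "\<tau> i \<in> unit_nodes p" for i by (rule PiE_mem) simp
        then have "0 \<le> \<tau> i \<and> \<tau> i \<le> 1" for i using unit_nodes(3)[OF p] by (meson atLeastAtMost_iff subsetD)
        then show "\<bar>q (a + h *\<^sub>R (\<chi> i. \<tau> i))\<bar> \<le> ?M" using h by (intro x0(2)) (auto simp: mult_le_cancel_left1)
      next
        fix j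
        have "a $ j \<le> z $ j" "z $ j \<le> a $ j + h" using that by auto
        then show "a $ j - h \<le> z $ j \<and> z $ j \<le> a $ j + 2 * h" using h by linarith
      qed (use p in auto)
      then show ?thesis by simp
    qed
    \<comment> \<open>In each coordinate, extend from the maximiser towards the farther face;
      \<open>\<rho> \<le> 1 / 2\<close> leaves room for this.\<close>
    define l where "l = (\<chi> i. if x0 $ i \<le> a $ i + h / 2 then x0 $ i else x0 $ i - \<rho> * h)"
    have \<rho>h: "0 < \<rho> * h" "\<rho> * h \<le> h / 2" using \<rho> h by auto
    have l: "a $ i \<le> l $ i \<and> l $ i + \<rho> * h \<le> a $ i + h" for i
      using x0(1) \<rho>h by (auto simp: l_def dest: spec[of _ i])
    have "(q x)\<^sup>2 \<le> 4 * (q y)\<^sup>2" if x: "\<forall>i. a $ i \<le> x $ i \<and> x $ i \<le> a $ i + h"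
      and y: "\<forall>i. l $ i \<le> y $ i \<and> y $ i \<le> l $ i + \<rho> * h" for x y
    proof -
      have yS: "y \<in> ?S"
      proof (rule CollectI, intro allI)
        fix i
        show "a $ i \<le> y $ i \<and> y $ i \<le> a $ i + h" using y[rule_format, of i] l[of i] by linarith
      qed
      have "\<bar>(y - x0) $ i\<bar> \<le> \<rho> * h" for i
        using y[rule_format, of i] \<rho>h by (auto simp: l_def split: if_splits)
      then have "(\<Sum>i\<in>UNIV. \<bar>(y - x0) $ i\<bar>) \<le> (\<Sum>i\<in>(UNIV :: 'n set). \<rho> * h)" by (intro sum_mono)
      then have nyx: "norm (y - x0) \<le> ?d * (\<rho> * h)" using norm_le_l1_cart[of "y - x0"] by simp
      have "\<bar>q y - q x0\<bar> \<le> ?d * (B * ?M / h) * norm (y - x0)"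
        by (rule Qp_lipschitz[OF q _ yS x0(1) G]) (simp only: S convex_box)
      also have "\<dots> \<le> ?d * (B * ?M / h) * (?d * (\<rho> * h))"
        using nyx B(1) h by (intro mult_left_mono) auto
      also have "\<dots> = ?M / 2" using h B(1) by (simp add: \<rho>_def field_simps)
      finally have "?M \<le> 2 * \<bar>q y\<bar>" by linarith
      then have "\<bar>q x\<bar> \<le> 2 * \<bar>q y\<bar>" using x0(2)[of x] x by simp
      then have "\<bar>q x\<bar>\<^sup>2 \<le> (2 * \<bar>q y\<bar>)\<^sup>2" by (intro power_mono) auto
      then show ?thesis by (simp add: power_mult_distrib)
    qed
    then show "\<exists>l. (\<forall>i. a $ i \<le> l $ i \<and> l $ i + \<rho> * h \<le> a $ i + h) \<and>
          (\<forall>x y. (\<forall>i. a $ i \<le> x $ i \<and> x $ i \<le> a $ i + h) \<longrightarrow> (\<forall>i. l $ i \<le> y $ i \<and> y $ i \<le> l $ i + \<rho> * h)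
              \<longrightarrow> (q x)\<^sup>2 \<le> 4 * (q y)\<^sup>2)"
      using l by blast
  qed
qed

lemma set_integral_ge_const:
  fixes f :: "'a \<Rightarrow> real"
  assumes "T \<in> sets M" "T \<subseteq> S" "emeasure M T < \<infinity>" "set_integrable M S f"
    "\<And>x. x \<in> T \<Longrightarrow> c \<le> f x" "\<And>x. x \<in> S \<Longrightarrow> 0 \<le> f x"
  shows "c * measure M T \<le> (LINT x:S|M. f x)"
proof -
  have "c * measure M T = (LINT x|M. c * indicator T x)"
    using assms(1,3) by simp
  also have "\<dots> \<le> (LINT x:S|M. f x)"
    unfolding set_lebesgue_integral_def
  proof (rule integral_mono)
    show "integrable M (\<lambda>x. c * indicator T x)" using assms(1,3) by simp
    show "integrable M (\<lambda>x. indicator S x *\<^sub>R f x)" using assms(4) by (simp add: set_integrable_def)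
    show "c * indicator T x \<le> indicator S x *\<^sub>R f x" for x
      using assms(2,5,6) by (auto simp: indicator_def)
  qed
  finally show ?thesis .
qed

lemma set_integrable_bounded:
  fixes f :: "'a \<Rightarrow> real"
  assumes "S \<in> sets M" "emeasure M S < \<infinity>" "set_borel_measurable M S f" "\<And>x. x \<in> S \<Longrightarrow> \<bar>f x\<bar> \<le> B"
  shows "set_integrable M S f"
  unfolding set_integrable_def
proof (rule integrableI_bounded_set[OF assms(1)])
  show "(\<lambda>x. indicat_real S x *\<^sub>R f x) \<in> borel_measurable M" using assms(3) by (simp only: set_borel_measurable_def)
  show "emeasure M S < \<infinity>" by (rule assms(2))
  show "AE x in M. x \<in> S \<longrightarrow> norm (indicat_real S x *\<^sub>R f x) \<le> B" using assms(4) by (intro AE_I2) simp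
  show "AE x in M. x \<notin> S \<longrightarrow> indicat_real S x *\<^sub>R f x = 0" by (intro AE_I2) simp
qed

text \<open>Makes a polynomial constant in the direction normal to a face, so that
  \<open>Qp_near_max\<close> for the cell applies to the face.\<close>

lemma Qp_freeze:
  fixes q :: "real ^ 'n::finite \<Rightarrow> real"
  assumes "q \<in> Qp p"
  shows "(\<lambda>x. q (\<chi> j. if j = i then c else x $ j)) \<in> Qp p"
proof -
  obtain b where b: "\<And>x. q x = (\<Sum>\<alpha> | \<forall>i. \<alpha> i \<le> p. b \<alpha> * (\<Prod>i\<in>UNIV. poly (monom 1 (\<alpha> i)) (x $ i)))"
    using assms Qp_obtain_prod by blast
  have "(\<lambda>x. q (\<chi> j. if j = i then c else x $ j)) =
    (\<lambda>x. \<Sum>\<alpha> | \<forall>i. \<alpha> i \<le> p. b \<alpha> * (\<Prod>j\<in>UNIV. poly (if j = i then [:c ^ \<alpha> j:] else monom 1 (\<alpha> j)) (x $ j)))"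
    unfolding b by (intro ext sum.cong refl arg_cong[of _ _ "(*) _"] prod.cong) (auto simp: poly_monom)
  also have "\<dots> \<in> Qp p"
    by (intro Qp_sum Qp_scale Qp_prod) (auto simp: degree_monom_eq)
  finally show ?thesis .
qed

lemma hausdorff_outer_face_finite:
  fixes a :: "real ^ 'n::finite"
  assumes d: "2 \<le> CARD('n)" and h: "0 < h"
  shows "hausdorff_outer (CARD('n) - 1) {x. x $ i0 = c \<and> (\<forall>i. a $ i \<le> x $ i \<and> x $ i \<le> a $ i + h)}
    \<le> ennreal (unit_ball_vol (real (CARD('n) - 1)) * (real CARD('n) * h) ^ (CARD('n) - 1))"
proof -
  \<comment> \<open>A second coordinate forces the \<open>\<delta>\<close> of the graph condition to
    be nonnegative.\<close>
  have nn: "\<exists>i. i \<noteq> i0"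
  proof (rule ccontr)
    assume "\<nexists>i. i \<noteq> i0"
    then have "UNIV = {i0}" by auto
    then have "CARD('n) = card {i0}" by simp
    then show False using d by simp
  qed
  show ?thesis
    using hausdorff_outer_graph_le[OF d h order.refl[of 1], of "{x. x $ i0 = c \<and> (\<forall>i. a $ i \<le> x $ i \<and> x $ i \<le> a $ i + h)}" a i0]
      nn by (fastforce dest: order.trans[OF abs_ge_zero])
qed

lemma face_integral_ge:
  assumes p: "1 \<le> p" and d: "2 \<le> CARD('n)"
  obtains c :: real where "0 < c"
    "\<And>(q :: real ^ 'n::finite \<Rightarrow> real) a h i0 f x. \<lbrakk>q \<in> Qp p; 0 < h; a $ i0 \<le> f; f \<le> a $ i0 + h;
       x $ i0 = f; \<And>i. a $ i \<le> x $ i \<and> x $ i \<le> a $ i + h\<rbrakk> \<Longrightarrow>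
       c * h ^ (CARD('n) - 1) * (q x)\<^sup>2 \<le>
         (LINT x:{x. x $ i0 = f \<and> (\<forall>i. a $ i \<le> x $ i \<and> x $ i \<le> a $ i + h)}|surf. (q x)\<^sup>2)"
proof -
  obtain \<rho> where \<rho>: "0 < \<rho>" "\<rho> \<le> 1 / 2"
    "\<And>(q :: real ^ 'n::finite \<Rightarrow> real) a h. \<lbrakk>q \<in> Qp p; 0 < h\<rbrakk> \<Longrightarrow>
      \<exists>l. (\<forall>i. a $ i \<le> l $ i \<and> l $ i + \<rho> * h \<le> a $ i + h) \<and>
          (\<forall>x y. (\<forall>i. a $ i \<le> x $ i \<and> x $ i \<le> a $ i + h) \<longrightarrow> (\<forall>i. l $ i \<le> y $ i \<and> y $ i \<le> l $ i + \<rho> * h)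
              \<longrightarrow> (q x)\<^sup>2 \<le> 4 * (q y)\<^sup>2)"
    using Qp_near_max[OF p, where 'n = 'n] by blast
  let ?s = "CARD('n) - 1"
  let ?v = "unit_ball_vol (real ?s)"
  have v: "0 < ?v" by (rule unit_ball_vol_pos) simp
  define c where "c = ?v * (\<rho> / 4) ^ ?s / 4"
  show ?thesis
  proof (rule that)
    show "0 < c" using v \<rho>(1) by (simp add: c_def)
  next
    fix q :: "real ^ 'n \<Rightarrow> real" and a x :: "real ^ 'n" and h f :: real and i0
    assume q: "q \<in> Qp p" and h: "0 < h" and f: "a $ i0 \<le> f" "f \<le> a $ i0 + h"
      and xf: "x $ i0 = f" and x: "\<And>i. a $ i \<le> x $ i \<and> x $ i \<le> a $ i + h"
    let ?F = "{x. x $ i0 = f \<and> (\<forall>i. a $ i \<le> x $ i \<and> x $ i \<le> a $ i + h)}"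
    let ?fr = "\<lambda>x :: real ^ 'n. \<chi> j. if j = i0 then f else x $ j"
    obtain l where l: "\<forall>i. a $ i \<le> l $ i \<and> l $ i + \<rho> * h \<le> a $ i + h"
      and lq: "\<And>x y. \<forall>i. a $ i \<le> x $ i \<and> x $ i \<le> a $ i + h \<Longrightarrow> \<forall>i. l $ i \<le> y $ i \<and> y $ i \<le> l $ i + \<rho> * h
              \<Longrightarrow> (q (?fr x))\<^sup>2 \<le> 4 * (q (?fr y))\<^sup>2"
      using \<rho>(3)[OF Qp_freeze[OF q, of i0 f] h, of a] by blast
    let ?T = "{x. x $ i0 = f \<and> (\<forall>i. i \<noteq> i0 \<longrightarrow> l $ i \<le> x $ i \<and> x $ i \<le> l $ i + \<rho> * h)}"
    have Fcb: "?F = {x. x $ i0 = f} \<inter> cbox a (a + (\<chi> i. h))" by (auto simp: mem_box_cart)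
    have hyp: "closed {x :: real ^ 'n. x $ i0 = f}" by (intro closed_Collect_eq continuous_intros)
    have cF: "compact ?F" unfolding Fcb using hyp compact_cbox by (rule closed_Int_compact)
    have "closed ?T"
      by (intro closed_Collect_conj closed_Collect_all closed_Collect_imp closed_Collect_eq closed_Collect_le continuous_intros open_Collect_const)
    have TF: "?T \<subseteq> ?F"
    proof (rule subsetI)
      fix y assume y: "y \<in> ?T"
      have "a $ i \<le> y $ i \<and> y $ i \<le> a $ i + h" for i
      proof (cases "i = i0")
        case True
        then show ?thesis using y f by simp
      next
        case False
        then have "l $ i \<le> y $ i" "y $ i \<le> l $ i + \<rho> * h" using y by auto
        then show ?thesis using l[rule_format, of i] by linarith
      qed
      then show "y \<in> ?F" using y by simp
    qed
    have bF: "?F \<in> sets borel" "?T \<in> sets borel" using cF \<open>closed ?T\<close> by (auto simp: borel_compact)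
    have fin: "emeasure surf ?F < \<infinity>"
      using hausdorff_outer_face_finite[OF d h, of i0 f a] unfolding emeasure_surf[OF d bF(1)]
      by (simp add: order_le_less_trans)
    then have finT: "emeasure surf ?T < \<infinity>"
      using emeasure_mono[OF TF, of surf] bF by (simp add: order_le_less_trans)
    have "ennreal (?v * (\<rho> * h / 4) ^ ?s) \<le> emeasure surf ?T"
      using hausdorff_outer_flat_ge[OF d, of "\<rho> * h" i0 f l] \<rho>(1) h unfolding emeasure_surf[OF d bF(2)] by simp
    then have mT: "?v * (\<rho> * h / 4) ^ ?s \<le> measure surf ?T"
      using finT v \<rho>(1) h by (subst (asm) emeasure_eq_ennreal_measure) (auto simp: less_top)
    have "set_integrable surf ?F (\<lambda>x. (q x)\<^sup>2)"
    proof -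
      have "continuous_on ?F (\<lambda>x. (q x)\<^sup>2)" by (intro continuous_intros continuous_on_Qp[OF q])
      then have meas: "set_borel_measurable surf ?F (\<lambda>x. (q x)\<^sup>2)"
        unfolding set_borel_measurable_def
        unfolding measurable_cong_sets[OF sets_surf refl]
        by (rule borel_measurable_continuous_on_indicator[OF bF(1)])
      have "bounded ((\<lambda>x. (q x)\<^sup>2) ` ?F)"
        by (intro compact_imp_bounded compact_continuous_image cF continuous_intros continuous_on_Qp[OF q])
      then obtain b where "\<And>x. x \<in> ?F \<Longrightarrow> \<bar>(q x)\<^sup>2\<bar> \<le> b" unfolding bounded_iff by (metis (no_types, lifting) image_eqI real_norm_def)
      with meas show ?thesis using fin bF(1) by (intro set_integrable_bounded) auto
    qed
    then have "((q x)\<^sup>2 / 4) * measure surf ?T \<le> (LINT x:?F|surf. (q x)\<^sup>2)"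
    proof (rule set_integral_ge_const[rotated 3])
      fix y assume y: "y \<in> ?T"
      have fx: "?fr x = x" using xf by (simp add: vec_eq_iff)
      have fy: "?fr (\<chi> i. if i = i0 then l $ i else y $ i) = y" using y by (simp add: vec_eq_iff)
      have "(q (?fr x))\<^sup>2 \<le> 4 * (q (?fr (\<chi> i. if i = i0 then l $ i else y $ i)))\<^sup>2"
        using x y \<rho>(1) h by (intro lq) auto
      then show "(q x)\<^sup>2 / 4 \<le> (q y)\<^sup>2" unfolding fx fy by simp
    qed (use bF TF finT in auto)
    moreover have "((q x)\<^sup>2 / 4) * (?v * (\<rho> * h / 4) ^ ?s) \<le> ((q x)\<^sup>2 / 4) * measure surf ?T"
      using mT by (intro mult_left_mono) auto
    moreover have "((q x)\<^sup>2 / 4) * (?v * (\<rho> * h / 4) ^ ?s) = c * h ^ ?s * (q x)\<^sup>2"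
      by (simp add: c_def power_mult_distrib power_divide mult_ac)
    ultimately show "c * h ^ ?s * (q x)\<^sup>2 \<le> (LINT x:?F|surf. (q x)\<^sup>2)" by linarith
  qed
qed

text \<open>\<open>S\<close> is only asked to contain the open cube because it will be a half-open
  cell.\<close>

lemma cell_integral_ge:
  assumes p: "1 \<le> p"
  obtains c :: real where "0 < c"
    "\<And>(q :: real ^ 'n::finite \<Rightarrow> real) a h S x. \<lbrakk>q \<in> Qp p; 0 < h; \<And>i. a $ i \<le> x $ i \<and> x $ i \<le> a $ i + h;
       box a (a + (\<chi> i. h)) \<subseteq> S; set_integrable lborel S (\<lambda>x. (q x)\<^sup>2)\<rbrakk> \<Longrightarrow>
       c * h ^ CARD('n) * (q x)\<^sup>2 \<le> (LINT x:S|lborel. (q x)\<^sup>2)"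
proof -
  obtain \<rho> where \<rho>: "0 < \<rho>" "\<rho> \<le> 1 / 2"
    "\<And>(q :: real ^ 'n::finite \<Rightarrow> real) a h. \<lbrakk>q \<in> Qp p; 0 < h\<rbrakk> \<Longrightarrow>
      \<exists>l. (\<forall>i. a $ i \<le> l $ i \<and> l $ i + \<rho> * h \<le> a $ i + h) \<and>
          (\<forall>x y. (\<forall>i. a $ i \<le> x $ i \<and> x $ i \<le> a $ i + h) \<longrightarrow> (\<forall>i. l $ i \<le> y $ i \<and> y $ i \<le> l $ i + \<rho> * h)
              \<longrightarrow> (q x)\<^sup>2 \<le> 4 * (q y)\<^sup>2)"
    using Qp_near_max[OF p, where 'n = 'n] by blast
  show ?thesis
  proof (rule that[of "\<rho> ^ CARD('n) / 4"])
    show "0 < \<rho> ^ CARD('n) / 4" using \<rho>(1) by simp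
  next
    fix q :: "real ^ 'n \<Rightarrow> real" and a x :: "real ^ 'n" and h :: real and S
    assume q: "q \<in> Qp p" and h: "0 < h" and x: "\<And>i. a $ i \<le> x $ i \<and> x $ i \<le> a $ i + h"
      and S: "box a (a + (\<chi> i. h)) \<subseteq> S" and int: "set_integrable lborel S (\<lambda>x. (q x)\<^sup>2)"
    obtain l where l: "\<forall>i. a $ i \<le> l $ i \<and> l $ i + \<rho> * h \<le> a $ i + h"
      and lq: "\<And>x y. \<forall>i. a $ i \<le> x $ i \<and> x $ i \<le> a $ i + h \<Longrightarrow> \<forall>i. l $ i \<le> y $ i \<and> y $ i \<le> l $ i + \<rho> * h
              \<Longrightarrow> (q x)\<^sup>2 \<le> 4 * (q y)\<^sup>2"
      using \<rho>(3)[OF q h, of a] by blast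
    let ?T = "box l (l + (\<chi> i. \<rho> * h))"
    have TS: "?T \<subseteq> S"
    proof (rule order.trans[OF _ S], rule subsetI)
      fix y assume "y \<in> ?T"
      then have "l $ i < y $ i" "y $ i < l $ i + \<rho> * h" for i by (simp_all add: mem_box_cart)
      then show "y \<in> box a (a + (\<chi> i. h))"
        using l by (auto simp: mem_box_cart intro: order_le_less_trans order_less_le_trans)
    qed
    have "measure lborel ?T = measure lborel (cbox l (l + (\<chi> i. \<rho> * h)))"
      by (simp add: measure_lborel_box_eq measure_lborel_cbox_eq)
    also have "\<dots> = (\<Prod>i\<in>(UNIV :: 'n set). \<rho> * h)"
    proof (subst content_cbox_cart)
      show "cbox l (l + (\<chi> i. \<rho> * h)) \<noteq> {}" using \<rho>(1) h by (auto simp: interval_ne_empty_cart)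
    qed simp
    finally have mT: "measure lborel ?T = \<rho> ^ CARD('n) * h ^ CARD('n)" by (simp add: power_mult_distrib)
    have "((q x)\<^sup>2 / 4) * measure lborel ?T \<le> (LINT x:S|lborel. (q x)\<^sup>2)"
    proof (rule set_integral_ge_const[OF _ TS _ int])
      fix y assume "y \<in> ?T"
      then have "(q x)\<^sup>2 \<le> 4 * (q y)\<^sup>2" using x by (intro lq) (auto simp: mem_box_cart less_imp_le)
      then show "(q x)\<^sup>2 / 4 \<le> (q y)\<^sup>2" by simp
    next
      show "emeasure lborel ?T < \<infinity>" by (rule emeasure_lborel_box_finite)
    qed auto
    then show "\<rho> ^ CARD('n) / 4 * h ^ CARD('n) * (q x)\<^sup>2 \<le> (LINT x:S|lborel. (q x)\<^sup>2)"
      unfolding mT by (simp add: algebra_simps)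
  qed
qed

subsection \<open>Cells, nodes and the nodal basis\<close>

text \<open>Coordinates in units of the edge length, in which cells are unit cubes with integer
  corners.\<close>

definition lat :: "('n::finite) grid \<Rightarrow> real ^ 'n \<Rightarrow> 'n \<Rightarrow> real" where
  "lat G x i = (x $ i - org G $ i) / edge G"

lemma vtx_nth: "vtx G z $ i = org G $ i + edge G * real_of_int (z $ i)"
  by (simp add: vtx_def)

lemma finite_int_box:
  fixes l u :: "'n::finite \<Rightarrow> int"
  shows "finite {z :: int ^ 'n. \<forall>i. l i \<le> z $ i \<and> z $ i \<le> u i}"
proof -
  have "{z :: int ^ 'n. \<forall>i. l i \<le> z $ i \<and> z $ i \<le> u i} \<subseteq> (\<lambda>f. \<chi> i. f i) ` PiE UNIV (\<lambda>i. {l i..u i})"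
  proof
    fix z :: "int ^ 'n" assume "z \<in> {z. \<forall>i. l i \<le> z $ i \<and> z $ i \<le> u i}"
    then have "(\<lambda>i. z $ i) \<in> PiE UNIV (\<lambda>i. {l i..u i})" by auto
    then show "z \<in> (\<lambda>f. \<chi> i. f i) ` PiE UNIV (\<lambda>i. {l i..u i})"
      by (rule rev_image_eqI) (simp add: vec_eq_iff)
  qed
  then show ?thesis by (rule finite_subset) (intro finite_imageI finite_PiE; simp)
qed

lemma card_int_box:
  fixes j :: "int ^ 'n::finite"
  shows "card {z :: int ^ 'n. \<forall>i. \<bar>z $ i - j $ i\<bar> \<le> int r} = (2 * r + 1) ^ CARD('n)"
proof -
  have eq: "{z :: int ^ 'n. \<forall>i. \<bar>z $ i - j $ i\<bar> \<le> int r} = (\<lambda>f. \<chi> i. f i) ` PiE UNIV (\<lambda>i. {j $ i - int r..j $ i + int r})"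
  proof (intro equalityI subsetI)
    fix z :: "int ^ 'n" assume z: "z \<in> {z. \<forall>i. \<bar>z $ i - j $ i\<bar> \<le> int r}"
    have "(\<lambda>i. z $ i) \<in> PiE UNIV (\<lambda>i. {j $ i - int r..j $ i + int r})"
    proof (rule PiE_I)
      fix i
      have "\<bar>z $ i - j $ i\<bar> \<le> int r" using z by simp
      then show "z $ i \<in> {j $ i - int r..j $ i + int r}" by auto
    qed simp
    then show "z \<in> (\<lambda>f. \<chi> i. f i) ` PiE UNIV (\<lambda>i. {j $ i - int r..j $ i + int r})"
      by (rule rev_image_eqI) (simp add: vec_eq_iff)
  next
    fix z :: "int ^ 'n" assume "z \<in> (\<lambda>f. \<chi> i. f i) ` PiE UNIV (\<lambda>i. {j $ i - int r..j $ i + int r})"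
    then obtain f where f: "f \<in> PiE UNIV (\<lambda>i. {j $ i - int r..j $ i + int r})" "z = (\<chi> i. f i)" by blast
    have "\<bar>f i - j $ i\<bar> \<le> int r" for i using PiE_mem[OF f(1), of i] by (auto simp: abs_le_iff)
    then show "z \<in> {z. \<forall>i. \<bar>z $ i - j $ i\<bar> \<le> int r}" unfolding f(2) by simp
  qed
  have inj: "inj_on (\<lambda>f. \<chi> i. (f i :: int)) A" for A :: "('n \<Rightarrow> int) set"
    by (auto simp: inj_on_def vec_eq_iff)
  have "nat (j $ i + int r + 1 - (j $ i - int r)) = 2 * r + 1" for i by simp
  then show ?thesis unfolding eq card_image[OF inj] by (simp add: card_PiE)
qed

lemma finite_int_nbhd: "finite {z :: int ^ 'n::finite. \<forall>i. \<bar>z $ i - j $ i\<bar> \<le> int r}"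
  by (rule card_ge_0_finite) (simp add: card_int_box)

locale cut_grid =
  fixes G :: "('n::finite) grid" and p :: nat
  assumes edge_pos: "0 < edge G" and degree_pos: "1 \<le> p"
    and bounded_dom: "bounded (dom G)" and open_dom: "open (dom G)"
begin

abbreviation h :: real where "h \<equiv> edge G"

lemma mem_cell: "x \<in> cell G z \<longleftrightarrow> (\<forall>i. vtx G z $ i \<le> x $ i \<and> x $ i \<le> vtx G z $ i + h)"
  unfolding cell_def mem_box_cart by (simp add: vtx_nth algebra_simps)

lemma cell_eq_cbox: "cell G z = cbox (vtx G z) (vtx G z + (\<chi> i. h))"
  by (intro set_eqI) (simp add: mem_cell mem_box_cart)

lemma mem_cell_lat: "x \<in> cell G z \<longleftrightarrow> (\<forall>i. real_of_int (z $ i) \<le> lat G x i \<and> lat G x i \<le> real_of_int (z $ i) + 1)"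
  unfolding mem_cell lat_def vtx_nth using edge_pos
  by (simp add: pos_le_divide_eq pos_divide_le_eq algebra_simps)

lemma lat_eq: "x $ i = org G $ i + h * lat G x i"
  using edge_pos by (simp add: lat_def)

lemma cell_index_eq: "cell_index G x = z \<longleftrightarrow> (\<forall>i. real_of_int (z $ i) \<le> lat G x i \<and> lat G x i < real_of_int (z $ i) + 1)"
  unfolding cell_index_def vec_eq_iff lat_def by (simp add: floor_eq_iff)

lemma mem_cell_index: "x \<in> cell G (cell_index G x)"
  using cell_index_eq[of x "cell_index G x"] unfolding mem_cell_lat by (auto intro: less_imp_le)

lemma box_cell_unique:
  assumes "w \<in> box (vtx G z) (vtx G z + (\<chi> i. h))" "w \<in> cell G z'"
  shows "z' = z"
proof -
  have "z' $ i = z $ i" for i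
  proof -
    have "real_of_int (z $ i) < lat G w i \<and> lat G w i < real_of_int (z $ i) + 1"
      using assms(1) edge_pos unfolding mem_box_cart lat_def vtx_nth
      by (simp add: pos_less_divide_eq pos_divide_less_eq vtx_nth algebra_simps)
    moreover have "real_of_int (z' $ i) \<le> lat G w i \<and> lat G w i \<le> real_of_int (z' $ i) + 1"
      using assms(2) mem_cell_lat by blast
    ultimately show ?thesis by linarith
  qed
  then show ?thesis by (simp add: vec_eq_iff)
qed

lemma box_cell_nonempty: "box (vtx G z) (vtx G z + (\<chi> i. h)) \<noteq> {}"
  using edge_pos by (simp add: interval_ne_empty_cart)

lemma box_subset_cell: "box (vtx G z) (vtx G z + (\<chi> i. h)) \<subseteq> cell G z"
  unfolding cell_eq_cbox by (rule box_subset_cbox)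

lemma cell_subset_closure_box: "cell G z \<subseteq> closure (box (vtx G z) (vtx G z + (\<chi> i. h)))"
  unfolding closure_box[OF box_cell_nonempty] cell_eq_cbox by simp

lemma finite_active: "finite (active G)"
proof -
  obtain R where R: "\<And>x. x \<in> dom G \<Longrightarrow> norm x \<le> R" using bounded_dom unfolding bounded_iff by blast
  define l where "l i = \<lfloor>(- R - org G $ i) / h\<rfloor> - 1" for i
  define u where "u i = \<lceil>(R - org G $ i) / h\<rceil>" for i
  have "active G \<subseteq> {z. \<forall>i. l i \<le> z $ i \<and> z $ i \<le> u i}"
  proof (rule subsetI, rule CollectI, rule allI)
    fix z i assume "z \<in> active G"
    then obtain x where x: "x \<in> cell G z" "x \<in> dom G" unfolding active_def by blast
    have "\<bar>x $ i\<bar> \<le> R" using R[OF x(2)] component_le_norm_cart[of x i] by simp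
    then have "(- R - org G $ i) / h \<le> lat G x i" "lat G x i \<le> (R - org G $ i) / h"
      using edge_pos unfolding lat_def by (auto intro!: divide_right_mono)
    moreover have "real_of_int (z $ i) \<le> lat G x i" "lat G x i \<le> real_of_int (z $ i) + 1"
      using x(1) mem_cell_lat by auto
    ultimately show "l i \<le> z $ i \<and> z $ i \<le> u i" unfolding l_def u_def by linarith
  qed
  then show ?thesis using finite_int_box finite_subset by blast
qed

lemma closed_cell: "closed (cell G z)" unfolding cell_eq_cbox by (rule closed_cbox)
lemma compact_cell: "compact (cell G z)" unfolding cell_eq_cbox by (rule compact_cbox)
lemma convex_cell: "convex (cell G z)" unfolding cell_eq_cbox by (rule convex_box)

lemma cell_index_active: "x \<in> dom G \<Longrightarrow> cell_index G x \<in> active G"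
  using mem_cell_index unfolding active_def by blast

lemma vtx_scale_mem_cell:
  assumes "\<tau> \<in> node_tuples p"
  shows "vtx G z + h *\<^sub>R (\<chi> i. \<tau> i) \<in> cell G z"
proof -
  have "\<tau> i \<in> unit_nodes p" for i using assms by (rule PiE_mem) simp
  then have "0 \<le> \<tau> i \<and> \<tau> i \<le> 1" for i using unit_nodes(3)[OF degree_pos] by (meson atLeastAtMost_iff subsetD)
  then show ?thesis unfolding mem_cell using edge_pos by (simp add: mult_le_cancel_left1)
qed

lemma Qp_eq_on_cell:
  assumes "q \<in> Qp p" "r \<in> Qp p" "\<And>x. x \<in> cell G z \<Longrightarrow> q x = r x"
  shows "q = r"
  using edge_pos assms(3)[OF vtx_scale_mem_cell]
  by (intro Qp_eqI[OF degree_pos assms(1,2), of h "vtx G z"]) auto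

lemma piece_eqI:
  assumes "q \<in> Qp p" "\<And>x. x \<in> cell G z \<Longrightarrow> q x = v x"
  shows "piece G p v z = q"
  unfolding piece_def
proof (rule the_equality)
  show "q \<in> Qp p \<and> (\<forall>x\<in>cell G z. q x = v x)" using assms by blast
next
  fix r assume r: "r \<in> Qp p \<and> (\<forall>x\<in>cell G z. r x = v x)"
  show "r = q" by (rule Qp_eq_on_cell[of _ _ z]) (use r assms in auto)
qed

lemma piece_Qp:
  assumes "v \<in> FE G p" "z \<in> active G"
  shows "piece G p v z \<in> Qp p" "x \<in> cell G z \<Longrightarrow> piece G p v z x = v x"
proof -
  obtain q where q: "q \<in> Qp p" "\<forall>x\<in>cell G z. v x = q x" using assms unfolding FE_def by blast
  then have "piece G p v z = q" by (intro piece_eqI) auto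
  then show "piece G p v z \<in> Qp p" "x \<in> cell G z \<Longrightarrow> piece G p v z x = v x" using q by auto
qed

text \<open>Continuity comes for free: finitely many closed cells, with a continuous restriction to
  each, can be pasted. Membership in \<open>FE G p\<close> thus becomes a cellwise
  condition.\<close>

lemma FE_iff:
  "v \<in> FE G p \<longleftrightarrow> (\<forall>x. x \<notin> active_dom G \<longrightarrow> v x = 0) \<and> (\<forall>z\<in>active G. \<exists>q\<in>Qp p. \<forall>x\<in>cell G z. v x = q x)"
proof -
  have "continuous_on (active_dom G) v" if pw: "\<forall>z\<in>active G. \<exists>q\<in>Qp p. \<forall>x\<in>cell G z. v x = q x"
    unfolding active_dom_def
  proof (rule continuous_on_closed_Union[OF finite_active])
    fix z assume "z \<in> active G"
    then obtain q where q: "q \<in> Qp p" "\<forall>x\<in>cell G z. v x = q x" using pw by blast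
    have "continuous_on (cell G z) v \<longleftrightarrow> continuous_on (cell G z) q"
      using q(2) by (intro continuous_on_cong refl) auto
    then show "continuous_on (cell G z) v" using continuous_on_Qp[OF q(1)] by simp
  qed (rule closed_cell)
  then show ?thesis unfolding FE_def by blast
qed

lemma FE_lincomb:
  assumes "v \<in> FE G p" "w \<in> FE G p"
  shows "(\<lambda>x. a * v x + b * w x) \<in> FE G p"
    and "z \<in> active G \<Longrightarrow> piece G p (\<lambda>x. a * v x + b * w x) z = (\<lambda>x. a * piece G p v z x + b * piece G p w z x)"
proof -
  have Q: "(\<lambda>x. a * piece G p v z x + b * piece G p w z x) \<in> Qp p" if "z \<in> active G" for z
    using piece_Qp(1)[OF assms(1) that] piece_Qp(1)[OF assms(2) that] by (intro Qp_add Qp_scale)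
  have eq: "a * piece G p v z x + b * piece G p w z x = a * v x + b * w x" if "z \<in> active G" "x \<in> cell G z" for z x
    using piece_Qp(2)[OF assms(1) that] piece_Qp(2)[OF assms(2) that] by simp
  show "(\<lambda>x. a * v x + b * w x) \<in> FE G p"
    unfolding FE_iff
  proof (intro conjI allI impI ballI)
    show "a * v x + b * w x = 0" if "x \<notin> active_dom G" for x
      using assms that unfolding FE_def by simp
    show "\<exists>q\<in>Qp p. \<forall>x\<in>cell G z. a * v x + b * w x = q x" if "z \<in> active G" for z
      using Q[OF that] eq[OF that] by (intro bexI[of _ "\<lambda>x. a * piece G p v z x + b * piece G p w z x"]) auto
  qed
  show "piece G p (\<lambda>x. a * v x + b * w x) z = (\<lambda>x. a * piece G p v z x + b * piece G p w z x)" if "z \<in> active G"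
    using Q[OF that] eq[OF that] by (intro piece_eqI) auto
qed

lemma FE_zero: "(\<lambda>x. 0) \<in> FE G p"
proof -
  have "(\<lambda>x :: real ^ 'n. 0 :: real) \<in> Qp p" using Qp_sum[of "{}" "\<lambda>_ _. 0 :: real" p] by simp
  then show ?thesis unfolding FE_iff by auto
qed

lemma FE_scale: "v \<in> FE G p \<Longrightarrow> (\<lambda>x. a * v x) \<in> FE G p"
  using FE_lincomb(1)[of v v a 0] by simp

lemma FE_add: "v \<in> FE G p \<Longrightarrow> w \<in> FE G p \<Longrightarrow> (\<lambda>x. v x + w x) \<in> FE G p"
  using FE_lincomb(1)[of v w 1 1] by simp

lemma FE_sum:
  assumes "finite A" "\<And>a. a \<in> A \<Longrightarrow> v a \<in> FE G p"
  shows "(\<lambda>x. \<Sum>a\<in>A. v a x) \<in> FE G p"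
  using assms by (induction A rule: finite_induct) (auto intro: FE_zero FE_add)

lemma mem_nodes: "x \<in> nodes G p \<longleftrightarrow> (\<exists>z\<in>active G. \<exists>\<tau>\<in>node_tuples p. x = vtx G z + h *\<^sub>R (\<chi> i. \<tau> i))"
proof
  assume "x \<in> nodes G p"
  then obtain z where z: "z \<in> active G" "\<forall>i. \<exists>t\<in>gauss_lobatto p. x $ i = vtx G z $ i + h * (1 + t) / 2"
    unfolding nodes_def by blast
  have "\<forall>i. \<exists>s. s \<in> unit_nodes p \<and> x $ i = vtx G z $ i + h * s"
  proof
    fix i
    obtain t where t: "t \<in> gauss_lobatto p" "x $ i = vtx G z $ i + h * (1 + t) / 2" using z(2) by blast
    have "(1 + t) / 2 \<in> unit_nodes p" unfolding unit_nodes_def using t(1) by (rule imageI)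
    then show "\<exists>s. s \<in> unit_nodes p \<and> x $ i = vtx G z $ i + h * s"
      using t(2) by (intro exI[of _ "(1 + t) / 2"]) simp
  qed
  from choice[OF this] obtain \<tau> where \<tau>: "\<And>i. \<tau> i \<in> unit_nodes p" "\<And>i. x $ i = vtx G z $ i + h * \<tau> i" by blast
  then have "\<tau> \<in> node_tuples p" "x = vtx G z + h *\<^sub>R (\<chi> i. \<tau> i)" by (auto simp: vec_eq_iff)
  then show "\<exists>z\<in>active G. \<exists>\<tau>\<in>node_tuples p. x = vtx G z + h *\<^sub>R (\<chi> i. \<tau> i)" using z(1) by blast
next
  assume "\<exists>z\<in>active G. \<exists>\<tau>\<in>node_tuples p. x = vtx G z + h *\<^sub>R (\<chi> i. \<tau> i)"
  then obtain z \<tau> where z: "z \<in> active G" "\<tau> \<in> node_tuples p" "x = vtx G z + h *\<^sub>R (\<chi> i. \<tau> i)" by blast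
  have "\<exists>t\<in>gauss_lobatto p. x $ i = vtx G z $ i + h * (1 + t) / 2" for i
  proof -
    have "\<tau> i \<in> unit_nodes p" using z(2) by (rule PiE_mem) simp
    then obtain t where "t \<in> gauss_lobatto p" "\<tau> i = (1 + t) / 2" unfolding unit_nodes_def by blast
    then show ?thesis using z(3) by (intro bexI[of _ t]) auto
  qed
  then show "x \<in> nodes G p" unfolding nodes_def using z(1) by blast
qed

lemma finite_nodes: "finite (nodes G p)"
proof -
  have "nodes G p \<subseteq> (\<lambda>(z, \<tau>). vtx G z + h *\<^sub>R (\<chi> i. \<tau> i)) ` (active G \<times> node_tuples p)"
    unfolding subset_iff mem_nodes by auto
  then show ?thesis
    by (rule finite_subset) (intro finite_imageI finite_cartesian_product finite_active finite_node_tuples degree_pos)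
qed

lemma cell_node: "z \<in> active G \<Longrightarrow> \<tau> \<in> node_tuples p \<Longrightarrow> vtx G z + h *\<^sub>R (\<chi> i. \<tau> i) \<in> nodes G p"
  unfolding mem_nodes by blast

section \<open>Unisolvence and the nodal basis\<close>

lemma piece_eq_of_nodes:
  assumes "v \<in> FE G p" "w \<in> FE G p" "z \<in> active G" "\<And>x. x \<in> nodes G p \<Longrightarrow> x \<in> cell G z \<Longrightarrow> v x = w x"
  shows "piece G p v z = piece G p w z"
proof (rule Qp_eqI[OF degree_pos piece_Qp(1)[OF assms(1,3)] piece_Qp(1)[OF assms(2,3)]])
  show "h \<noteq> 0" using edge_pos by simp
  fix \<tau> :: "'n \<Rightarrow> real" assume \<tau>: "\<tau> \<in> node_tuples p"
  note m = vtx_scale_mem_cell[OF \<tau>, of z]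
  show "piece G p v z (vtx G z + h *\<^sub>R (\<chi> i. \<tau> i)) = piece G p w z (vtx G z + h *\<^sub>R (\<chi> i. \<tau> i))"
    unfolding piece_Qp(2)[OF assms(1,3) m] piece_Qp(2)[OF assms(2,3) m]
    by (rule assms(4)[OF cell_node[OF assms(3) \<tau>] m])
qed

lemma FE_eqI:
  assumes "v \<in> FE G p" "w \<in> FE G p" "\<And>x. x \<in> nodes G p \<Longrightarrow> v x = w x"
  shows "v = w"
proof
  fix x
  show "v x = w x"
  proof (cases "x \<in> active_dom G")
    case True
    then obtain z where z: "z \<in> active G" "x \<in> cell G z" unfolding active_dom_def by blast
    have "piece G p v z = piece G p w z" by (rule piece_eq_of_nodes[OF assms(1,2) z(1) assms(3)])
    then show ?thesis using piece_Qp(2)[OF assms(1) z] piece_Qp(2)[OF assms(2) z] by simp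
  next
    case False
    then show ?thesis using assms(1,2) unfolding FE_def by simp
  qed
qed

text \<open>The one-dimensional nodal function with peak at lattice coordinate \<open>a\<close>. The
  floor selects the unit interval of \<open>s\<close>, and the Lagrange polynomial is used if
  \<open>a\<close> is one of the nodes of that interval.\<close>

definition hat :: "real \<Rightarrow> real \<Rightarrow> real" where
  "hat a s = (if a - real_of_int \<lfloor>s\<rfloor> \<in> unit_nodes p
     then poly (lagrange (unit_nodes p) (a - real_of_int \<lfloor>s\<rfloor>)) (s - real_of_int \<lfloor>s\<rfloor>) else 0)"

definition hat_poly :: "real \<Rightarrow> int \<Rightarrow> real poly" where
  "hat_poly a k = (if a - real_of_int k \<in> unit_nodes p then lagrange (unit_nodes p) (a - real_of_int k) else 0)"

text \<open>At an integer point the floor prefers the interval on the right. The interval on the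
  left gives the same value because both endpoints of the unit interval are nodes; this is the
  continuity of the basis across faces.\<close>

lemma hat_cell:
  assumes "real_of_int k \<le> s" "s \<le> real_of_int k + 1"
  shows "hat a s = poly (hat_poly a k) (s - real_of_int k)"
proof (cases "s < real_of_int k + 1")
  case True
  then have "\<lfloor>s\<rfloor> = k" using assms(1) by (simp add: floor_eq_iff)
  then show ?thesis by (simp add: hat_def hat_poly_def)
next
  case False
  then have s: "s = real_of_int (k + 1)" using assms(2) by simp
  note X = unit_nodes[OF degree_pos]
  have fl: "\<lfloor>s\<rfloor> = k + 1" unfolding s by (rule floor_of_int)
  have "hat a s = (if a = real_of_int k + 1 then 1 else 0)"
    unfolding hat_def fl using X(4) poly_lagrange[OF X(1) _ X(4)] by (auto simp: s)
  moreover have "poly (hat_poly a k) (s - real_of_int k) = (if a = real_of_int k + 1 then 1 else 0)"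
    unfolding hat_poly_def using X(5) poly_lagrange[OF X(1) _ X(5)] by (auto simp: s)
  ultimately show ?thesis by simp
qed

lemma degree_hat_poly: "degree (hat_poly a k) \<le> p"
  unfolding hat_poly_def using degree_lagrange[OF unit_nodes(1,2)[OF degree_pos]] by simp

lemma hat_node:
  assumes "t \<in> unit_nodes p"
  shows "hat a (real_of_int k + t) = (if a = real_of_int k + t then 1 else 0)"
proof -
  note X = unit_nodes[OF degree_pos]
  have "0 \<le> t" "t \<le> 1" using assms X(3) by (meson atLeastAtMost_iff subsetD)+
  then have "hat a (real_of_int k + t) = poly (hat_poly a k) t"
    using hat_cell[of k "real_of_int k + t" a] by simp
  also have "\<dots> = (if a = real_of_int k + t then 1 else 0)"
    unfolding hat_poly_def using poly_lagrange[OF X(1) _ assms] assms by (auto simp: algebra_simps)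
  finally show ?thesis .
qed

definition tensor_hat :: "real ^ 'n \<Rightarrow> real ^ 'n \<Rightarrow> real" where
  "tensor_hat x y = (if y \<in> active_dom G then \<Prod>i\<in>UNIV. hat (lat G x i) (lat G y i) else 0)"

lemma tensor_hat_FE: "tensor_hat x \<in> FE G p"
  unfolding FE_iff
proof (intro conjI allI impI ballI)
  show "tensor_hat x y = 0" if "y \<notin> active_dom G" for y using that by (simp add: tensor_hat_def)
next
  fix z assume z: "z \<in> active G"
  let ?q = "\<lambda>y. \<Prod>i\<in>UNIV. poly (pcompose (hat_poly (lat G x i) (z $ i)) [:- vtx G z $ i / h, 1 / h:]) (y $ i)"
  have "?q \<in> Qp p"
    by (intro Qp_prod order.trans[OF degree_affine_pcompose degree_hat_poly])
  moreover have "tensor_hat x y = ?q y" if y: "y \<in> cell G z" for y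
  proof -
    have "y \<in> active_dom G" using z y unfolding active_dom_def by blast
    moreover have "hat (lat G x i) (lat G y i) =
        poly (pcompose (hat_poly (lat G x i) (z $ i)) [:- vtx G z $ i / h, 1 / h:]) (y $ i)" for i
    proof -
      have "hat (lat G x i) (lat G y i) = poly (hat_poly (lat G x i) (z $ i)) (lat G y i - real_of_int (z $ i))"
        using y unfolding mem_cell_lat by (intro hat_cell) auto
      moreover have "lat G y i - real_of_int (z $ i) = - vtx G z $ i / h + y $ i * (1 / h)"
        using edge_pos by (simp add: lat_def vtx_nth field_simps)
      ultimately show ?thesis by (simp add: poly_pcompose)
    qed
    ultimately show ?thesis by (simp add: tensor_hat_def)
  qed
  ultimately show "\<exists>q\<in>Qp p. \<forall>y\<in>cell G z. tensor_hat x y = q y"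
    by (intro bexI[of _ ?q] ballI)
qed

lemma tensor_hat_node:
  assumes "y \<in> nodes G p"
  shows "tensor_hat x y = (if y = x then 1 else 0)"
proof -
  obtain z \<tau> where z: "z \<in> active G" "\<tau> \<in> node_tuples p" "y = vtx G z + h *\<^sub>R (\<chi> i. \<tau> i)"
    using assms mem_nodes by blast
  have "y \<in> active_dom G" using z vtx_scale_mem_cell[OF z(2)] unfolding active_dom_def by blast
  then have "tensor_hat x y = (\<Prod>i\<in>UNIV. hat (lat G x i) (lat G y i))" by (simp add: tensor_hat_def)
  also have "\<dots> = (\<Prod>i\<in>UNIV. if x $ i = y $ i then 1 else 0)"
  proof (rule prod.cong[OF refl])
    fix i
    have "\<tau> i \<in> unit_nodes p" using z(2) by (rule PiE_mem) simp
    moreover have ly: "lat G y i = real_of_int (z $ i) + \<tau> i"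
      using edge_pos by (simp add: z(3) lat_def vtx_nth field_simps)
    moreover have "lat G x i = lat G y i \<longleftrightarrow> x $ i = y $ i" using edge_pos by (auto simp: lat_def)
    ultimately show "hat (lat G x i) (lat G y i) = (if x $ i = y $ i then 1 else 0)"
      using hat_node[of "\<tau> i" "lat G x i" "z $ i"] by simp
  qed
  also have "\<dots> = (if y = x then 1 else 0)"
  proof (cases "y = x")
    case False
    then obtain i where "y $ i \<noteq> x $ i" by (auto simp: vec_eq_iff)
    then have "x $ i \<noteq> y $ i" by simp
    then have "(\<Prod>i\<in>UNIV. if x $ i = y $ i then 1 else 0 :: real) = 0"
      by (intro prod_zero bexI[of _ i]) simp_all
    then show ?thesis using False by simp
  qed simp
  finally show ?thesis .
qed

text \<open>Existence by the tensor hat, uniqueness by unisolvence; from here on the definite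
  description can be replaced by a formula.\<close>

lemma basis_fun_eq: "basis_fun G p x = tensor_hat x"
  unfolding basis_fun_def
proof (rule the_equality)
  show "tensor_hat x \<in> FE G p \<and> (\<forall>y\<in>nodes G p. tensor_hat x y = (if y = x then 1 else 0))"
    using tensor_hat_FE tensor_hat_node by blast
next
  fix \<phi> assume \<phi>: "\<phi> \<in> FE G p \<and> (\<forall>y\<in>nodes G p. \<phi> y = (if y = x then 1 else 0))"
  show "\<phi> = tensor_hat x"
    by (rule FE_eqI) (use \<phi> tensor_hat_FE tensor_hat_node in auto)
qed

lemma nodal_comb:
  assumes "finite S" "S \<subseteq> nodes G p"
  shows "(\<lambda>y. \<Sum>x\<in>S. c x * basis_fun G p x y) \<in> FE G p"
    and "y \<in> nodes G p \<Longrightarrow> (\<Sum>x\<in>S. c x * basis_fun G p x y) = (if y \<in> S then c y else 0)"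
proof -
  show "(\<lambda>y. \<Sum>x\<in>S. c x * basis_fun G p x y) \<in> FE G p"
    unfolding basis_fun_eq by (intro FE_sum assms(1) FE_scale tensor_hat_FE)
  assume y: "y \<in> nodes G p"
  have "(\<Sum>x\<in>S. c x * basis_fun G p x y) = (\<Sum>x\<in>S. if y = x then c x else 0)"
    unfolding basis_fun_eq tensor_hat_node[OF y] by (intro sum.cong) auto
  also have "\<dots> = (if y \<in> S then c y else 0)" using assms(1) by simp
  finally show "(\<Sum>x\<in>S. c x * basis_fun G p x y) = (if y \<in> S then c y else 0)" .
qed

text \<open>Describing a span by vanishing nodal values turns membership into linear conditions,
  which are visibly stable under linear combinations.\<close>

lemma nodal_span_eq:
  assumes "S \<subseteq> nodes G p"
  shows "nodal_span G p S = {v \<in> FE G p. \<forall>y\<in>nodes G p - S. v y = 0}"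
proof (intro equalityI subsetI)
  have fin: "finite S" using assms finite_nodes finite_subset by blast
  fix v
  {
    assume "v \<in> nodal_span G p S"
    then obtain c where v: "v = (\<lambda>y. \<Sum>x\<in>S. c x * basis_fun G p x y)" unfolding nodal_span_def by blast
    show "v \<in> {v \<in> FE G p. \<forall>y\<in>nodes G p - S. v y = 0}"
      unfolding v using nodal_comb[OF fin assms] by auto
  next
    assume v: "v \<in> {v \<in> FE G p. \<forall>y\<in>nodes G p - S. v y = 0}"
    have "v = (\<lambda>y. \<Sum>x\<in>S. v x * basis_fun G p x y)"
    proof (rule FE_eqI)
      show "v \<in> FE G p" using v by blast
      show "(\<lambda>y. \<Sum>x\<in>S. v x * basis_fun G p x y) \<in> FE G p" by (rule nodal_comb(1)[OF fin assms])
      show "v y = (\<Sum>x\<in>S. v x * basis_fun G p x y)" if "y \<in> nodes G p" for y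
        using nodal_comb(2)[OF fin assms that] v that by auto
    qed
    then show "v \<in> nodal_span G p S" unfolding nodal_span_def by blast
  }
qed

subsection \<open>Patch spaces\<close>

text \<open>A common description of both patch kinds. What the energy arguments use about these
  nodes is the locality in \<open>patch_nodes_cell\<close>.\<close>

definition patch_nodes :: "patch_kind \<Rightarrow> int ^ 'n \<Rightarrow> (real ^ 'n) set" where
  "patch_nodes kd j = (case kd of Kind_D \<Rightarrow> {x\<in>nodes G p. x \<in> interior (full_patch G j)}
     | Kind_FR \<Rightarrow> {x\<in>nodes G p. node_patch G x \<subseteq> patch G j})"

lemma patch_space_eq: "patch_space kd G p j = {v \<in> FE G p. \<forall>y\<in>nodes G p - patch_nodes kd j. v y = 0}"
proof -
  have "patch_space kd G p j = nodal_span G p (patch_nodes kd j)" by (cases kd) (simp_all add: patch_nodes_def)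
  then show ?thesis by (simp add: nodal_span_eq patch_nodes_def split: patch_kind.split)
qed

lemma patch_nodes_subset: "patch_nodes kd j \<subseteq> nodes G p"
  unfolding patch_nodes_def by (cases kd) auto

lemma cell_subset_UN:
  assumes "cell G z \<subseteq> (\<Union>z'\<in>Z. cell G z')"
  shows "z \<in> Z"
proof -
  obtain w where w: "w \<in> box (vtx G z) (vtx G z + (\<chi> i. h))" using box_cell_nonempty by blast
  then have "w \<in> cell G z" using box_subset_cell by blast
  then obtain z' where "z' \<in> Z" "w \<in> cell G z'" using assms by blast
  then show ?thesis using box_cell_unique[OF w] by blast
qed

text \<open>If the node is interior to the full patch, the patch meets the interior of each cell at
  the node, and an interior point lies in a single cell, so that cell belongs to the patch. For the
  second kind the cell lies in the patch by definition, and an interior point again identifies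
  it.\<close>

lemma patch_nodes_cell:
  assumes x: "x \<in> patch_nodes kd j" and z: "z \<in> active G" "x \<in> cell G z"
  shows "vtx G j \<in> cell G z"
proof (cases kd)
  case Kind_D
  then have "x \<in> interior (full_patch G j)" using x by (simp add: patch_nodes_def)
  moreover have "x \<in> closure (box (vtx G z) (vtx G z + (\<chi> i. h)))" using cell_subset_closure_box z(2) by blast
  ultimately have "interior (full_patch G j) \<inter> box (vtx G z) (vtx G z + (\<chi> i. h)) \<noteq> {}"
    by (metis disjoint_iff open_Int_closure_eq_empty open_interior)
  then obtain w where w: "w \<in> full_patch G j" "w \<in> box (vtx G z) (vtx G z + (\<chi> i. h))"
    using interior_subset by blast
  then obtain z' where "vtx G j \<in> cell G z'" "w \<in> cell G z'" unfolding full_patch_def by blast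
  then show ?thesis using box_cell_unique[OF w(2)] by blast
next
  case Kind_FR
  then have "node_patch G x \<subseteq> patch G j" using x by (simp add: patch_nodes_def)
  then have "cell G z \<subseteq> patch G j" using z unfolding node_patch_def by blast
  then show ?thesis unfolding patch_def using cell_subset_UN[of z "{z \<in> active G. vtx G j \<in> cell G z}"] by blast
qed

lemma cell_subset_patch: "cell G z \<subseteq> patch G j \<Longrightarrow> z \<in> active G \<and> vtx G j \<in> cell G z"
  unfolding patch_def using cell_subset_UN[of z "{z \<in> active G. vtx G j \<in> cell G z}"] by blast

lemma vtx_mem_cell: "vtx G j \<in> cell G z \<longleftrightarrow> (\<forall>i. z $ i = j $ i \<or> z $ i = j $ i - 1)"
proof -
  have "lat G (vtx G j) i = real_of_int (j $ i)" for i using edge_pos by (simp add: lat_def vtx_nth)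
  moreover have "(real_of_int (z $ i) \<le> real_of_int (j $ i) \<and> real_of_int (j $ i) \<le> real_of_int (z $ i) + 1)
      \<longleftrightarrow> (z $ i = j $ i \<or> z $ i = j $ i - 1)" for i by linarith
  ultimately show ?thesis unfolding mem_cell_lat by simp
qed

lemma patch_space_piece_zero:
  assumes "v \<in> patch_space kd G p j" "z \<in> active G" "vtx G j \<notin> cell G z"
  shows "piece G p v z = (\<lambda>x. 0)"
proof -
  have v: "v \<in> FE G p" "\<And>y. y \<in> nodes G p \<Longrightarrow> y \<notin> patch_nodes kd j \<Longrightarrow> v y = 0"
    using assms(1) unfolding patch_space_eq by auto
  have "piece G p v z = piece G p (\<lambda>x. 0) z"
    using v patch_nodes_cell[OF _ assms(2)] assms(3) by (intro piece_eq_of_nodes FE_zero assms(2)) blast+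
  moreover have "piece G p (\<lambda>x. 0) z = (\<lambda>x. 0)"
    using FE_lincomb(2)[OF FE_zero FE_zero assms(2), of 0 0] by simp
  ultimately show ?thesis by simp
qed

end

subsection \<open>Multiplicative subspace correction\<close>

text \<open>Stability makes the cut form nonnegative on the whole finite element space; definiteness
  is derived later, on the strip space.\<close>

locale semi_inner_space =
  fixes F :: "('x \<Rightarrow> real) set" and A :: "('x \<Rightarrow> real) \<Rightarrow> ('x \<Rightarrow> real) \<Rightarrow> real"
  assumes zero_mem: "(\<lambda>x. 0) \<in> F"
    and lincomb_mem: "\<And>u w a b. u \<in> F \<Longrightarrow> w \<in> F \<Longrightarrow> (\<lambda>x. a * u x + b * w x) \<in> F"
    and lincomb: "\<And>u w v a b. u \<in> F \<Longrightarrow> w \<in> F \<Longrightarrow> v \<in> F \<Longrightarrow> A (\<lambda>x. a * u x + b * w x) v = a * A u v + b * A w v"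
    and sym: "\<And>u v. A u v = A v u"
    and nonneg: "\<And>v. v \<in> F \<Longrightarrow> 0 \<le> A v v"
begin

lemma add_mem: "u \<in> F \<Longrightarrow> w \<in> F \<Longrightarrow> (\<lambda>x. u x + w x) \<in> F"
  using lincomb_mem[of u w 1 1] by simp

lemma diff_mem: "u \<in> F \<Longrightarrow> w \<in> F \<Longrightarrow> (\<lambda>x. u x - w x) \<in> F"
  using lincomb_mem[of u w 1 "-1"] by simp

lemma A_add: "u \<in> F \<Longrightarrow> w \<in> F \<Longrightarrow> v \<in> F \<Longrightarrow> A (\<lambda>x. u x + w x) v = A u v + A w v"
  using lincomb[of u w v 1 1] by simp

lemma A_diff: "u \<in> F \<Longrightarrow> w \<in> F \<Longrightarrow> v \<in> F \<Longrightarrow> A (\<lambda>x. u x - w x) v = A u v - A w v"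
  using lincomb[of u w v 1 "-1"] by simp

lemma A_zero: "v \<in> F \<Longrightarrow> A (\<lambda>x. 0) v = 0"
  using lincomb[of v v v 0 0] by simp

lemma sum_mem: "finite I \<Longrightarrow> (\<And>i. i \<in> I \<Longrightarrow> u i \<in> F) \<Longrightarrow> (\<lambda>x. \<Sum>i\<in>I. u i x) \<in> F"
  by (induction I rule: finite_induct) (auto intro: zero_mem add_mem)

lemma A_sum:
  assumes "finite I" "\<And>i. i \<in> I \<Longrightarrow> u i \<in> F" "v \<in> F"
  shows "A (\<lambda>x. \<Sum>i\<in>I. u i x) v = (\<Sum>i\<in>I. A (u i) v)"
  using assms
proof (induction I rule: finite_induct)
  case empty
  then show ?case by (simp add: A_zero)
next
  case (insert a I)
  have "A (\<lambda>x. u a x + (\<Sum>i\<in>I. u i x)) v = A (u a) v + A (\<lambda>x. \<Sum>i\<in>I. u i x) v"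
    using insert by (intro A_add sum_mem) auto
  then show ?case using insert by simp
qed

text \<open>Expand the energy of \<open>t * u - w\<close>. The weight \<open>t\<close> is left free
  to balance corrections against pieces of a splitting.\<close>

lemma young:
  assumes "u \<in> F" "w \<in> F" "0 < t"
  shows "A u w \<le> t / 2 * A u u + A w w / (2 * t)"
proof -
  let ?d = "\<lambda>x. t * u x + (-1) * w x"
  have d: "?d \<in> F" by (rule lincomb_mem[OF assms(1,2)])
  have "A ?d ?d = t * A u ?d + (-1) * A w ?d" by (rule lincomb[OF assms(1,2) d])
  moreover have "A u ?d = t * A u u - A w u" using lincomb[OF assms(1,2,1), of t "-1"] sym[of u ?d] by simp
  moreover have "A w ?d = t * A u w - A w w" using lincomb[OF assms(1,2,2), of t "-1"] sym[of w ?d] by simp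
  ultimately have "0 \<le> t * (t * A u u - A u w) - (t * A u w - A w w)" using nonneg[OF d] sym[of w u] by simp
  then have "2 * t * A u w \<le> t * t * A u u + A w w" by (simp add: algebra_simps)
  then have "A u w \<le> (t * t * A u u + A w w) / (2 * t)" using assms(3) by (simp add: pos_le_divide_eq mult.commute)
  then show ?thesis using assms(3) by (simp add: field_simps)
qed

text \<open>Replace \<open>e\<close> by \<open>c * e\<close>: Young's inequality bounds
  \<open>c * A u e\<close> independently of \<open>c\<close>, which is impossible unless
  \<open>A u e = 0\<close>.\<close>

lemma null_vector:
  assumes "u \<in> F" "e \<in> F" "A e e = 0"
  shows "A u e = 0"
proof -
  have le: "c * A u e \<le> A u u / 2" for c
  proof -
    have ce: "(\<lambda>x. c * e x) \<in> F" using lincomb_mem[OF assms(2,2), of c 0] by simp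
    have cv: "A (\<lambda>x. c * e x) v = c * A e v" if "v \<in> F" for v using lincomb[OF assms(2,2) that, of c 0] by simp
    have "A u (\<lambda>x. c * e x) \<le> 1 / 2 * A u u + A (\<lambda>x. c * e x) (\<lambda>x. c * e x) / 2"
      using young[OF assms(1) ce, of 1] by simp
    moreover have "A e (\<lambda>x. c * e x) = 0"
      using cv[OF assms(2)] sym[of e "\<lambda>x. c * e x"] assms(3) by simp
    then have "A (\<lambda>x. c * e x) (\<lambda>x. c * e x) = 0" using cv[OF ce] by simp
    moreover have "A u (\<lambda>x. c * e x) = c * A u e"
      using cv[OF assms(1)] sym[of u "\<lambda>x. c * e x"] sym[of u e] by simp
    ultimately show ?thesis by simp
  qed
  show ?thesis
  proof (rule ccontr)
    assume "A u e \<noteq> 0"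
    then have "(A u u / 2 + 1) / A u e * A u e = A u u / 2 + 1" by simp
    then show False using le[of "(A u u / 2 + 1) / A u e"] by simp
  qed
qed

text \<open>One Gram-Schmidt step, adapted to a semidefinite form: iterated over the nodes it yields
  projections onto nodal spans without completeness or definiteness.\<close>

lemma projection_extend:
  assumes V: "V \<subseteq> F" "\<And>u w a b. u \<in> V \<Longrightarrow> w \<in> V \<Longrightarrow> (\<lambda>x. a * u x + b * w x) \<in> V"
    and ex: "\<And>v. v \<in> F \<Longrightarrow> \<exists>w\<in>V. \<forall>u\<in>V. A (\<lambda>x. v x - w x) u = 0"
    and g: "g \<in> F" and v: "v \<in> F"
  shows "\<exists>w\<in>{(\<lambda>x. c * g x + u x) |c u. u \<in> V}. \<forall>u\<in>{(\<lambda>x. c * g x + u x) |c u. u \<in> V}. A (\<lambda>x. v x - w x) u = 0"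
proof -
  obtain p where p: "p \<in> V" "\<And>u. u \<in> V \<Longrightarrow> A (\<lambda>x. g x - p x) u = 0" using ex[OF g] by blast
  obtain w where w: "w \<in> V" "\<And>u. u \<in> V \<Longrightarrow> A (\<lambda>x. v x - w x) u = 0" using ex[OF v] by blast
  have pF: "p \<in> F" and wF: "w \<in> F" using p(1) w(1) V(1) by blast+
  define e where "e = (\<lambda>x. g x - p x)"
  define r where "r = (\<lambda>x. v x - w x)"
  have eF: "e \<in> F" unfolding e_def by (rule diff_mem[OF g pF])
  have rF: "r \<in> F" unfolding r_def by (rule diff_mem[OF v wF])
  \<comment> \<open>If \<open>e\<close> has no energy, \<open>A r e\<close> vanishes by
    \<open>null_vector\<close>, so the coefficient 0 is right as well.\<close>
  define \<alpha> where "\<alpha> = (if A e e = 0 then 0 else A r e / A e e)"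
  have re: "A r e = \<alpha> * A e e" using null_vector[OF rF eF] by (auto simp: \<alpha>_def)
  define q where "q = (\<lambda>x. \<alpha> * g x + (1 * w x + (- \<alpha>) * p x))"
  have "(\<lambda>x. 1 * w x + (- \<alpha>) * p x) \<in> V" by (rule V(2)[OF w(1) p(1)])
  then have qm: "q \<in> {(\<lambda>x. c * g x + u x) |c u. u \<in> V}"
    unfolding q_def by (intro CollectI exI conjI) (rule refl)
  have vq: "(\<lambda>x. v x - q x) = (\<lambda>x. 1 * r x + (- \<alpha>) * e x)"
    by (simp add: q_def r_def e_def algebra_simps)
  have orth: "A (\<lambda>x. v x - q x) u = 0" if "u \<in> {(\<lambda>x. c * g x + u x) |c u. u \<in> V}" for u
  proof -
    from that obtain c u' where u: "u = (\<lambda>x. c * g x + u' x)" "u' \<in> V" by (elim CollectE exE conjE)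
    define s where "s = (\<lambda>x. c * p x + 1 * u' x)"
    have s: "s \<in> V" unfolding s_def by (rule V(2)[OF p(1) u(2)])
    then have sF: "s \<in> F" using V(1) by blast
    have us: "u = (\<lambda>x. c * e x + 1 * s x)" by (simp add: u(1) s_def e_def algebra_simps)
    have uF: "u \<in> F" unfolding us by (rule lincomb_mem[OF eF sF])
    have "A r u = c * A r e + A r s"
      using lincomb[OF eF sF rF, of c 1] unfolding us[symmetric] sym[of u r] sym[of e r] sym[of s r] by simp
    moreover have "A e u = c * A e e + A e s"
      using lincomb[OF eF sF eF, of c 1] unfolding us[symmetric] sym[of u e] sym[of s e] by simp
    moreover have "A r s = 0" "A e s = 0" using w(2)[OF s] p(2)[OF s] by (auto simp: r_def e_def)
    ultimately show ?thesis unfolding vq lincomb[OF rF eF uF] using re by simp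
  qed
  show ?thesis by (rule bexI[OF _ qm]) (rule ballI, rule orth)
qed

text \<open>The energy removed by the sweep is the sum of the energies of the corrections
  \<open>e i\<close>. Pairing \<open>v\<close> with the pieces of the splitting expresses the energy
  of \<open>v\<close> by products of corrections and pieces, of which only boundedly many are
  nonzero for each index; Young's inequality absorbs the pieces. Since \<open>M\<close> counts
  neighbours regardless of their position in the list, no ordering is distinguished.\<close>

lemma multiplicative_correction:
  fixes js :: "'j list" and V :: "'j \<Rightarrow> ('x \<Rightarrow> real) set"
  assumes V: "\<And>j. j \<in> set js \<Longrightarrow> V j \<subseteq> F" and W: "W \<subseteq> F"
    and P: "\<And>j v. j \<in> set js \<Longrightarrow> v \<in> W \<Longrightarrow> P j v \<in> V j"
      "\<And>j v u. j \<in> set js \<Longrightarrow> v \<in> W \<Longrightarrow> u \<in> V j \<Longrightarrow> A (\<lambda>x. v x - P j v x) u = 0"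
      "\<And>j v. j \<in> set js \<Longrightarrow> v \<in> W \<Longrightarrow> (\<lambda>x. v x - P j v x) \<in> W"
    and dist: "distinct js"
    and near: "\<And>j k u w. j \<in> set js \<Longrightarrow> k \<in> set js \<Longrightarrow> \<not> near j k \<Longrightarrow> u \<in> V j \<Longrightarrow> w \<in> V k \<Longrightarrow> A u w = 0"
      "\<And>j k. near j k = near k j"
      "\<And>j. j \<in> set js \<Longrightarrow> card {k \<in> set js. near j k} \<le> M"
    and v: "v \<in> W"
    and w: "\<And>j. j \<in> set js \<Longrightarrow> w j \<in> V j" "v = (\<lambda>x. \<Sum>j\<in>set js. w j x)"
      "(\<Sum>j\<in>set js. A (w j) (w j)) \<le> K * A v v"
    and M: "1 \<le> M" and K: "1 \<le> K"
  shows "A (fold (\<lambda>j v x. v x - P j v x) js v) (fold (\<lambda>j v x. v x - P j v x) js v)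
      \<le> (1 - 1 / (real M ^ 2 * K)) * A v v"
proof -
  let ?n = "length js"
  let ?f = "\<lambda>j v x. v x - P j v x"
  define u where "u i = fold ?f (take i js) v" for i
  define e where "e i = P (js ! i) (u i)" for i
  define b where "b i = w (js ! i)" for i
  have u0: "u 0 = v" by (simp add: u_def)
  have un: "u ?n = fold ?f js v" by (simp add: u_def)
  have uS: "u (Suc i) = (\<lambda>x. u i x - e i x)" if "i < ?n" for i
    using that by (simp add: u_def e_def take_Suc_conv_app_nth)
  have mem: "js ! i \<in> set js" if "i < ?n" for i using that by simp
  have uW: "u i \<in> W" if "i \<le> ?n" for i
    using that
  proof (induction i)
    case 0
    then show ?case using v u0 by simp
  next
    case (Suc i)
    then have i: "i < ?n" by simp
    have "u i \<in> W" using Suc i by simp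
    from P(3)[OF mem[OF i] this] show ?case unfolding uS[OF i] e_def .
  qed
  have uF: "u i \<in> F" if "i \<le> ?n" for i using uW[OF that] W by blast
  have eV: "e i \<in> V (js ! i)" if "i < ?n" for i
    unfolding e_def using P(1)[OF mem[OF that] uW] that by simp
  have eF: "e i \<in> F" if "i < ?n" for i using eV[OF that] V[OF mem[OF that]] by blast
  have bV: "b i \<in> V (js ! i)" if "i < ?n" for i unfolding b_def using w(1)[OF mem[OF that]] .
  have bF: "b i \<in> F" if "i < ?n" for i using bV[OF that] V[OF mem[OF that]] by blast
  have vF: "v \<in> F" using v W by blast
  have orth: "A (u (Suc i)) q = 0" if "i < ?n" "q \<in> V (js ! i)" for i q
    unfolding uS[OF that(1)] e_def using P(2)[OF mem[OF that(1)] uW that(2)] that(1) by simp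
  have pyth: "A (u (Suc i)) (u (Suc i)) = A (u i) (u i) - A (e i) (e i)" if i: "i < ?n" for i
  proof -
    have ui: "u i \<in> F" "u (Suc i) \<in> F" using uF i by auto
    have eq: "u i = (\<lambda>x. u (Suc i) x + e i x)" unfolding uS[OF i] by simp
    have "A (u i) (u i) = A (u (Suc i)) (u i) + A (e i) (u i)"
      by (subst (1) eq) (rule A_add[OF ui(2) eF[OF i] ui(1)])
    moreover have "A (u (Suc i)) (u i) = A (u (Suc i)) (u (Suc i)) + A (e i) (u (Suc i))"
      using A_add[OF ui(2) eF[OF i] ui(2)] eq sym by metis
    moreover have "A (e i) (u i) = A (u (Suc i)) (e i) + A (e i) (e i)"
      using A_add[OF ui(2) eF[OF i] eF[OF i]] eq sym by metis
    moreover have "A (u (Suc i)) (e i) = 0" by (rule orth[OF i eV[OF i]])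
    ultimately show ?thesis using sym[of "e i" "u (Suc i)"] by simp
  qed
  define Q where "Q = (\<Sum>i<?n. A (e i) (e i))"
  have tele: "(\<Sum>i<k. A (e i) (e i)) = A v v - A (u k) (u k)" if "k \<le> ?n" for k
    using that by (induction k) (auto simp: u0 pyth)
  then have Q: "Q = A v v - A (u ?n) (u ?n)" by (simp add: Q_def)
  have vi: "v = (\<lambda>x. u k x + (\<Sum>i<k. e i x))" if "k \<le> ?n" for k
    using that
  proof (induction k)
    case (Suc k)
    then have k: "k < ?n" by simp
    have "v x = u (Suc k) x + (\<Sum>i<Suc k. e i x)" for x
    proof -
      have "v x = u k x + (\<Sum>i<k. e i x)" using Suc k by (metis less_imp_le)
      then show ?thesis unfolding uS[OF k] by simp
    qed
    then show ?case by (rule ext)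
  qed (simp add: u0)
  \<comment> \<open>The next iterate is orthogonal to \<open>V (js ! k)\<close>, so the pairing with
    \<open>b k\<close> sees the corrections up to and including \<open>k\<close>.\<close>
  have split: "A v (b k) = (\<Sum>i<Suc k. A (e i) (b k))" if k: "k < ?n" for k
  proof -
    have "(\<lambda>x. \<Sum>i<k. e i x) \<in> F" using eF k by (intro sum_mem) auto
    then have "A v (b k) = A (u k) (b k) + A (\<lambda>x. \<Sum>i<k. e i x) (b k)"
      using A_add[OF uF _ bF[OF k]] vi[of k] k by (metis less_imp_le)
    moreover have "A (\<lambda>x. \<Sum>i<k. e i x) (b k) = (\<Sum>i<k. A (e i) (b k))"
      using eF k bF by (intro A_sum) auto
    moreover have "A (u k) (b k) = A (e k) (b k)"
      using A_diff[OF uF eF bF, of k k k] orth[OF k bV[OF k]] k unfolding uS[OF k] by simp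
    ultimately show ?thesis by simp
  qed
  let ?N = "\<lambda>i k. near (js ! i) (js ! k)"
  \<comment> \<open>With this weight the terms with the pieces add up to at most half of
    \<open>A v v\<close>.\<close>
  define t where "t = real M * K"
  have t: "0 < t" using M K by (simp add: t_def)
  have pair_le: "A (e i) (b k) \<le> (if ?N i k then t / 2 * A (e i) (e i) + A (b k) (b k) / (2 * t) else 0)"
    if "i < ?n" "k < ?n" for i k
  proof (cases "?N i k")
    case True
    then show ?thesis using young[OF eF[OF that(1)] bF[OF that(2)] t] by simp
  next
    case False
    then show ?thesis using near(1)[OF mem[OF that(1)] mem[OF that(2)] False eV[OF that(1)] bV[OF that(2)]] by simp
  qed
  have pair_nonneg: "0 \<le> (if ?N i k then t / 2 * A (e i) (e i) + A (b k) (b k) / (2 * t) else 0)"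
    if "i < ?n" "k < ?n" for i k
    using nonneg[OF eF[OF that(1)]] nonneg[OF bF[OF that(2)]] t by simp
  have count: "card {k. k < ?n \<and> near j (js ! k)} \<le> M" if "j \<in> set js" for j
  proof -
    have "inj_on ((!) js) {k. k < ?n \<and> near j (js ! k)}"
      using dist by (auto simp: inj_on_def nth_eq_iff_index_eq)
    then have "card {k. k < ?n \<and> near j (js ! k)} = card ((!) js ` {k. k < ?n \<and> near j (js ! k)})"
      by (simp add: card_image)
    also have "\<dots> \<le> card {k \<in> set js. near j k}" by (intro card_mono) auto
    also have "\<dots> \<le> M" by (rule near(3)[OF that])
    finally show ?thesis .
  qed
  have reindex: "(\<Sum>j\<in>set js. g j) = (\<Sum>k<?n. g (js ! k))" for g :: "'j \<Rightarrow> real"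
  proof -
    have "bij_betw ((!) js) {..<?n} (set js)" using bij_betw_nth[OF dist] by auto
    then show ?thesis by (rule sum.reindex_bij_betw[symmetric])
  qed
  have Avw: "A v v = (\<Sum>k<?n. A v (b k))"
  proof -
    have wF: "w j \<in> F" if "j \<in> set js" for j using w(1)[OF that] V[OF that] by blast
    have "A v v = A (\<lambda>x. \<Sum>j\<in>set js. w j x) v" using w(2) by simp
    also have "\<dots> = (\<Sum>j\<in>set js. A (w j) v)" by (rule A_sum[OF _ wF vF]) auto
    also have "\<dots> = (\<Sum>j\<in>set js. A v (w j))" by (intro sum.cong refl sym)
    also have "\<dots> = (\<Sum>k<?n. A v (b k))" unfolding b_def by (rule reindex)
    finally show ?thesis .
  qed
  \<comment> \<open>The triangular range of \<open>i\<close> is enlarged to all indices, which makes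
    the bound independent of the order of the patches.\<close>
  have "A v v \<le> (\<Sum>k<?n. \<Sum>i<?n. if ?N i k then t / 2 * A (e i) (e i) + A (b k) (b k) / (2 * t) else 0)"
    unfolding Avw
  proof (rule sum_mono)
    fix k assume "k \<in> {..<?n}"
    then have k: "k < ?n" by simp
    have "A v (b k) \<le> (\<Sum>i<Suc k. if ?N i k then t / 2 * A (e i) (e i) + A (b k) (b k) / (2 * t) else 0)"
      unfolding split[OF k] using k by (intro sum_mono pair_le) auto
    also have "\<dots> \<le> (\<Sum>i<?n. if ?N i k then t / 2 * A (e i) (e i) + A (b k) (b k) / (2 * t) else 0)"
      using k pair_nonneg by (intro sum_mono2) auto
    finally show "A v (b k) \<le> \<dots>" .
  qed
  also have "\<dots> = (\<Sum>k<?n. \<Sum>i<?n. (if ?N i k then t / 2 * A (e i) (e i) else 0)) + (\<Sum>k<?n. \<Sum>i<?n. (if ?N i k then A (b k) (b k) / (2 * t) else 0))"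
    unfolding sum.distrib[symmetric] by (intro sum.cong refl) auto
  also have "(\<Sum>k<?n. \<Sum>i<?n. (if ?N i k then t / 2 * A (e i) (e i) else 0)) \<le> (\<Sum>i<?n. M * (t / 2 * A (e i) (e i)))"
  proof (subst sum.swap, rule sum_mono)
    fix i assume "i \<in> {..<?n}"
    then have i: "i < ?n" by simp
    have "(\<Sum>k<?n. if ?N i k then t / 2 * A (e i) (e i) else 0) = real (card {k. k < ?n \<and> ?N i k}) * (t / 2 * A (e i) (e i))"
      by (simp add: sum.If_cases Int_def conj_commute)
    also have "\<dots> \<le> M * (t / 2 * A (e i) (e i))"
      using count[OF mem[OF i]] nonneg[OF eF[OF i]] t by (intro mult_right_mono) auto
    finally show "(\<Sum>k<?n. if ?N i k then t / 2 * A (e i) (e i) else 0) \<le> M * (t / 2 * A (e i) (e i))" .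
  qed
  also have "(\<Sum>i<?n. M * (t / 2 * A (e i) (e i))) = M * t / 2 * Q"
    by (simp add: Q_def sum_distrib_left mult.assoc)
  also have "(\<Sum>k<?n. \<Sum>i<?n. (if ?N i k then A (b k) (b k) / (2 * t) else 0)) \<le> (\<Sum>k<?n. M * (A (b k) (b k) / (2 * t)))"
  proof (rule sum_mono)
    fix k assume "k \<in> {..<?n}"
    then have k: "k < ?n" by simp
    have swap: "{i. i < ?n \<and> near (js ! k) (js ! i)} = {i. i < ?n \<and> ?N i k}" using near(2) by blast
    have "(\<Sum>i<?n. if ?N i k then A (b k) (b k) / (2 * t) else 0) = real (card {i. i < ?n \<and> near (js ! k) (js ! i)}) * (A (b k) (b k) / (2 * t))"
      unfolding swap by (simp add: sum.If_cases Int_def conj_commute)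
    also have "\<dots> \<le> M * (A (b k) (b k) / (2 * t))"
      using count[OF mem[OF k]] nonneg[OF bF[OF k]] t by (intro mult_right_mono) auto
    finally show "(\<Sum>i<?n. if ?N i k then A (b k) (b k) / (2 * t) else 0) \<le> M * (A (b k) (b k) / (2 * t))" .
  qed
  also have "(\<Sum>k<?n. M * (A (b k) (b k) / (2 * t))) = M / (2 * t) * (\<Sum>j\<in>set js. A (w j) (w j))"
    by (subst reindex) (simp add: b_def sum_distrib_left)
  also have "\<dots> \<le> M / (2 * t) * (K * A v v)" using w(3) t by (intro mult_left_mono) auto
  also have "\<dots> = A v v / 2" using M K by (simp add: t_def)
  finally have "A v v \<le> M * t * Q" by simp
  then have main: "A v v \<le> (real M ^ 2 * K) * (A v v - A (u ?n) (u ?n))"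
    unfolding Q by (simp add: t_def power2_eq_square mult.assoc)
  have pos: "0 < real M ^ 2 * K" using M K by simp
  then have "A v v / (real M ^ 2 * K) \<le> A v v - A (u ?n) (u ?n)"
    using main by (simp add: pos_divide_le_eq mult.commute)
  then show ?thesis unfolding un[symmetric] by (simp add: left_diff_distrib)
qed

end

subsection \<open>Integrability and bilinearity\<close>

text \<open>Bounded and measurable rather than integrable, because this class is closed under
  products; on sets of finite measure it implies integrability.\<close>

definition bounded_meas :: "'a measure \<Rightarrow> 'a set \<Rightarrow> ('a \<Rightarrow> real) \<Rightarrow> bool" where
  "bounded_meas M S f \<longleftrightarrow> set_borel_measurable M S f \<and> (\<exists>B. \<forall>x\<in>S. \<bar>f x\<bar> \<le> B)"

lemma bounded_meas_mult:
  assumes "bounded_meas M S f" "bounded_meas M S g"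
  shows "bounded_meas M S (\<lambda>x. f x * g x)"
proof -
  obtain B C where B: "\<And>x. x \<in> S \<Longrightarrow> \<bar>f x\<bar> \<le> B" and C: "\<And>x. x \<in> S \<Longrightarrow> \<bar>g x\<bar> \<le> C"
    using assms unfolding bounded_meas_def by blast
  have "(\<lambda>x. (indicat_real S x *\<^sub>R f x) * (indicat_real S x *\<^sub>R g x)) \<in> borel_measurable M"
    using assms unfolding bounded_meas_def set_borel_measurable_def by (intro borel_measurable_times) blast+
  moreover have "(\<lambda>x. (indicat_real S x *\<^sub>R f x) * (indicat_real S x *\<^sub>R g x)) = (\<lambda>x. indicat_real S x *\<^sub>R (f x * g x))"
    by (auto simp: indicator_def)
  moreover have "\<bar>f x * g x\<bar> \<le> B * C" if "x \<in> S" for x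
    unfolding abs_mult using B[OF that] C[OF that] by (intro mult_mono) auto
  ultimately show ?thesis unfolding bounded_meas_def set_borel_measurable_def by auto
qed

lemma bounded_meas_add:
  assumes "bounded_meas M S f" "bounded_meas M S g"
  shows "bounded_meas M S (\<lambda>x. f x + g x)"
proof -
  obtain B C where B: "\<And>x. x \<in> S \<Longrightarrow> \<bar>f x\<bar> \<le> B" and C: "\<And>x. x \<in> S \<Longrightarrow> \<bar>g x\<bar> \<le> C"
    using assms unfolding bounded_meas_def by blast
  have "(\<lambda>x. (indicat_real S x *\<^sub>R f x) + (indicat_real S x *\<^sub>R g x)) \<in> borel_measurable M"
    using assms unfolding bounded_meas_def set_borel_measurable_def by (intro borel_measurable_add) blast+
  moreover have "(\<lambda>x. (indicat_real S x *\<^sub>R f x) + (indicat_real S x *\<^sub>R g x)) = (\<lambda>x. indicat_real S x *\<^sub>R (f x + g x))"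
    by (auto simp: indicator_def)
  moreover have "\<bar>f x + g x\<bar> \<le> B + C" if "x \<in> S" for x using B[OF that] C[OF that] by linarith
  ultimately show ?thesis unfolding bounded_meas_def set_borel_measurable_def by auto
qed

lemma bounded_meas_sum:
  assumes "finite A" "\<And>a. a \<in> A \<Longrightarrow> bounded_meas M S (f a)"
  shows "bounded_meas M S (\<lambda>x. \<Sum>a\<in>A. f a x)"
  using assms
proof (induction A rule: finite_induct)
  case empty
  show ?case unfolding bounded_meas_def set_borel_measurable_def by auto
next
  case (insert a A)
  then show ?case by (simp add: bounded_meas_add)
qed

lemma bounded_meas_integrable:
  assumes "S \<in> sets M" "emeasure M S < \<infinity>" "bounded_meas M S f"
  shows "set_integrable M S f"
  using assms unfolding bounded_meas_def by (auto intro: set_integrable_bounded)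

lemma bounded_meas_continuous_compact:
  fixes f :: "'a::euclidean_space \<Rightarrow> real"
  assumes "compact S" "continuous_on S f" "sets M = sets borel"
  shows "bounded_meas M S f"
proof -
  have "set_borel_measurable M S f"
    unfolding set_borel_measurable_def measurable_cong_sets[OF assms(3) refl]
    using assms by (intro borel_measurable_continuous_on_indicator) (auto simp: borel_compact)
  moreover have "bounded (f ` S)" using assms by (intro compact_imp_bounded compact_continuous_image)
  then have "\<exists>B. \<forall>x\<in>S. \<bar>f x\<bar> \<le> B" unfolding bounded_iff by auto
  ultimately show ?thesis unfolding bounded_meas_def by blast
qed

lemma set_integral_le_const:
  fixes f :: "'a \<Rightarrow> real"
  assumes T: "T \<in> sets M" "emeasure M T < \<infinity>" and int: "set_integrable M S f" and c: "0 \<le> c"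
    and "\<And>x. x \<in> S \<Longrightarrow> x \<in> T \<Longrightarrow> f x \<le> c" "\<And>x. x \<in> S \<Longrightarrow> x \<notin> T \<Longrightarrow> f x \<le> 0"
  shows "(LINT x:S|M. f x) \<le> c * measure M T"
proof -
  have "(LINT x:S|M. f x) \<le> (LINT x|M. c * indicator T x)"
    unfolding set_lebesgue_integral_def
  proof (rule integral_mono)
    show "integrable M (\<lambda>x. c * indicator T x)" using T by simp
    show "integrable M (\<lambda>x. indicator S x *\<^sub>R f x)" using int by (simp add: set_integrable_def)
    show "indicator S x *\<^sub>R f x \<le> c * indicator T x" for x
      using assms(4-6) by (auto simp: indicator_def)
  qed
  also have "\<dots> = c * measure M T" using T by simp
  finally show ?thesis .
qed

lemma set_integral_nonneg':
  fixes f :: "'a \<Rightarrow> real"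
  assumes "\<And>x. x \<in> S \<Longrightarrow> 0 \<le> f x"
  shows "0 \<le> (LINT x:S|M. f x)"
  unfolding set_lebesgue_integral_def using assms by (intro integral_nonneg_AE AE_I2) (auto simp: indicator_def)

text \<open>Choosing the constant once, from dimension and degree, makes it a term that cannot
  depend on the grid; the uniformity of the final bound rests on this device.\<close>

definition deriv_bound :: "'n::finite itself \<Rightarrow> nat \<Rightarrow> real" where
  "deriv_bound _ p = (SOME B. 1 \<le> B \<and> (\<forall>(q :: real ^ 'n \<Rightarrow> real) a h M k i x. q \<in> Qp p \<longrightarrow> 0 < h \<longrightarrow> k \<le> p \<longrightarrow> 0 \<le> M \<longrightarrow>
       (\<forall>\<tau>\<in>node_tuples p. \<bar>q (a + h *\<^sub>R (\<chi> i. \<tau> i))\<bar> \<le> M) \<longrightarrow>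
       (\<forall>j. a $ j - h \<le> x $ j \<and> x $ j \<le> a $ j + 2 * h)
     \<longrightarrow> \<bar>dir_deriv k (axis i 1) q x\<bar> \<le> B * M / h ^ k))"

lemma deriv_bound:
  assumes "1 \<le> p"
  shows "1 \<le> deriv_bound TYPE('n::finite) p"
    "\<And>(q :: real ^ 'n \<Rightarrow> real) a h M k i x. \<lbrakk>q \<in> Qp p; 0 < h; k \<le> p; 0 \<le> M;
       \<And>\<tau>. \<tau> \<in> node_tuples p \<Longrightarrow> \<bar>q (a + h *\<^sub>R (\<chi> i. \<tau> i))\<bar> \<le> M;
       \<And>j. a $ j - h \<le> x $ j \<and> x $ j \<le> a $ j + 2 * h\<rbrakk>
     \<Longrightarrow> \<bar>dir_deriv k (axis i 1) q x\<bar> \<le> deriv_bound TYPE('n) p * M / h ^ k"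
proof -
  let ?P = "\<lambda>B. 1 \<le> B \<and> (\<forall>(q :: real ^ 'n \<Rightarrow> real) a h M k i x. q \<in> Qp p \<longrightarrow> 0 < h \<longrightarrow> k \<le> p \<longrightarrow> 0 \<le> M \<longrightarrow>
       (\<forall>\<tau>\<in>node_tuples p. \<bar>q (a + h *\<^sub>R (\<chi> i. \<tau> i))\<bar> \<le> M) \<longrightarrow>
       (\<forall>j. a $ j - h \<le> x $ j \<and> x $ j \<le> a $ j + 2 * h)
     \<longrightarrow> \<bar>dir_deriv k (axis i 1) q x\<bar> \<le> B * M / h ^ k)"
  have "\<exists>B. ?P B"
    by (rule Qp_deriv_bound[OF assms, where 'n = 'n], rule exI, rule conjI, assumption) blast
  then have *: "?P (deriv_bound TYPE('n) p)" unfolding deriv_bound_def by (rule someI_ex)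
  then show "1 \<le> deriv_bound TYPE('n) p" by blast
  show "\<bar>dir_deriv k (axis i 1) q x\<bar> \<le> deriv_bound TYPE('n) p * M / h ^ k"
    if "q \<in> Qp p" "0 < h" "k \<le> p" "0 \<le> M"
       "\<And>\<tau>. \<tau> \<in> node_tuples p \<Longrightarrow> \<bar>q (a + h *\<^sub>R (\<chi> i. \<tau> i))\<bar> \<le> M"
       "\<And>j. a $ j - h \<le> x $ j \<and> x $ j \<le> a $ j + 2 * h"
    for q :: "real ^ 'n \<Rightarrow> real" and a h M k i x
    using * that by blast
qed

text \<open>With reach above \<open>9 * sqrt (real CARD('a)) * edge G\<close>, unit normals differ
  by at most 1/9 from a fixed one in the same cell, and there is room to walk from the strip to
  cells on which strip functions vanish.\<close>

locale cut_domain = cut_grid +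
  fixes \<delta> :: real
  assumes dim: "CARD('a) \<in> {2, 3}"
    and C2: "C2_boundary (dom G)" and reach: "has_reach (bdry G) \<delta>"
    and nonempty: "dom G \<noteq> {}"
    and reach_large: "9 * sqrt (real CARD('a)) * edge G < \<delta>"
    and regular: "\<And>z. z \<in> cut G \<Longrightarrow> regular_cut G z"
begin

section \<open>Cut cells and the area of the boundary\<close>

lemma dim2: "2 \<le> CARD('a)" using dim by auto

lemma sqrt_dim: "1 \<le> sqrt (real CARD('a))" "sqrt (real CARD('a)) \<le> 9 / 5"
proof -
  show "1 \<le> sqrt (real CARD('a))" using dim2 by simp
  have "real CARD('a) \<le> (9 / 5)\<^sup>2" using dim by (auto simp: power2_eq_square)
  then have "sqrt (real CARD('a)) \<le> sqrt ((9 / 5)\<^sup>2)" by (rule real_sqrt_le_mono)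
  then show "sqrt (real CARD('a)) \<le> 9 / 5" by simp
qed

lemma bdry_nonempty: "bdry G \<noteq> {}"
proof
  assume "bdry G = {}"
  then have "dom G = UNIV" using nonempty by (simp add: bdry_def frontier_eq_empty)
  then show False using bounded_dom not_bounded_UNIV by simp
qed

lemma closed_bdry: "closed (bdry G)" unfolding bdry_def by simp

text \<open>The boundary cannot touch a cut cell along its faces only: the rest of the cell would
  lie between the open cube and its closure and be connected, against the two components. So the
  boundary enters the interior, and then the domain does too.\<close>

lemma cut_subset_active: "cut G \<subseteq> active G"
proof
  fix z assume z: "z \<in> cut G"
  let ?B = "box (vtx G z) (vtx G z + (\<chi> i. h))"
  have "?B \<inter> bdry G \<noteq> {}"
  proof
    assume "?B \<inter> bdry G = {}"
    then have "?B \<subseteq> cell G z - bdry G" using box_subset_cell by blast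
    moreover have "cell G z - bdry G \<subseteq> closure ?B" using cell_subset_closure_box by blast
    moreover have "connected ?B" by (intro convex_connected convex_box)
    ultimately have "connected (cell G z - bdry G)" by (rule connected_intermediate_closure[rotated])
    then have "components (cell G z - bdry G) \<subseteq> {cell G z - bdry G}"
      by (simp add: connected_eq_components_subset_sing)
    then have "card (components (cell G z - bdry G)) \<le> card {cell G z - bdry G}" by (intro card_mono) auto
    moreover have "card (components (cell G z - bdry G)) = 2" using regular[OF z] unfolding regular_cut_def by blast
    ultimately show False by simp
  qed
  then obtain y where y: "y \<in> ?B" "y \<in> closure (dom G)" unfolding bdry_def frontier_def by blast
  then have "?B \<inter> dom G \<noteq> {}" by (metis disjoint_iff open_Int_closure_eq_empty open_box)
  then show "z \<in> active G" using box_subset_cell unfolding active_def by blast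
qed

lemma cell_index_bdry: "x \<in> bdry G \<Longrightarrow> cell_index G x \<in> active G"
  using mem_cell_index cut_subset_active unfolding cut_def by blast

lemma uncut_cell_subset:
  assumes "z \<in> active G" "z \<notin> cut G"
  shows "cell G z \<subseteq> dom G"
proof (rule ccontr)
  assume "\<not> ?thesis"
  then have "cell G z - dom G \<noteq> {}" by blast
  moreover have "cell G z \<inter> dom G \<noteq> {}" using assms(1) by (simp add: active_def)
  ultimately have "cell G z \<inter> frontier (dom G) \<noteq> {}"
    by (intro connected_Int_frontier convex_connected convex_cell)
  then show False using assms(2) by (simp add: cut_def bdry_def)
qed

text \<open>The 7 is the Lipschitz constant of the boundary graph found in
  \<open>surf_bdry_cell\<close>.\<close>

definition surf_const :: real where
  "surf_const = unit_ball_vol (real (CARD('a) - 1)) * (real CARD('a) * 7) ^ (CARD('a) - 1)"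

lemma surf_const_pos: "0 < surf_const"
  unfolding surf_const_def using unit_ball_vol_pos by simp

lemma dist_in_cell:
  assumes "x \<in> cell G z" "y \<in> cell G z"
  shows "norm (x - y) \<le> sqrt (real CARD('a)) * h"
proof -
  have "\<bar>(x - y) $ i\<bar> \<le> h" for i
  proof -
    have "vtx G z $ i \<le> x $ i" "x $ i \<le> vtx G z $ i + h" "vtx G z $ i \<le> y $ i" "y $ i \<le> vtx G z $ i + h"
      using assms mem_cell by blast+
    then show ?thesis by (simp add: abs_le_iff)
  qed
  then have "(norm ((x - y) $ i))\<^sup>2 \<le> h\<^sup>2" for i using power_mono[of "\<bar>(x - y) $ i\<bar>" h 2] by simp
  then have "(\<Sum>i\<in>UNIV. (norm ((x - y) $ i))\<^sup>2) \<le> (\<Sum>i\<in>(UNIV :: 'a set). h\<^sup>2)" by (intro sum_mono)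
  then have "norm (x - y) \<le> sqrt (real CARD('a) * h\<^sup>2)"
    unfolding norm_vec_def L2_set_def by (intro real_sqrt_le_mono) simp
  then show ?thesis using edge_pos by (simp add: real_sqrt_mult)
qed

text \<open>
  Inside a cell the unit normals vary so little that the boundary is a Lipschitz graph over one of
  the coordinate hyperplanes.
\<close>

lemma surf_bdry_cell: "emeasure surf (bdry G \<inter> cell G z) \<le> ennreal (surf_const * h ^ (CARD('a) - 1))"
proof -
  let ?r = "9 * sqrt (real CARD('a)) * h"
  have r: "0 < ?r" using sqrt_dim edge_pos by simp
  obtain \<nu> where \<nu>: "\<And>x. x \<in> bdry G \<Longrightarrow> norm (\<nu> x) = 1"
    "\<And>x y. x \<in> bdry G \<Longrightarrow> y \<in> bdry G \<Longrightarrow> \<bar>inner (y - x) (\<nu> x)\<bar> \<le> (norm (y - x))\<^sup>2 / (2 * ?r)"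
    "\<And>x y. x \<in> bdry G \<Longrightarrow> y \<in> bdry G \<Longrightarrow> norm (\<nu> x - \<nu> y) \<le> norm (x - y) / ?r"
    using reach_normals[OF C2 open_dom reach[unfolded bdry_def] bdry_nonempty[unfolded bdry_def] r reach_large]
    unfolding bdry_def by blast
  let ?A = "bdry G \<inter> cell G z"
  have bA: "?A \<in> sets borel" using closed_bdry closed_cell by (intro borel_closed closed_Int)
  show ?thesis
  proof (cases "?A = {}")
    case True
    then show ?thesis by simp
  next
    case False
    then obtain x0 where x0: "x0 \<in> bdry G" "x0 \<in> cell G z" by blast
    have n0: "norm (\<nu> x0) = 1" using \<nu>(1) x0(1) .
    have ca: "\<bar>\<nu> x0 $ i\<bar> \<le> 1" for i using component_le_norm_cart[of "\<nu> x0" i] n0 by simp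
    \<comment> \<open>In dimension at most 3 a unit vector has a component of size at least 1/2;
      otherwise its squared norm would be at most 3/4.\<close>
    obtain i0 where i0: "1 / 2 \<le> \<bar>\<nu> x0 $ i0\<bar>"
    proof -
      have "\<exists>i. 1 / 2 \<le> \<bar>\<nu> x0 $ i\<bar>"
      proof (rule ccontr)
        assume "\<not> ?thesis"
        then have "\<bar>\<nu> x0 $ i\<bar> < 1 / 2" for i by (meson not_le)
        then have "\<bar>\<nu> x0 $ i\<bar>\<^sup>2 \<le> (1 / 2)\<^sup>2" for i by (intro power_mono) (auto intro: less_imp_le)
        then have "(\<Sum>i\<in>UNIV. (\<nu> x0 $ i)\<^sup>2) \<le> (\<Sum>i\<in>(UNIV :: 'a set). (1 / 2)\<^sup>2)" by (intro sum_mono) simp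
        moreover have "(\<Sum>i\<in>UNIV. (\<nu> x0 $ i)\<^sup>2) = (norm (\<nu> x0))\<^sup>2"
          by (simp only: power2_norm_eq_inner) (simp add: inner_vec_def power2_eq_square)
        ultimately have "1 \<le> real CARD('a) * (1 / 4)" using n0 by (simp add: power2_eq_square)
        then show False using dim by auto
      qed
      then show ?thesis using that by blast
    qed
    \<comment> \<open>The quadratic bound at \<open>x\<close> contributes 1/18, the variation of the
      normals over the cell 1/9.\<close>
    have cone: "\<bar>inner (y - x) (\<nu> x0)\<bar> \<le> norm (y - x) / 6" if x: "x \<in> ?A" and y: "y \<in> ?A" for x y
    proof -
      have d1: "norm (y - x) \<le> ?r / 9" using dist_in_cell[of y z x] x y by simp
      have d2: "norm (x - x0) \<le> ?r / 9" using dist_in_cell[of x z x0] x x0 by simp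
      have "\<bar>inner (y - x) (\<nu> x)\<bar> \<le> norm (y - x) * norm (y - x) / (2 * ?r)"
        using \<nu>(2)[of x y] x y by (simp add: power2_eq_square)
      also have "\<dots> \<le> norm (y - x) * (?r / 9) / (2 * ?r)"
        using d1 r by (intro divide_right_mono mult_left_mono) auto
      finally have 1: "\<bar>inner (y - x) (\<nu> x)\<bar> \<le> norm (y - x) / 18" using r edge_pos by simp
      have "norm (\<nu> x0 - \<nu> x) \<le> norm (x0 - x) / ?r" using \<nu>(3) x0 x by blast
      also have "\<dots> \<le> 1 / 9" using d2 unfolding pos_divide_le_eq[OF r] by (simp add: norm_minus_commute)
      finally have "norm (\<nu> x0 - \<nu> x) \<le> 1 / 9" .
      then have "norm (y - x) * norm (\<nu> x0 - \<nu> x) \<le> norm (y - x) * (1 / 9)" by (intro mult_left_mono) auto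
      then have "\<bar>inner (y - x) (\<nu> x0 - \<nu> x)\<bar> \<le> norm (y - x) / 9"
        using Cauchy_Schwarz_ineq2[of "y - x" "\<nu> x0 - \<nu> x"] by linarith
      then show ?thesis using 1 unfolding inner_diff_right by linarith
    qed
    have "hausdorff_outer (CARD('a) - 1) ?A \<le>
      ennreal (unit_ball_vol (real (CARD('a) - 1)) * (real CARD('a) * 7 * h) ^ (CARD('a) - 1))"
    proof (rule hausdorff_outer_graph_le[OF dim2 edge_pos, of 7 ?A "vtx G z" i0])
      show "vtx G z $ i \<le> x $ i \<and> x $ i \<le> vtx G z $ i + h" if "x \<in> ?A" for x i
        using that mem_cell by blast
    next
      fix x y \<delta> assume x: "x \<in> ?A" and y: "y \<in> ?A" and le: "\<And>i. i \<noteq> i0 \<Longrightarrow> \<bar>x $ i - y $ i\<bar> \<le> \<delta>"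
      let ?e = "y - x"
      have others: "\<bar>\<Sum>i\<in>UNIV - {i0}. ?e $ i * \<nu> x0 $ i\<bar> \<le> 2 * \<delta>" "(\<Sum>i\<in>UNIV - {i0}. \<bar>?e $ i\<bar>) \<le> 2 * \<delta>"
      proof -
        have \<delta>0: "0 \<le> \<delta>"
        proof -
          have "UNIV - {i0} \<noteq> {}"
          proof
            assume "UNIV - {i0} = {}"
            then have "card (UNIV - {i0}) = 0" by (simp only: card.empty)
            then show False using card_pred_index[of i0] dim2 by linarith
          qed
          then obtain i where "i \<noteq> i0" by blast
          then show ?thesis using le[of i] by linarith
        qed
        have "(\<Sum>i\<in>UNIV - {i0}. \<bar>?e $ i\<bar>) \<le> (\<Sum>i\<in>UNIV - {i0}. \<delta>)"
          using le by (intro sum_mono) (auto simp: abs_minus_commute)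
        also have "\<dots> = real (CARD('a) - 1) * \<delta>" by simp
        also have "\<dots> \<le> 2 * \<delta>" using dim \<delta>0 by (intro mult_right_mono) auto
        finally show 2: "(\<Sum>i\<in>UNIV - {i0}. \<bar>?e $ i\<bar>) \<le> 2 * \<delta>" .
        have "\<bar>?e $ i * \<nu> x0 $ i\<bar> \<le> \<bar>?e $ i\<bar>" for i
          unfolding abs_mult using ca[of i] by (rule mult_left_le) simp
        then have "\<bar>\<Sum>i\<in>UNIV - {i0}. ?e $ i * \<nu> x0 $ i\<bar> \<le> (\<Sum>i\<in>UNIV - {i0}. \<bar>?e $ i\<bar>)"
          by (intro order.trans[OF sum_abs sum_mono])
        then show "\<bar>\<Sum>i\<in>UNIV - {i0}. ?e $ i * \<nu> x0 $ i\<bar> \<le> 2 * \<delta>" using 2 by linarith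
      qed
      have "norm ?e \<le> (\<Sum>i\<in>UNIV. \<bar>?e $ i\<bar>)" by (rule norm_le_l1_cart)
      also have "\<dots> = \<bar>?e $ i0\<bar> + (\<Sum>i\<in>UNIV - {i0}. \<bar>?e $ i\<bar>)" by (rule sum.remove) auto
      finally have ne: "norm ?e \<le> \<bar>?e $ i0\<bar> + 2 * \<delta>" using others(2) by linarith
      have "inner ?e (\<nu> x0) = ?e $ i0 * \<nu> x0 $ i0 + (\<Sum>i\<in>UNIV - {i0}. ?e $ i * \<nu> x0 $ i)"
        unfolding inner_vec_def by (subst sum.remove[of _ i0]) auto
      then have "\<bar>?e $ i0 * \<nu> x0 $ i0\<bar> \<le> norm ?e / 6 + 2 * \<delta>" using cone[OF x y] others(1) by linarith
      moreover have "\<bar>?e $ i0\<bar> * (1 / 2) \<le> \<bar>?e $ i0 * \<nu> x0 $ i0\<bar>"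
        unfolding abs_mult using i0 by (intro mult_left_mono) auto
      \<comment> \<open>With \<open>e\<close> for the size of the component \<open>i0\<close>: from
        \<open>e / 2 \<le> (e + 2 * \<delta>) / 6 + 2 * \<delta>\<close> follows
        \<open>e \<le> 7 * \<delta>\<close>.\<close>
      ultimately have "\<bar>?e $ i0\<bar> \<le> 7 * \<delta>" using ne by linarith
      then show "\<bar>x $ i0 - y $ i0\<bar> \<le> 7 * \<delta>" by (simp add: abs_minus_commute)
    qed simp
    then show ?thesis
      unfolding emeasure_surf[OF dim2 bA] surf_const_def by (simp add: power_mult_distrib mult.assoc)
  qed
qed

lemma bdry_eq_UN: "bdry G = (\<Union>z\<in>active G. bdry G \<inter> cell G z)"
  using cell_index_bdry mem_cell_index by blast

lemma surf_bdry_finite: "emeasure surf (bdry G) < \<infinity>"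
proof -
  have "emeasure surf (bdry G) = emeasure surf (\<Union>z\<in>active G. bdry G \<inter> cell G z)"
    using bdry_eq_UN by simp
  also have "\<dots> \<le> (\<Sum>z\<in>active G. emeasure surf (bdry G \<inter> cell G z))"
    using closed_bdry closed_cell by (intro emeasure_subadditive_finite finite_active) auto
  also have "\<dots> \<le> (\<Sum>z\<in>active G. ennreal (surf_const * h ^ (CARD('a) - 1)))"
    by (intro sum_mono surf_bdry_cell)
  also have "\<dots> < \<infinity>" by (simp add: ennreal_mult_less_top of_nat_less_top)
  finally show ?thesis .
qed

lemma face_eq: "face G z i = {x. x $ i = vtx G z $ i + h \<and> (\<forall>j. vtx G z $ j \<le> x $ j \<and> x $ j \<le> vtx G z $ j + h)}"
proof -
  have nth: "vtx G (z + axis i 1) $ j = vtx G z $ j + (if j = i then h else 0)" for j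
    by (simp add: vtx_nth axis_def algebra_simps)
  show ?thesis
  proof (intro equalityI subsetI)
    fix x assume x: "x \<in> face G z i"
    have 1: "vtx G z $ j \<le> x $ j \<and> x $ j \<le> vtx G z $ j + h" for j using x unfolding face_def Int_iff mem_cell by blast
    have "vtx G (z + axis i 1) $ i \<le> x $ i" using x unfolding face_def Int_iff mem_cell by blast
    then have "x $ i = vtx G z $ i + h" using 1[of i] unfolding nth by simp
    then show "x \<in> {x. x $ i = vtx G z $ i + h \<and> (\<forall>j. vtx G z $ j \<le> x $ j \<and> x $ j \<le> vtx G z $ j + h)}" using 1 by blast
  next
    fix x assume x: "x \<in> {x. x $ i = vtx G z $ i + h \<and> (\<forall>j. vtx G z $ j \<le> x $ j \<and> x $ j \<le> vtx G z $ j + h)}"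
    then show "x \<in> face G z i" unfolding face_def Int_iff mem_cell nth using edge_pos by auto
  qed
qed

lemma compact_face: "compact (face G z i)"
  unfolding face_def using compact_cell by (intro compact_Int)

lemma surf_face: "emeasure surf (face G z i) \<le> ennreal (surf_const * h ^ (CARD('a) - 1))"
proof -
  have b: "face G z i \<in> sets borel" using compact_face by (rule borel_compact)
  have "(real CARD('a) * h) ^ (CARD('a) - 1) \<le> (real CARD('a) * 7 * h) ^ (CARD('a) - 1)"
    using edge_pos by (intro power_mono) auto
  then have "unit_ball_vol (real (CARD('a) - 1)) * (real CARD('a) * h) ^ (CARD('a) - 1) \<le> surf_const * h ^ (CARD('a) - 1)"
    unfolding surf_const_def by (simp add: power_mult_distrib mult.assoc mult_left_mono)
  then show ?thesis
    unfolding emeasure_surf[OF dim2 b] unfolding face_eq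
    by (intro order.trans[OF hausdorff_outer_face_finite[OF dim2 edge_pos]] ennreal_leI)
qed

lemma surf_face_finite: "emeasure surf (face G z i) < \<infinity>"
  using surf_face[of z i] by (simp add: order_le_less_trans)

section \<open>Measurability of piecewise polynomials\<close>

lemma hcell_borel: "{x. cell_index G x = z} \<in> sets borel"
proof -
  have "{x. cell_index G x = z} = (\<Inter>i. {x. vtx G z $ i \<le> x $ i} \<inter> {x. x $ i < vtx G z $ i + h})"
    unfolding cell_index_eq lat_def vtx_nth using edge_pos
    by (auto simp: pos_le_divide_eq pos_divide_less_eq algebra_simps)
  also have "\<dots> \<in> sets borel"
    by (intro sets.countable_INT'' sets.Int borel_closed borel_open closed_Collect_le open_Collect_less continuous_intros)
      auto
  finally show ?thesis .
qed

text \<open>Half-open cells partition space, so on \<open>S\<close> the function is a finite sum of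
  polynomials times indicators of Borel sets.\<close>

lemma bounded_meas_piecewise:
  assumes M: "sets M = sets borel" and S: "S \<in> sets borel" "\<And>x. x \<in> S \<Longrightarrow> cell_index G x \<in> active G"
    and F: "\<And>z. z \<in> active G \<Longrightarrow> F z \<in> Qp p" and f: "\<And>x. x \<in> S \<Longrightarrow> f x = F (cell_index G x) x"
  shows "bounded_meas M S f"
proof -
  have eq: "indicat_real S x *\<^sub>R f x = (\<Sum>z\<in>active G. indicat_real (S \<inter> {x. cell_index G x = z}) x * F z x)" for x
  proof (cases "x \<in> S")
    case True
    have "(\<Sum>z\<in>active G. indicat_real (S \<inter> {x. cell_index G x = z}) x * F z x)
        = (\<Sum>z\<in>active G. if cell_index G x = z then F z x else 0)"
      using True by (intro sum.cong) (auto simp: indicator_def)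
    also have "\<dots> = F (cell_index G x) x" using S(2)[OF True] finite_active by simp
    finally show ?thesis using True f by simp
  qed (simp add: indicator_def)
  have "(\<lambda>x. indicat_real S x *\<^sub>R f x) \<in> borel_measurable borel"
    unfolding eq
  proof (intro borel_measurable_sum borel_measurable_times)
    fix z assume z: "z \<in> active G"
    show "indicat_real (S \<inter> {x. cell_index G x = z}) \<in> borel_measurable borel"
      using S(1) hcell_borel by (intro borel_measurable_indicator sets.Int)
    show "F z \<in> borel_measurable borel"
      using continuous_on_Qp[OF F[OF z]] by (rule borel_measurable_continuous_onI)
  qed
  then have "set_borel_measurable M S f"
    unfolding set_borel_measurable_def measurable_cong_sets[OF M refl] .
  moreover have "\<exists>B. \<forall>x\<in>S. \<bar>f x\<bar> \<le> B"
  proof -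
    have "\<forall>z\<in>active G. \<exists>b. \<forall>x\<in>cell G z. \<bar>F z x\<bar> \<le> b"
    proof
      fix z assume "z \<in> active G"
      have "bounded (F z ` cell G z)"
        by (intro compact_imp_bounded compact_continuous_image continuous_on_Qp[OF F] compact_cell) fact
      then show "\<exists>b. \<forall>x\<in>cell G z. \<bar>F z x\<bar> \<le> b" unfolding bounded_iff by auto
    qed
    from bchoice[OF this] obtain b where b: "\<forall>z\<in>active G. \<forall>x\<in>cell G z. \<bar>F z x\<bar> \<le> b z" ..
    have "\<bar>f x\<bar> \<le> (\<Sum>z\<in>active G. \<bar>b z\<bar>)" if x: "x \<in> S" for x
    proof -
      have "\<bar>f x\<bar> \<le> b (cell_index G x)" using f[OF x] b S(2)[OF x] mem_cell_index by simp
      also have "\<dots> \<le> \<bar>b (cell_index G x)\<bar>" by simp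
      also have "\<dots> \<le> (\<Sum>z\<in>active G. \<bar>b z\<bar>)"
        using S(2)[OF x] finite_active by (intro member_le_sum) auto
      finally show ?thesis .
    qed
    then show ?thesis by blast
  qed
  ultimately show ?thesis unfolding bounded_meas_def by blast
qed

lemma grad_nth: "grad G p v x $ i = dir_deriv 1 (axis i 1) (piece G p v (cell_index G x)) x"
  by (simp add: grad_def)

lemma bounded_meas_grad:
  assumes "sets M = sets borel" "S \<in> sets borel" "\<And>x. x \<in> S \<Longrightarrow> cell_index G x \<in> active G" "v \<in> FE G p"
  shows "bounded_meas M S (\<lambda>x. grad G p v x $ i)"
  using assms(1-3)
  by (rule bounded_meas_piecewise[where F = "\<lambda>z. dir_deriv 1 (axis i 1) (piece G p v z)"])
    (auto simp: grad_nth intro!: Qp_dir_deriv piece_Qp(1)[OF assms(4)])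

lemma FE_eq_piece: "v \<in> FE G p \<Longrightarrow> cell_index G x \<in> active G \<Longrightarrow> v x = piece G p v (cell_index G x) x"
  using piece_Qp(2)[of v "cell_index G x" x] mem_cell_index by simp

lemma bounded_meas_trace:
  assumes "v \<in> FE G p"
  shows "bounded_meas surf (bdry G) v"
  by (rule bounded_meas_piecewise[where F = "piece G p v"])
    (auto simp: cell_index_bdry closed_bdry intro: piece_Qp(1)[OF assms] FE_eq_piece[OF assms])

lemma bounded_meas_normal:
  "bounded_meas surf (bdry G) (\<lambda>x. outward_normal (dom G) x $ i)"
proof -
  have "continuous_on (bdry G) (\<lambda>x. outward_normal (dom G) x $ i)"
    using continuous_on_outward_normal[OF C2] unfolding bdry_def by (intro continuous_intros)
  then have "(\<lambda>x. indicat_real (bdry G) x *\<^sub>R outward_normal (dom G) x $ i) \<in> borel_measurable borel"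
    using closed_bdry by (intro borel_measurable_continuous_on_indicator) auto
  moreover have "\<bar>outward_normal (dom G) x $ i\<bar> \<le> 1" if "x \<in> bdry G" for x
    using norm_outward_normal_le[OF C2, of x] component_le_norm_cart[of "outward_normal (dom G) x" i] that
    unfolding bdry_def by linarith
  ultimately show ?thesis
    unfolding bounded_meas_def set_borel_measurable_def measurable_cong_sets[OF sets_surf refl] by blast
qed

lemma bounded_meas_normal_deriv:
  assumes "v \<in> FE G p"
  shows "bounded_meas surf (bdry G) (normal_deriv G p v)"
proof -
  have "normal_deriv G p v = (\<lambda>x. \<Sum>i\<in>UNIV. grad G p v x $ i * outward_normal (dom G) x $ i)"
    by (simp add: normal_deriv_def inner_vec_def fun_eq_iff)
  moreover have "bounded_meas surf (bdry G) (\<lambda>x. \<Sum>i\<in>UNIV. grad G p v x $ i * outward_normal (dom G) x $ i)"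
    by (intro bounded_meas_sum bounded_meas_mult bounded_meas_normal bounded_meas_grad[OF _ _ _ assms])
      (auto simp: closed_bdry cell_index_bdry)
  ultimately show ?thesis by simp
qed

lemma bdry_integrable:
  assumes "bounded_meas surf (bdry G) f" "bounded_meas surf (bdry G) g"
  shows "set_integrable surf (bdry G) (\<lambda>x. f x * g x)"
  using bounded_meas_mult[OF assms] surf_bdry_finite closed_bdry by (intro bounded_meas_integrable) auto

lemma dom_finite: "dom G \<in> sets lborel" "emeasure lborel (dom G) < \<infinity>"
proof -
  show m: "dom G \<in> sets lborel" using open_dom by simp
  obtain a where a: "dom G \<subseteq> cbox (-a) a" using bounded_subset_cbox_symmetric[OF bounded_dom] by blast
  then have "emeasure lborel (dom G) \<le> emeasure lborel (cbox (-a) a)" by (intro emeasure_mono) auto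
  also have "\<dots> < \<infinity>" by (rule emeasure_lborel_cbox_finite)
  finally show "emeasure lborel (dom G) < \<infinity>" .
qed

lemma grad_inner: "inner (grad G p u x) (grad G p v x) = (\<Sum>i\<in>UNIV. grad G p u x $ i * grad G p v x $ i)"
  by (simp add: inner_vec_def)

lemma grad_integrable:
  assumes "u \<in> FE G p" "v \<in> FE G p" "S \<in> sets lborel" "S \<subseteq> dom G"
  shows "set_integrable lborel S (\<lambda>x. inner (grad G p u x) (grad G p v x))"
proof -
  have "set_integrable lborel (dom G) (\<lambda>x. inner (grad G p u x) (grad G p v x))"
    unfolding grad_inner
    by (intro bounded_meas_integrable dom_finite bounded_meas_sum bounded_meas_mult bounded_meas_grad)
      (use assms open_dom cell_index_active in auto)
  then show ?thesis using assms(3,4) by (rule set_integrable_subset)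
qed

section \<open>Linearity and symmetry of the form\<close>

lemma grad_lincomb:
  assumes "u \<in> FE G p" "w \<in> FE G p" "cell_index G x \<in> active G"
  shows "grad G p (\<lambda>x. a * u x + b * w x) x = a *\<^sub>R grad G p u x + b *\<^sub>R grad G p w x"
  unfolding vec_eq_iff
  using dir_deriv_linear[OF piece_Qp(1)[OF assms(1,3)] piece_Qp(1)[OF assms(2,3)]]
  by (simp add: grad_nth FE_lincomb(2)[OF assms])

lemma grad_prod_lincomb:
  assumes "u \<in> FE G p" "w \<in> FE G p" "v \<in> FE G p"
  shows "grad_prod G p (dom G) (\<lambda>x. a * u x + b * w x) v = a * grad_prod G p (dom G) u v + b * grad_prod G p (dom G) w v"
proof -
  have "grad_prod G p (dom G) (\<lambda>x. a * u x + b * w x) v =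
     (LINT x:dom G|lborel. a * inner (grad G p u x) (grad G p v x) + b * inner (grad G p w x) (grad G p v x))"
    unfolding grad_prod_def
    by (intro set_lebesgue_integral_cong dom_finite)
      (simp add: grad_lincomb[OF assms(1,2) cell_index_active] inner_add_left)
  also have "\<dots> = (LINT x:dom G|lborel. a * inner (grad G p u x) (grad G p v x)) + (LINT x:dom G|lborel. b * inner (grad G p w x) (grad G p v x))"
    by (intro set_integral_add set_integrable_mult_right grad_integrable[OF assms(1,3)] grad_integrable[OF assms(2,3)] dom_finite order.refl)
  finally show ?thesis by (simp add: grad_prod_def)
qed

lemma bdry_prod_lincomb:
  assumes "bounded_meas surf (bdry G) f" "bounded_meas surf (bdry G) g" "bounded_meas surf (bdry G) k"
    and "\<And>x. x \<in> bdry G \<Longrightarrow> e x = a * f x + b * g x"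
  shows "bdry_prod G e k = a * bdry_prod G f k + b * bdry_prod G g k"
proof -
  have "bdry_prod G e k = (LINT x:bdry G|surf. a * (f x * k x) + b * (g x * k x))"
    unfolding bdry_prod_def using closed_bdry
    by (intro set_lebesgue_integral_cong) (auto simp: assms(4) algebra_simps)
  also have "\<dots> = (LINT x:bdry G|surf. a * (f x * k x)) + (LINT x:bdry G|surf. b * (g x * k x))"
    by (intro set_integral_add set_integrable_mult_right bdry_integrable assms)
  finally show ?thesis by (simp add: bdry_prod_def)
qed

lemma bdry_prod_commute: "bdry_prod G f g = bdry_prod G g f"
  by (simp add: bdry_prod_def mult.commute)

lemma nitsche_lincomb:
  assumes "u \<in> FE G p" "w \<in> FE G p" "v \<in> FE G p"
  shows "nitsche_form G p gD (\<lambda>x. a * u x + b * w x) v = a * nitsche_form G p gD u v + b * nitsche_form G p gD w v"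
proof -
  note bm = bounded_meas_trace bounded_meas_normal_deriv
  have nd: "normal_deriv G p (\<lambda>x. a * u x + b * w x) x = a * normal_deriv G p u x + b * normal_deriv G p w x"
    if "x \<in> bdry G" for x
    unfolding normal_deriv_def grad_lincomb[OF assms(1,2) cell_index_bdry[OF that]] by (simp add: inner_add_left)
  have "bdry_prod G (normal_deriv G p (\<lambda>x. a * u x + b * w x)) v = a * bdry_prod G (normal_deriv G p u) v + b * bdry_prod G (normal_deriv G p w) v"
    by (intro bdry_prod_lincomb bm assms nd)
  moreover have "bdry_prod G (\<lambda>x. a * u x + b * w x) (normal_deriv G p v) = a * bdry_prod G u (normal_deriv G p v) + b * bdry_prod G w (normal_deriv G p v)"
    by (intro bdry_prod_lincomb bm assms) simp
  moreover have "bdry_prod G (\<lambda>x. a * u x + b * w x) v = a * bdry_prod G u v + b * bdry_prod G w v"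
    by (intro bdry_prod_lincomb bm assms) simp
  ultimately show ?thesis
    unfolding nitsche_form_def grad_prod_lincomb[OF assms] by (simp only: algebra_simps)
qed

lemma ghost_facesD: "(z, i) \<in> ghost_faces G \<Longrightarrow> z \<in> active G \<and> z + axis i 1 \<in> active G"
  unfolding ghost_faces_def by blast

lemma jump_Qp:
  assumes "v \<in> FE G p" "(z, i) \<in> ghost_faces G"
  shows "jump G p k v z i \<in> Qp p"
proof -
  have "(\<lambda>x. dir_deriv k (axis i 1) (piece G p v (z + axis i 1)) x - dir_deriv k (axis i 1) (piece G p v z) x) \<in> Qp p"
    using ghost_facesD[OF assms(2)] by (intro Qp_diff Qp_dir_deriv piece_Qp(1)[OF assms(1)]) auto
  then show ?thesis by (simp add: jump_def[abs_def])
qed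

lemma jump_lincomb:
  assumes "u \<in> FE G p" "w \<in> FE G p" "(z, i) \<in> ghost_faces G"
  shows "jump G p k (\<lambda>x. a * u x + b * w x) z i x = a * jump G p k u z i x + b * jump G p k w z i x"
proof -
  have act: "z \<in> active G" "z + axis i 1 \<in> active G" using ghost_facesD[OF assms(3)] by auto
  show ?thesis
    unfolding jump_def FE_lincomb(2)[OF assms(1,2) act(1)] FE_lincomb(2)[OF assms(1,2) act(2)]
      dir_deriv_linear[OF piece_Qp(1)[OF assms(1) act(1)] piece_Qp(1)[OF assms(2) act(1)]]
      dir_deriv_linear[OF piece_Qp(1)[OF assms(1) act(2)] piece_Qp(1)[OF assms(2) act(2)]]
    by (simp add: algebra_simps)
qed

lemma face_integrable:
  assumes "q \<in> Qp p" "r \<in> Qp p"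
  shows "set_integrable surf (face G z i) (\<lambda>x. q x * r x)"
  by (intro bounded_meas_integrable surf_face_finite bounded_meas_mult bounded_meas_continuous_compact
      compact_face continuous_on_Qp[OF assms(1)] continuous_on_Qp[OF assms(2)])
    (auto simp: borel_compact compact_face)

lemma ghost_lincomb:
  assumes "u \<in> FE G p" "w \<in> FE G p" "v \<in> FE G p"
  shows "ghost_form G p \<gamma> (\<lambda>x. a * u x + b * w x) v = a * ghost_form G p \<gamma> u v + b * ghost_form G p \<gamma> w v"
proof -
  let ?J = "\<lambda>k u v z i. LINT x:face G z i|surf. jump G p k u z i x * jump G p k v z i x"
  have J: "?J k (\<lambda>x. a * u x + b * w x) v z i = a * ?J k u v z i + b * ?J k w v z i" if zi: "(z, i) \<in> ghost_faces G" for k z i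
  proof -
    have "?J k (\<lambda>x. a * u x + b * w x) v z i =
      (LINT x:face G z i|surf. a * (jump G p k u z i x * jump G p k v z i x) + b * (jump G p k w z i x * jump G p k v z i x))"
      unfolding jump_lincomb[OF assms(1,2) zi] by (simp add: algebra_simps)
    also have "\<dots> = (LINT x:face G z i|surf. a * (jump G p k u z i x * jump G p k v z i x)) + (LINT x:face G z i|surf. b * (jump G p k w z i x * jump G p k v z i x))"
      by (intro set_integral_add set_integrable_mult_right face_integrable jump_Qp zi assms)
    finally show ?thesis by simp
  qed
  have "(\<Sum>(z, i)\<in>ghost_faces G. \<Sum>k=1..p. edge G ^ (2 * k - 1) / (fact k)\<^sup>2 * ?J k (\<lambda>x. a * u x + b * w x) v z i)
    = (\<Sum>(z, i)\<in>ghost_faces G. a * (\<Sum>k=1..p. edge G ^ (2 * k - 1) / (fact k)\<^sup>2 * ?J k u v z i)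
        + b * (\<Sum>k=1..p. edge G ^ (2 * k - 1) / (fact k)\<^sup>2 * ?J k w v z i))"
  proof (rule sum.cong[OF refl], clarify)
    fix z i assume zi: "(z, i) \<in> ghost_faces G"
    show "(\<Sum>k=1..p. edge G ^ (2 * k - 1) / (fact k)\<^sup>2 * ?J k (\<lambda>x. a * u x + b * w x) v z i) =
      a * (\<Sum>k=1..p. edge G ^ (2 * k - 1) / (fact k)\<^sup>2 * ?J k u v z i)
        + b * (\<Sum>k=1..p. edge G ^ (2 * k - 1) / (fact k)\<^sup>2 * ?J k w v z i)"
      unfolding J[OF zi] by (simp add: sum_distrib_left sum.distrib distrib_left mult.left_commute)
  qed
  then show ?thesis
    unfolding ghost_form_def by (simp add: sum.distrib sum_distrib_left case_prod_unfold distrib_left mult.left_commute)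
qed

lemma cut_form_lincomb:
  assumes "u \<in> FE G p" "w \<in> FE G p" "v \<in> FE G p"
  shows "cut_form G p \<gamma> gD (\<lambda>x. a * u x + b * w x) v = a * cut_form G p \<gamma> gD u v + b * cut_form G p \<gamma> gD w v"
  unfolding cut_form_def nitsche_lincomb[OF assms] ghost_lincomb[OF assms] by (simp add: algebra_simps)

lemma cut_form_commute: "cut_form G p \<gamma> gD u v = cut_form G p \<gamma> gD v u"
  unfolding cut_form_def nitsche_form_def ghost_form_def grad_prod_def
  by (simp add: bdry_prod_commute[of _ u] bdry_prod_commute[of _ "normal_deriv G p u"] inner_commute mult.commute[of "jump G p _ u _ _ _"])

end

subsection \<open>Energies\<close>

lemma dir_deriv_zero: "dir_deriv k \<nu> (\<lambda>_. 0) = (\<lambda>_. 0)"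
proof -
  have "deriv (\<lambda>_ :: real. 0 :: real) = (\<lambda>_. 0)" by (rule ext, rule DERIV_imp_deriv) simp
  then have "(deriv ^^ k) (\<lambda>_ :: real. 0 :: real) = (\<lambda>_. 0)" by (induction k) simp_all
  then show ?thesis by (simp add: dir_deriv_def fun_eq_iff)
qed

lemma measure_le_of_emeasure: "emeasure M S \<le> ennreal c \<Longrightarrow> 0 \<le> c \<Longrightarrow> measure M S \<le> c"
  unfolding measure_def by (rule enn2real_leI)

lemma set_integral_subset_le:
  fixes f :: "'b \<Rightarrow> real"
  assumes "set_integrable M T f" "S \<in> sets M" "S \<subseteq> T" "\<And>x. x \<in> T \<Longrightarrow> 0 \<le> f x"
  shows "(LINT x:S|M. f x) \<le> (LINT x:T|M. f x)"
  unfolding set_lebesgue_integral_def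
proof (rule integral_mono)
  show "integrable M (\<lambda>x. indicator S x *\<^sub>R f x)"
    using set_integrable_subset[OF assms(1,2,3)] by (simp add: set_integrable_def)
  show "integrable M (\<lambda>x. indicator T x *\<^sub>R f x)" using assms(1) by (simp add: set_integrable_def)
  show "indicator S x *\<^sub>R f x \<le> indicator T x *\<^sub>R f x" for x
    using assms(3,4) by (auto simp: indicator_def)
qed

definition int_nbhd :: "int ^ 'n::finite \<Rightarrow> nat \<Rightarrow> (int ^ 'n) set" where
  "int_nbhd j r = {z. \<forall>i. \<bar>z $ i - j $ i\<bar> \<le> int r}"

lemma int_nbhd: "finite (int_nbhd j r)" "card (int_nbhd (j :: int ^ 'n::finite) r) = (2 * r + 1) ^ CARD('n)"
  unfolding int_nbhd_def by (rule finite_int_nbhd, rule card_int_box)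

lemma int_nbhd_sym: "z \<in> int_nbhd j r \<longleftrightarrow> j \<in> int_nbhd z r"
  unfolding int_nbhd_def by (simp add: abs_minus_commute)

text \<open>Double counting: each \<open>a\<close> is seen by at most
  \<open>(2 * r + 1) ^ CARD('n)\<close> indices. The map \<zeta> locates objects other than cells,
  such as faces.\<close>

lemma sum_int_nbhd_le:
  fixes f :: "'b \<Rightarrow> real" and \<zeta> :: "'b \<Rightarrow> int ^ 'n::finite"
  assumes "finite J" "finite A" "\<And>a. a \<in> A \<Longrightarrow> 0 \<le> f a"
  shows "(\<Sum>j\<in>J. \<Sum>a\<in>{a\<in>A. \<zeta> a \<in> int_nbhd j r}. f a) \<le> (2 * real r + 1) ^ CARD('n) * (\<Sum>a\<in>A. f a)"
proof -
  have "(\<Sum>j\<in>J. \<Sum>a\<in>{a\<in>A. \<zeta> a \<in> int_nbhd j r}. f a) = (\<Sum>j\<in>J. \<Sum>a\<in>A. if \<zeta> a \<in> int_nbhd j r then f a else 0)"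
    using assms(2) by (intro sum.cong refl sum.inter_filter)
  also have "\<dots> = (\<Sum>a\<in>A. \<Sum>j\<in>J. if \<zeta> a \<in> int_nbhd j r then f a else 0)" by (rule sum.swap)
  also have "\<dots> \<le> (\<Sum>a\<in>A. (2 * real r + 1) ^ CARD('n) * f a)"
  proof (rule sum_mono)
    fix a assume a: "a \<in> A"
    have "(\<Sum>j\<in>J. if \<zeta> a \<in> int_nbhd j r then f a else 0) = real (card {j\<in>J. \<zeta> a \<in> int_nbhd j r}) * f a"
      using assms(1) by (simp add: sum.inter_filter[symmetric])
    also have "\<dots> \<le> real ((2 * r + 1) ^ CARD('n)) * f a"
    proof (intro mult_right_mono of_nat_mono)
      have "card {j\<in>J. \<zeta> a \<in> int_nbhd j r} \<le> card (int_nbhd (\<zeta> a) r)"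
        using int_nbhd_sym by (intro card_mono int_nbhd(1)) blast
      then show "card {j\<in>J. \<zeta> a \<in> int_nbhd j r} \<le> (2 * r + 1) ^ CARD('n)" by (simp only: int_nbhd(2))
    qed (rule assms(3)[OF a])
    finally show "(\<Sum>j\<in>J. if \<zeta> a \<in> int_nbhd j r then f a else 0) \<le> (2 * real r + 1) ^ CARD('n) * f a" by (simp add: add.commute)
  qed
  finally show ?thesis by (simp add: sum_distrib_left)
qed

context cut_domain
begin

text \<open>The contribution of one face, taken without the weight \<gamma>; the inverse weight
  appears when local energies are compared with the form.\<close>

definition ghost_energy :: "(real ^ 'a \<Rightarrow> real) \<Rightarrow> (int ^ 'a) \<times> 'a \<Rightarrow> real" where
  "ghost_energy v F = (\<Sum>k=1..p. h ^ (2 * k - 1) / (fact k)\<^sup>2 *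
     (LINT x:face G (fst F) (snd F)|surf. (jump G p k v (fst F) (snd F) x)\<^sup>2))"

text \<open>Half-open cells are disjoint, so the energies of different cells add up.\<close>

definition cell_energy :: "(real ^ 'a \<Rightarrow> real) \<Rightarrow> int ^ 'a \<Rightarrow> real" where
  "cell_energy v z = (LINT x:{x. cell_index G x = z}|lborel. (norm (grad G p v x))\<^sup>2)"

lemma ghost_form_eq: "ghost_form G p \<gamma> v v = \<gamma> * (\<Sum>F\<in>ghost_faces G. ghost_energy v F)"
  unfolding ghost_form_def ghost_energy_def case_prod_unfold by (simp add: power2_eq_square[of "jump G p _ v _ _ _"])

lemma ghost_term_nonneg:
  "0 \<le> h ^ (2 * k - 1) / (fact k)\<^sup>2 * (LINT x:face G z i|surf. (jump G p k v z i x)\<^sup>2)"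
  using edge_pos by (intro mult_nonneg_nonneg divide_nonneg_nonneg set_integral_nonneg') auto

lemma ghost_energy_nonneg: "0 \<le> ghost_energy v F"
  unfolding ghost_energy_def by (intro sum_nonneg ghost_term_nonneg)

lemma cell_energy_nonneg: "0 \<le> cell_energy v z"
  unfolding cell_energy_def by (rule set_integral_nonneg') simp

lemma finite_ghost_faces: "finite (ghost_faces G)"
proof -
  have "ghost_faces G \<subseteq> active G \<times> UNIV" unfolding ghost_faces_def by auto
  then show ?thesis using finite_active finite_subset by (metis finite_SigmaI finite_class.finite_UNIV)
qed

lemma grad_prod_diag: "grad_prod G p S v v = (LINT x:S|lborel. (norm (grad G p v x))\<^sup>2)"
  unfolding grad_prod_def by (simp add: power2_norm_eq_inner)

lemma grad_sq_integrable:
  assumes "v \<in> FE G p" "S \<in> sets lborel" "S \<subseteq> dom G"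
  shows "set_integrable lborel S (\<lambda>x. (norm (grad G p v x))\<^sup>2)"
  using grad_integrable[OF assms(1,1,2,3)] by (simp add: power2_norm_eq_inner)

lemma N_norm_sq:
  assumes "0 \<le> \<gamma>"
  shows "(N_norm G p \<gamma> v)\<^sup>2 = grad_prod G p (dom G) v v + h * bdry_prod G (normal_deriv G p v) (normal_deriv G p v)
     + 1 / h * bdry_prod G v v + ghost_form G p \<gamma> v v"
    and "grad_prod G p (dom G) v v + ghost_form G p \<gamma> v v \<le> (N_norm G p \<gamma> v)\<^sup>2"
proof -
  have g: "0 \<le> grad_prod G p (dom G) v v" unfolding grad_prod_diag by (rule set_integral_nonneg') simp
  have b: "0 \<le> bdry_prod G f f" for f unfolding bdry_prod_def by (rule set_integral_nonneg') simp
  have gh: "0 \<le> ghost_form G p \<gamma> v v" unfolding ghost_form_eq using assms ghost_energy_nonneg by (intro mult_nonneg_nonneg sum_nonneg) auto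
  have b1: "0 \<le> h * bdry_prod G (normal_deriv G p v) (normal_deriv G p v)" "0 \<le> 1 / h * bdry_prod G v v"
    using b edge_pos by (intro mult_nonneg_nonneg; simp)+
  show 1: "(N_norm G p \<gamma> v)\<^sup>2 = grad_prod G p (dom G) v v + h * bdry_prod G (normal_deriv G p v) (normal_deriv G p v)
     + 1 / h * bdry_prod G v v + ghost_form G p \<gamma> v v"
    unfolding N_norm_def using g b1 gh by (intro real_sqrt_pow2) linarith
  show "grad_prod G p (dom G) v v + ghost_form G p \<gamma> v v \<le> (N_norm G p \<gamma> v)\<^sup>2"
    unfolding 1 using b1 by linarith
qed

lemma sum_cell_energy_le:
  assumes "v \<in> FE G p"
  shows "(\<Sum>z\<in>active G - cut G. cell_energy v z) \<le> grad_prod G p (dom G) v v"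
proof -
  let ?Z = "active G - cut G" and ?H = "\<lambda>z. {x. cell_index G x = z}"
  have sub: "?H z \<subseteq> dom G" if "z \<in> ?Z" for z
    using uncut_cell_subset[of z] that mem_cell_index by auto
  have meas: "?H z \<in> sets lborel" for z using hcell_borel by simp
  have "(\<Sum>z\<in>?Z. cell_energy v z) = (LINT x:(\<Union>z\<in>?Z. ?H z)|lborel. (norm (grad G p v x))\<^sup>2)"
    unfolding cell_energy_def
  proof (rule set_integral_finite_Union[symmetric])
    show "finite ?Z" using finite_active by simp
    show "disjoint_family_on ?H ?Z" by (auto simp: disjoint_family_on_def)
    show "set_integrable lborel (?H z) (\<lambda>x. (norm (grad G p v x))\<^sup>2)" if "z \<in> ?Z" for z
      by (rule grad_sq_integrable[OF assms meas sub[OF that]])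
    show "?H z \<in> sets lborel" if "z \<in> ?Z" for z by (rule meas)
  qed
  also have "\<dots> \<le> grad_prod G p (dom G) v v"
    unfolding grad_prod_diag
  proof (rule set_integral_subset_le)
    show "set_integrable lborel (dom G) (\<lambda>x. (norm (grad G p v x))\<^sup>2)"
      by (rule grad_sq_integrable[OF assms dom_finite(1) order.refl])
    show "(\<Union>z\<in>?Z. ?H z) \<in> sets lborel" using finite_active meas by (intro sets.finite_UN) auto
    show "(\<Union>z\<in>?Z. ?H z) \<subseteq> dom G" using sub by blast
  qed simp
  finally show ?thesis .
qed

subsection \<open>Locality\<close>

lemma patch_zero:
  assumes "w \<in> patch_space kd G p j" "cell_index G x \<in> active G" "vtx G j \<notin> cell G (cell_index G x)"
  shows "w x = 0" "grad G p w x = 0"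
proof -
  have z: "piece G p w (cell_index G x) = (\<lambda>x. 0)" by (rule patch_space_piece_zero[OF assms])
  have "w \<in> FE G p" using assms(1) unfolding patch_space_eq by blast
  from FE_eq_piece[OF this assms(2)] show "w x = 0" unfolding z .
  show "grad G p w x = 0" unfolding vec_eq_iff grad_nth z dir_deriv_zero by simp
qed

lemma jump_zero:
  assumes "w \<in> patch_space kd G p j" "(z, i) \<in> ghost_faces G" "vtx G j \<notin> cell G z" "vtx G j \<notin> cell G (z + axis i 1)"
  shows "jump G p k w z i x = 0"
  using patch_space_piece_zero[OF assms(1) _ assms(3)] patch_space_piece_zero[OF assms(1) _ assms(4)] ghost_facesD[OF assms(2)]
  by (simp add: jump_def dir_deriv_zero)

lemma vtx_mem_face_cells:
  assumes "vtx G j \<in> cell G z \<or> vtx G j \<in> cell G (z + axis i 1)"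
  shows "j $ l - 2 \<le> z $ l" "z $ l \<le> j $ l"
proof -
  have "(z + axis i 1) $ l = z $ l \<or> (z + axis i 1) $ l = z $ l + 1" by (simp add: axis_def)
  moreover have "z $ l = j $ l \<or> z $ l = j $ l - 1 \<or> (z + axis i 1) $ l = j $ l \<or> (z + axis i 1) $ l = j $ l - 1"
    using assms unfolding vtx_mem_cell by blast
  ultimately show "j $ l - 2 \<le> z $ l" "z $ l \<le> j $ l" by linarith+
qed

text \<open>The radius 2 is due to the ghost terms: two patches that share a cell have indices at
  distance at most 1, but a face couples the cells on both of its sides and adds 1.\<close>

lemma cut_form_local:
  assumes u: "u \<in> patch_space kd G p j" and w: "w \<in> patch_space kd G p k" and far: "k \<notin> int_nbhd j 2"
  shows "cut_form G p \<gamma> gD u w = 0"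
proof -
  obtain l where "\<not> \<bar>k $ l - j $ l\<bar> \<le> int 2" using far unfolding int_nbhd_def by blast
  then have l: "2 < \<bar>k $ l - j $ l\<bar>" by simp
  have sep: "vtx G j \<notin> cell G z \<or> vtx G k \<notin> cell G z" for z
  proof (rule ccontr)
    assume "\<not> ?thesis"
    then have "z $ l = j $ l \<or> z $ l = j $ l - 1" "z $ l = k $ l \<or> z $ l = k $ l - 1" unfolding vtx_mem_cell by blast+
    then show False using l by linarith
  qed
  have pt: "(u x = 0 \<and> grad G p u x = 0) \<or> (w x = 0 \<and> grad G p w x = 0)" if "cell_index G x \<in> active G" for x
    using sep[of "cell_index G x"] patch_zero[OF u that] patch_zero[OF w that] by blast
  have "grad_prod G p (dom G) u w = 0"
  proof -
    have "grad_prod G p (dom G) u w = (LINT x:dom G|lborel. 0)"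
      unfolding grad_prod_def using pt[OF cell_index_active]
      by (intro set_lebesgue_integral_cong dom_finite allI impI) fastforce
    then show ?thesis by simp
  qed
  moreover have bz: "bdry_prod G f g = 0" if "\<And>x. x \<in> bdry G \<Longrightarrow> f x * g x = 0" for f g
  proof -
    have "bdry_prod G f g = (LINT x:bdry G|surf. 0)"
      unfolding bdry_prod_def using that closed_bdry by (intro set_lebesgue_integral_cong) auto
    then show ?thesis by simp
  qed
  have "normal_deriv G p u x * w x = 0" "u x * normal_deriv G p w x = 0" "u x * w x = 0" if "x \<in> bdry G" for x
    using pt[OF cell_index_bdry[OF that]] unfolding normal_deriv_def by auto
  then have "bdry_prod G (normal_deriv G p u) w = 0" "bdry_prod G u (normal_deriv G p w) = 0" "bdry_prod G u w = 0"
    by (intro bz; simp)+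
  moreover have "ghost_form G p \<gamma> u w = 0"
  proof -
    have J0: "jump G p m u z i x * jump G p m w z i x = 0" if zi: "(z, i) \<in> ghost_faces G" for z i x m
    proof (rule ccontr)
      assume "\<not> ?thesis"
      then have "vtx G j \<in> cell G z \<or> vtx G j \<in> cell G (z + axis i 1)" "vtx G k \<in> cell G z \<or> vtx G k \<in> cell G (z + axis i 1)"
        using jump_zero[OF u zi] jump_zero[OF w zi] by auto
      from vtx_mem_face_cells[OF this(1), of l] vtx_mem_face_cells[OF this(2), of l] show False using l by linarith
    qed
    have "(\<Sum>(z, i)\<in>ghost_faces G. \<Sum>m=1..p. edge G ^ (2 * m - 1) / (fact m)\<^sup>2 *
        (LINT x:face G z i|surf. jump G p m u z i x * jump G p m w z i x)) = 0"
    proof (rule sum.neutral, clarify)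
      fix z i assume zi: "(z, i) \<in> ghost_faces G"
      show "(\<Sum>m=1..p. edge G ^ (2 * m - 1) / (fact m)\<^sup>2 *
        (LINT x:face G z i|surf. jump G p m u z i x * jump G p m w z i x)) = 0"
        unfolding J0[OF zi] by simp
    qed
    then show ?thesis unfolding ghost_form_def by simp
  qed
  ultimately show ?thesis unfolding cut_form_def nitsche_form_def by simp
qed

subsection \<open>Inverse estimate for patch functions\<close>

text \<open>The four summands belong to the four terms of \<open>N_norm\<close>: the patch lies in a
  cube of volume \<open>(2 * h) ^ CARD('a)\<close>, at most \<open>3 ^ CARD('a)\<close> cells touch
  the vertex, at most \<open>5 ^ CARD('a) * CARD('a)\<close> ghost faces see the patch, and the 4
  comes from squaring a jump between two bounded derivatives.\<close>

definition inverse_const :: real where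
  "inverse_const = (deriv_bound TYPE('a) p)\<^sup>2 *
     (real CARD('a) * 2 ^ CARD('a) + real CARD('a) * (3 ^ CARD('a) * surf_const) + 3 ^ CARD('a) * surf_const
      + 4 * real p * real CARD('a) * (5 ^ CARD('a) * surf_const))"

lemma inverse_const_pos: "0 < inverse_const"
proof -
  have "0 < deriv_bound TYPE('a) p" using deriv_bound(1)[OF degree_pos, where 'n = 'a] by linarith
  moreover have "0 < real CARD('a) * 2 ^ CARD('a)" by simp
  moreover have "0 \<le> real CARD('a) * (3 ^ CARD('a) * surf_const)" "0 \<le> 3 ^ CARD('a) * surf_const"
    "0 \<le> 4 * real p * real CARD('a) * (5 ^ CARD('a) * surf_const)"
    using surf_const_pos by auto
  ultimately show ?thesis
    unfolding inverse_const_def by (intro mult_pos_pos zero_less_power add_pos_nonneg) (assumption | simp)+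
qed

lemma piece_deriv_bound:
  assumes v: "v \<in> FE G p" and z: "z \<in> active G" and k: "k \<le> p" and m: "0 \<le> m"
    and nod: "\<And>y. y \<in> nodes G p \<Longrightarrow> y \<in> cell G z \<Longrightarrow> \<bar>v y\<bar> \<le> m"
    and x: "\<And>l. vtx G z $ l - h \<le> x $ l \<and> x $ l \<le> vtx G z $ l + 2 * h"
  shows "\<bar>dir_deriv k (axis i 1) (piece G p v z) x\<bar> \<le> deriv_bound TYPE('a) p * m / h ^ k"
proof (rule deriv_bound(2)[OF degree_pos piece_Qp(1)[OF v z] edge_pos k m _ x])
  fix \<tau> :: "'a \<Rightarrow> real" assume \<tau>: "\<tau> \<in> node_tuples p"
  note mem = vtx_scale_mem_cell[OF \<tau>, of z]
  show "\<bar>piece G p v z (vtx G z + h *\<^sub>R (\<chi> i. \<tau> i))\<bar> \<le> m"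
    unfolding piece_Qp(2)[OF v z mem] by (rule nod[OF cell_node[OF z \<tau>] mem])
qed

lemma mem_cell_enlarged: "x \<in> cell G z \<Longrightarrow> vtx G z $ l - h \<le> x $ l \<and> x $ l \<le> vtx G z $ l + 2 * h"
proof -
  assume "x \<in> cell G z"
  then have "vtx G z $ l \<le> x $ l" "x $ l \<le> vtx G z $ l + h" unfolding mem_cell by blast+
  then show ?thesis using edge_pos by linarith
qed

lemma power_dim_split: "h ^ CARD('a) = h ^ (CARD('a) - 2) * h\<^sup>2" "h ^ (CARD('a) - 1) = h ^ (CARD('a) - 2) * h"
proof -
  obtain d where d: "CARD('a) = d + 2" using dim2 by (metis add.commute le_Suc_ex)
  show "h ^ CARD('a) = h ^ (CARD('a) - 2) * h\<^sup>2" "h ^ (CARD('a) - 1) = h ^ (CARD('a) - 2) * h"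
    unfolding d by (simp_all add: power_add power2_eq_square)
qed

lemma surf_patch:
  "emeasure surf (bdry G \<inter> (\<Union>z\<in>{z\<in>active G. vtx G j \<in> cell G z}. cell G z)) \<le>
    ennreal (3 ^ CARD('a) * surf_const * h ^ (CARD('a) - 1))"
proof -
  let ?Z = "{z\<in>active G. vtx G j \<in> cell G z}"
  have fin: "finite ?Z" using finite_active by simp
  have sub: "?Z \<subseteq> int_nbhd j 1"
    unfolding int_nbhd_def
  proof (rule subsetI, rule CollectI, rule allI)
    fix z l assume "z \<in> ?Z"
    then have "z $ l = j $ l \<or> z $ l = j $ l - 1" unfolding vtx_mem_cell by blast
    then show "\<bar>z $ l - j $ l\<bar> \<le> int 1" by auto
  qed
  have card: "card ?Z \<le> 3 ^ CARD('a)" using card_mono[OF int_nbhd(1) sub] int_nbhd(2)[of j 1] by simp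
  have "bdry G \<inter> (\<Union>z\<in>?Z. cell G z) = (\<Union>z\<in>?Z. bdry G \<inter> cell G z)" by blast
  then have "emeasure surf (bdry G \<inter> (\<Union>z\<in>?Z. cell G z)) = emeasure surf (\<Union>z\<in>?Z. bdry G \<inter> cell G z)" by simp
  also have "\<dots> \<le> (\<Sum>z\<in>?Z. emeasure surf (bdry G \<inter> cell G z))"
    using closed_bdry closed_cell by (intro emeasure_subadditive_finite fin) auto
  also have "\<dots> \<le> (\<Sum>z\<in>?Z. ennreal (surf_const * h ^ (CARD('a) - 1)))" by (intro sum_mono surf_bdry_cell)
  also have "\<dots> = ennreal (real (card ?Z) * (surf_const * h ^ (CARD('a) - 1)))"
    using surf_const_pos edge_pos by (simp add: ennreal_mult' ennreal_of_nat_eq_real_of_nat)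
  also have "\<dots> \<le> ennreal (3 ^ CARD('a) * surf_const * h ^ (CARD('a) - 1))"
  proof (rule ennreal_leI)
    have "real (card ?Z) \<le> 3 ^ CARD('a)" using card by (metis of_nat_le_iff of_nat_numeral of_nat_power)
    then have "real (card ?Z) * (surf_const * h ^ (CARD('a) - 1)) \<le> 3 ^ CARD('a) * (surf_const * h ^ (CARD('a) - 1))"
      using surf_const_pos edge_pos by (intro mult_right_mono) auto
    then show "real (card ?Z) * (surf_const * h ^ (CARD('a) - 1)) \<le> 3 ^ CARD('a) * surf_const * h ^ (CARD('a) - 1)"
      by (simp only: mult.assoc)
  qed
  finally show ?thesis .
qed

text \<open>All four terms scale alike: a derivative of order \<open>k\<close> costs a factor
  \<open>1 / h ^ k\<close>, and the weights of the norm compensate this up to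
  \<open>h ^ (CARD('a) - 2)\<close>. Only upper bounds for volumes and areas occur, so the estimate
  is insensitive to the size of the cuts.\<close>

lemma patch_inverse_estimate:
  assumes w: "w \<in> patch_space kd G p j" and m: "0 \<le> m" "\<And>y. y \<in> nodes G p \<Longrightarrow> \<bar>w y\<bar> \<le> m"
    and \<gamma>: "0 \<le> \<gamma>" "\<gamma> \<le> 1"
  shows "(N_norm G p \<gamma> w)\<^sup>2 \<le> inverse_const * h ^ (CARD('a) - 2) * m\<^sup>2"
proof -
  let ?B = "deriv_bound TYPE('a) p" and ?d = "real CARD('a)" and ?e = "CARD('a) - 2"
  let ?Bm = "?B * m"
  have B: "1 \<le> ?B" by (rule deriv_bound(1)[OF degree_pos])
  have Bm: "0 \<le> ?Bm" using B m by simp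
  have wF: "w \<in> FE G p" using w unfolding patch_space_eq by blast
  have db: "\<bar>dir_deriv k (axis i 1) (piece G p w z) x\<bar> \<le> ?Bm / h ^ k" if "z \<in> active G" "k \<le> p" "x \<in> cell G z" for z k x i
    by (rule piece_deriv_bound[OF wF that(1,2) m(1)]) (use m(2) mem_cell_enlarged[OF that(3)] in blast)+
  have g: "(norm (grad G p w x))\<^sup>2 \<le> ?d * (?Bm / h)\<^sup>2" if "cell_index G x \<in> active G" for x
  proof -
    have "(grad G p w x $ i)\<^sup>2 \<le> (?Bm / h)\<^sup>2" for i
    proof -
      have "\<bar>grad G p w x $ i\<bar> \<le> ?Bm / h"
        using db[OF that degree_pos mem_cell_index, of i] unfolding grad_nth by simp
      then have "\<bar>grad G p w x $ i\<bar>\<^sup>2 \<le> (?Bm / h)\<^sup>2" by (intro power_mono) auto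
      then show ?thesis by simp
    qed
    then have "(\<Sum>i\<in>UNIV. (grad G p w x $ i)\<^sup>2) \<le> (\<Sum>i\<in>(UNIV :: 'a set). (?Bm / h)\<^sup>2)" by (intro sum_mono)
    moreover have "(norm (grad G p w x))\<^sup>2 = (\<Sum>i\<in>UNIV. (grad G p w x $ i)\<^sup>2)"
      by (simp only: power2_norm_eq_inner) (simp add: inner_vec_def power2_eq_square)
    ultimately show ?thesis by simp
  qed
  have val: "(w x)\<^sup>2 \<le> ?Bm\<^sup>2" if "cell_index G x \<in> active G" for x
  proof -
    have "\<bar>w x\<bar> \<le> ?Bm"
      using db[OF that _ mem_cell_index, of 0] FE_eq_piece[OF wF that] by (simp add: dir_deriv_0)
    then have "\<bar>w x\<bar>\<^sup>2 \<le> ?Bm\<^sup>2" by (intro power_mono) auto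
    then show ?thesis by simp
  qed
  have T1: "grad_prod G p (dom G) w w \<le> ?B\<^sup>2 * (?d * 2 ^ CARD('a)) * (h ^ ?e * m\<^sup>2)"
  proof -
    \<comment> \<open>Off this cube of edge \<open>2 * h\<close> around the vertex the gradient
      vanishes.\<close>
    let ?T = "cbox (vtx G j - (\<chi> i. h)) (vtx G j + (\<chi> i. h))"
    have "grad_prod G p (dom G) w w \<le> (?d * (?Bm / h)\<^sup>2) * measure lborel ?T"
      unfolding grad_prod_diag
    proof (rule set_integral_le_const)
      show "emeasure lborel ?T < \<infinity>" by (rule emeasure_lborel_cbox_finite)
      show "set_integrable lborel (dom G) (\<lambda>x. (norm (grad G p w x))\<^sup>2)"
        by (rule grad_sq_integrable[OF wF dom_finite(1) order.refl])
      show "(norm (grad G p w x))\<^sup>2 \<le> ?d * (?Bm / h)\<^sup>2" if "x \<in> dom G" "x \<in> ?T" for x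
        by (rule g[OF cell_index_active[OF that(1)]])
      show "(norm (grad G p w x))\<^sup>2 \<le> 0" if x: "x \<in> dom G" "x \<notin> ?T" for x
      proof -
        have "vtx G j \<notin> cell G (cell_index G x)"
        proof
          assume a: "vtx G j \<in> cell G (cell_index G x)"
          have "vtx G j $ i - h \<le> x $ i \<and> x $ i \<le> vtx G j $ i + h" for i
          proof -
            let ?v = "vtx G (cell_index G x) $ i"
            have "?v \<le> vtx G j $ i" "vtx G j $ i \<le> ?v + h" "?v \<le> x $ i" "x $ i \<le> ?v + h"
              using a mem_cell_index[of x] unfolding mem_cell by blast+
            then show ?thesis by linarith
          qed
          then show False using x(2) by (simp add: mem_box_cart)
        qed
        then show ?thesis using patch_zero(2)[OF w cell_index_active[OF x(1)]] by simp
      qed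
    qed auto
    also have "measure lborel ?T = (2 * h) ^ CARD('a)"
    proof (subst content_cbox_cart)
      show "?T \<noteq> {}" using edge_pos by (simp add: interval_ne_empty_cart)
    qed simp
    also have "?d * (?Bm / h)\<^sup>2 * (2 * h) ^ CARD('a) = ?B\<^sup>2 * (?d * 2 ^ CARD('a)) * (h ^ ?e * m\<^sup>2)"
      using edge_pos unfolding power_mult_distrib power_dim_split power_divide by simp
    finally show ?thesis .
  qed
  let ?Tb = "bdry G \<inter> (\<Union>z\<in>{z\<in>active G. vtx G j \<in> cell G z}. cell G z)"
  have Tb: "?Tb \<in> sets surf"
  proof -
    have "closed (\<Union>z\<in>{z\<in>active G. vtx G j \<in> cell G z}. cell G z)" using finite_active closed_cell by (intro closed_UN) auto
    then show ?thesis using closed_bdry by simp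
  qed
  have mTb: "measure surf ?Tb \<le> 3 ^ CARD('a) * surf_const * h ^ (CARD('a) - 1)"
    using surf_patch[of j] surf_const_pos edge_pos by (intro measure_le_of_emeasure) auto
  have bd: "bdry_prod G f f \<le> c * (3 ^ CARD('a) * surf_const * h ^ (CARD('a) - 1))"
    if f: "bounded_meas surf (bdry G) f" and c: "0 \<le> c" and le: "\<And>x. x \<in> bdry G \<Longrightarrow> (f x)\<^sup>2 \<le> c"
      and zero: "\<And>x. x \<in> bdry G \<Longrightarrow> vtx G j \<notin> cell G (cell_index G x) \<Longrightarrow> f x = 0" for f c
  proof -
    have "bdry_prod G f f \<le> c * measure surf ?Tb"
      unfolding bdry_prod_def
    proof (rule set_integral_le_const[OF Tb _ bdry_integrable[OF f f] c])
      show "emeasure surf ?Tb < \<infinity>" using surf_patch[of j] by (simp add: order_le_less_trans)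
      show "f x * f x \<le> c" if "x \<in> bdry G" for x using le[OF that] by (simp add: power2_eq_square)
      show "f x * f x \<le> 0" if x: "x \<in> bdry G" "x \<notin> ?Tb" for x
      proof -
        have "vtx G j \<notin> cell G (cell_index G x)" using x cell_index_bdry[OF x(1)] mem_cell_index by blast
        then show ?thesis using zero[OF x(1)] by simp
      qed
    qed
    also have "\<dots> \<le> c * (3 ^ CARD('a) * surf_const * h ^ (CARD('a) - 1))" using mTb c by (rule mult_left_mono)
    finally show ?thesis .
  qed
  have T2: "h * bdry_prod G (normal_deriv G p w) (normal_deriv G p w) \<le> ?B\<^sup>2 * (?d * (3 ^ CARD('a) * surf_const)) * (h ^ ?e * m\<^sup>2)"
  proof -
    have "bdry_prod G (normal_deriv G p w) (normal_deriv G p w) \<le> (?d * (?Bm / h)\<^sup>2) * (3 ^ CARD('a) * surf_const * h ^ (CARD('a) - 1))"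
    proof (rule bd[OF bounded_meas_normal_deriv[OF wF]])
      fix x assume x: "x \<in> bdry G"
      have "\<bar>normal_deriv G p w x\<bar> \<le> norm (grad G p w x) * norm (outward_normal (dom G) x)"
        unfolding normal_deriv_def by (rule Cauchy_Schwarz_ineq2)
      also have "\<dots> \<le> norm (grad G p w x) * 1"
        using norm_outward_normal_le[OF C2, of x] x unfolding bdry_def by (intro mult_left_mono) auto
      finally have "\<bar>normal_deriv G p w x\<bar>\<^sup>2 \<le> (norm (grad G p w x))\<^sup>2" by (intro power_mono) auto
      then show "(normal_deriv G p w x)\<^sup>2 \<le> ?d * (?Bm / h)\<^sup>2" using g[OF cell_index_bdry[OF x]] by simp
    next
      fix x assume "x \<in> bdry G" "vtx G j \<notin> cell G (cell_index G x)"
      then show "normal_deriv G p w x = 0" using patch_zero(2)[OF w cell_index_bdry] by (simp add: normal_deriv_def)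
    qed simp
    then have "h * bdry_prod G (normal_deriv G p w) (normal_deriv G p w) \<le> h * ((?d * (?Bm / h)\<^sup>2) * (3 ^ CARD('a) * surf_const * h ^ (CARD('a) - 1)))"
      using edge_pos by (intro mult_left_mono) auto
    also have "\<dots> = ?B\<^sup>2 * (?d * (3 ^ CARD('a) * surf_const)) * (h ^ ?e * m\<^sup>2)"
      using edge_pos unfolding power_mult_distrib power_dim_split power_divide by (simp add: power2_eq_square)
    finally show ?thesis .
  qed
  have T3: "1 / h * bdry_prod G w w \<le> ?B\<^sup>2 * (3 ^ CARD('a) * surf_const) * (h ^ ?e * m\<^sup>2)"
  proof -
    have "bdry_prod G w w \<le> ?Bm\<^sup>2 * (3 ^ CARD('a) * surf_const * h ^ (CARD('a) - 1))"
      by (rule bd[OF bounded_meas_trace[OF wF]])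
        (auto intro: val cell_index_bdry patch_zero(1)[OF w])
    then have "1 / h * bdry_prod G w w \<le> 1 / h * (?Bm\<^sup>2 * (3 ^ CARD('a) * surf_const * h ^ (CARD('a) - 1)))"
      using edge_pos by (intro mult_left_mono) auto
    also have "\<dots> = ?B\<^sup>2 * (3 ^ CARD('a) * surf_const) * (h ^ ?e * m\<^sup>2)"
      using edge_pos unfolding power_mult_distrib power_dim_split by simp
    finally show ?thesis .
  qed
  have T4: "ghost_form G p \<gamma> w w \<le> ?B\<^sup>2 * (4 * real p * ?d * (5 ^ CARD('a) * surf_const)) * (h ^ ?e * m\<^sup>2)"
  proof -
    let ?c = "real p * (4 * ?Bm\<^sup>2 * surf_const * h ^ ?e)"
    have c0: "0 \<le> ?c" using surf_const_pos edge_pos by simp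
    have E: "ghost_energy w F \<le> ?c" if F: "F \<in> ghost_faces G" for F
    proof -
      obtain z i where zi: "F = (z, i)" by (cases F)
      have act: "z \<in> active G" "z + axis i 1 \<in> active G" using ghost_facesD[of z i] F zi by auto
      have J: "jump G p k w z i \<in> Qp p" for k using jump_Qp[OF wF] F zi by blast
      have "h ^ (2 * k - 1) / (fact k)\<^sup>2 * (LINT x:face G z i|surf. (jump G p k w z i x)\<^sup>2) \<le> 4 * ?Bm\<^sup>2 * surf_const * h ^ ?e"
        if k: "k \<in> {1..p}" for k
      proof -
        have Jx: "(jump G p k w z i x)\<^sup>2 \<le> (2 * ?Bm / h ^ k)\<^sup>2" if "x \<in> face G z i" for x
        proof -
          have "\<bar>jump G p k w z i x\<bar> \<le> ?Bm / h ^ k + ?Bm / h ^ k"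
            unfolding jump_def using db[OF act(1), of k x i] db[OF act(2), of k x i] k that unfolding face_def
            by (intro order.trans[OF abs_triangle_ineq4 add_mono]) auto
          then have "\<bar>jump G p k w z i x\<bar> \<le> 2 * ?Bm / h ^ k" by (simp only: mult_2 add_divide_distrib)
          then have "\<bar>jump G p k w z i x\<bar>\<^sup>2 \<le> (2 * ?Bm / h ^ k)\<^sup>2" by (intro power_mono) auto
          then show ?thesis by simp
        qed
        have "(LINT x:face G z i|surf. (jump G p k w z i x)\<^sup>2) \<le> (2 * ?Bm / h ^ k)\<^sup>2 * measure surf (face G z i)"
        proof (rule set_integral_le_const)
          show "face G z i \<in> sets surf" using compact_face by (simp add: borel_compact)
          show "emeasure surf (face G z i) < \<infinity>" by (rule surf_face_finite)
          show "set_integrable surf (face G z i) (\<lambda>x. (jump G p k w z i x)\<^sup>2)"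
            using face_integrable[OF J J] by (simp add: power2_eq_square)
        qed (use Jx in auto)
        also have "\<dots> \<le> (2 * ?Bm / h ^ k)\<^sup>2 * (surf_const * h ^ (CARD('a) - 1))"
          using surf_face[of z i] surf_const_pos edge_pos by (intro mult_left_mono measure_le_of_emeasure) auto
        finally have I: "(LINT x:face G z i|surf. (jump G p k w z i x)\<^sup>2) \<le> (2 * ?Bm / h ^ k)\<^sup>2 * (surf_const * h ^ (CARD('a) - 1))" .
        \<comment> \<open>The weight cancels the powers of \<open>h\<close> from the squared jump
          except for \<open>1 / h\<close>, which lowers the area factor to
          \<open>h ^ (CARD('a) - 2)\<close>.\<close>
        have "h ^ (2 * k - 1) / (fact k)\<^sup>2 * (LINT x:face G z i|surf. (jump G p k w z i x)\<^sup>2)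
            \<le> h ^ (2 * k - 1) / 1 * ((2 * ?Bm / h ^ k)\<^sup>2 * (surf_const * h ^ (CARD('a) - 1)))"
        proof (rule mult_mono[OF _ I])
          have "(1 :: real) \<le> (fact k)\<^sup>2" by (simp add: one_le_power)
          then show "h ^ (2 * k - 1) / (fact k)\<^sup>2 \<le> h ^ (2 * k - 1) / 1" using edge_pos by (intro divide_left_mono) auto
        qed (use edge_pos in \<open>auto intro: set_integral_nonneg'\<close>)
        also have "\<dots> = 4 * ?Bm\<^sup>2 * surf_const * h ^ ?e"
        proof -
          have "Suc (2 * k - 1) = 2 * k" using k by simp
          then have "h ^ (2 * k - 1) * h = h ^ (2 * k)" by (metis power_Suc2)
          then have "h ^ (2 * k - 1) * h = (h ^ k)\<^sup>2" by (simp only: power_even_eq)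
          then have e: "h ^ (2 * k - 1) = (h ^ k)\<^sup>2 / h" using edge_pos by (simp add: eq_divide_eq)
          show ?thesis unfolding e power_dim_split using edge_pos by (simp add: power_divide power_mult_distrib)
        qed
        finally show ?thesis .
      qed
      then have "ghost_energy w F \<le> (\<Sum>k=1..p. 4 * ?Bm\<^sup>2 * surf_const * h ^ ?e)"
        unfolding ghost_energy_def zi fst_conv snd_conv by (intro sum_mono)
      then show ?thesis by simp
    qed
    \<comment> \<open>A face with first cell \<open>z\<close> sees the patch only if
      \<open>z\<close> is within index distance 2 of \<open>j\<close>; elsewhere the jumps
      vanish.\<close>
    let ?N = "ghost_faces G \<inter> (int_nbhd j 2 \<times> UNIV)"
    have finN: "finite ?N" using finite_ghost_faces by simp
    have "card ?N \<le> card (int_nbhd j 2 \<times> (UNIV :: 'a set))" by (intro card_mono finite_cartesian_product int_nbhd) auto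
    then have "card ?N \<le> 5 ^ CARD('a) * CARD('a)" by (simp add: card_cartesian_product int_nbhd)
    then have cardN: "real (card ?N) \<le> 5 ^ CARD('a) * ?d" by (metis of_nat_le_iff of_nat_mult of_nat_numeral of_nat_power)
    have zero: "ghost_energy w F = 0" if "F \<in> ghost_faces G - ?N" for F
    proof -
      obtain z i where zi: "F = (z, i)" by (cases F)
      have F: "(z, i) \<in> ghost_faces G" "z \<notin> int_nbhd j 2" using that zi by auto
      have "\<not> (vtx G j \<in> cell G z \<or> vtx G j \<in> cell G (z + axis i 1))"
      proof
        assume "vtx G j \<in> cell G z \<or> vtx G j \<in> cell G (z + axis i 1)"
        note near = vtx_mem_face_cells[OF this]
        have "\<bar>z $ l - j $ l\<bar> \<le> int 2" for l using near(1)[of l] near(2)[of l] by linarith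
        then show False using F(2) unfolding int_nbhd_def by blast
      qed
      then have "jump G p k w z i x = 0" for k x using jump_zero[OF w F(1)] by blast
      then show ?thesis unfolding ghost_energy_def zi by (simp add: set_lebesgue_integral_def)
    qed
    have "(\<Sum>F\<in>ghost_faces G. ghost_energy w F) = (\<Sum>F\<in>?N. ghost_energy w F)"
      using zero by (intro sum.mono_neutral_right finite_ghost_faces) auto
    also have "\<dots> \<le> (\<Sum>F\<in>?N. ?c)" using E by (intro sum_mono) auto
    also have "\<dots> = real (card ?N) * ?c" by simp
    also have "\<dots> \<le> (5 ^ CARD('a) * ?d) * ?c" using cardN c0 by (rule mult_right_mono)
    finally have S: "(\<Sum>F\<in>ghost_faces G. ghost_energy w F) \<le> (5 ^ CARD('a) * ?d) * ?c" .
    have "ghost_form G p \<gamma> w w \<le> 1 * (\<Sum>F\<in>ghost_faces G. ghost_energy w F)"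
      unfolding ghost_form_eq using \<gamma> ghost_energy_nonneg by (intro mult_right_mono sum_nonneg) auto
    then show ?thesis using S by (simp add: power_mult_distrib mult_ac)
  qed
  have "(N_norm G p \<gamma> w)\<^sup>2 \<le> ?B\<^sup>2 * (?d * 2 ^ CARD('a)) * (h ^ ?e * m\<^sup>2) + ?B\<^sup>2 * (?d * (3 ^ CARD('a) * surf_const)) * (h ^ ?e * m\<^sup>2)
      + ?B\<^sup>2 * (3 ^ CARD('a) * surf_const) * (h ^ ?e * m\<^sup>2) + ?B\<^sup>2 * (4 * real p * ?d * (5 ^ CARD('a) * surf_const)) * (h ^ ?e * m\<^sup>2)"
    unfolding N_norm_sq(1)[OF \<gamma>(1)] by (intro add_mono T1 T2 T3 T4)
  also have "\<dots> = inverse_const * h ^ ?e * m\<^sup>2"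
    unfolding inverse_const_def by (simp only: distrib_left distrib_right mult.assoc)
  finally show ?thesis .
qed

end

subsection \<open>A discrete Friedrichs inequality on the strip\<close>

definition face_const :: "'n::finite itself \<Rightarrow> nat \<Rightarrow> real" where
  "face_const _ p = (SOME c. 0 < c \<and> (\<forall>(q :: real ^ 'n \<Rightarrow> real) a h i0 f x. q \<in> Qp p \<longrightarrow> 0 < h \<longrightarrow> a $ i0 \<le> f \<longrightarrow>
       f \<le> a $ i0 + h \<longrightarrow> x $ i0 = f \<longrightarrow> (\<forall>i. a $ i \<le> x $ i \<and> x $ i \<le> a $ i + h) \<longrightarrow>
       c * h ^ (CARD('n) - 1) * (q x)\<^sup>2 \<le>
         (LINT x:{x. x $ i0 = f \<and> (\<forall>i. a $ i \<le> x $ i \<and> x $ i \<le> a $ i + h)}|surf. (q x)\<^sup>2)))"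

lemma face_const:
  assumes "1 \<le> p" "2 \<le> CARD('n::finite)"
  shows "0 < face_const TYPE('n) p"
    "\<And>(q :: real ^ 'n \<Rightarrow> real) a h i0 f x. \<lbrakk>q \<in> Qp p; 0 < h; a $ i0 \<le> f; f \<le> a $ i0 + h;
       x $ i0 = f; \<And>i. a $ i \<le> x $ i \<and> x $ i \<le> a $ i + h\<rbrakk> \<Longrightarrow>
       face_const TYPE('n) p * h ^ (CARD('n) - 1) * (q x)\<^sup>2 \<le>
         (LINT x:{x. x $ i0 = f \<and> (\<forall>i. a $ i \<le> x $ i \<and> x $ i \<le> a $ i + h)}|surf. (q x)\<^sup>2)"
proof -
  let ?P = "\<lambda>c. 0 < c \<and> (\<forall>(q :: real ^ 'n \<Rightarrow> real) a h i0 f x. q \<in> Qp p \<longrightarrow> 0 < h \<longrightarrow> a $ i0 \<le> f \<longrightarrow>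
       f \<le> a $ i0 + h \<longrightarrow> x $ i0 = f \<longrightarrow> (\<forall>i. a $ i \<le> x $ i \<and> x $ i \<le> a $ i + h) \<longrightarrow>
       c * h ^ (CARD('n) - 1) * (q x)\<^sup>2 \<le>
         (LINT x:{x. x $ i0 = f \<and> (\<forall>i. a $ i \<le> x $ i \<and> x $ i \<le> a $ i + h)}|surf. (q x)\<^sup>2))"
  have "\<exists>c. ?P c"
    by (rule face_integral_ge[OF assms], rule exI, rule conjI, assumption) blast
  then have *: "?P (face_const TYPE('n) p)" unfolding face_const_def by (rule someI_ex)
  then show "0 < face_const TYPE('n) p" by blast
  show "face_const TYPE('n) p * h ^ (CARD('n) - 1) * (q x)\<^sup>2 \<le>
         (LINT x:{x. x $ i0 = f \<and> (\<forall>i. a $ i \<le> x $ i \<and> x $ i \<le> a $ i + h)}|surf. (q x)\<^sup>2)"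
    if "q \<in> Qp p" "0 < h" "a $ i0 \<le> f" "f \<le> a $ i0 + h" "x $ i0 = f" "\<And>i. a $ i \<le> x $ i \<and> x $ i \<le> a $ i + h"
    for q :: "real ^ 'n \<Rightarrow> real" and a h i0 f x
    using * that by blast
qed

definition cell_const :: "'n::finite itself \<Rightarrow> nat \<Rightarrow> real" where
  "cell_const _ p = (SOME c. 0 < c \<and> (\<forall>(q :: real ^ 'n \<Rightarrow> real) a h S x. q \<in> Qp p \<longrightarrow> 0 < h \<longrightarrow>
       (\<forall>i. a $ i \<le> x $ i \<and> x $ i \<le> a $ i + h) \<longrightarrow> box a (a + (\<chi> i. h)) \<subseteq> S \<longrightarrow>
       set_integrable lborel S (\<lambda>x. (q x)\<^sup>2) \<longrightarrow>
       c * h ^ CARD('n) * (q x)\<^sup>2 \<le> (LINT x:S|lborel. (q x)\<^sup>2)))"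

lemma cell_const:
  assumes "1 \<le> p"
  shows "0 < cell_const TYPE('n::finite) p"
    "\<And>(q :: real ^ 'n \<Rightarrow> real) a h S x. \<lbrakk>q \<in> Qp p; 0 < h; \<And>i. a $ i \<le> x $ i \<and> x $ i \<le> a $ i + h;
       box a (a + (\<chi> i. h)) \<subseteq> S; set_integrable lborel S (\<lambda>x. (q x)\<^sup>2)\<rbrakk> \<Longrightarrow>
       cell_const TYPE('n) p * h ^ CARD('n) * (q x)\<^sup>2 \<le> (LINT x:S|lborel. (q x)\<^sup>2)"
proof -
  let ?P = "\<lambda>c. 0 < c \<and> (\<forall>(q :: real ^ 'n \<Rightarrow> real) a h S x. q \<in> Qp p \<longrightarrow> 0 < h \<longrightarrow>
       (\<forall>i. a $ i \<le> x $ i \<and> x $ i \<le> a $ i + h) \<longrightarrow> box a (a + (\<chi> i. h)) \<subseteq> S \<longrightarrow>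
       set_integrable lborel S (\<lambda>x. (q x)\<^sup>2) \<longrightarrow>
       c * h ^ CARD('n) * (q x)\<^sup>2 \<le> (LINT x:S|lborel. (q x)\<^sup>2))"
  have "\<exists>c. ?P c"
    by (rule cell_integral_ge[OF assms], rule exI, rule conjI, assumption) blast
  then have *: "?P (cell_const TYPE('n) p)" unfolding cell_const_def by (rule someI_ex)
  then show "0 < cell_const TYPE('n) p" by blast
  show "cell_const TYPE('n) p * h ^ CARD('n) * (q x)\<^sup>2 \<le> (LINT x:S|lborel. (q x)\<^sup>2)"
    if "q \<in> Qp p" "0 < h" "\<And>i. a $ i \<le> x $ i \<and> x $ i \<le> a $ i + h"
       "box a (a + (\<chi> i. h)) \<subseteq> S" "set_integrable lborel S (\<lambda>x. (q x)\<^sup>2)"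
    for q :: "real ^ 'n \<Rightarrow> real" and a h S x
    using * that by blast
qed

section \<open>Propagation of bounds from cell to cell\<close>

definition adjacent :: "int ^ 'n::finite \<Rightarrow> int ^ 'n \<Rightarrow> bool" where
  "adjacent a b \<longleftrightarrow> (\<exists>i. b = a + axis i 1 \<or> a = b + axis i 1)"

text \<open>In units of \<open>s\<close>, the bound reached after \<open>n\<close> steps from
  \<open>m\<close> to \<open>C * (m + s)\<close>, starting at 0.\<close>

fun chain_const :: "real \<Rightarrow> nat \<Rightarrow> real" where
  "chain_const C 0 = 0"
| "chain_const C (Suc n) = C * (chain_const C n + 1)"

lemma chain_const_mono:
  assumes "1 \<le> C"
  shows "0 \<le> chain_const C n" "m \<le> n \<Longrightarrow> chain_const C m \<le> chain_const C n"
proof -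
  show nn: "0 \<le> chain_const C n" for n using assms by (induction n) auto
  have step: "chain_const C n \<le> chain_const C (Suc n)" for n
  proof -
    have "1 * chain_const C n \<le> C * (chain_const C n + 1)"
      using assms nn[of n] by (intro mult_mono) auto
    then show ?thesis by simp
  qed
  show "m \<le> n \<Longrightarrow> chain_const C m \<le> chain_const C n" by (rule lift_Suc_mono_le[of "chain_const C"]) (rule step)
qed

text \<open>No path is constructed: the set of cells already bounded is enlarged by an adjacent cell
  until it is all of \<open>Z\<close>, which takes fewer than \<open>card Z\<close> steps. Hence the
  constant depends on the number of cells and not on the shape of the chain.\<close>

lemma chain_bound:
  fixes B :: "'z \<Rightarrow> real \<Rightarrow> bool"
  assumes fin: "finite Z" and z0: "z0 \<in> Z" "B z0 0" and C: "1 \<le> C" and s: "0 \<le> s"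
    and weaken: "\<And>z m m'. B z m \<Longrightarrow> m \<le> m' \<Longrightarrow> B z m'"
    and step: "\<And>a b m. a \<in> Z \<Longrightarrow> b \<in> Z \<Longrightarrow> adj a b \<Longrightarrow> 0 \<le> m \<Longrightarrow> B a m \<Longrightarrow> B b (C * (m + s))"
    and conn: "\<And>T. T \<subseteq> Z \<Longrightarrow> T \<noteq> {} \<Longrightarrow> T \<noteq> Z \<Longrightarrow> \<exists>a\<in>T. \<exists>b\<in>Z - T. adj a b"
    and z: "z \<in> Z" and n: "card Z \<le> n"
  shows "B z (chain_const C n * s)"
proof -
  have "k < card Z \<Longrightarrow> \<exists>T. T \<subseteq> Z \<and> card T = Suc k \<and> (\<forall>z\<in>T. B z (chain_const C k * s))" for k
  proof (induction k)
    case 0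
    then show ?case using z0 by (intro exI[of _ "{z0}"]) auto
  next
    case (Suc k)
    then obtain T where T: "T \<subseteq> Z" "card T = Suc k" "\<forall>z\<in>T. B z (chain_const C k * s)" by auto
    have "T \<noteq> {}" "T \<noteq> Z" using T Suc.prems by auto
    then obtain a b where ab: "a \<in> T" "b \<in> Z" "b \<notin> T" "adj a b" using conn[OF T(1)] by blast
    have "B b (C * (chain_const C k * s + s))"
      using ab T chain_const_mono(1)[OF C, of k] s by (intro step[of a]) auto
    then have b: "B b (chain_const C (Suc k) * s)" by (simp add: algebra_simps)
    have "chain_const C k * s \<le> chain_const C (Suc k) * s"
      using chain_const_mono(2)[OF C, of k "Suc k"] s by (intro mult_right_mono) auto
    then have "\<forall>z\<in>insert b T. B z (chain_const C (Suc k) * s)" using b T(3) weaken by blast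
    moreover have "card (insert b T) = Suc (Suc k)" using ab T fin finite_subset by (metis card_insert_disjoint)
    ultimately show ?case using ab T by (intro exI[of _ "insert b T"]) auto
  qed
  moreover have "card Z - 1 < card Z" using fin z by (metis card_gt_0_iff diff_less empty_iff zero_less_one)
  ultimately obtain T where T: "T \<subseteq> Z" "card T = Suc (card Z - 1)" "\<forall>z\<in>T. B z (chain_const C (card Z - 1) * s)" by blast
  then have "card T = card Z" using \<open>card Z - 1 < card Z\<close> by simp
  then have "T = Z" using card_subset_eq[OF fin T(1)] by simp
  then have "B z (chain_const C (card Z - 1) * s)" using T z by blast
  moreover have "chain_const C (card Z - 1) * s \<le> chain_const C n * s"
    using n s by (intro mult_right_mono chain_const_mono(2)[OF C]) auto
  ultimately show ?thesis using weaken by blast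
qed

context cut_domain
begin

definition cell_bound :: "(real ^ 'a \<Rightarrow> real) \<Rightarrow> int ^ 'a \<Rightarrow> real \<Rightarrow> bool" where
  "cell_bound v z m \<longleftrightarrow> (\<forall>x\<in>cell G z. \<bar>v x\<bar> \<le> m)"

text \<open>One constant for both kinds of step. The summands stand for extrapolation from the old
  cell, the Taylor sum across a ghost face and the gradient on an uncut cell.\<close>

definition step_const :: real where
  "step_const = deriv_bound TYPE('a) p + real p / sqrt (face_const TYPE('a) p) + 2 * real CARD('a) / sqrt (cell_const TYPE('a) p) + 1"

lemma step_const:
  "1 \<le> step_const" "deriv_bound TYPE('a) p \<le> step_const" "real p / sqrt (face_const TYPE('a) p) \<le> step_const"
  "2 * real CARD('a) / sqrt (cell_const TYPE('a) p) \<le> step_const"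
proof -
  have "1 \<le> deriv_bound TYPE('a) p" by (rule deriv_bound(1)[OF degree_pos])
  moreover have "0 \<le> real p / sqrt (face_const TYPE('a) p)" "0 \<le> 2 * real CARD('a) / sqrt (cell_const TYPE('a) p)"
    using face_const(1)[OF degree_pos dim2] cell_const(1)[OF degree_pos, where 'n = 'a] by auto
  ultimately show "1 \<le> step_const" "deriv_bound TYPE('a) p \<le> step_const" "real p / sqrt (face_const TYPE('a) p) \<le> step_const"
    "2 * real CARD('a) / sqrt (cell_const TYPE('a) p) \<le> step_const"
    unfolding step_const_def by linarith+
qed

lemma vtx_shift: "vtx G (z + axis i 1) $ l = vtx G z $ l + (if l = i then h else 0)"
  by (simp add: vtx_nth axis_def algebra_simps)

lemma adjacent_enlarged:
  assumes "adjacent a b" "x \<in> cell G b"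
  shows "vtx G a $ l - h \<le> x $ l \<and> x $ l \<le> vtx G a $ l + 2 * h"
proof -
  obtain i where "b = a + axis i 1 \<or> a = b + axis i 1" using assms(1) unfolding adjacent_def by blast
  then have "vtx G b $ l = vtx G a $ l \<or> vtx G b $ l = vtx G a $ l + h \<or> vtx G b $ l = vtx G a $ l - h"
    using vtx_shift[of a i l] vtx_shift[of b i l] by (auto split: if_splits)
  moreover have "vtx G b $ l \<le> x $ l" "x $ l \<le> vtx G b $ l + h" using assms(2) unfolding mem_cell by blast+
  ultimately show ?thesis using edge_pos by auto
qed

text \<open>
  Across a ghost face the two polynomials differ by their normal Taylor expansion, whose
  coefficients are the penalised jumps.
\<close>

lemma ghost_step:
  assumes v: "v \<in> FE G p" and F: "(z, i) \<in> ghost_faces G" and ab: "(a = z \<and> b = z + axis i 1) \<or> (b = z \<and> a = z + axis i 1)"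
    and m: "0 \<le> m" "cell_bound v a m" and s: "0 \<le> s" "ghost_energy v (z, i) \<le> s\<^sup>2 * h ^ (CARD('a) - 2)"
  shows "cell_bound v b (step_const * (m + s))"
  unfolding cell_bound_def
proof
  fix y assume y: "y \<in> cell G b"
  let ?c = "face_const TYPE('a) p" and ?e = "CARD('a) - 2"
  have c: "0 < ?c" by (rule face_const(1)[OF degree_pos dim2])
  have act: "z \<in> active G" "z + axis i 1 \<in> active G" using ghost_facesD[OF F] by auto
  have acta: "a \<in> active G" "b \<in> active G" "adjacent a b" using ab act unfolding adjacent_def by auto
  let ?q1 = "piece G p v z" and ?q2 = "piece G p v (z + axis i 1)"
  note q1 = piece_Qp[OF v act(1)] and q2 = piece_Qp[OF v act(2)]
  define dq where "dq = (\<lambda>x. 1 * ?q2 x + (-1) * ?q1 x)"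
  have dqQ: "dq \<in> Qp p" unfolding dq_def by (intro Qp_add Qp_scale q1 q2)
  have dqJ: "dir_deriv k (axis i 1) dq x = jump G p k v z i x" for k x
    unfolding dq_def dir_deriv_linear[OF q2(1) q1(1)] jump_def by simp
  define f where "f = vtx G z $ i + h"
  \<comment> \<open>The orthogonal projection of \<open>y\<close> to the plane of the face; the
    expansion runs from \<open>x\<close> to \<open>y\<close> in the normal direction.\<close>
  define x where "x = (\<chi> l. if l = i then f else y $ l)"
  define t where "t = y $ i - f"
  have yx: "y = x + t *\<^sub>R axis i 1" by (simp add: vec_eq_iff x_def t_def axis_def)
  have yb: "vtx G b $ l \<le> y $ l" "y $ l \<le> vtx G b $ l + h" for l using y unfolding mem_cell by blast+
  have vb: "vtx G b $ l = vtx G z $ l" if "l \<noteq> i" for l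
    using ab vtx_shift[of z i l] that by auto
  have vbi: "vtx G b $ i = vtx G z $ i \<or> vtx G b $ i = vtx G z $ i + h"
    using ab vtx_shift[of z i i] by auto
  have xz: "vtx G z $ l \<le> x $ l \<and> x $ l \<le> vtx G z $ l + h" for l
    using yb[of l] vb[of l] edge_pos by (auto simp: x_def f_def)
  have xf: "x \<in> face G z i" unfolding face_eq using xz by (simp add: x_def f_def)
  have t: "\<bar>t\<bar> \<le> h" using yb[of i] vbi unfolding t_def f_def by auto
  \<comment> \<open>Up to one factor \<open>h\<close>, the weight of the \<open>k\<close>-th jump in
    the ghost energy is the square of the Taylor factor \<open>h ^ k / fact k\<close>.\<close>
  have trm: "\<bar>t ^ k / fact k * dir_deriv k (axis i 1) dq x\<bar> \<le> s / sqrt ?c" if k: "k \<in> {1..p}" for k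
  proof -
    let ?I = "LINT x:face G z i|surf. (jump G p k v z i x)\<^sup>2"
    have I: "?c * h ^ (CARD('a) - 1) * (jump G p k v z i x)\<^sup>2 \<le> ?I"
      unfolding face_eq f_def[symmetric]
      using xz edge_pos by (intro face_const(2)[OF degree_pos dim2 jump_Qp[OF v F] edge_pos]) (auto simp: f_def x_def)
    have "h ^ (2 * k - 1) / (fact k)\<^sup>2 * ?I \<le> ghost_energy v (z, i)"
      unfolding ghost_energy_def fst_conv snd_conv using k by (intro member_le_sum ghost_term_nonneg) auto
    then have E: "h ^ (2 * k - 1) / (fact k)\<^sup>2 * ?I \<le> s\<^sup>2 * h ^ ?e" using s(2) by linarith
    have "h ^ (2 * k - 1) / (fact k)\<^sup>2 * (?c * h ^ (CARD('a) - 1) * (jump G p k v z i x)\<^sup>2) \<le> s\<^sup>2 * h ^ ?e"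
      using I edge_pos by (intro order.trans[OF mult_left_mono E]) auto
    moreover have "h ^ (2 * k - 1) / (fact k)\<^sup>2 * (?c * h ^ (CARD('a) - 1) * (jump G p k v z i x)\<^sup>2)
        = (?c * (h ^ k / fact k * jump G p k v z i x)\<^sup>2) * h ^ ?e"
    proof -
      have "Suc (2 * k - 1) = 2 * k" using k by simp
      then have "h ^ (2 * k - 1) * h = h ^ (2 * k)" by (metis power_Suc2)
      then have e: "h ^ (2 * k - 1) * h = (h ^ k)\<^sup>2" by (simp only: power_even_eq)
      have "h ^ (2 * k - 1) / (fact k)\<^sup>2 * (?c * h ^ (CARD('a) - 1) * (jump G p k v z i x)\<^sup>2)
          = (h ^ (2 * k - 1) * h) / (fact k)\<^sup>2 * (?c * h ^ ?e * (jump G p k v z i x)\<^sup>2)"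
        unfolding power_dim_split(2) by simp
      also have "\<dots> = (?c * (h ^ k / fact k * jump G p k v z i x)\<^sup>2) * h ^ ?e"
        unfolding e by (simp add: power_mult_distrib power_divide)
      finally show ?thesis .
    qed
    ultimately have "(?c * (h ^ k / fact k * jump G p k v z i x)\<^sup>2) * h ^ ?e \<le> s\<^sup>2 * h ^ ?e" by simp
    then have "?c * (h ^ k / fact k * jump G p k v z i x)\<^sup>2 \<le> s\<^sup>2"
      using edge_pos by (simp add: mult_le_cancel_right)
    then have "(sqrt ?c * (h ^ k / fact k * \<bar>jump G p k v z i x\<bar>))\<^sup>2 \<le> s\<^sup>2"
      unfolding power_mult_distrib power2_abs using c by simp
    then have "sqrt ?c * (h ^ k / fact k * \<bar>jump G p k v z i x\<bar>) \<le> s" using s(1) by (rule power2_le_imp_le)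
    then have 1: "h ^ k / fact k * \<bar>jump G p k v z i x\<bar> \<le> s / sqrt ?c" using c by (simp add: pos_le_divide_eq mult.commute)
    have "\<bar>t ^ k / fact k * dir_deriv k (axis i 1) dq x\<bar> = \<bar>t\<bar> ^ k / fact k * \<bar>jump G p k v z i x\<bar>"
      unfolding dqJ by (simp add: abs_mult power_abs)
    also have "\<dots> \<le> h ^ k / fact k * \<bar>jump G p k v z i x\<bar>"
      using t by (intro mult_right_mono divide_right_mono power_mono) auto
    finally show ?thesis using 1 by linarith
  qed
  have dq0: "dq x = 0"
  proof -
    have "x \<in> cell G z" "x \<in> cell G (z + axis i 1)" using xf unfolding face_def by auto
    then show ?thesis using q1(2) q2(2) by (simp add: dq_def)
  qed
  have "dq y = (\<Sum>k\<le>p. t ^ k / fact k * dir_deriv k (axis i 1) dq x)" unfolding yx by (rule Qp_taylor[OF dqQ])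
  \<comment> \<open>The term of order 0 vanishes since both polynomials agree with \<open>v\<close>
    on the face.\<close>
  also have "\<dots> = (\<Sum>k\<in>{1..p}. t ^ k / fact k * dir_deriv k (axis i 1) dq x)"
  proof (rule sum.mono_neutral_right)
    show "\<forall>k\<in>{..p} - {1..p}. t ^ k / fact k * dir_deriv k (axis i 1) dq x = 0"
    proof
      fix k assume "k \<in> {..p} - {1..p}"
      then have "k = 0" by auto
      then show "t ^ k / fact k * dir_deriv k (axis i 1) dq x = 0" using dq0 by (simp add: dir_deriv_0)
    qed
  qed auto
  finally have dqs: "dq y = (\<Sum>k\<in>{1..p}. t ^ k / fact k * dir_deriv k (axis i 1) dq x)" .
  have "\<bar>dq y\<bar> \<le> (\<Sum>k\<in>{1..p}. s / sqrt ?c)" unfolding dqs by (rule order.trans[OF sum_abs sum_mono[OF trm]])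
  then have dqy: "\<bar>dq y\<bar> \<le> real p / sqrt ?c * s" by simp
  \<comment> \<open>The polynomial of \<open>a\<close> is extrapolated to the neighbouring cell by
    the derivative bound of order 0 on the enlarged cell.\<close>
  have "\<bar>dir_deriv 0 (axis i 1) (piece G p v a) y\<bar> \<le> deriv_bound TYPE('a) p * m / h ^ 0"
    using m(2) adjacent_enlarged[OF acta(3) y] unfolding cell_bound_def
    by (intro piece_deriv_bound[OF v acta(1) _ m(1)]) auto
  then have "\<bar>piece G p v a y\<bar> \<le> deriv_bound TYPE('a) p * m" by (simp add: dir_deriv_0)
  moreover have "\<bar>piece G p v b y - piece G p v a y\<bar> = \<bar>dq y\<bar>"
    using ab by (elim disjE conjE) (simp_all add: dq_def abs_minus_commute)
  moreover have "piece G p v b y = v y" by (rule piece_Qp(2)[OF v acta(2) y])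
  ultimately have "\<bar>v y\<bar> \<le> deriv_bound TYPE('a) p * m + real p / sqrt ?c * s" using dqy by linarith
  also have "\<dots> \<le> step_const * m + step_const * s"
    using m(1) s(1) by (intro add_mono mult_right_mono step_const)
  finally show "\<bar>v y\<bar> \<le> step_const * (m + s)" by (simp add: distrib_left)
qed

text \<open>An uncut cell lies in the domain, so its gradient energy controls the gradient of the
  polynomial pointwise; the resulting Lipschitz bound transports the estimate from a point shared
  with \<open>a\<close>.\<close>

lemma uncut_step:
  assumes v: "v \<in> FE G p" and b: "b \<in> active G" "b \<notin> cut G" and ab: "adjacent a b"
    and m: "0 \<le> m" "cell_bound v a m" and s: "0 \<le> s" "cell_energy v b \<le> s\<^sup>2 * h ^ (CARD('a) - 2)"
  shows "cell_bound v b (step_const * (m + s))"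
  unfolding cell_bound_def
proof
  fix y assume y: "y \<in> cell G b"
  let ?c = "cell_const TYPE('a) p" and ?e = "CARD('a) - 2" and ?q = "piece G p v b"
  have c: "0 < ?c" by (rule cell_const(1)[OF degree_pos])
  note q = piece_Qp[OF v b(1)]
  \<comment> \<open>The lower corner of the upper cell belongs to both.\<close>
  obtain w where w: "w \<in> cell G a" "w \<in> cell G b"
  proof -
    obtain i where "b = a + axis i 1 \<or> a = b + axis i 1" using ab unfolding adjacent_def by blast
    then show ?thesis
    proof (elim disjE)
      assume b: "b = a + axis i 1"
      have "vtx G b \<in> cell G a" "vtx G b \<in> cell G b" unfolding mem_cell b vtx_shift using edge_pos by auto
      then show ?thesis by (rule that)
    next
      assume a: "a = b + axis i 1"
      have "vtx G a \<in> cell G a" "vtx G a \<in> cell G b" unfolding mem_cell a vtx_shift using edge_pos by auto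
      then show ?thesis by (rule that)
    qed
  qed
  let ?H = "{x. cell_index G x = b}"
  have Hd: "?H \<subseteq> dom G" using uncut_cell_subset[OF b] mem_cell_index by auto
  have Hb: "?H \<in> sets lborel" using hcell_borel by simp
  have boxH: "box (vtx G b) (vtx G b + (\<chi> i. h)) \<subseteq> ?H"
    using box_cell_unique mem_cell_index by blast
  have G: "\<bar>dir_deriv 1 (axis i 1) ?q x\<bar> \<le> s / (sqrt ?c * h)" if x: "x \<in> cell G b" for x i
  proof -
    let ?g = "dir_deriv 1 (axis i 1) ?q"
    have gQ: "?g \<in> Qp p" by (rule Qp_dir_deriv[OF q(1)])
    have int: "set_integrable lborel ?H (\<lambda>x. (?g x)\<^sup>2)"
    proof (rule bounded_meas_integrable[OF Hb])
      have "emeasure lborel ?H \<le> emeasure lborel (dom G)" using Hd dom_finite(1) by (rule emeasure_mono)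
      then show "emeasure lborel ?H < \<infinity>" using dom_finite(2) by (rule order_le_less_trans)
      have "bounded_meas lborel ?H ?g"
        using b(1) gQ Hb by (intro bounded_meas_piecewise[where F = "\<lambda>_. ?g"]) auto
      from bounded_meas_mult[OF this this] show "bounded_meas lborel ?H (\<lambda>x. (?g x)\<^sup>2)" by (simp add: power2_eq_square)
    qed
    have "?c * h ^ CARD('a) * (?g x)\<^sup>2 \<le> (LINT x:?H|lborel. (?g x)\<^sup>2)"
      using x unfolding mem_cell by (intro cell_const(2)[OF degree_pos gQ edge_pos _ boxH int]) blast
    also have "\<dots> \<le> cell_energy v b"
      unfolding cell_energy_def set_lebesgue_integral_def
    proof (rule integral_mono)
      show "integrable lborel (\<lambda>x. indicator ?H x *\<^sub>R (?g x)\<^sup>2)" using int by (simp add: set_integrable_def)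
      show "integrable lborel (\<lambda>x. indicator ?H x *\<^sub>R (norm (grad G p v x))\<^sup>2)"
        using grad_sq_integrable[OF v Hb Hd] by (simp add: set_integrable_def)
      fix x
      show "indicator ?H x *\<^sub>R (?g x)\<^sup>2 \<le> indicator ?H x *\<^sub>R (norm (grad G p v x))\<^sup>2"
      proof (cases "x \<in> ?H")
        case True
        then have "?g x = grad G p v x $ i" by (simp add: grad_nth)
        then have "\<bar>?g x\<bar> \<le> norm (grad G p v x)" using component_le_norm_cart[of "grad G p v x" i] by simp
        then have "\<bar>?g x\<bar>\<^sup>2 \<le> (norm (grad G p v x))\<^sup>2" by (intro power_mono) auto
        then show ?thesis by (simp add: indicator_def)
      qed simp
    qed
    also note s(2)
    finally have "(?c * (h\<^sup>2 * (?g x)\<^sup>2)) * h ^ ?e \<le> s\<^sup>2 * h ^ ?e" unfolding power_dim_split(1) by (simp add: mult_ac)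
    then have "?c * (h\<^sup>2 * (?g x)\<^sup>2) \<le> s\<^sup>2" using edge_pos by (simp add: mult_le_cancel_right)
    then have "(sqrt ?c * h * \<bar>?g x\<bar>)\<^sup>2 \<le> s\<^sup>2" using c by (simp add: power_mult_distrib)
    then have "sqrt ?c * h * \<bar>?g x\<bar> \<le> s" using s(1) by (rule power2_le_imp_le)
    then show ?thesis using c edge_pos by (simp add: pos_le_divide_eq mult.commute)
  qed
  have "\<bar>?q y - ?q w\<bar> \<le> real CARD('a) * (s / (sqrt ?c * h)) * norm (y - w)"
    by (rule Qp_lipschitz[OF q(1) convex_cell y w(2) G])
  also have "\<dots> \<le> real CARD('a) * (s / (sqrt ?c * h)) * (2 * h)"
  proof (rule mult_left_mono)
    have "norm (y - w) \<le> sqrt (real CARD('a)) * h" by (rule dist_in_cell[OF y w(2)])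
    also have "\<dots> \<le> 2 * h" using sqrt_dim(2) edge_pos by (intro mult_right_mono) auto
    finally show "norm (y - w) \<le> 2 * h" .
    show "0 \<le> real CARD('a) * (s / (sqrt ?c * h))" using s(1) c edge_pos by simp
  qed
  also have "\<dots> = 2 * real CARD('a) / sqrt ?c * s" using edge_pos by simp
  finally have "\<bar>v y - v w\<bar> \<le> 2 * real CARD('a) / sqrt ?c * s" using q(2)[OF y] q(2)[OF w(2)] by simp
  moreover have "\<bar>v w\<bar> \<le> m" using m(2) w(1) unfolding cell_bound_def by blast
  ultimately have "\<bar>v y\<bar> \<le> 1 * m + 2 * real CARD('a) / sqrt ?c * s" by linarith
  also have "\<dots> \<le> step_const * m + step_const * s"
    using m(1) s(1) by (intro add_mono mult_right_mono step_const)
  finally show "\<bar>v y\<bar> \<le> step_const * (m + s)" by (simp add: distrib_left)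
qed

lemma mem_cell_gap:
  assumes "w \<in> cell G z" "w \<in> cell G z'"
  shows "\<bar>z $ i - z' $ i\<bar> \<le> 1"
proof -
  have "real_of_int (z $ i) \<le> lat G w i" "lat G w i \<le> real_of_int (z $ i) + 1"
    "real_of_int (z' $ i) \<le> lat G w i" "lat G w i \<le> real_of_int (z' $ i) + 1"
    using assms mem_cell_lat by blast+
  then show ?thesis by linarith
qed

text \<open>Change the indices of \<open>z\<close> into those of \<open>z'\<close> one at a time; the common point stays in every cell on the way.\<close>

lemma adjacent_through_point:
  assumes "w \<in> cell G z" "w \<in> cell G z'" "z \<in> T" "z' \<notin> T"
  shows "\<exists>a b. a \<in> T \<and> b \<notin> T \<and> adjacent a b \<and> w \<in> cell G a \<and> w \<in> cell G b"
  using assms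
proof (induction "card {i. z $ i \<noteq> z' $ i}" arbitrary: z rule: less_induct)
  case less
  then have "z \<noteq> z'" by blast
  then obtain i where i: "z $ i \<noteq> z' $ i" by (auto simp: vec_eq_iff)
  define y where "y = (\<chi> l. if l = i then z' $ i else z $ l)"
  have wy: "w \<in> cell G y" using less.prems(1,2) unfolding mem_cell_lat y_def by simp
  have "z' $ i = z $ i + 1 \<or> z $ i = z' $ i + 1"
    using mem_cell_gap[OF less.prems(1,2), of i] i by linarith
  then have adj: "adjacent z y"
  proof
    assume "z' $ i = z $ i + 1"
    then have "y = z + axis i 1" by (simp add: vec_eq_iff y_def axis_def)
    then show ?thesis unfolding adjacent_def by blast
  next
    assume "z $ i = z' $ i + 1"
    then have "z = y + axis i 1" by (simp add: vec_eq_iff y_def axis_def)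
    then show ?thesis unfolding adjacent_def by blast
  qed
  show ?case
  proof (cases "y \<in> T")
    case True
    have "{l. y $ l \<noteq> z' $ l} \<subset> {l. z $ l \<noteq> z' $ l}" using i by (auto simp: y_def)
    then have "card {l. y $ l \<noteq> z' $ l} < card {l. z $ l \<noteq> z' $ l}" by (intro psubset_card_mono) auto
    then show ?thesis using less.hyps[OF _ wy less.prems(2) True less.prems(4)] by blast
  next
    case False
    then show ?thesis using less.prems(1,3) wy adj by blast
  qed
qed

text \<open>The cells of \<open>T\<close> and the remaining ones form two closed sets that cover
  \<open>S\<close> and both meet it, so they share a point of \<open>S\<close>.
  \<open>adjacent_through_point\<close> turns this contact into a common face, and the new cell is
  active since it contains a point of the domain.\<close>

lemma cells_of_connected:
  assumes S: "connected S" "S \<subseteq> dom G" and T: "T \<subseteq> {z\<in>active G. cell G z \<inter> S \<noteq> {}}" "T \<noteq> {}"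
    "T \<noteq> {z\<in>active G. cell G z \<inter> S \<noteq> {}}"
  shows "\<exists>a\<in>T. \<exists>b\<in>{z\<in>active G. cell G z \<inter> S \<noteq> {}} - T. adjacent a b"
proof -
  let ?Z = "{z\<in>active G. cell G z \<inter> S \<noteq> {}}"
  let ?U = "\<lambda>T. \<Union>z\<in>T. cell G z"
  have fin: "finite ?Z" using finite_active by simp
  then have finT: "finite T" using T(1) finite_subset by blast
  have cl: "closed (?U T)" "closed (?U (?Z - T))" using fin finT closed_cell by (auto intro!: closed_UN)
  have cover: "S \<subseteq> ?U T \<union> ?U (?Z - T)"
  proof
    fix x assume x: "x \<in> S"
    then have "cell_index G x \<in> ?Z" using S(2) cell_index_active mem_cell_index by blast
    then show "x \<in> ?U T \<union> ?U (?Z - T)" using mem_cell_index by blast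
  qed
  have nT: "?U T \<inter> S \<noteq> {}" using T(1,2) by blast
  have nZT: "?U (?Z - T) \<inter> S \<noteq> {}"
  proof -
    obtain z where "z \<in> ?Z" "z \<notin> T" using T(1,3) by blast
    then show ?thesis by blast
  qed
  have "?U T \<inter> ?U (?Z - T) \<inter> S \<noteq> {}"
    using connected_closedD[OF S(1) _ cover cl] nT nZT by metis
  then have "\<exists>w. w \<in> ?U T \<inter> ?U (?Z - T) \<inter> S" by (rule ex_in_conv[THEN iffD2])
  then obtain w where wi: "w \<in> ?U T \<inter> ?U (?Z - T) \<inter> S" ..
  note w0 = IntD1[OF IntD1[OF wi]] IntD2[OF IntD1[OF wi]] IntD2[OF wi]
  obtain z where z: "z \<in> T" "w \<in> cell G z" using w0(1) by (rule UN_E)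
  obtain z' where z': "z' \<in> ?Z - T" "w \<in> cell G z'" using w0(2) by (rule UN_E)
  have "z' \<notin> T" using z'(1) by simp
  from adjacent_through_point[OF z(2) z'(2) z(1) this]
  obtain a b where ab: "a \<in> T" "b \<notin> T" "adjacent a b" "w \<in> cell G b" by blast
  have "w \<in> cell G b \<inter> dom G" using ab(4) w0(3) S(2) by blast
  then have "b \<in> active G" unfolding active_def by blast
  moreover have "cell G b \<inter> S \<noteq> {}" using ab(4) w0(3) by blast
  ultimately have "b \<in> ?Z - T" using ab(2) by simp
  then show ?thesis using ab(1,3) by (intro bexI[of _ a] bexI[of _ b])
qed

text \<open>Leave the boundary along the ray from the closest point through \<open>y\<close>, on which the distance grows at unit speed.\<close>

lemma inward_segment:
  assumes y: "y \<in> dom G" "infdist y (bdry G) \<le> r" and r: "r < \<delta>"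
  obtains y' where "closed_segment y y' \<subseteq> dom G" "infdist y' (bdry G) = r" "norm (y' - y) \<le> r"
proof -
  obtain \<pi> where C1: "C1_on {x. infdist x (bdry G) < \<delta>} \<pi>"
    and \<pi>: "\<And>x. infdist x (bdry G) < \<delta> \<Longrightarrow> \<pi> x \<in> bdry G \<and> dist x (\<pi> x) = infdist x (bdry G)"
    using reach unfolding has_reach_def by blast
  have cont: "continuous_on {x. infdist x (bdry G) < \<delta>} \<pi>"
    using C1 unfolding C1_on_def
    by (auto intro!: continuous_at_imp_continuous_on simp: has_derivative_continuous)
  have "y \<notin> bdry G" using y(1) open_dom by (simp add: bdry_def frontier_def interior_open)
  then have D0: "0 < infdist y (bdry G)"
    using closed_bdry bdry_nonempty by (metis in_closed_iff_infdist_zero infdist_nonneg order_less_le)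
  let ?D = "infdist y (bdry G)"
  define u where "u = sgn (y - \<pi> y)"
  define y' where "y' = y + (r - ?D) *\<^sub>R u"
  have along: "infdist (y + s *\<^sub>R u) (bdry G) = ?D + s" if "0 \<le> s" "s \<le> r - ?D" for s
    unfolding u_def by (rule infdist_along_normal[OF \<pi> cont D0]) (use that r in auto)
  \<comment> \<open>On the segment the distance to the boundary never falls below its positive
    initial value.\<close>
  have "closed_segment y y' \<inter> frontier (dom G) = {}"
  proof (rule ccontr)
    assume "\<not> ?thesis"
    then obtain x where x: "x \<in> closed_segment y y'" "x \<in> bdry G" unfolding bdry_def by blast
    then obtain t where t: "0 \<le> t" "t \<le> 1" "x = y + t *\<^sub>R (y' - y)"
      by (auto simp: in_segment algebra_simps)
    then have "x = y + (t * (r - ?D)) *\<^sub>R u" by (simp add: y'_def)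
    moreover have "0 \<le> t * (r - ?D)" "t * (r - ?D) \<le> r - ?D"
      using t y(2) by (auto intro: mult_left_le_one_le)
    ultimately have "infdist x (bdry G) = ?D + t * (r - ?D)" using along by simp
    then show False using D0 \<open>0 \<le> t * (r - ?D)\<close> x(2) by simp
  qed
  moreover have "closed_segment y y' \<inter> dom G \<noteq> {}" using y(1) by auto
  ultimately have seg: "closed_segment y y' \<subseteq> dom G"
    using connected_Int_frontier[OF connected_segment] by blast
  have "infdist y' (bdry G) = r" using along[of "r - ?D"] y(2) by (simp add: y'_def)
  moreover have "norm u \<le> 1" by (simp add: u_def norm_sgn)
  then have "norm (y' - y) \<le> (r - ?D) * 1" unfolding y'_def using y(2) by (simp add: mult_left_le)
  then have "norm (y' - y) \<le> r" using D0 by simp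
  ultimately show ?thesis using seg that by blast
qed

text \<open>\<open>20\<close> cells cover a segment of length \<open>9 \<surd>d h \<le> 81/5 h\<close> that starts in a cell adjacent to \<open>j\<close>.\<close>

definition local_energy :: "(real ^ 'a \<Rightarrow> real) \<Rightarrow> int ^ 'a \<Rightarrow> real" where
  "local_energy v j = (\<Sum>z\<in>{z\<in>active G - cut G. z \<in> int_nbhd j 20}. cell_energy v z)
     + (\<Sum>F\<in>{F\<in>ghost_faces G. fst F \<in> int_nbhd j 20}. ghost_energy v F)"

lemma local_energy_nonneg: "0 \<le> local_energy v j"
  unfolding local_energy_def by (intro add_nonneg_nonneg sum_nonneg cell_energy_nonneg ghost_energy_nonneg)

text \<open>\<open>41 = 2 * 20 + 1\<close>: the power counts the indices within distance 20, hence
  the cells that a chain can visit.\<close>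

definition friedrichs_const :: real where
  "friedrichs_const = (chain_const step_const (41 ^ CARD('a)))\<^sup>2"

section \<open>The Friedrichs inequality on strip patches\<close>

lemma strip_near_bdry:
  assumes "j \<in> strip G" "x \<in> cell G z" "vtx G j \<in> cell G z"
  shows "infdist x (bdry G) \<le> 2 * sqrt (real CARD('a)) * h"
proof -
  obtain zc where zc: "zc \<in> cut G" "cell G zc \<subseteq> patch G j" using assms(1) unfolding strip_def by blast
  then have v: "vtx G j \<in> cell G zc" using cell_subset_patch by blast
  obtain g where g: "g \<in> bdry G" "g \<in> cell G zc" using zc(1) unfolding cut_def by blast
  have "infdist x (bdry G) \<le> dist x g" by (rule infdist_le[OF g(1)])
  also have "\<dots> \<le> dist x (vtx G j) + dist (vtx G j) g" by (rule dist_triangle)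
  also have "\<dots> \<le> 2 * sqrt (real CARD('a)) * h"
    using dist_in_cell[OF assms(2,3)] dist_in_cell[OF v g(2)] unfolding dist_norm by linarith
  finally show ?thesis .
qed

lemma strip_space_zero:
  assumes v: "v \<in> strip_space kd G p" and far: "2 * sqrt (real CARD('a)) * h < infdist x (bdry G)"
  shows "v x = 0"
proof (cases "x \<in> active_dom G")
  case True
  then obtain z where z: "z \<in> active G" "x \<in> cell G z" unfolding active_dom_def by blast
  obtain w where w: "\<forall>j\<in>strip G. w j \<in> patch_space kd G p j" "v = (\<lambda>x. \<Sum>j\<in>strip G. w j x)"
    using v unfolding strip_space_def by blast
  have "w j x = 0" if j: "j \<in> strip G" for j
  proof -
    have "vtx G j \<notin> cell G z" using strip_near_bdry[OF j z(2)] far by linarith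
    then have "piece G p (w j) z = (\<lambda>x. 0)" using w(1) j z(1) patch_space_piece_zero by blast
    moreover have "w j \<in> FE G p" using w(1) j unfolding patch_space_eq by blast
    ultimately show ?thesis using piece_Qp(2)[OF _ z] by metis
  qed
  then show ?thesis unfolding w(2) by simp
next
  case False
  obtain w where w: "\<forall>j\<in>strip G. w j \<in> patch_space kd G p j" "v = (\<lambda>x. \<Sum>j\<in>strip G. w j x)"
    using v unfolding strip_space_def by blast
  have "w j x = 0" if "j \<in> strip G" for j
    using w(1) that False unfolding patch_space_eq FE_def by blast
  then show ?thesis unfolding w(2) by simp
qed

lemma strip_friedrichs:
  assumes vF: "v \<in> FE G p" and v: "v \<in> strip_space kd G p" and j: "j \<in> strip G"
    and z: "z \<in> active G" "vtx G j \<in> cell G z" and x: "x \<in> cell G z"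
  shows "(v x)\<^sup>2 * h ^ (CARD('a) - 2) \<le> friedrichs_const * local_energy v j"
proof -
  let ?r = "9 * sqrt (real CARD('a)) * h" and ?e = "CARD('a) - 2"
  have sh: "0 < sqrt (real CARD('a)) * h" using sqrt_dim(1) edge_pos by simp
  \<comment> \<open>Any point of the cell inside the domain may start the segment, however small
    that part of the cell is.\<close>
  obtain y where y: "y \<in> cell G z" "y \<in> dom G" using z(1) unfolding active_def by blast
  have "infdist y (bdry G) \<le> ?r" using strip_near_bdry[OF j y(1) z(2)] sh by linarith
  from inward_segment[OF y(2) this reach_large]
  obtain y' where y': "closed_segment y y' \<subseteq> dom G" "infdist y' (bdry G) = ?r" "norm (y' - y) \<le> ?r" .
  let ?S = "closed_segment y y'"
  define Z where "Z = {z\<in>active G. cell G z \<inter> ?S \<noteq> {}}"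
  have finZ: "finite Z" unfolding Z_def using finite_active by simp
  have Znear: "Z \<subseteq> int_nbhd j 20"
    unfolding int_nbhd_def
  proof (rule subsetI, rule CollectI, rule allI)
    fix z' l assume "z' \<in> Z"
    then obtain s where s: "s \<in> cell G z'" "s \<in> ?S" unfolding Z_def by blast
    have "norm (s - y) \<le> norm (y' - y)" using segment_bound(1)[OF s(2)] by simp
    then have "\<bar>s $ l - y $ l\<bar> \<le> ?r" using component_le_norm_cart[of "s - y" l] y'(3) by simp
    also have "?r \<le> (81 / 5) * h" using sqrt_dim(2) edge_pos by (intro mult_right_mono) auto
    finally have "\<bar>h * (lat G s l - lat G y l)\<bar> \<le> (81 / 5) * h" using lat_eq[of s l] lat_eq[of y l] by (simp add: right_diff_distrib)
    then have "h * \<bar>lat G s l - lat G y l\<bar> \<le> h * (81 / 5)" using edge_pos by (simp add: abs_mult mult.commute)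
    then have "\<bar>lat G s l - lat G y l\<bar> \<le> 81 / 5" using edge_pos by (simp only: mult_le_cancel_left_pos)
    moreover have "real_of_int (z' $ l) \<le> lat G s l" "lat G s l \<le> real_of_int (z' $ l) + 1"
      "real_of_int (z $ l) \<le> lat G y l" "lat G y l \<le> real_of_int (z $ l) + 1"
      using s(1) y(1) mem_cell_lat by blast+
    \<comment> \<open>\<open>81 / 5 + 1 < 18\<close>, and one more step leads from \<open>z\<close>
      to \<open>j\<close>; the radius 20 leaves some slack.\<close>
    ultimately have "\<bar>z' $ l - z $ l\<bar> \<le> 17" by linarith
    moreover have "z $ l = j $ l \<or> z $ l = j $ l - 1" using z(2) unfolding vtx_mem_cell by blast
    ultimately show "\<bar>z' $ l - j $ l\<bar> \<le> int 20" by auto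
  qed
  \<comment> \<open>Normalised so that each energy near \<open>j\<close> is at most
    \<open>s\<^sup>2 * h ^ ?e\<close>, the form in which the step lemmas take it.\<close>
  define s where "s = sqrt (local_energy v j / h ^ ?e)"
  have s0: "0 \<le> s" unfolding s_def using local_energy_nonneg edge_pos by simp
  have s2: "s\<^sup>2 * h ^ ?e = local_energy v j" unfolding s_def using local_energy_nonneg edge_pos by simp
  have Ecell: "cell_energy v b \<le> s\<^sup>2 * h ^ ?e" if "b \<in> Z" "b \<notin> cut G" for b
  proof -
    have "cell_energy v b \<le> (\<Sum>z\<in>{z\<in>active G - cut G. z \<in> int_nbhd j 20}. cell_energy v z)"
      using that Znear finite_active by (intro member_le_sum cell_energy_nonneg) (auto simp: Z_def)
    then show ?thesis unfolding s2 local_energy_def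
      using sum_nonneg[of "{F\<in>ghost_faces G. fst F \<in> int_nbhd j 20}" "ghost_energy v"] ghost_energy_nonneg by (simp add: add_increasing2)
  qed
  have Eghost: "ghost_energy v (b, i) \<le> s\<^sup>2 * h ^ ?e" if "b \<in> Z" "(b, i) \<in> ghost_faces G" for b i
  proof -
    have "ghost_energy v (b, i) \<le> (\<Sum>F\<in>{F\<in>ghost_faces G. fst F \<in> int_nbhd j 20}. ghost_energy v F)"
      using that Znear finite_ghost_faces by (intro member_le_sum ghost_energy_nonneg) auto
    then show ?thesis unfolding s2 local_energy_def
      using sum_nonneg[of "{z\<in>active G - cut G. z \<in> int_nbhd j 20}" "cell_energy v"] cell_energy_nonneg by (simp add: add_increasing)
  qed
  let ?z0 = "cell_index G y'"
  have "y' \<in> dom G" using y'(1) by auto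
  then have z0: "?z0 \<in> Z" unfolding Z_def using cell_index_active mem_cell_index by blast
  \<comment> \<open>All points of this cell are at least 8 cell diameters away from the boundary,
    while strip functions vanish beyond 2.\<close>
  have b0: "cell_bound v ?z0 0"
    unfolding cell_bound_def
  proof
    fix t assume t: "t \<in> cell G ?z0"
    have "?r \<le> infdist t (bdry G) + dist y' t" using infdist_triangle[of y' "bdry G" t] y'(2) by simp
    moreover have "dist y' t \<le> sqrt (real CARD('a)) * h" using dist_in_cell[OF mem_cell_index t] unfolding dist_norm .
    ultimately have "2 * sqrt (real CARD('a)) * h < infdist t (bdry G)" using sh by linarith
    then show "\<bar>v t\<bar> \<le> 0" using strip_space_zero[OF v] by simp
  qed
  have "cell_bound v z (chain_const step_const (41 ^ CARD('a)) * s)"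
  proof (rule chain_bound[where Z = Z and adj = adjacent and B = "cell_bound v", OF finZ z0 b0 step_const(1) s0])
    show "cell_bound v z m'" if "cell_bound v z m" "m \<le> m'" for z m m'
      using that unfolding cell_bound_def by fastforce
    \<comment> \<open>If one of the two cells is cut, their common face is a ghost face; otherwise
      \<open>b\<close> is uncut and its gradient energy is available.\<close>
    show "cell_bound v b (step_const * (m + s))" if ab: "a \<in> Z" "b \<in> Z" "adjacent a b" "0 \<le> m" "cell_bound v a m" for a b m
    proof (cases "a \<in> cut G \<or> b \<in> cut G")
      case False
      then show ?thesis using ab Ecell[OF ab(2)] s0 by (intro uncut_step[OF vF]) (auto simp: Z_def)
    next
      case True
      obtain i where i: "b = a + axis i 1 \<or> a = b + axis i 1" using ab(3) unfolding adjacent_def by blast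
      have act: "a \<in> active G" "b \<in> active G" using ab unfolding Z_def by auto
      show ?thesis
      proof (cases "b = a + axis i 1")
        case b: True
        have F: "(a, i) \<in> ghost_faces G" unfolding ghost_faces_def using act True b by auto
        show ?thesis by (rule ghost_step[OF vF F _ ab(4,5) s0 Eghost[OF ab(1) F]]) (use b in simp)
      next
        case False
        then have a: "a = b + axis i 1" using i by blast
        have F: "(b, i) \<in> ghost_faces G" unfolding ghost_faces_def using act True a by auto
        show ?thesis by (rule ghost_step[OF vF F _ ab(4,5) s0 Eghost[OF ab(2) F]]) (use a in simp)
      qed
    qed
    show "\<exists>a\<in>T. \<exists>b\<in>Z - T. adjacent a b" if "T \<subseteq> Z" "T \<noteq> {}" "T \<noteq> Z" for T
      using cells_of_connected[OF connected_segment y'(1)] that unfolding Z_def by blast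
    show "z \<in> Z" unfolding Z_def using z(1) y(1) by auto
    show "card Z \<le> 41 ^ CARD('a)" using card_mono[OF int_nbhd(1) Znear] int_nbhd(2)[of j 20] by simp
  qed
  then have "\<bar>v x\<bar> \<le> chain_const step_const (41 ^ CARD('a)) * s" using x unfolding cell_bound_def by blast
  then have "\<bar>v x\<bar>\<^sup>2 \<le> (chain_const step_const (41 ^ CARD('a)) * s)\<^sup>2" by (intro power_mono) auto
  then have "(v x)\<^sup>2 \<le> friedrichs_const * s\<^sup>2" by (simp add: friedrichs_const_def power_mult_distrib)
  then have "(v x)\<^sup>2 * h ^ ?e \<le> friedrichs_const * s\<^sup>2 * h ^ ?e" using edge_pos by (intro mult_right_mono) auto
  then show ?thesis using s2 by (simp add: mult.assoc)
qed

end

subsection \<open>Stable decomposition and contraction of the strip sweep\<close>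

text \<open>\<open>finite_strip\<close> is supplied in the end by the list \<open>js\<close> that
  enumerates the strip.\<close>

locale stable_domain = cut_domain +
  fixes \<gamma> \<gamma>\<^sub>D c\<^sub>A C\<^sub>A C :: real
  assumes gamma: "0 < \<gamma>" "\<gamma> \<le> 1" and stability_pos: "0 < c\<^sub>A" "0 < C\<^sub>A"
    and stable: "cutfem_stable G p \<gamma> \<gamma>\<^sub>D c\<^sub>A C\<^sub>A C"
    and finite_strip: "finite (strip G)"
begin

abbreviation A :: "(real ^ 'a \<Rightarrow> real) \<Rightarrow> (real ^ 'a \<Rightarrow> real) \<Rightarrow> real" where
  "A \<equiv> cut_form G p \<gamma> \<gamma>\<^sub>D"

lemma coercive: "v \<in> FE G p \<Longrightarrow> c\<^sub>A * (N_norm G p \<gamma> v)\<^sup>2 \<le> A v v"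
  using stable unfolding cutfem_stable_def by blast

lemma A_le_N: "v \<in> FE G p \<Longrightarrow> A v v \<le> C\<^sub>A * (N_norm G p \<gamma> v)\<^sup>2"
  using stable unfolding cutfem_stable_def by (simp add: power2_eq_square mult.assoc)

sublocale semi_inner_space "FE G p" A
proof
  show "(\<lambda>x. 0) \<in> FE G p" by (rule FE_zero)
  show "(\<lambda>x. a * u x + b * w x) \<in> FE G p" if "u \<in> FE G p" "w \<in> FE G p" for u w a b
    by (rule FE_lincomb(1)[OF that])
  show "A (\<lambda>x. a * u x + b * w x) v = a * A u v + b * A w v"
    if "u \<in> FE G p" "w \<in> FE G p" "v \<in> FE G p" for u w v a b
    by (rule cut_form_lincomb[OF that])
  show "A u v = A v u" for u v by (rule cut_form_commute)
  show "0 \<le> A v v" if "v \<in> FE G p" for v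
    by (rule order.trans[OF _ coercive[OF that]]) (simp add: stability_pos less_imp_le)
qed

section \<open>Linear structure of patch and strip spaces\<close>

lemma patch_space_FE: "patch_space kd G p j \<subseteq> FE G p"
  unfolding patch_space_eq by blast

lemma strip_space_FE: "strip_space kd G p \<subseteq> FE G p"
proof
  fix v assume "v \<in> strip_space kd G p"
  then obtain w where w: "\<forall>j\<in>strip G. w j \<in> patch_space kd G p j" "v = (\<lambda>x. \<Sum>j\<in>strip G. w j x)"
    unfolding strip_space_def by blast
  show "v \<in> FE G p" unfolding w(2) using w(1) patch_space_FE by (intro FE_sum finite_strip) blast
qed

lemma patch_space_lincomb:
  assumes "v \<in> patch_space kd G p j" "w \<in> patch_space kd G p j"
  shows "(\<lambda>x. a * v x + b * w x) \<in> patch_space kd G p j"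
  using assms FE_lincomb(1)[of v w a b] unfolding patch_space_eq by auto

lemma patch_space_zero: "(\<lambda>x. 0) \<in> patch_space kd G p j"
  unfolding patch_space_eq using FE_zero by auto

lemma strip_space_lincomb:
  assumes "v \<in> strip_space kd G p" "w \<in> strip_space kd G p"
  shows "(\<lambda>x. a * v x + b * w x) \<in> strip_space kd G p"
proof -
  obtain f g where f: "\<forall>j\<in>strip G. f j \<in> patch_space kd G p j" "v = (\<lambda>x. \<Sum>j\<in>strip G. f j x)"
    and g: "\<forall>j\<in>strip G. g j \<in> patch_space kd G p j" "w = (\<lambda>x. \<Sum>j\<in>strip G. g j x)"
    using assms unfolding strip_space_def by blast
  have "(\<lambda>x. a * v x + b * w x) = (\<lambda>x. \<Sum>j\<in>strip G. a * f j x + b * g j x)"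
    unfolding f(2) g(2) by (simp add: sum.distrib sum_distrib_left)
  moreover have "\<forall>j\<in>strip G. (\<lambda>x. a * f j x + b * g j x) \<in> patch_space kd G p j"
    using f(1) g(1) patch_space_lincomb by blast
  ultimately show ?thesis
    unfolding strip_space_def by (intro CollectI exI[of _ "\<lambda>j x. a * f j x + b * g j x"]) blast
qed

lemma patch_space_strip_space:
  assumes "j \<in> strip G"
  shows "patch_space kd G p j \<subseteq> strip_space kd G p"
proof
  fix v assume v: "v \<in> patch_space kd G p j"
  let ?w = "\<lambda>k. if k = j then v else (\<lambda>x. 0)"
  have "v = (\<lambda>x. \<Sum>k\<in>strip G. ?w k x)"
  proof
    fix x
    have "(\<Sum>k\<in>strip G. ?w k x) = (\<Sum>k\<in>strip G. if k = j then v x else 0)" by (intro sum.cong) auto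
    then show "v x = (\<Sum>k\<in>strip G. ?w k x)" using assms finite_strip by simp
  qed
  moreover have "\<forall>k\<in>strip G. ?w k \<in> patch_space kd G p k" using v patch_space_zero by auto
  ultimately show "v \<in> strip_space kd G p" unfolding strip_space_def by (intro CollectI exI[of _ ?w]) blast
qed

text \<open>Each cell and each face is counted by at most \<open>41 ^ CARD('a)\<close> patches.
  Since \<open>\<gamma> \<le> 1\<close>, the factor \<open>1 / \<gamma>\<close> serves the gradient
  part together with the ghost part, and coercivity passes to the form.\<close>

lemma sum_local_energy:
  assumes "v \<in> FE G p"
  shows "(\<Sum>j\<in>strip G. local_energy v j) \<le> 41 ^ CARD('a) / (\<gamma> * c\<^sub>A) * A v v"
proof -
  let ?K = "41 ^ CARD('a) :: real"
  have "(\<Sum>j\<in>strip G. \<Sum>z\<in>{z\<in>active G - cut G. z \<in> int_nbhd j 20}. cell_energy v z) \<le> ?K * (\<Sum>z\<in>active G - cut G. cell_energy v z)"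
    using sum_int_nbhd_le[OF finite_strip, of "active G - cut G" "cell_energy v" "\<lambda>z. z" 20] finite_active cell_energy_nonneg by simp
  also have "\<dots> \<le> ?K * grad_prod G p (dom G) v v" by (intro mult_left_mono sum_cell_energy_le assms) simp
  also have "\<dots> \<le> ?K / \<gamma> * grad_prod G p (dom G) v v"
  proof (rule mult_right_mono)
    show "0 \<le> grad_prod G p (dom G) v v" unfolding grad_prod_diag by (rule set_integral_nonneg') simp
    show "?K \<le> ?K / \<gamma>" using gamma by (simp add: pos_le_divide_eq)
  qed
  finally have 1: "(\<Sum>j\<in>strip G. \<Sum>z\<in>{z\<in>active G - cut G. z \<in> int_nbhd j 20}. cell_energy v z) \<le> ?K / \<gamma> * grad_prod G p (dom G) v v" .
  have "(\<Sum>j\<in>strip G. \<Sum>F\<in>{F\<in>ghost_faces G. fst F \<in> int_nbhd j 20}. ghost_energy v F) \<le> ?K * (\<Sum>F\<in>ghost_faces G. ghost_energy v F)"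
    using sum_int_nbhd_le[OF finite_strip finite_ghost_faces, of "ghost_energy v" fst 20] ghost_energy_nonneg by simp
  also have "\<dots> = ?K / \<gamma> * ghost_form G p \<gamma> v v" unfolding ghost_form_eq using gamma by simp
  finally have "(\<Sum>j\<in>strip G. local_energy v j) \<le> ?K / \<gamma> * grad_prod G p (dom G) v v + ?K / \<gamma> * ghost_form G p \<gamma> v v"
    unfolding local_energy_def sum.distrib using 1 by (intro add_mono)
  also have "\<dots> \<le> ?K / \<gamma> * (N_norm G p \<gamma> v)\<^sup>2"
    unfolding distrib_left[symmetric] using gamma by (intro mult_left_mono N_norm_sq(2)) auto
  also have "\<dots> \<le> ?K / \<gamma> * (A v v / c\<^sub>A)"
    using coercive[OF assms] gamma stability_pos by (intro mult_left_mono) (auto simp: pos_le_divide_eq mult.commute)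
  finally show ?thesis by simp
qed

lemma strip_space_node:
  assumes v: "v \<in> strip_space kd G p" and y: "y \<in> nodes G p" "\<And>j. j \<in> strip G \<Longrightarrow> y \<notin> patch_nodes kd j"
  shows "v y = 0"
proof -
  obtain w where w: "\<forall>j\<in>strip G. w j \<in> patch_space kd G p j" "v = (\<lambda>x. \<Sum>j\<in>strip G. w j x)"
    using v unfolding strip_space_def by blast
  have "w j y = 0" if "j \<in> strip G" for j using w(1) that y unfolding patch_space_eq by blast
  then show ?thesis unfolding w(2) by simp
qed

lemma strip_node_friedrichs:
  assumes v: "v \<in> strip_space kd G p" and j: "j \<in> strip G" and y: "y \<in> patch_nodes kd j"
  shows "(v y)\<^sup>2 * h ^ (CARD('a) - 2) \<le> friedrichs_const * local_energy v j"
proof -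
  have "y \<in> nodes G p" using y patch_nodes_subset by blast
  then obtain z \<tau> where z: "z \<in> active G" "\<tau> \<in> node_tuples p" "y = vtx G z + h *\<^sub>R (\<chi> i. \<tau> i)"
    using mem_nodes by blast
  then have yz: "y \<in> cell G z" using vtx_scale_mem_cell by blast
  have "v \<in> FE G p" using v strip_space_FE by blast
  then show ?thesis
    by (rule strip_friedrichs[OF _ v j z(1) patch_nodes_cell[OF y z(1) yz] yz])
qed

text \<open>Zero energy makes all local energies vanish, and then the Friedrichs bound kills every
  nodal value. This gives the uniqueness of the patch projections.\<close>

lemma strip_definite:
  assumes v: "v \<in> strip_space kd G p" and zero: "A v v = 0"
  shows "v = (\<lambda>x. 0)"
proof (rule FE_eqI)
  show vF: "v \<in> FE G p" using v strip_space_FE by blast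
  show "(\<lambda>x. 0) \<in> FE G p" by (rule FE_zero)
  have "(\<Sum>j\<in>strip G. local_energy v j) \<le> 0" using sum_local_energy[OF vF] zero by simp
  then have "(\<Sum>j\<in>strip G. local_energy v j) = 0"
    using sum_nonneg[of "strip G" "local_energy v"] local_energy_nonneg by (simp add: antisym)
  then have E: "local_energy v j = 0" if "j \<in> strip G" for j
    using sum_nonneg_eq_0_iff[OF finite_strip, of "local_energy v"] local_energy_nonneg that by simp
  fix y assume y: "y \<in> nodes G p"
  show "v y = 0"
  proof (cases "\<exists>j\<in>strip G. y \<in> patch_nodes kd j")
    case True
    then obtain j where j: "j \<in> strip G" "y \<in> patch_nodes kd j" by blast
    have "(v y)\<^sup>2 * h ^ (CARD('a) - 2) \<le> 0" using strip_node_friedrichs[OF v j] E[OF j(1)] by simp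
    moreover have "0 < h ^ (CARD('a) - 2)" using edge_pos by (rule zero_less_power)
    ultimately have "(v y)\<^sup>2 \<le> 0" by (simp add: mult_le_0_iff)
    then show ?thesis by simp
  next
    case False
    then show ?thesis using strip_space_node[OF v y] by blast
  qed
qed

text \<open>The summand 1 ensures \<open>1 \<le> decomposition_const\<close>, so that the
  contraction factor is the root of a nonnegative number.\<close>

definition decomposition_const :: real where
  "decomposition_const = 1 + C\<^sub>A * inverse_const * friedrichs_const * (41 ^ CARD('a) / (\<gamma> * c\<^sub>A))"

lemma friedrichs_const_nonneg: "0 \<le> friedrichs_const"
  by (simp add: friedrichs_const_def)

lemma decomposition_const_ge: "1 \<le> decomposition_const"
  unfolding decomposition_const_def using stability_pos gamma inverse_const_pos friedrichs_const_nonneg by simp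

text \<open>Each node of the strip is assigned to one of the patches that own it.\<close>

lemma stable_decomposition:
  assumes v: "v \<in> strip_space kd G p"
  obtains w where "\<And>j. j \<in> strip G \<Longrightarrow> w j \<in> patch_space kd G p j" "v = (\<lambda>x. \<Sum>j\<in>strip G. w j x)"
    "(\<Sum>j\<in>strip G. A (w j) (w j)) \<le> decomposition_const * A v v"
proof -
  let ?e = "CARD('a) - 2"
  have vF: "v \<in> FE G p" using v strip_space_FE by blast
  \<comment> \<open>One owner is chosen per node: the sets \<open>S j\<close> are disjoint, so the
    pieces add up to \<open>v\<close> without a partition of unity.\<close>
  define J where "J y = (SOME j. j \<in> strip G \<and> y \<in> patch_nodes kd j)" for y
  have J: "J y \<in> strip G \<and> y \<in> patch_nodes kd (J y)" if "j \<in> strip G" "y \<in> patch_nodes kd j" for y j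
    unfolding J_def by (rule someI[of _ j]) (use that in blast)
  define S where "S j = {y \<in> patch_nodes kd j. J y = j}" for j
  have Sn: "S j \<subseteq> nodes G p" for j using patch_nodes_subset unfolding S_def by blast
  have finS: "finite (S j)" for j using Sn finite_nodes finite_subset by blast
  define w where "w j = (\<lambda>x. \<Sum>y\<in>S j. v y * basis_fun G p y x)" for j
  have wF: "w j \<in> FE G p" for j unfolding w_def by (rule nodal_comb(1)[OF finS Sn])
  have wn: "w j y = (if y \<in> S j then v y else 0)" if "y \<in> nodes G p" for j y
    unfolding w_def by (rule nodal_comb(2)[OF finS Sn that])
  have wp: "w j \<in> patch_space kd G p j" for j
    unfolding patch_space_eq using wF wn by (auto simp: S_def)
  have sum: "v = (\<lambda>x. \<Sum>j\<in>strip G. w j x)"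
  proof (rule FE_eqI[OF vF])
    show "(\<lambda>x. \<Sum>j\<in>strip G. w j x) \<in> FE G p" by (intro FE_sum finite_strip wF)
    fix y assume y: "y \<in> nodes G p"
    show "v y = (\<Sum>j\<in>strip G. w j y)"
    proof (cases "\<exists>j\<in>strip G. y \<in> patch_nodes kd j")
      case True
      then have Jy: "J y \<in> strip G" "y \<in> patch_nodes kd (J y)" using J by blast+
      have "w j y = (if j = J y then v y else 0)" for j using wn[OF y, of j] Jy(2) by (auto simp: S_def)
      then have "(\<Sum>j\<in>strip G. w j y) = (\<Sum>j\<in>strip G. if j = J y then v y else 0)" by simp
      then show ?thesis using Jy(1) finite_strip by simp
    next
      case False
      then have "v y = 0" using strip_space_node[OF v y] by blast
      moreover have "w j y = 0" if "j \<in> strip G" for j using wn[OF y, of j] False that by (auto simp: S_def)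
      ultimately show ?thesis by simp
    qed
  qed
  have each: "A (w j) (w j) \<le> C\<^sub>A * inverse_const * friedrichs_const * local_energy v j" if j: "j \<in> strip G" for j
  proof -
    \<comment> \<open>The bound for nodal values from the Friedrichs inequality;
      \<open>h ^ ?e\<close> times its square is a multiple of the local energy, as the inverse
      estimate requires.\<close>
    define m where "m = sqrt (friedrichs_const * local_energy v j / h ^ ?e)"
    have m0: "0 \<le> friedrichs_const * local_energy v j / h ^ ?e"
      using friedrichs_const_nonneg local_energy_nonneg edge_pos by simp
    have m2: "h ^ ?e * m\<^sup>2 = friedrichs_const * local_energy v j"
      unfolding m_def using m0 edge_pos by simp
    have "\<bar>w j y\<bar> \<le> m" if y: "y \<in> nodes G p" for y
    proof (cases "y \<in> S j")
      case True
      then have "(v y)\<^sup>2 * h ^ ?e \<le> friedrichs_const * local_energy v j"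
        by (intro strip_node_friedrichs[OF v j]) (simp add: S_def)
      then have "(v y)\<^sup>2 \<le> friedrichs_const * local_energy v j / h ^ ?e" using edge_pos by (simp add: pos_le_divide_eq)
      then have "sqrt ((v y)\<^sup>2) \<le> m" unfolding m_def by (rule real_sqrt_le_mono)
      then show ?thesis using wn[OF y, of j] True by simp
    next
      case False
      then show ?thesis using wn[OF y, of j] m0 by (simp add: m_def)
    qed
    then have "(N_norm G p \<gamma> (w j))\<^sup>2 \<le> inverse_const * h ^ ?e * m\<^sup>2"
      using m0 gamma by (intro patch_inverse_estimate[OF wp]) (auto simp: m_def)
    also have "\<dots> = inverse_const * (friedrichs_const * local_energy v j)" by (simp only: mult.assoc m2)
    finally have "C\<^sub>A * (N_norm G p \<gamma> (w j))\<^sup>2 \<le> C\<^sub>A * (inverse_const * (friedrichs_const * local_energy v j))"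
      using stability_pos by (intro mult_left_mono) auto
    then show ?thesis using A_le_N[OF wF, of j] by (simp add: mult.assoc)
  qed
  have "(\<Sum>j\<in>strip G. A (w j) (w j)) \<le> (\<Sum>j\<in>strip G. C\<^sub>A * inverse_const * friedrichs_const * local_energy v j)"
    using each by (rule sum_mono)
  also have "\<dots> = C\<^sub>A * inverse_const * friedrichs_const * (\<Sum>j\<in>strip G. local_energy v j)" by (simp add: sum_distrib_left)
  also have "\<dots> \<le> C\<^sub>A * inverse_const * friedrichs_const * (41 ^ CARD('a) / (\<gamma> * c\<^sub>A) * A v v)"
    using sum_local_energy[OF vF] stability_pos inverse_const_pos friedrichs_const_nonneg by (intro mult_left_mono) auto
  also have "\<dots> \<le> decomposition_const * A v v"
    unfolding decomposition_const_def using nonneg[OF vF] by (simp add: algebra_simps)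
  finally show ?thesis using that[of w] wp sum by blast
qed

text \<open>Projections are built by adding one basis function at a time, since on a general nodal
  span the form is only known to be semidefinite.\<close>

lemma nodal_projection:
  assumes "finite S" "S \<subseteq> nodes G p"
  shows "v \<in> FE G p \<Longrightarrow> \<exists>w\<in>{v \<in> FE G p. \<forall>y\<in>nodes G p - S. v y = 0}. \<forall>u\<in>{v \<in> FE G p. \<forall>y\<in>nodes G p - S. v y = 0}. A (\<lambda>x. v x - w x) u = 0"
  using assms
proof (induction S arbitrary: v rule: finite_induct)
  case empty
  have vF: "v \<in> FE G p" using empty.prems by simp
  have A0: "A (\<lambda>x. v x - 0) (\<lambda>x. 0) = 0" using A_zero[OF vF] sym[of v "\<lambda>x. 0"] by simp
  show ?case
  proof (rule bexI[of _ "\<lambda>x. 0"], rule ballI)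
    fix u assume u: "u \<in> {v \<in> FE G p. \<forall>y\<in>nodes G p - {}. v y = 0}"
    have "u = (\<lambda>x. 0)" by (rule FE_eqI) (use u FE_zero in auto)
    then show "A (\<lambda>x. v x - 0) u = 0" using A0 by (simp only:)
  qed (use FE_zero in simp)
next
  case (insert s S)
  let ?V = "{v \<in> FE G p. \<forall>y\<in>nodes G p - S. v y = 0}"
  let ?g = "basis_fun G p s"
  have s: "s \<in> nodes G p" using insert.prems by simp
  have gF: "?g \<in> FE G p" unfolding basis_fun_eq by (rule tensor_hat_FE)
  have gn: "?g y = (if y = s then 1 else 0)" if "y \<in> nodes G p" for y
    unfolding basis_fun_eq by (rule tensor_hat_node[OF that])
  \<comment> \<open>Admitting the node \<open>s\<close> adds the span of its basis function:
    subtract \<open>f s\<close> times that function.\<close>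
  have eq: "{v \<in> FE G p. \<forall>y\<in>nodes G p - insert s S. v y = 0} = {(\<lambda>x. c * ?g x + u x) |c u. u \<in> ?V}"
  proof (intro equalityI subsetI)
    fix f assume f: "f \<in> {v \<in> FE G p. \<forall>y\<in>nodes G p - insert s S. v y = 0}"
    define u where "u = (\<lambda>x. 1 * f x + (- f s) * ?g x)"
    have "u \<in> FE G p" unfolding u_def using f gF by (intro FE_lincomb(1)) auto
    moreover have "u y = 0" if "y \<in> nodes G p - S" for y
      using f gn[of y] that by (cases "y = s") (auto simp: u_def)
    ultimately have "u \<in> ?V" by blast
    moreover have "f = (\<lambda>x. f s * ?g x + u x)" by (simp add: u_def)
    ultimately show "f \<in> {(\<lambda>x. c * ?g x + u x) |c u. u \<in> ?V}" by blast
  next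
    fix f assume "f \<in> {(\<lambda>x. c * ?g x + u x) |c u. u \<in> ?V}"
    then obtain c u where f: "f = (\<lambda>x. c * ?g x + u x)" "u \<in> FE G p" "\<forall>y\<in>nodes G p - S. u y = 0" by blast
    have "f \<in> FE G p" using FE_lincomb(1)[OF gF f(2), of c 1] f(1) by simp
    moreover have "f y = 0" if "y \<in> nodes G p - insert s S" for y
      using f(3) gn[of y] that by (simp add: f(1))
    ultimately show "f \<in> {v \<in> FE G p. \<forall>y\<in>nodes G p - insert s S. v y = 0}" by blast
  qed
  show ?case
    unfolding eq
  proof (rule projection_extend)
    show "?V \<subseteq> FE G p" by blast
    show "(\<lambda>x. a * u x + b * w x) \<in> ?V" if "u \<in> ?V" "w \<in> ?V" for u w a b
      using that FE_lincomb(1)[of u w a b] by auto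
    show "\<exists>w\<in>?V. \<forall>u\<in>?V. A (\<lambda>x. v x - w x) u = 0" if "v \<in> FE G p" for v
      by (rule insert.IH) (use insert.prems that in auto)
  qed (use gF insert.prems in auto)
qed

text \<open>Two candidates differ by an element of the patch space without energy. As
  \<open>j\<close> belongs to the strip, \<open>strip_definite\<close> applies, so the definite
  description denotes the projection that exists by \<open>nodal_projection\<close>.\<close>

lemma A_proj:
  assumes j: "j \<in> strip G" and v: "v \<in> FE G p"
  shows "A_proj kd G p \<gamma> \<gamma>\<^sub>D j v \<in> patch_space kd G p j"
    "u \<in> patch_space kd G p j \<Longrightarrow> A (\<lambda>x. v x - A_proj kd G p \<gamma> \<gamma>\<^sub>D j v x) u = 0"
proof -
  let ?V = "patch_space kd G p j"
  let ?P = "\<lambda>w. w \<in> ?V \<and> (\<forall>u\<in>?V. A (\<lambda>x. v x - w x) u = 0)"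
  have "finite (patch_nodes kd j)" using patch_nodes_subset finite_nodes finite_subset by blast
  from nodal_projection[OF this patch_nodes_subset v]
  obtain w where w: "?P w" unfolding patch_space_eq by blast
  have "w' = w" if w': "?P w'" for w'
  proof -
    define d where "d = (\<lambda>x. 1 * w x + (-1) * w' x)"
    have dV: "d \<in> ?V" unfolding d_def using w w' patch_space_lincomb by blast
    have F: "w \<in> FE G p" "w' \<in> FE G p" "d \<in> FE G p" using w w' dV patch_space_FE by blast+
    have "A v d - A w d = 0" "A v d - A w' d = 0"
      using w w' dV A_diff[OF v F(1,3)] A_diff[OF v F(2,3)] by auto
    then have "A d d = 0" using lincomb[OF F(1,2,3), of 1 "-1"] unfolding d_def[symmetric] by simp
    moreover have "d \<in> strip_space kd G p" using dV patch_space_strip_space[OF j] by blast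
    ultimately have "d = (\<lambda>x. 0)" using strip_definite by blast
    then have "d x = 0" for x by simp
    then show ?thesis unfolding d_def by (intro ext) (simp add: algebra_simps)
  qed
  then have "A_proj kd G p \<gamma> \<gamma>\<^sub>D j v = w" unfolding A_proj_def using w by (intro the_equality) blast+
  then show "A_proj kd G p \<gamma> \<gamma>\<^sub>D j v \<in> ?V" "u \<in> ?V \<Longrightarrow> A (\<lambda>x. v x - A_proj kd G p \<gamma> \<gamma>\<^sub>D j v x) u = 0"
    using w by auto
qed

text \<open>\<open>5 = 2 * 2 + 1\<close> counts indices within distance 2, outside which patches are
  orthogonal by \<open>cut_form_local\<close>.\<close>

definition contraction_const :: real where
  "contraction_const = sqrt (1 - 1 / (real (5 ^ CARD('a)) ^ 2 * decomposition_const))"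

lemma contraction_const: "0 \<le> contraction_const" "contraction_const < 1"
    "contraction_const\<^sup>2 = 1 - 1 / (real (5 ^ CARD('a)) ^ 2 * decomposition_const)"
proof -
  let ?x = "real (5 ^ CARD('a)) ^ 2 * decomposition_const"
  have "1 * 1 \<le> ?x" using decomposition_const_ge by (intro mult_mono one_le_power) auto
  then have x: "0 < 1 / ?x" "1 / ?x \<le> 1" by (auto simp: divide_le_eq)
  then show "contraction_const\<^sup>2 = 1 - 1 / ?x" "0 \<le> contraction_const" unfolding contraction_const_def by simp_all
  show "contraction_const < 1" unfolding contraction_const_def real_sqrt_lt_1_iff using x(1) by linarith
qed

lemma sweep_contraction:
  assumes js: "distinct js" "set js = strip G" and v: "v \<in> strip_space kd G p"
  shows "A_norm G p \<gamma> \<gamma>\<^sub>D (sweep kd G p \<gamma> \<gamma>\<^sub>D js v) \<le> contraction_const * A_norm G p \<gamma> \<gamma>\<^sub>D v"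
proof -
  obtain w where w: "\<And>j. j \<in> strip G \<Longrightarrow> w j \<in> patch_space kd G p j" "v = (\<lambda>x. \<Sum>j\<in>strip G. w j x)"
    "(\<Sum>j\<in>strip G. A (w j) (w j)) \<le> decomposition_const * A v v"
    using stable_decomposition[OF v] by blast
  let ?P = "A_proj kd G p \<gamma> \<gamma>\<^sub>D"
  have sF: "u \<in> FE G p" if "u \<in> strip_space kd G p" for u using that strip_space_FE by blast
  have "A (fold (\<lambda>j v x. v x - ?P j v x) js v) (fold (\<lambda>j v x. v x - ?P j v x) js v)
      \<le> (1 - 1 / (real (5 ^ CARD('a)) ^ 2 * decomposition_const)) * A v v"
  proof (rule multiplicative_correction[where V = "patch_space kd G p" and W = "strip_space kd G p"
        and near = "\<lambda>j k. k \<in> int_nbhd j 2" and w = w])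
    show "patch_space kd G p j \<subseteq> FE G p" for j by (rule patch_space_FE)
    show "strip_space kd G p \<subseteq> FE G p" by (rule strip_space_FE)
    show "?P j u \<in> patch_space kd G p j" if "j \<in> set js" "u \<in> strip_space kd G p" for j u
      using that js(2) by (intro A_proj(1) sF) auto
    show "A (\<lambda>x. u x - ?P j u x) q = 0" if "j \<in> set js" "u \<in> strip_space kd G p" "q \<in> patch_space kd G p j" for j u q
      using that js(2) by (intro A_proj(2) sF) auto
    show "(\<lambda>x. u x - ?P j u x) \<in> strip_space kd G p" if "j \<in> set js" "u \<in> strip_space kd G p" for j u
    proof -
      have "?P j u \<in> strip_space kd G p"
        using A_proj(1)[of j u kd] patch_space_strip_space[of j kd] that js(2) sF by blast
      then show ?thesis using strip_space_lincomb[OF that(2), of "?P j u" 1 "-1"] by simp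
    qed
    show "distinct js" by (rule js(1))
    show "A u q = 0" if "\<not> k \<in> int_nbhd j 2" "u \<in> patch_space kd G p j" "q \<in> patch_space kd G p k" for j k u q
      by (rule cut_form_local[OF that(2,3,1)])
    show "(k \<in> int_nbhd j 2) = (j \<in> int_nbhd k 2)" for j k by (rule int_nbhd_sym)
    show "card {k \<in> set js. k \<in> int_nbhd j 2} \<le> 5 ^ CARD('a)" for j
    proof -
      have "card {k \<in> set js. k \<in> int_nbhd j 2} \<le> card (int_nbhd j 2)" by (intro card_mono int_nbhd(1)) auto
      then show ?thesis using int_nbhd(2)[of j 2] by simp
    qed
    show "v \<in> strip_space kd G p" by (rule v)
    show "w j \<in> patch_space kd G p j" if "j \<in> set js" for j using w(1) that js(2) by simp
    show "v = (\<lambda>x. \<Sum>j\<in>set js. w j x)" using w(2) js(2) by simp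
    show "(\<Sum>j\<in>set js. A (w j) (w j)) \<le> decomposition_const * A v v" using w(3) js(2) by simp
    show "1 \<le> decomposition_const" by (rule decomposition_const_ge)
  qed simp
  then have "A (sweep kd G p \<gamma> \<gamma>\<^sub>D js v) (sweep kd G p \<gamma> \<gamma>\<^sub>D js v) \<le> contraction_const\<^sup>2 * A v v"
    unfolding sweep_def contraction_const(3) .
  then have "sqrt (A (sweep kd G p \<gamma> \<gamma>\<^sub>D js v) (sweep kd G p \<gamma> \<gamma>\<^sub>D js v)) \<le> sqrt (contraction_const\<^sup>2 * A v v)"
    by (rule real_sqrt_le_mono)
  then show ?thesis unfolding A_norm_def using contraction_const(1) by (simp add: real_sqrt_mult)
qed

lemma sweep_opnorm:
  assumes "distinct js" "set js = strip G"
  shows "A_opnorm G p \<gamma> \<gamma>\<^sub>D (strip_space kd G p) (sweep kd G p \<gamma> \<gamma>\<^sub>D js) \<le> contraction_const"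
  unfolding A_opnorm_def
proof (rule cSUP_least)
  have "(\<lambda>x. \<Sum>j\<in>strip G. 0) \<in> strip_space kd G p"
    unfolding strip_space_def using patch_space_zero by (intro CollectI exI[of _ "\<lambda>_ _. 0"]) simp
  then show "strip_space kd G p \<noteq> {}" by blast
  fix v assume v: "v \<in> strip_space kd G p"
  have "v \<in> FE G p" using v strip_space_FE by blast
  then have "0 \<le> A_norm G p \<gamma> \<gamma>\<^sub>D v" using nonneg by (simp add: A_norm_def)
  \<comment> \<open>A quotient with denominator 0 has the value 0, which respects the bound.\<close>
  then show "A_norm G p \<gamma> \<gamma>\<^sub>D (sweep kd G p \<gamma> \<gamma>\<^sub>D js v) / A_norm G p \<gamma> \<gamma>\<^sub>D v \<le> contraction_const"
    using sweep_contraction[OF assms v] contraction_const(1)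
    by (cases "A_norm G p \<gamma> \<gamma>\<^sub>D v = 0") (auto simp: pos_divide_le_eq)
qed

end

theorem proposition3:
  fixes p :: nat and \<gamma> \<gamma>\<^sub>D c\<^sub>A C\<^sub>A C :: real
  assumes "CARD('n::finite) \<in> {2, 3}" and "1 \<le> p"
    and "0 < \<gamma>" "\<gamma> \<le> 1"
    and "0 < c\<^sub>A" "0 < C\<^sub>A" "0 < C"
  shows "\<exists>\<sigma><1. \<forall>(\<Omega> :: (real ^ 'n) set) o\<^sub>0 h\<^sub>0 L \<delta>\<^sub>0 kd.
           open \<Omega> \<and> connected \<Omega> \<and> bounded \<Omega> \<and> \<Omega> \<noteq> {} \<and> 0 < h\<^sub>0 \<and>
           geometric_assumption \<Omega> o\<^sub>0 h\<^sub>0 L \<delta>\<^sub>0 \<and>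
           (\<forall>l\<le>L. cutfem_stable (level \<Omega> o\<^sub>0 h\<^sub>0 l) p \<gamma> \<gamma>\<^sub>D c\<^sub>A C\<^sub>A C) \<and>
           (\<forall>l\<le>L. covering_assumption kd (level \<Omega> o\<^sub>0 h\<^sub>0 l) p)
           \<longrightarrow> (\<forall>l\<le>L. \<forall>js. distinct js \<and> set js = strip (level \<Omega> o\<^sub>0 h\<^sub>0 l) \<longrightarrow>
                  A_opnorm (level \<Omega> o\<^sub>0 h\<^sub>0 l) p \<gamma> \<gamma>\<^sub>D (strip_space kd (level \<Omega> o\<^sub>0 h\<^sub>0 l) p)
                    (sweep kd (level \<Omega> o\<^sub>0 h\<^sub>0 l) p \<gamma> \<gamma>\<^sub>D js) \<le> \<sigma>)"
proof -
  \<comment> \<open>As a constant exported from the locale it depends on the dimension,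
    \<open>p\<close>, \<gamma>, \<open>c\<^sub>A\<close> and \<open>C\<^sub>A\<close> only, so one
    number serves all domains, levels and orderings.\<close>
  let ?\<sigma> = "stable_domain.contraction_const TYPE('n) p \<gamma> c\<^sub>A C\<^sub>A"
  have level: "stable_domain (level \<Omega> o\<^sub>0 h\<^sub>0 l) p \<delta>\<^sub>0 \<gamma> \<gamma>\<^sub>D c\<^sub>A C\<^sub>A C"
    if "open \<Omega>" "bounded \<Omega>" "\<Omega> \<noteq> {}" "0 < h\<^sub>0" "geometric_assumption \<Omega> o\<^sub>0 h\<^sub>0 L \<delta>\<^sub>0"
      "\<forall>l\<le>L. cutfem_stable (level \<Omega> o\<^sub>0 h\<^sub>0 l) p \<gamma> \<gamma>\<^sub>D c\<^sub>A C\<^sub>A C" "l \<le> L"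
      "finite (strip (level \<Omega> o\<^sub>0 h\<^sub>0 l))"
    for \<Omega> :: "(real ^ 'n) set" and o\<^sub>0 h\<^sub>0 L \<delta>\<^sub>0 l
  proof -
    let ?G = "level \<Omega> o\<^sub>0 h\<^sub>0 l"
    have geo: "C2_boundary \<Omega>" "has_reach (frontier \<Omega>) \<delta>\<^sub>0" "\<forall>z\<in>cut ?G. regular_cut ?G z"
      "c_R TYPE('n) * edge (level \<Omega> o\<^sub>0 h\<^sub>0 (l - 1)) \<le> \<delta>\<^sub>0"
      using that(5,7) unfolding geometric_assumption_def by blast+
    have pos: "0 < edge ?G" using that(4) by (simp add: level_def)
    \<comment> \<open>The reach condition is stated with the next coarser mesh size and carries over
      to level \<open>l\<close>; for \<open>l = 0\<close> both sizes coincide.\<close>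
    have "h\<^sub>0 / 2 ^ l \<le> h\<^sub>0 / 2 ^ (l - 1)" using that(4) by (intro divide_left_mono power_increasing) auto
    then have "edge ?G \<le> edge (level \<Omega> o\<^sub>0 h\<^sub>0 (l - 1))" by (simp add: level_def)
    then have "c_R TYPE('n) * edge ?G \<le> c_R TYPE('n) * edge (level \<Omega> o\<^sub>0 h\<^sub>0 (l - 1))"
      by (intro mult_left_mono) (simp_all add: c_R_def)
    then have le: "c_R TYPE('n) * edge ?G \<le> \<delta>\<^sub>0" using geo(4) by linarith
    have "9 * sqrt (real CARD('n)) < c_R TYPE('n)"
    proof -
      have "0 < 24 * real CARD('n)" "0 \<le> sqrt (real CARD('n))" by simp_all
      then show ?thesis unfolding c_R_def by linarith
    qed
    then have "9 * sqrt (real CARD('n)) * edge ?G < c_R TYPE('n) * edge ?G"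
      using pos by (rule mult_strict_right_mono)
    then have large: "9 * sqrt (real CARD('n)) * edge ?G < \<delta>\<^sub>0" using le by linarith
    have dom: "grid.dom ?G = \<Omega>" by (simp add: level_def)
    show ?thesis
      by unfold_locales (use that pos geo large assms in \<open>auto simp: dom bdry_def\<close>)
  qed
  \<comment> \<open>That the contraction factor is below 1 is a theorem of the locale and
    presupposes an instance. If there is none, the premises and an enumeration of the strip never
    occur together, and 0 serves as bound.\<close>
  show ?thesis
  proof (cases "\<exists>(G :: 'n grid) \<delta>. stable_domain G p \<delta> \<gamma> \<gamma>\<^sub>D c\<^sub>A C\<^sub>A C")
    case True
    then have "?\<sigma> < 1" using stable_domain.contraction_const(2) by blast
    moreover have "\<forall>(\<Omega> :: (real ^ 'n) set) o\<^sub>0 h\<^sub>0 L \<delta>\<^sub>0 kd.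
           open \<Omega> \<and> connected \<Omega> \<and> bounded \<Omega> \<and> \<Omega> \<noteq> {} \<and> 0 < h\<^sub>0 \<and>
           geometric_assumption \<Omega> o\<^sub>0 h\<^sub>0 L \<delta>\<^sub>0 \<and>
           (\<forall>l\<le>L. cutfem_stable (level \<Omega> o\<^sub>0 h\<^sub>0 l) p \<gamma> \<gamma>\<^sub>D c\<^sub>A C\<^sub>A C) \<and>
           (\<forall>l\<le>L. covering_assumption kd (level \<Omega> o\<^sub>0 h\<^sub>0 l) p)
           \<longrightarrow> (\<forall>l\<le>L. \<forall>js. distinct js \<and> set js = strip (level \<Omega> o\<^sub>0 h\<^sub>0 l) \<longrightarrow>
                  A_opnorm (level \<Omega> o\<^sub>0 h\<^sub>0 l) p \<gamma> \<gamma>\<^sub>D (strip_space kd (level \<Omega> o\<^sub>0 h\<^sub>0 l) p)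
                    (sweep kd (level \<Omega> o\<^sub>0 h\<^sub>0 l) p \<gamma> \<gamma>\<^sub>D js) \<le> ?\<sigma>)"
    proof (intro allI impI, elim conjE)
      fix \<Omega> :: "(real ^ 'n) set" and o\<^sub>0 h\<^sub>0 L \<delta>\<^sub>0 kd l js
      assume *: "open \<Omega>" "bounded \<Omega>" "\<Omega> \<noteq> {}" "0 < h\<^sub>0" "geometric_assumption \<Omega> o\<^sub>0 h\<^sub>0 L \<delta>\<^sub>0"
        "\<forall>l\<le>L. cutfem_stable (level \<Omega> o\<^sub>0 h\<^sub>0 l) p \<gamma> \<gamma>\<^sub>D c\<^sub>A C\<^sub>A C" "l \<le> L"
        and js: "distinct js" "set js = strip (level \<Omega> o\<^sub>0 h\<^sub>0 l)"
      have "finite (strip (level \<Omega> o\<^sub>0 h\<^sub>0 l))" using js(2) finite_set by metis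
      then interpret stable_domain "level \<Omega> o\<^sub>0 h\<^sub>0 l" p \<delta>\<^sub>0 \<gamma> \<gamma>\<^sub>D c\<^sub>A C\<^sub>A C by (rule level[OF *])
      show "A_opnorm (level \<Omega> o\<^sub>0 h\<^sub>0 l) p \<gamma> \<gamma>\<^sub>D (strip_space kd (level \<Omega> o\<^sub>0 h\<^sub>0 l) p)
                    (sweep kd (level \<Omega> o\<^sub>0 h\<^sub>0 l) p \<gamma> \<gamma>\<^sub>D js) \<le> ?\<sigma>"
        by (rule sweep_opnorm[OF js])
    qed
    ultimately show ?thesis by blast
  next
    case False
    show ?thesis
    proof (rule exI[of _ 0], intro conjI allI impI, goal_cases)
      case (2 \<Omega> o\<^sub>0 h\<^sub>0 L \<delta>\<^sub>0 kd l js)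
      then have "finite (strip (level \<Omega> o\<^sub>0 h\<^sub>0 l))" by (metis finite_set)
      then show ?case using level[of \<Omega> h\<^sub>0 o\<^sub>0 L \<delta>\<^sub>0 l] 2 False by blast
    qed simp
  qed
qed

end
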